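(* Let $(X_{ij})_{i,j\ge1}$ be i.i.d. complex random variables with $\mathbb{E}X_{ij}=0$, $\mathbb{E}|X_{ij}|^2=1$, and such that for some $c>0$, $\mathbb{E}|X_{ij}|^k\le(ck)^{ck}$ for all integers $k\ge1$. Let $A_N=\theta_Nv_Nu_N^\top\in M_N(\mathbb{C})$ where $\theta_N\in\mathbb{C}\setminus\{0\}$ with $\sqrt N/\theta_N\to\kappa\in\mathbb{C}$, and $u_N,v_N\in\mathbb{R}^N$ are deterministic with $\|u_N\|=\|v_N\|=1$, $\theta_Nu_N^\top v_N\to\lambda\in\mathbb{C}$ and $\|u_N\|_\infty,\|v_N\|_\infty=O(1/\sqrt N)$. Let $M_N=A_N+X_N/\sqrt N$. Fix $\varepsilon>0$ and set $\Gamma=\mathbb{C}\setminus B(0,1+\varepsilon)$. Consider $g(z)=\sum_{k\ge0}\gamma_kz^{-k}$ with $(\gamma_k)_{k\ge0}$ independent centered complex Gaussian variables with $\mathbb{E}|\gamma_k|^2=1$ and $\mathbb{E}\gamma_k^2=(\mathbb{E}X_{11}^2)^{k+1}$. Then, as $N\to\infty$, the point process of eigenvalues of $M_N$ in $\Gamma$ converges vaguely to the point process of zeros of $\kappa z(z-\lambda)+g(z)$ in $\Gamma$.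
   Context: $X_N=(X_{ij})_{1\le i,j\le N}$; $\|\cdot\|$ and $\|\cdot\|_\infty$ on vectors are the Euclidean and sup norms; $B(0,t)$ is the closed ball. Points (eigenvalues, zeros) are counted with multiplicity. Vague convergence of point processes on $\Gamma$ means that for every continuous $\phi:\Gamma\to\mathbb{R}$ with compact support, the sum of $\phi$ over the points converges in distribution to the corresponding sum for the limit process. A complex centered Gaussian variable $\gamma$ means $(\Re\gamma,\Im\gamma)$ is a (possibly degenerate) centered Gaussian vector in $\mathbb{R}^2$. *)

theory Defs
  imports
    "HOL-Probability.Probability"
    "HOL-Complex_Analysis.Complex_Analysis"
    "HOL-Library.Landau_Symbols"
    "Jordan_Normal_Form.Char_Poly"
begin

definition l2_norm_vec :: "real Matrix.vec \<Rightarrow> real" where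
  "l2_norm_vec v = sqrt (scalar_prod v v)"

definition sup_norm_vec :: "real Matrix.vec \<Rightarrow> real" where
  "sup_norm_vec v = Max ((\<lambda>i. \<bar>vec_index v i\<bar>) ` {..<dim_vec v})"

definition rank_one_mat :: "complex \<Rightarrow> real Matrix.vec \<Rightarrow> real Matrix.vec \<Rightarrow> complex Matrix.mat" where
  "rank_one_mat \<theta> v u = Matrix.mat (dim_vec v) (dim_vec u)
     (\<lambda>(i, j). \<theta> * of_real (vec_index v i) * of_real (vec_index u j))"

definition scaled_corner :: "(nat \<Rightarrow> nat \<Rightarrow> complex) \<Rightarrow> nat \<Rightarrow> complex Matrix.mat" where
  "scaled_corner x N = Matrix.mat N N (\<lambda>(i, j). x i j / of_real (sqrt (real N)))"

definition centered_gaussian_real :: "'a measure \<Rightarrow> ('a \<Rightarrow> real) \<Rightarrow> bool" where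
  "centered_gaussian_real M Y \<longleftrightarrow> Y \<in> borel_measurable M \<and>
     ((AE \<omega> in M. Y \<omega> = 0) \<or> (\<exists>\<sigma>>0. distributed M lborel Y (normal_density 0 \<sigma>)))"

text \<open>\<open>(Re Z, Im Z)\<close> is a Gaussian vector: every linear combination of the coordinates is
  Gaussian.  Degenerate covariance matrices are allowed.\<close>

definition centered_gaussian_complex :: "'a measure \<Rightarrow> ('a \<Rightarrow> complex) \<Rightarrow> bool" where
  "centered_gaussian_complex M Z \<longleftrightarrow>
     (\<forall>a b. centered_gaussian_real M (\<lambda>\<omega>. a * Re (Z \<omega>) + b * Im (Z \<omega>)))"

text \<open>Convergence in distribution of real random variables \<open>Y\<^sub>N\<close>, defined on \<open>M\<close>, to \<open>Y'\<close>,
  defined on \<open>M'\<close>.  The measures are completed because a random variable that is meaningful only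
  almost surely (such as a functional of a random power series) takes junk values on a null set.\<close>

definition converges_in_distribution ::
  "'a measure \<Rightarrow> (nat \<Rightarrow> 'a \<Rightarrow> real) \<Rightarrow> 'b measure \<Rightarrow> ('b \<Rightarrow> real) \<Rightarrow> bool" where
  "converges_in_distribution M Y M' Y' \<longleftrightarrow>
     (\<forall>N. Y N \<in> borel_measurable (completion M)) \<and>
     Y' \<in> borel_measurable (completion M') \<and>
     weak_conv_m (\<lambda>N. distr (completion M) borel (Y N)) (distr (completion M') borel Y')"

text \<open>A point configuration is given by the multiplicity \<open>m z\<close> of every point \<open>z\<close>; here
  \<open>\<phi>\<close> is summed over the points in \<open>\<Gamma>\<close>.\<close>

definition sum_over_points ::
  "complex set \<Rightarrow> (complex \<Rightarrow> nat) \<Rightarrow> (complex \<Rightarrow> real) \<Rightarrow> real" where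
  "sum_over_points \<Gamma> m \<phi> = (\<Sum>\<^sub>\<infinity>z\<in>\<Gamma>. real (m z) * \<phi> z)"

definition converges_vaguely ::
  "complex set \<Rightarrow> 'a measure \<Rightarrow> (nat \<Rightarrow> 'a \<Rightarrow> complex \<Rightarrow> nat)
     \<Rightarrow> 'b measure \<Rightarrow> ('b \<Rightarrow> complex \<Rightarrow> nat) \<Rightarrow> bool" where
  "converges_vaguely \<Gamma> M \<Xi> M' \<Xi>' \<longleftrightarrow>
     (\<forall>\<phi> :: complex \<Rightarrow> real.
        continuous_on \<Gamma> \<phi> \<and> (\<exists>K. compact K \<and> K \<subseteq> \<Gamma> \<and> (\<forall>z\<in>\<Gamma> - K. \<phi> z = 0)) \<longrightarrow>
        converges_in_distribution
          M (\<lambda>N \<omega>. sum_over_points \<Gamma> (\<Xi> N \<omega>) \<phi>)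
          M' (\<lambda>\<omega>. sum_over_points \<Gamma> (\<Xi>' \<omega>) \<phi>))"

definition eigenvalue_points :: "complex Matrix.mat \<Rightarrow> complex \<Rightarrow> nat" where
  "eigenvalue_points A z = Polynomial.order z (char_poly A)"

text \<open>Meaningful at points near which \<open>f\<close> is holomorphic and not identically zero.\<close>

definition zero_points :: "(complex \<Rightarrow> complex) \<Rightarrow> complex \<Rightarrow> nat" where
  "zero_points f z = (if f z = 0 then nat (zorder f z) else 0)"

end

theory Submission
  imports
    Defs
    "Jordan_Normal_Form.Schur_Decomposition"
begin

text \<open>Put \<open>Y = X\<^sub>N / \<surd>N\<close>, \<open>w = 1 / z\<close> and \<open>D(w) = det (1 - w Y)\<close>.  As \<open>M\<^sub>N\<close> is a rank-one perturbation of \<open>Y\<close>,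
  \<open>\<surd>N / \<theta> det (1 - w M\<^sub>N) = D(w) G(w)\<close> with
  \<open>G(w) = \<surd>N / \<theta> - \<surd>N w u\<^sup>T (1 - w Y)\<^sup>-\<^sup>1 v\<close>, whose Taylor coefficients are \<open>\<surd>N / \<theta>\<close>, \<open>- \<surd>N u\<^sup>T v\<close> and
  \<open>- \<surd>N u\<^sup>T Y\<^sup>k v\<close> for \<open>k \<ge> 1\<close>.  The first two converge to \<open>\<kappa>\<close> and \<open>- \<kappa> \<lambda>\<close>, and by the method of moments
  the others converge jointly to independent Gaussians.

  Outside the unit disc the eigenvalues are therefore the zeros of \<open>G(1/z)\<close>, provided that \<open>D\<close> has no zeros
  and \<open>G\<close> is bounded in a disc of radius less than 1, with high probability.  No spectral radius estimate is
  needed: the coefficients of \<open>D\<close> and of \<open>D G\<close> have bounded second moments, because the monomials in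
  the expansion of a determinant are orthogonal, and boundedly many traces \<open>tr Y\<^sup>k\<close> have bounded second moments.
  Multiplying \<open>D\<close> by \<open>exp (\<Sum>k\<le>m. w\<^sup>k tr Y\<^sup>k / k)\<close> gives a product of Weierstrass factors, which is close
  to 1, so \<open>D\<close> is bounded away from 0.

  Then the coefficient sequences lie, up to small probability, in a compact set of sequences on which the
  sum of a test function over the zeros is continuous by Rouche's theorem, and convergence in distribution follows
  from convergence of the characteristic functions.\<close>

section \<open>Moments of the matrix entries\<close>

text \<open>The method of moments yields the joint law of finitely many coefficients only. Its
  constants explode with the length k of the walks, so it gives no bound on the coefficients of
  \<open>G\<close> that is uniform in k, hence no compactness in a space of series. That bound comes
  from writing \<open>G\<close> as the quotient of \<open>D G\<close> by \<open>D\<close>: both have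
  coefficients whose second moments grow at most polynomially in k, uniformly in N, and once
  \<open>D\<close> is bounded below Cauchy's estimates give \<open>B * R ^ k\<close> for every k.
  The traces needed for the lower bound also have moments with constants growing in k, but their
  number m depends only on the radius and on the level K of the bounds. So the order of choices
  matters: K first, independent of m, then m, and N large last.

  Multiplicities are stable only away from the zero series. Since \<kappa> may be 0, the first two
  coefficients cannot guarantee this; the third one can, because its limit \<gamma>_0 has variance 1
  and hence, even if concentrated on a line, no atom at 0.\<close>

locale iid_entries = prob_space P for P :: "'a measure" +
  fixes X :: "nat \<Rightarrow> nat \<Rightarrow> 'a \<Rightarrow> complex"
  assumes indep: "indep_vars (\<lambda>_. borel) (\<lambda>(i, j). X i j) UNIV"
    and ident: "distr P borel (X i j) = distr P borel (X 0 0)"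
    and mean_zero: "expectation (X 0 0) = 0"
    and var_one: "expectation (\<lambda>\<omega>. (cmod (X 0 0 \<omega>))\<^sup>2) = 1"
    and moments: "integrable P (\<lambda>\<omega>. cmod (X 0 0 \<omega>) ^ k)"
begin

lemma X_measurable [measurable]: "X i j \<in> borel_measurable P"
  using indep unfolding indep_vars_def by (auto dest!: conjunct1 bspec[of _ _ "(i, j)"])

lemma expectation_X_eq:
  fixes f :: "complex \<Rightarrow> 'b::{banach, second_countable_topology}"
  assumes [measurable]: "f \<in> borel_measurable borel"
  shows "expectation (\<lambda>\<omega>. f (X i j \<omega>)) = expectation (\<lambda>\<omega>. f (X 0 0 \<omega>))"
proof -
  have "expectation (\<lambda>\<omega>. f (X i j \<omega>)) = integral\<^sup>L (distr P borel (X i j)) f"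
    by (subst integral_distr) auto
  also have "\<dots> = expectation (\<lambda>\<omega>. f (X 0 0 \<omega>))"
    by (subst ident, subst integral_distr) auto
  finally show ?thesis .
qed

lemma integrable_X_iff:
  fixes f :: "complex \<Rightarrow> 'b::{banach, second_countable_topology}"
  assumes [measurable]: "f \<in> borel_measurable borel"
  shows "integrable P (\<lambda>\<omega>. f (X i j \<omega>)) \<longleftrightarrow> integrable P (\<lambda>\<omega>. f (X 0 0 \<omega>))"
proof -
  have "integrable P (\<lambda>\<omega>. f (X i j \<omega>)) \<longleftrightarrow> integrable (distr P borel (X i j)) f"
    by (subst integrable_distr_eq) auto
  also have "\<dots> \<longleftrightarrow> integrable P (\<lambda>\<omega>. f (X 0 0 \<omega>))"
    by (subst ident, subst integrable_distr_eq) auto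
  finally show ?thesis .
qed

definition mixed_moment :: "nat \<Rightarrow> nat \<Rightarrow> complex" where
  "mixed_moment p q = expectation (\<lambda>\<omega>. X 0 0 \<omega> ^ p * cnj (X 0 0 \<omega>) ^ q)"

text \<open>The flag turns conjugation on, so that products mixing entries with conjugates form a
  single indexed family.\<close>

definition entry :: "nat \<times> nat \<Rightarrow> bool \<Rightarrow> 'a \<Rightarrow> complex" where
  "entry e b \<omega> = (if b then cnj (X (fst e) (snd e) \<omega>) else X (fst e) (snd e) \<omega>)"

lemma entry_measurable [measurable]: "entry e b \<in> borel_measurable P"
proof -
  have "entry e b = (if b then (\<lambda>\<omega>. cnj (X (fst e) (snd e) \<omega>)) else X (fst e) (snd e))"
    by (auto simp: entry_def fun_eq_iff)
  moreover have "(\<lambda>\<omega>. cnj (X i j \<omega>)) \<in> borel_measurable P" for i j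
    by (rule measurable_compose[OF X_measurable]) (intro borel_measurable_continuous_onI continuous_intros)
  ultimately show ?thesis by simp
qed

lemma monomial_measurable [measurable]: "(\<lambda>x::complex. x ^ p * cnj x ^ q) \<in> borel_measurable borel"
  by (intro borel_measurable_continuous_onI continuous_intros)

lemma integrable_monomial: "integrable P (\<lambda>\<omega>. X i j \<omega> ^ p * cnj (X i j \<omega>) ^ q)"
proof -
  have "integrable P (\<lambda>\<omega>. X 0 0 \<omega> ^ p * cnj (X 0 0 \<omega>) ^ q)"
    by (rule Bochner_Integration.integrable_bound[OF moments[of "p + q"]])
      (auto simp: norm_mult norm_power power_add)
  thus ?thesis by (subst integrable_X_iff) auto
qed

lemma expectation_monomial:
  "expectation (\<lambda>\<omega>. X i j \<omega> ^ p * cnj (X i j \<omega>) ^ q) = mixed_moment p q"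
  unfolding mixed_moment_def by (rule expectation_X_eq) simp

text \<open>Grouping the factors by their position \<open>ed s\<close> leaves independent groups,
  and a group of p plain and q conjugated factors has expectation
  \<open>mixed_moment p q\<close>.\<close>

lemma
  assumes fin: "finite S"
  shows integrable_prod_entry: "integrable P (\<lambda>\<omega>. \<Prod>s\<in>S. entry (ed s) (fl s) \<omega>)" (is ?I)
    and expectation_prod_entry: "expectation (\<lambda>\<omega>. \<Prod>s\<in>S. entry (ed s) (fl s) \<omega>)
      = (\<Prod>e\<in>ed ` S. mixed_moment (card {s \<in> S. ed s = e \<and> \<not> fl s}) (card {s \<in> S. ed s = e \<and> fl s}))"
      (is ?E)
proof -
  define Z where "Z e \<omega> = (X (fst e) (snd e) \<omega>) ^ card {s \<in> S. ed s = e \<and> \<not> fl s}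
      * cnj (X (fst e) (snd e) \<omega>) ^ card {s \<in> S. ed s = e \<and> fl s}" for e \<omega>
  have eq: "(\<Prod>s\<in>S. entry (ed s) (fl s) \<omega>) = (\<Prod>e\<in>ed ` S. Z e \<omega>)" for \<omega>
  proof -
    have "(\<Prod>s\<in>S. entry (ed s) (fl s) \<omega>)
        = (\<Prod>e\<in>ed ` S. \<Prod>s\<in>{s \<in> S. ed s = e}. entry (ed s) (fl s) \<omega>)"
      by (rule prod.image_gen[OF fin])
    also have "\<dots> = (\<Prod>e\<in>ed ` S. Z e \<omega>)"
    proof (rule prod.cong[OF refl])
      fix e assume "e \<in> ed ` S"
      have "(\<Prod>s\<in>{s \<in> S. ed s = e}. entry (ed s) (fl s) \<omega>)
          = (\<Prod>s\<in>{s \<in> S. ed s = e}. if fl s then cnj (X (fst e) (snd e) \<omega>) else X (fst e) (snd e) \<omega>)"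
        by (rule prod.cong) (auto simp: entry_def)
      also have "\<dots> = Z e \<omega>"
      proof -
        have "{s \<in> S. ed s = e} \<inter> {s. fl s} = {s \<in> S. ed s = e \<and> fl s}"
          "{s \<in> S. ed s = e} \<inter> - {s. fl s} = {s \<in> S. ed s = e \<and> \<not> fl s}" by auto
        thus ?thesis using fin by (subst prod.If_cases) (simp_all add: Z_def)
      qed
      finally show "(\<Prod>s\<in>{s \<in> S. ed s = e}. entry (ed s) (fl s) \<omega>) = Z e \<omega>" .
    qed
    finally show ?thesis .
  qed
  have ind: "indep_vars (\<lambda>_. borel) Z (ed ` S)"
  proof -
    have "indep_vars (\<lambda>_. borel) (\<lambda>(i, j). X i j) (ed ` S)"
      by (rule indep_vars_subset[OF indep]) auto
    from indep_vars_compose2[OF this, of "\<lambda>e x. x ^ card {s \<in> S. ed s = e \<and> \<not> fl s}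
        * cnj x ^ card {s \<in> S. ed s = e \<and> fl s}" "\<lambda>_. borel"]
    show ?thesis by (simp add: Z_def[abs_def] case_prod_beta)
  qed
  have int: "integrable P (Z e)" for e unfolding Z_def by (rule integrable_monomial)
  have "integrable P (\<lambda>\<omega>. \<Prod>e\<in>ed ` S. Z e \<omega>)"
    by (rule indep_vars_integrable[OF _ ind int]) (use fin in auto)
  thus ?I by (simp add: eq)
  have "expectation (\<lambda>\<omega>. \<Prod>e\<in>ed ` S. Z e \<omega>) = (\<Prod>e\<in>ed ` S. expectation (Z e))"
    by (rule indep_vars_lebesgue_integral[OF _ ind int]) (use fin in auto)
  also have "\<dots> = (\<Prod>e\<in>ed ` S. mixed_moment (card {s \<in> S. ed s = e \<and> \<not> fl s}) (card {s \<in> S. ed s = e \<and> fl s}))"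
    unfolding Z_def by (simp add: expectation_monomial)
  finally show ?E by (simp add: eq)
qed

lemma mixed_moment_1_0 [simp]: "mixed_moment (Suc 0) 0 = 0"
  using mean_zero by (simp add: mixed_moment_def)

lemma mixed_moment_0_1 [simp]: "mixed_moment 0 (Suc 0) = 0"
  using mean_zero by (simp add: mixed_moment_def)

lemma mixed_moment_1_1 [simp]: "mixed_moment (Suc 0) (Suc 0) = 1"
proof -
  have "(\<lambda>\<omega>. X 0 0 \<omega> * cnj (X 0 0 \<omega>)) = (\<lambda>\<omega>. complex_of_real ((cmod (X 0 0 \<omega>))\<^sup>2))"
    by (simp add: complex_norm_square fun_eq_iff del: of_real_power)
  thus ?thesis using var_one by (simp add: mixed_moment_def del: of_real_power)
qed

definition pseudo_var :: complex where "pseudo_var = expectation (\<lambda>\<omega>. (X 0 0 \<omega>)\<^sup>2)"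

lemma mixed_moment_2_0: "mixed_moment 2 0 = pseudo_var"
  by (simp add: mixed_moment_def pseudo_var_def)

lemma mixed_moment_0_2: "mixed_moment 0 2 = cnj pseudo_var"
proof -
  have "expectation (\<lambda>\<omega>. cnj ((X 0 0 \<omega>)\<^sup>2)) = cnj pseudo_var"
    unfolding pseudo_var_def by (rule Bochner_Integration.integral_cnj)
  thus ?thesis by (simp add: mixed_moment_def)
qed

text \<open>The summand 1 keeps the bound at least 1, so that a power indexed by distinct positions
  can be enlarged to one indexed by all factors.\<close>

definition abs_moment_bound :: "nat \<Rightarrow> real" where
  "abs_moment_bound n = 1 + (\<Sum>k\<le>n. expectation (\<lambda>\<omega>. cmod (X 0 0 \<omega>) ^ k))"

lemma abs_moment_bound_ge_1: "abs_moment_bound n \<ge> 1"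
  unfolding abs_moment_bound_def by (simp add: sum_nonneg)

lemma norm_mixed_moment_le:
  assumes "p + q \<le> n" shows "cmod (mixed_moment p q) \<le> abs_moment_bound n"
proof -
  have "cmod (mixed_moment p q) \<le> expectation (\<lambda>\<omega>. cmod (X 0 0 \<omega> ^ p * cnj (X 0 0 \<omega>) ^ q))"
    unfolding mixed_moment_def by (rule integral_norm_bound)
  also have "\<dots> = expectation (\<lambda>\<omega>. cmod (X 0 0 \<omega>) ^ (p + q))"
    by (simp add: norm_mult norm_power power_add)
  also have "\<dots> \<le> (\<Sum>k\<le>n. expectation (\<lambda>\<omega>. cmod (X 0 0 \<omega>) ^ k))"
    using assms by (intro member_le_sum) auto
  finally show ?thesis by (simp add: abs_moment_bound_def)
qed

lemma norm_expectation_prod_entry_le: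
  assumes fin: "finite S"
  shows "cmod (expectation (\<lambda>\<omega>. \<Prod>s\<in>S. entry (ed s) (fl s) \<omega>)) \<le> abs_moment_bound (card S) ^ card S"
proof -
  have "cmod (expectation (\<lambda>\<omega>. \<Prod>s\<in>S. entry (ed s) (fl s) \<omega>)) =
     (\<Prod>e\<in>ed ` S. cmod (mixed_moment (card {s \<in> S. ed s = e \<and> \<not> fl s}) (card {s \<in> S. ed s = e \<and> fl s})))"
    by (simp add: expectation_prod_entry[OF fin] prod_norm)
  also have "\<dots> \<le> (\<Prod>e\<in>ed ` S. abs_moment_bound (card S))"
  proof (rule prod_mono, intro conjI norm_mixed_moment_le norm_ge_zero)
    fix e
    have "card {s \<in> S. ed s = e \<and> \<not> fl s} + card {s \<in> S. ed s = e \<and> fl s}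
        = card ({s \<in> S. ed s = e \<and> \<not> fl s} \<union> {s \<in> S. ed s = e \<and> fl s})"
      using fin by (subst card_Un_disjoint) auto
    also have "\<dots> \<le> card S" using fin by (intro card_mono) auto
    finally show "card {s \<in> S. ed s = e \<and> \<not> fl s} + card {s \<in> S. ed s = e \<and> fl s} \<le> card S" .
  qed
  also have "\<dots> = abs_moment_bound (card S) ^ card (ed ` S)" by simp
  also have "\<dots> \<le> abs_moment_bound (card S) ^ card S"
    using abs_moment_bound_ge_1 fin by (intro power_increasing card_image_le) auto
  finally show ?thesis .
qed

text \<open>A position occupied once contributes the mean of an entry or of its conjugate, which is
  0. This confines the later expansions to walks whose edges all repeat.\<close>

lemma expectation_prod_entry_eq_0:
  assumes fin: "finite S" and "s0 \<in> S" and only: "\<And>s. s \<in> S \<Longrightarrow> ed s = ed s0 \<Longrightarrow> s = s0"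
  shows "expectation (\<lambda>\<omega>. \<Prod>s\<in>S. entry (ed s) (fl s) \<omega>) = 0"
proof -
  have "mixed_moment (card {s \<in> S. ed s = ed s0 \<and> \<not> fl s}) (card {s \<in> S. ed s = ed s0 \<and> fl s}) = 0"
  proof (cases "fl s0")
    case True
    hence "{s \<in> S. ed s = ed s0 \<and> \<not> fl s} = {}" "{s \<in> S. ed s = ed s0 \<and> fl s} = {s0}"
      using assms by auto
    thus ?thesis by (simp only: card.empty card.insert finite.emptyI empty_iff mixed_moment_0_1) simp
  next
    case False
    hence "{s \<in> S. ed s = ed s0 \<and> \<not> fl s} = {s0}" "{s \<in> S. ed s = ed s0 \<and> fl s} = {}"
      using assms by auto
    thus ?thesis by (simp only: card.empty card.insert finite.emptyI empty_iff mixed_moment_1_0) simp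
  qed
  thus ?thesis
    unfolding expectation_prod_entry[OF fin] using fin \<open>s0 \<in> S\<close> by (intro prod_zero) auto
qed

text \<open>Disjoint sets of positions are independent; this will split a pair of coinciding walks
  off from the remaining ones.\<close>

lemma expectation_prod_entry_Un:
  assumes fin: "finite S" "finite T" and disj: "S \<inter> T = {}" "ed ` S \<inter> ed ` T = {}"
  shows "expectation (\<lambda>\<omega>. \<Prod>s\<in>S \<union> T. entry (ed s) (fl s) \<omega>) =
    expectation (\<lambda>\<omega>. \<Prod>s\<in>S. entry (ed s) (fl s) \<omega>) * expectation (\<lambda>\<omega>. \<Prod>s\<in>T. entry (ed s) (fl s) \<omega>)"
proof -
  let ?m = "\<lambda>S e. mixed_moment (card {s \<in> S. ed s = e \<and> \<not> fl s}) (card {s \<in> S. ed s = e \<and> fl s})"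
  have "expectation (\<lambda>\<omega>. \<Prod>s\<in>S \<union> T. entry (ed s) (fl s) \<omega>)
      = (\<Prod>e\<in>ed ` S. ?m (S \<union> T) e) * (\<Prod>e\<in>ed ` T. ?m (S \<union> T) e)"
    using fin disj by (subst expectation_prod_entry) (auto simp: image_Un intro: prod.union_disjoint)
  also have "(\<Prod>e\<in>ed ` S. ?m (S \<union> T) e) = (\<Prod>e\<in>ed ` S. ?m S e)"
  proof (rule prod.cong[OF refl])
    fix e assume "e \<in> ed ` S"
    hence "{s \<in> S \<union> T. ed s = e \<and> \<not> fl s} = {s \<in> S. ed s = e \<and> \<not> fl s}"
      "{s \<in> S \<union> T. ed s = e \<and> fl s} = {s \<in> S. ed s = e \<and> fl s}" using disj by auto
    thus "?m (S \<union> T) e = ?m S e" by simp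
  qed
  also have "(\<Prod>e\<in>ed ` T. ?m (S \<union> T) e) = (\<Prod>e\<in>ed ` T. ?m T e)"
  proof (rule prod.cong[OF refl])
    fix e assume "e \<in> ed ` T"
    hence "{s \<in> S \<union> T. ed s = e \<and> \<not> fl s} = {s \<in> T. ed s = e \<and> \<not> fl s}"
      "{s \<in> S \<union> T. ed s = e \<and> fl s} = {s \<in> T. ed s = e \<and> fl s}" using disj by auto
    thus "?m (S \<union> T) e = ?m T e" by simp
  qed
  finally show ?thesis using fin by (simp add: expectation_prod_entry)
qed

end

text \<open>A map with at most m values factors through m labels: there are
  \<open>m ^ card I\<close> labellings and \<open>N ^ m\<close> ways to give the labels
  values.\<close>

lemma card_PiE_image_le:
  fixes I :: "'i set" and N m :: nat
  assumes fin: "finite I" and N: "N \<ge> 1"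
  shows "card {f \<in> I \<rightarrow>\<^sub>E {..<N}. card (f ` I) \<le> m} \<le> m ^ card I * N ^ m"
proof -
  let ?B = "(I \<rightarrow>\<^sub>E {..<m}) \<times> ({..<m} \<rightarrow>\<^sub>E {..<N})"
  let ?c = "\<lambda>(h, g). restrict (\<lambda>x. g (h x)) I"
  have "{f \<in> I \<rightarrow>\<^sub>E {..<N}. card (f ` I) \<le> m} \<subseteq> ?c ` ?B"
  proof
    fix f assume f: "f \<in> {f \<in> I \<rightarrow>\<^sub>E {..<N}. card (f ` I) \<le> m}"
    have "finite (f ` I)" using fin by simp
    then obtain e where e: "bij_betw e {..<card (f ` I)} (f ` I)"
      using ex_bij_betw_nat_finite lessThan_atLeast0 by metis
    \<comment> \<open>Labels beyond the image are sent to 0, a legal value because N is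
      positive.\<close>
    define g where "g = restrict (\<lambda>a. if a < card (f ` I) then e a else 0) {..<m}"
    define h where "h = restrict (\<lambda>x. inv_into {..<card (f ` I)} e (f x)) I"
    have h1: "x \<in> I \<Longrightarrow> h x < card (f ` I)" for x
      using inv_into_into[of "f x" e "{..<card (f ` I)}"] e by (simp add: h_def bij_betw_def)
    have eh: "x \<in> I \<Longrightarrow> e (h x) = f x" for x
      unfolding h_def using e by (simp add: bij_betw_inv_into_right)
    have "h \<in> I \<rightarrow>\<^sub>E {..<m}" using h1 f by (force simp: h_def intro: less_le_trans)
    moreover have "g \<in> {..<m} \<rightarrow>\<^sub>E {..<N}"
    proof (rule PiE_I)
      fix a assume a: "a \<in> {..<m}"
      show "g a \<in> {..<N}"
      proof (cases "a < card (f ` I)")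
        case True
        hence "e a \<in> f ` I" using e by (auto simp: bij_betw_def)
        thus ?thesis using a True f by (auto simp: g_def)
      qed (use a N in \<open>auto simp: g_def\<close>)
    qed (auto simp: g_def)
    moreover have "f = ?c (h, g)"
    proof
      fix x show "f x = ?c (h, g) x"
      proof (cases "x \<in> I")
        case True
        have "h x < m" using h1[OF True] f by auto
        thus ?thesis using True h1[OF True] eh[OF True] by (simp add: g_def)
      qed (use f in \<open>auto simp: PiE_def extensional_def\<close>)
    qed
    ultimately show "f \<in> ?c ` ?B" by blast
  qed
  hence "card {f \<in> I \<rightarrow>\<^sub>E {..<N}. card (f ` I) \<le> m} \<le> card ?B"
    using fin by (intro surj_card_le) (auto intro!: finite_PiE)
  also have "\<dots> = m ^ card I * N ^ m"
    using fin by (simp add: card_cartesian_product card_PiE)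
  finally show ?thesis .
qed

section \<open>Walks in which every edge is repeated\<close>

text \<open>Every fibre over the image has at least two elements.\<close>

lemma twice_card_image_le:
  assumes fin: "finite I" and ex: "\<And>x. x \<in> I \<Longrightarrow> \<exists>y\<in>I. y \<noteq> x \<and> f y = f x"
  shows "2 * card (f ` I) \<le> card I"
proof -
  have "card I = (\<Sum>v\<in>f ` I. card {x \<in> I. f x = v})"
    using fin sum.image_gen[of I "\<lambda>_. 1::nat" f] by simp
  also have "\<dots> \<ge> (\<Sum>v\<in>f ` I. 2)"
  proof (rule sum_mono)
    fix v assume "v \<in> f ` I"
    then obtain x where x: "x \<in> I" "f x = v" by auto
    then obtain y where y: "y \<in> I" "y \<noteq> x" "f y = f x" using ex by blast
    have "card {x, y} \<le> card {x \<in> I. f x = v}"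
      using x y fin by (intro card_mono) auto
    thus "2 \<le> card {x \<in> I. f x = v}" using y by simp
  qed
  finally show ?thesis by simp
qed

text \<open>In the equality case of \<open>twice_card_image_le\<close> no fibre has three elements,
  so partners are unique.\<close>

lemma two_to_one_if_card_eq:
  assumes fin: "finite I" and ex: "\<And>x. x \<in> I \<Longrightarrow> \<exists>y\<in>I. y \<noteq> x \<and> f y = f x"
    and card: "card I \<le> 2 * card (f ` I)"
    and xyz: "x \<in> I" "y \<in> I" "z \<in> I" "f x = f y" "f y = f z" "x \<noteq> y" "y \<noteq> z"
  shows "x = z"
proof (rule ccontr)
  assume "x \<noteq> z"
  have sum: "card I = (\<Sum>v\<in>f ` I. card {x \<in> I. f x = v})"
    using fin sum.image_gen[of I "\<lambda>_. 1::nat" f] by simp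
  have "(\<Sum>v\<in>f ` I. 2) < (\<Sum>v\<in>f ` I. card {x \<in> I. f x = v})"
  proof (rule sum_strict_mono_ex1)
    show "\<forall>v\<in>f ` I. 2 \<le> card {x \<in> I. f x = v}"
    proof
      fix v assume "v \<in> f ` I"
      then obtain x where x: "x \<in> I" "f x = v" by auto
      then obtain y where y: "y \<in> I" "y \<noteq> x" "f y = f x" using ex by blast
      have "card {x, y} \<le> card {x \<in> I. f x = v}"
        using x y fin by (intro card_mono) auto
      thus "2 \<le> card {x \<in> I. f x = v}" using y by simp
    qed
    have "card {x, y, z} \<le> card {t \<in> I. f t = f x}"
      using xyz fin by (intro card_mono) auto
    hence "2 < card {t \<in> I. f t = f x}" using xyz \<open>x \<noteq> z\<close> by simp
    thus "\<exists>v\<in>f ` I. 2 < card {x \<in> I. f x = v}" using xyz by blast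
  qed (use fin in auto)
  thus False using card sum by simp
qed

text \<open>Walk a has \<open>k a\<close> steps. Each step has to be taken again in the same
  direction by a different step, of the same or of another walk; otherwise the expectation along the
  family is 0.\<close>

definition edges_repeated :: "nat set \<Rightarrow> (nat \<Rightarrow> nat) \<Rightarrow> (nat \<Rightarrow> nat \<Rightarrow> nat) \<Rightarrow> bool" where
  "edges_repeated A k g \<longleftrightarrow> (\<forall>a\<in>A. \<forall>j<k a. \<exists>a'\<in>A. \<exists>j'<k a'. (a', j') \<noteq> (a, j) \<and>
     g a' j' = g a j \<and> g a' (Suc j') = g a (Suc j))"

definition walk_vertices :: "nat set \<Rightarrow> (nat \<Rightarrow> nat) \<Rightarrow> (nat \<Rightarrow> nat \<Rightarrow> nat) \<Rightarrow> nat set" where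
  "walk_vertices A k g = (\<lambda>(a, j). g a j) ` (SIGMA a:A. {..k a})"

lemma finite_walk_vertices: "finite A \<Longrightarrow> finite (walk_vertices A k g)"
  by (auto simp: walk_vertices_def)

text \<open>Repeated edges give repeated vertices: a vertex where a step starts is paired with the
  start of the repeated step, and the last vertex of a walk with the end of the repetition of its
  last step, which exists as walks have positive length.\<close>

lemma edges_repeated_partner:
  assumes rep: "edges_repeated A k g" and pos: "\<And>a. a \<in> A \<Longrightarrow> k a \<ge> 1"
    and x: "x \<in> (SIGMA a:A. {..k a})"
  shows "\<exists>y\<in>(SIGMA a:A. {..k a}). y \<noteq> x \<and> (\<lambda>(a, j). g a j) y = (\<lambda>(a, j). g a j) x"
proof -
  obtain a j where aj: "x = (a, j)" "a \<in> A" "j \<le> k a" using x by auto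
  show ?thesis
  proof (cases "j < k a")
    case True
    then obtain a' j' where "a' \<in> A" "j' < k a'" "(a', j') \<noteq> (a, j)" "g a' j' = g a j"
      using rep aj unfolding edges_repeated_def by meson
    thus ?thesis using aj by (intro bexI[of _ "(a', j')"]) auto
  next
    case False
    hence j: "j = Suc (k a - 1)" "k a - 1 < k a" using aj pos[of a] by auto
    then obtain a' j' where "a' \<in> A" "j' < k a'" "(a', j') \<noteq> (a, k a - 1)"
      "g a' (Suc j') = g a (Suc (k a - 1))"
      using rep aj unfolding edges_repeated_def by meson
    thus ?thesis using aj j by (intro bexI[of _ "(a', Suc j')"]) auto
  qed
qed

lemma card_walk_vertices_le:
  assumes "finite A" "edges_repeated A k g" "\<And>a. a \<in> A \<Longrightarrow> k a \<ge> 1"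
  shows "2 * card (walk_vertices A k g) \<le> (\<Sum>a\<in>A. k a + 1)"
  using twice_card_image_le[OF _ edges_repeated_partner[OF assms(2,3)]] assms(1)
  by (simp add: walk_vertices_def)

text \<open>When every vertex is visited exactly twice, uniqueness of partners propagates: the other
  visit to the start of a0 is the start of some walk b, which must then follow a0 step by step and
  stop with it.\<close>

lemma extremal_walks_paired:
  assumes fin: "finite A" and rep: "edges_repeated A k g" and pos: "\<And>a. a \<in> A \<Longrightarrow> k a \<ge> 1"
    and eq: "(\<Sum>a\<in>A. k a + 1) \<le> 2 * card (walk_vertices A k g)" and a0: "a0 \<in> A"
  obtains b where "b \<in> A" "b \<noteq> a0" "k b = k a0" "\<And>j. j \<le> k a0 \<Longrightarrow> g b j = g a0 j"
    "inj_on (g a0) {..k a0}" "\<And>a j. a \<in> A \<Longrightarrow> a \<noteq> a0 \<Longrightarrow> a \<noteq> b \<Longrightarrow> j \<le> k a \<Longrightarrow> g a j \<notin> g a0 ` {..k a0}"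
proof -
  \<comment> \<open>\<open>U\<close> excludes three visits to one vertex: two visits that both
    differ from a third one at the same vertex coincide.\<close>
  have U: "(a, i) = (c, l)" if "a \<in> A" "i \<le> k a" "b \<in> A" "j \<le> k b" "c \<in> A" "l \<le> k c"
    "g a i = g b j" "g b j = g c l" "(a, i) \<noteq> (b, j)" "(b, j) \<noteq> (c, l)" for a i b j c l
    using two_to_one_if_card_eq[OF _ edges_repeated_partner[OF rep pos], of "(a, i)" "(b, j)" "(c, l)"]
      that fin eq by (simp add: walk_vertices_def)
  obtain b j where b: "b \<in> A" "j \<le> k b" "(b, j) \<noteq> (a0, 0)" "g b j = g a0 0"
    using edges_repeated_partner[OF rep pos, of "(a0, 0)"] a0 by auto
  \<comment> \<open>Otherwise an edge of b ends at this visit. Its repetition ends at another visit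
    to the same vertex, which can only be \<open>(a0, 0)\<close>, but no edge ends there.\<close>
  have j0: "j = 0"
  proof (rule ccontr)
    assume "j \<noteq> 0"
    then obtain j1 where j1: "j = Suc j1" by (cases j) auto
    with b have "j1 < k b" by simp
    then obtain a' j' where aj: "a' \<in> A" "j' < k a'" "(a', j') \<noteq> (b, j1)"
       "g a' (Suc j') = g b (Suc j1)"
      using rep b unfolding edges_repeated_def by meson
    have "(a0, 0) = (a', Suc j')"
      by (rule U[of _ _ b j]) (use aj b j1 a0 in auto)
    thus False by simp
  qed
  hence ba: "b \<noteq> a0" using b by auto
  have follow: "j \<le> k b \<and> g b j = g a0 j" if "j \<le> k a0" for j
    using that
  proof (induction j)
    case 0 thus ?case using b j0 by simp
  next
    case (Suc j)
    hence IH: "j \<le> k b" "g b j = g a0 j" "j < k a0" by auto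
    obtain a' j' where aj: "a' \<in> A" "j' < k a'" "(a', j') \<noteq> (a0, j)" "g a' j' = g a0 j"
       "g a' (Suc j') = g a0 (Suc j)"
      using rep a0 \<open>j < k a0\<close> unfolding edges_repeated_def by meson
    have "(b, j) = (a', j')"
      by (rule U[of _ _ a0 j]) (use aj b IH a0 ba in auto)
    thus ?case using aj by auto
  qed
  have kk: "k b = k a0"
  proof (rule antisym)
    show "k a0 \<le> k b" using follow[of "k a0"] by simp
    \<comment> \<open>If b went on, the repetition of its next edge would have to start at
      \<open>(a0, k a0)\<close>, where a0 has already stopped.\<close>
    show "k b \<le> k a0"
    proof (rule ccontr)
      assume "\<not> k b \<le> k a0"
      hence l: "k a0 < k b" by simp
      then obtain a' j' where aj: "a' \<in> A" "j' < k a'" "(a', j') \<noteq> (b, k a0)" "g a' j' = g b (k a0)"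
        using rep b unfolding edges_repeated_def by meson
      have "(a0, k a0) = (a', j')"
        by (rule U[of _ _ b "k a0"]) (use aj b l a0 ba follow[of "k a0"] in auto)
      thus False using aj by auto
    qed
  qed
  show ?thesis
  proof (rule that[of b])
    show "inj_on (g a0) {..k a0}"
    proof (rule inj_onI, rule ccontr)
      fix i j assume ij: "i \<in> {..k a0}" "j \<in> {..k a0}" "g a0 i = g a0 j" "i \<noteq> j"
      have "(b, i) = (a0, j)"
        by (rule U[of _ _ a0 i]) (use ij b a0 ba follow[of i] in auto)
      thus False using ba by simp
    qed
    fix a j assume aj: "a \<in> A" "a \<noteq> a0" "a \<noteq> b" "j \<le> k a"
    show "g a j \<notin> g a0 ` {..k a0}"
    proof
      assume "g a j \<in> g a0 ` {..k a0}"
      then obtain i where i: "i \<le> k a0" "g a j = g a0 i" by auto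
      have "(b, i) = (a, j)"
        by (rule U[of _ _ a0 i]) (use i b a0 ba aj follow[of i] in auto)
      thus False using aj by simp
    qed
  qed (use b ba kk follow in auto)
qed

section \<open>Pairs of closed walks\<close>

definition cyc_next :: "nat \<Rightarrow> bool \<times> nat \<Rightarrow> bool \<times> nat" where
  "cyc_next k x = (fst x, Suc (snd x) mod k)"

text \<open>The analogue of \<open>edges_repeated\<close> for two closed walks of length k, told
  apart by the Boolean; the one flagged \<open>True\<close> will carry the conjugates.\<close>

definition cyc_repeated :: "nat \<Rightarrow> (bool \<times> nat \<Rightarrow> nat) \<Rightarrow> bool" where
  "cyc_repeated k h \<longleftrightarrow> (\<forall>x\<in>UNIV \<times> {..<k}. \<exists>y\<in>UNIV \<times> {..<k}. y \<noteq> x \<and> h y = h x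
     \<and> h (cyc_next k y) = h (cyc_next k x))"

lemma cyc_next_in: "x \<in> UNIV \<times> {..<k} \<Longrightarrow> cyc_next k x \<in> UNIV \<times> {..<k}"
  by (auto simp: cyc_next_def)

lemma inj_cyc_next: "inj_on (cyc_next k) (UNIV \<times> {..<k})"
proof (rule inj_onI)
  fix x y assume xy: "x \<in> UNIV \<times> {..<k}" "y \<in> UNIV \<times> {..<k}" "cyc_next k x = cyc_next k y"
  have l: "snd x < k" "snd y < k" using xy by (auto simp: mem_Times_iff)
  have "Suc (snd x) mod k = Suc (snd y) mod k" using xy by (simp add: cyc_next_def)
  hence "snd x = snd y"
    using l by (simp add: mod_Suc split: if_splits)
  thus "x = y" using xy by (auto simp: cyc_next_def prod_eq_iff)
qed

lemma cyc_repeated_ex: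
  assumes "cyc_repeated k h" "x \<in> UNIV \<times> {..<k}"
  shows "\<exists>y\<in>UNIV \<times> {..<k}. y \<noteq> x \<and> h y = h x"
  using assms unfolding cyc_repeated_def by blast

lemma cyc_repeated_card_le:
  assumes "cyc_repeated k h" shows "card (h ` (UNIV \<times> {..<k})) \<le> k"
proof -
  have "2 * card (h ` (UNIV \<times> {..<k})) \<le> card ((UNIV :: bool set) \<times> {..<k})"
    by (intro twice_card_image_le cyc_repeated_ex[OF assms]) auto
  thus ?thesis by (simp add: card_cartesian_product)
qed

text \<open>The edge leaving x is repeated from another visit to the same vertex, and in the
  extremal case this visit can only be y. So partners advance together.\<close>

lemma cyc_extremal_follow:
  assumes rep: "cyc_repeated k h" and eq: "card (h ` (UNIV \<times> {..<k})) = k"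
    and x: "x \<in> UNIV \<times> {..<k}" and y: "y \<in> UNIV \<times> {..<k}" and xy: "x \<noteq> y" "h x = h y"
  shows "(cyc_next k ^^ n) x \<noteq> (cyc_next k ^^ n) y \<and> h ((cyc_next k ^^ n) x) = h ((cyc_next k ^^ n) y)
    \<and> (cyc_next k ^^ n) x \<in> UNIV \<times> {..<k} \<and> (cyc_next k ^^ n) y \<in> UNIV \<times> {..<k}"
proof (induction n)
  case 0 thus ?case using x y xy by simp
next
  case (Suc n)
  let ?x = "(cyc_next k ^^ n) x" and ?y = "(cyc_next k ^^ n) y"
  obtain z where z: "z \<in> UNIV \<times> {..<k}" "z \<noteq> ?x" "h z = h ?x" "h (cyc_next k z) = h (cyc_next k ?x)"
    using rep[unfolded cyc_repeated_def, THEN bspec, of ?x] Suc by (auto simp only:)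
  have card: "card ((UNIV :: bool set) \<times> {..<k}) \<le> 2 * card (h ` (UNIV \<times> {..<k}))"
    using eq by (simp add: card_cartesian_product)
  have "z = ?y"
    by (rule two_to_one_if_card_eq[OF _ cyc_repeated_ex[OF rep] card, of z ?x])
      (use z Suc in simp_all)
  hence "h (cyc_next k ?y) = h (cyc_next k ?x)" using z by simp
  moreover have "cyc_next k ?x \<noteq> cyc_next k ?y"
    using Suc inj_cyc_next[of k] by (simp only: inj_on_eq_iff) simp
  ultimately show ?case using Suc cyc_next_in[of ?x k] cyc_next_in[of ?y k] by simp
qed

lemma cyc_next_funpow: "a < k \<Longrightarrow> (cyc_next k ^^ a) (s, 0) = (s, a)"
  by (induction a) (auto simp: cyc_next_def)

text \<open>The partner of \<open>(s, a)\<close> under a two-to-one labelling is the \<open>a\<close>-fold successor of the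
  partner of \<open>(s, 0)\<close>, so only the two partners of the base points are free.\<close>

lemma card_cyc_extremal_le:
  assumes "k \<ge> 1"
  shows "card {h \<in> (UNIV \<times> {..<k}) \<rightarrow>\<^sub>E {..<N}. cyc_repeated k h \<and> card (h ` (UNIV \<times> {..<k})) = k}
    \<le> 4 * k\<^sup>2 * N ^ k"
proof -
  have k0: "k \<noteq> 0" using assms by simp
  define I where "I = (UNIV :: bool set) \<times> {..<k}"
  define H where "H = {h \<in> I \<rightarrow>\<^sub>E {..<N}. cyc_repeated k h \<and> card (h ` I) = k}"
  define C where "C p q = {h \<in> H. p \<noteq> (False, 0) \<and> h p = h (False, 0) \<and> q \<noteq> (True, 0) \<and> h q = h (True, 0)}" for p q
  have finI: "finite I" by (simp add: I_def)
  have cardI: "card I = 2 * k" by (simp add: I_def card_cartesian_product)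
  have finH: "finite H" unfolding H_def using finI by (auto intro!: finite_PiE)
  have H_le: "H \<subseteq> (\<Union>p\<in>I. \<Union>q\<in>I. C p q)"
  proof
    fix h assume h: "h \<in> H"
    hence rep: "cyc_repeated k h" by (simp add: H_def)
    obtain p where p: "p \<in> I" "p \<noteq> (False, 0)" "h p = h (False, 0)"
      using cyc_repeated_ex[OF rep, of "(False, 0)"] k0 unfolding I_def by blast
    obtain q where q: "q \<in> I" "q \<noteq> (True, 0)" "h q = h (True, 0)"
      using cyc_repeated_ex[OF rep, of "(True, 0)"] k0 unfolding I_def by blast
    show "h \<in> (\<Union>p\<in>I. \<Union>q\<in>I. C p q)" using h p q by (auto simp: C_def)
  qed
  have cardC: "card (C p q) \<le> N ^ k" if pq: "p \<in> I" "q \<in> I" for p q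
  proof (cases "C p q = {}")
    case False
    then obtain h0 where h0: "h0 \<in> C p q" by auto
    \<comment> \<open>The partner of x, computed from p and q alone and therefore common to all
      labellings in \<open>C p q\<close>.\<close>
    define pt where "pt x = (cyc_next k ^^ snd x) (if fst x then q else p)" for x
    have pt: "pt x \<noteq> x \<and> h (pt x) = h x \<and> pt x \<in> I" if "h \<in> C p q" "x \<in> I" for h x
    proof -
      obtain s a where x: "x = (s, a)" "a < k" using \<open>x \<in> I\<close> by (auto simp: I_def)
      define p' where "p' = (if s then q else p)"
      have p': "p' \<in> I" "p' \<noteq> (s, 0)" "h p' = h (s, 0)"
        using that(1) pq by (auto simp: C_def p'_def)
      have "(cyc_next k ^^ a) p' \<noteq> (cyc_next k ^^ a) (s, 0) \<and> h ((cyc_next k ^^ a) p') = h ((cyc_next k ^^ a) (s, 0))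
        \<and> (cyc_next k ^^ a) p' \<in> UNIV \<times> {..<k} \<and> (cyc_next k ^^ a) (s, 0) \<in> UNIV \<times> {..<k}"
      proof (rule cyc_extremal_follow)
        show "cyc_repeated k h" "card (h ` (UNIV \<times> {..<k})) = k"
          using that by (simp_all add: C_def H_def I_def)
      qed (use p' x in \<open>simp_all add: I_def\<close>)
      thus ?thesis using x by (auto simp: pt_def p'_def cyc_next_funpow I_def)
    qed
    \<comment> \<open>Every labelling in \<open>C p q\<close> identifies the points that
      \<open>h0\<close> identifies.\<close>
    have same: "h x = h y" if h: "h \<in> C p q" and xy: "x \<in> I" "y \<in> I" "h0 x = h0 y" for h x y
    proof (cases "x = y")
      case False
      have rep: "cyc_repeated k h0" and c0: "card I \<le> 2 * card (h0 ` I)"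
        using h0 cardI by (simp_all add: C_def H_def)
      have "pt x = y"
        by (rule two_to_one_if_card_eq[OF finI cyc_repeated_ex[OF rep, folded I_def] c0, of _ x])
          (use pt[OF h0 \<open>x \<in> I\<close>] xy False in simp_all)
      thus ?thesis using pt[OF h \<open>x \<in> I\<close>] by simp
    qed simp
    \<comment> \<open>One representative per fibre of \<open>h0\<close>: these k values determine a
      labelling, which gives \<open>N ^ k\<close>. The pairs (p, q) number (2 k)^2, the source of
      the factor 4 k^2.\<close>
    define R where "R = inv_into I h0 ` (h0 ` I)"
    have R: "R \<subseteq> I" "card R = k"
    proof -
      show "R \<subseteq> I" unfolding R_def by (intro image_subsetI inv_into_into) auto
      have "card R = card (h0 ` I)" unfolding R_def
        by (intro card_image inj_on_inv_into) simp
      thus "card R = k" using h0 by (simp add: C_def H_def)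
    qed
    have "inj_on (\<lambda>h. restrict h R) (C p q)"
    proof (rule inj_onI)
      fix h h' assume hh: "h \<in> C p q" "h' \<in> C p q" "restrict h R = restrict h' R"
      show "h = h'"
      proof
        fix x show "h x = h' x"
        proof (cases "x \<in> I")
          case True
          define r where "r = inv_into I h0 (h0 x)"
          have r: "r \<in> R" "h0 r = h0 x" using True by (auto simp: R_def r_def f_inv_into_f)
          have "restrict h R r = restrict h' R r" using hh(3) by simp
          hence "h r = h' r" using r(1) by simp
          moreover have "h r = h x" "h' r = h' x"
            using same[OF hh(1) _ True r(2)] same[OF hh(2) _ True r(2)] r(1) R(1) by blast+
          ultimately show ?thesis by simp
        next
          case False
          have "h \<in> I \<rightarrow>\<^sub>E {..<N}" "h' \<in> I \<rightarrow>\<^sub>E {..<N}"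
            using hh by (simp_all add: C_def H_def)
          thus ?thesis using PiE_arb[of h I _ x] PiE_arb[of h' I _ x] False by metis
        qed
      qed
    qed
    moreover have "(\<lambda>h. restrict h R) ` C p q \<subseteq> R \<rightarrow>\<^sub>E {..<N}"
    proof (rule image_subsetI)
      fix h assume "h \<in> C p q"
      hence "h \<in> I \<rightarrow>\<^sub>E {..<N}" by (simp add: C_def H_def)
      thus "restrict h R \<in> R \<rightarrow>\<^sub>E {..<N}" using R(1) by (intro restrict_PiE_iff[THEN iffD2]) auto
    qed
    ultimately have "card (C p q) \<le> card (R \<rightarrow>\<^sub>E {..<N})"
      using finite_subset[OF R(1) finI] by (intro card_inj_on_le finite_PiE) auto
    thus ?thesis using R finite_subset[OF R(1) finI] by (simp add: card_PiE)
  qed auto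
  have "card H \<le> card (\<Union>p\<in>I. \<Union>q\<in>I. C p q)"
    using H_le finH finI by (intro card_mono) (auto simp: C_def)
  also have "\<dots> \<le> (\<Sum>p\<in>I. card (\<Union>q\<in>I. C p q))" using finI by (rule card_UN_le)
  also have "\<dots> \<le> (\<Sum>p\<in>I. \<Sum>q\<in>I. card (C p q))" using finI by (intro sum_mono card_UN_le)
  also have "\<dots> \<le> (\<Sum>p\<in>I. \<Sum>q\<in>I. N ^ k)" by (intro sum_mono cardC)
  also have "\<dots> = 4 * k\<^sup>2 * N ^ k" by (simp add: cardI power2_eq_square)
  finally show ?thesis by (simp add: H_def I_def)
qed

section \<open>Characteristic functions from moments\<close>

text \<open>The Taylor remainder of the characteristic function is controlled by an even moment, and the
  Gaussian moments \<open>(2 n - 1)!! \<sigma>\<^sup>2\<^sup>n = (2 n)! (\<sigma>\<^sup>2 / 2)\<^sup>n / n!\<close> grow slowly enough for the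
  remainder to vanish.\<close>

definition gaussian_moment :: "real \<Rightarrow> nat \<Rightarrow> real" where
  "gaussian_moment s n = (if even n then fact n / fact (n div 2) * (s / 2) ^ (n div 2) else 0)"

lemma gaussian_moment_0 [simp]: "gaussian_moment s 0 = 1"
  and gaussian_moment_1 [simp]: "gaussian_moment s (Suc 0) = 0"
  by (simp_all add: gaussian_moment_def)

lemma gaussian_moment_rec: "gaussian_moment s (Suc (Suc n)) = real (Suc n) * s * gaussian_moment s n"
proof (cases "even n")
  case True
  then obtain m where n: "n = 2 * m" by (elim evenE)
  have "(fact (Suc (Suc n)) :: real) / fact (Suc m) = 2 * real (Suc n) * (fact n / fact m)"
    unfolding n by (simp add: divide_simps) (simp add: algebra_simps)
  thus ?thesis by (simp add: gaussian_moment_def n del: fact_Suc) (simp add: field_simps)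
qed (simp add: gaussian_moment_def)

lemma (in prob_space) cos_sin_tendsto_of_moments:
  fixes L :: "nat \<Rightarrow> 'a \<Rightarrow> real"
  assumes meas [measurable]: "\<And>N. L N \<in> borel_measurable M"
    and int: "\<And>N n. N \<ge> 1 \<Longrightarrow> integrable M (\<lambda>x. L N x ^ n)"
    and lim: "\<And>n. (\<lambda>N. expectation (\<lambda>x. L N x ^ n)) \<longlonglongrightarrow> gaussian_moment s n"
  shows "(\<lambda>N. expectation (\<lambda>x. iexp (L N x))) \<longlonglongrightarrow> exp (- s / 2)"
proof (rule tendstoI)
  fix e :: real assume e: "e > 0"
  define r where "r n = ((\<bar>s\<bar> / 2) ^ n / fact n :: real)" for n
  define S where "S m = (\<Sum>k\<le>2 * m. (\<i> ^ k / fact k) * of_real (gaussian_moment s k) :: complex)" for m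
  have even_term: "\<i> ^ (2 * n) / fact (2 * n) * complex_of_real (gaussian_moment s (2 * n))
      = of_real ((- s / 2) ^ n / fact n)" for n
  proof -
    have "gaussian_moment s (2 * n) = fact (2 * n) / fact n * (s / 2) ^ n" by (simp add: gaussian_moment_def)
    moreover have "\<i> ^ (2 * n) = complex_of_real ((- 1) ^ n)" by (simp add: power_mult)
    moreover have "(- s / 2) ^ n = (- 1) ^ n * (s / 2) ^ n" by (simp add: power_mult_distrib[symmetric])
    ultimately show ?thesis by (simp only: of_real_mult of_real_divide of_real_fact) simp
  qed
  have S_eq: "S m = (\<Sum>k\<le>m. of_real ((- s / 2) ^ k / fact k))" for m
  proof (induction m)
    case (Suc m)
    have "2 * Suc m = Suc (Suc (2 * m))" by simp
    hence "S (Suc m) = S m + \<i> ^ (2 * Suc m) / fact (2 * Suc m) * of_real (gaussian_moment s (2 * Suc m))"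
      unfolding S_def by (simp add: gaussian_moment_def)
    also have "\<dots> = S m + of_real ((- s / 2) ^ Suc m / fact (Suc m))" by (simp only: even_term)
    finally show ?case using Suc by simp
  qed (simp add: S_def)
  have S_lim: "S \<longlonglongrightarrow> exp (- s / 2)"
  proof -
    have "(\<lambda>k. (- s / 2) ^ k /\<^sub>R fact k) sums exp (- s / 2)"
      by (rule exp_converges)
    hence "(\<lambda>m. \<Sum>k\<le>m. (- s / 2) ^ k / fact k) \<longlonglongrightarrow> exp (- s / 2)"
      by (simp add: sums_def_le scaleR_conv_of_real field_simps)
    hence "(\<lambda>m. complex_of_real (\<Sum>k\<le>m. (- s / 2) ^ k / fact k)) \<longlonglongrightarrow> of_real (exp (- s / 2))"
      by (rule tendsto_of_real)
    moreover have "(\<lambda>m. complex_of_real (\<Sum>k\<le>m. (- s / 2) ^ k / fact k)) = S"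
      by (rule ext) (simp add: S_eq)
    ultimately show ?thesis by (simp only: exp_of_real[symmetric])
  qed
  have r_lim: "r \<longlonglongrightarrow> 0"
    unfolding r_def using summable_LIMSEQ_zero[OF summable_exp[of "\<bar>s\<bar> / 2"]]
    by (simp add: field_simps)
  have "\<forall>\<^sub>F m in sequentially. dist (S m) (exp (- s / 2)) < e / 3"
    using S_lim e by (intro tendstoD) auto
  moreover have "\<forall>\<^sub>F m in sequentially. r m < e / 12"
    by (rule order_tendstoD(2)[OF r_lim]) (use e in simp)
  ultimately have "\<forall>\<^sub>F m in sequentially. dist (S m) (exp (- s / 2)) < e / 3 \<and> r m < e / 12"
    by eventually_elim simp
  \<comment> \<open>The order of the Taylor expansion is fixed before N grows. The bound e / 12 on
    \<open>r m\<close> keeps the limit of the remainder, at most \<open>2 * r m\<close>, below e /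
    3.\<close>
  then obtain m where m: "dist (S m) (exp (- s / 2)) < e / 3" "r m < e / 12"
    using eventually_happens'[OF sequentially_bot] by blast
  define T where "T N = (\<Sum>k\<le>2 * m. (\<i> ^ k / fact k) * of_real (expectation (\<lambda>x. L N x ^ k)) :: complex)" for N
  have "T \<longlonglongrightarrow> S m"
    unfolding T_def S_def by (intro tendsto_intros lim)
  hence "\<forall>\<^sub>F N in sequentially. dist (T N) (S m) < e / 3"
    using e by (intro tendstoD) auto
  moreover have "(\<lambda>N. 2 / fact (2 * m) * expectation (\<lambda>x. L N x ^ (2 * m))) \<longlonglongrightarrow>
     2 / fact (2 * m) * gaussian_moment s (2 * m)"
    by (intro tendsto_intros lim)
  hence "\<forall>\<^sub>F N in sequentially. 2 / fact (2 * m) * expectation (\<lambda>x. L N x ^ (2 * m)) < e / 3"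
  proof (rule order_tendstoD)
    have "2 / fact (2 * m) * gaussian_moment s (2 * m) = 2 * ((s / 2) ^ m / fact m)"
      by (simp add: gaussian_moment_def)
    also have "\<dots> \<le> 2 * r m"
      unfolding r_def using abs_ge_self[of "(s / 2) ^ m"]
      by (intro mult_left_mono divide_right_mono) (auto simp: power_abs)
    finally have "2 / fact (2 * m) * gaussian_moment s (2 * m) \<le> 2 * r m" .
    thus "2 / fact (2 * m) * gaussian_moment s (2 * m) < e / 3" using m e by simp
  qed
  ultimately show "\<forall>\<^sub>F N in sequentially. dist (expectation (\<lambda>x. iexp (L N x))) (exp (- s / 2)) < e"
    using eventually_ge_at_top[of 1]
  proof eventually_elim
    case (elim N)
    \<comment> \<open>The order is even, so the absolute moment in the remainder is an ordinary
      moment, whose limit is known.\<close>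
    have "cmod (char (distr M borel (L N)) 1 - (\<Sum>k \<le> 2 * m. ((\<i> * complex_of_real 1)^k / fact k) * expectation (\<lambda>x. L N x ^ k))) \<le>
        (2 * \<bar>1\<bar>^(2 * m) / fact (2 * m)) * expectation (\<lambda>x. \<bar>L N x\<bar>^(2 * m))"
      by (rule char_approx1'[where X = "L N"]) (use int elim in auto)
    moreover have "char (distr M borel (L N)) 1 = expectation (\<lambda>x. iexp (L N x))"
      by (simp add: char_def integral_distr)
    ultimately have "dist (expectation (\<lambda>x. iexp (L N x))) (T N) < e / 3"
      using elim(2) unfolding T_def dist_norm by (simp add: power_even_abs)
    moreover have "dist (expectation (\<lambda>x. iexp (L N x))) (exp (- s / 2))
      \<le> dist (expectation (\<lambda>x. iexp (L N x))) (T N) + (dist (T N) (S m) + dist (S m) (exp (- s / 2)))"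
      by (rule order_trans[OF dist_triangle[of _ _ "T N"]]) (intro add_left_mono dist_triangle)
    ultimately show ?case using m(1) elim(1) by simp
  qed
qed

section \<open>Coefficients of characteristic determinants\<close>

text \<open>Each row takes either its \<open>K\<close> entry or its \<open>w * Z\<close> entry, and
  T collects the rows of the second kind.\<close>

lemma det_add_smult_expansion:
  fixes K Z :: "nat \<Rightarrow> nat \<Rightarrow> complex"
  shows "det (Matrix.mat n n (\<lambda>(i, j). K i j + w * Z i j)) =
    (\<Sum>k\<le>n. w ^ k * (\<Sum>(T, p)\<in>{T. T \<subseteq> {..<n} \<and> card T = k} \<times> {p. p permutes {..<n}}.
       signof p * (\<Prod>i\<in>{..<n} - T. K i (p i)) * (\<Prod>i\<in>T. Z i (p i))))"
proof -
  let ?P = "{p. p permutes {..<n}}"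
  have finP: "finite ?P" by (simp add: finite_permutations)
  have "det (Matrix.mat n n (\<lambda>(i, j). K i j + w * Z i j)) =
      (\<Sum>p\<in>?P. signof p * (\<Prod>i<n. w * Z i (p i) + K i (p i)))"
    by (subst det_def'[where n = n])
      (auto simp: lessThan_atLeast0 permutes_in_image add.commute intro!: sum.cong prod.cong)
  also have "\<dots> = (\<Sum>p\<in>?P. \<Sum>T\<in>Pow {..<n}.
      w ^ card T * (signof p * (\<Prod>i\<in>{..<n} - T. K i (p i)) * (\<Prod>i\<in>T. Z i (p i))))"
    by (intro sum.cong refl, subst prod_add)
      (auto simp: sum_distrib_left prod.distrib mult_ac intro!: sum.cong)
  also have "\<dots> = (\<Sum>T\<in>Pow {..<n}. \<Sum>p\<in>?P.
      w ^ card T * (signof p * (\<Prod>i\<in>{..<n} - T. K i (p i)) * (\<Prod>i\<in>T. Z i (p i))))"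
    by (rule sum.swap)
  also have "\<dots> = (\<Sum>k\<le>n. \<Sum>T\<in>{T \<in> Pow {..<n}. card T = k}. \<Sum>p\<in>?P.
      w ^ card T * (signof p * (\<Prod>i\<in>{..<n} - T. K i (p i)) * (\<Prod>i\<in>T. Z i (p i))))"
  proof (rule sum.group[symmetric])
    show "card ` Pow {..<n} \<subseteq> {..n}"
      by (auto intro: order_trans[OF card_mono[of "{..<n}"]])
  qed auto
  also have "\<dots> = (\<Sum>k\<le>n. w ^ k * (\<Sum>(T, p)\<in>{T. T \<subseteq> {..<n} \<and> card T = k} \<times> ?P.
       signof p * (\<Prod>i\<in>{..<n} - T. K i (p i)) * (\<Prod>i\<in>T. Z i (p i))))"
    by (intro sum.cong refl) (auto simp: sum_distrib_left sum.cartesian_product intro!: sum.cong)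
  finally show ?thesis .
qed

context iid_entries
begin

text \<open>Each position occurs at most once in either product. A common position contributes E
  |X|^2 = 1, and a position of only one product contributes a mean, which is 0.\<close>

lemma X_prod_orthogonal:
  assumes "finite F" "finite G"
  shows "integrable P (\<lambda>\<omega>. (\<Prod>(i, j)\<in>F. X i j \<omega>) * cnj (\<Prod>(i, j)\<in>G. X i j \<omega>))"
    and "expectation (\<lambda>\<omega>. (\<Prod>(i, j)\<in>F. X i j \<omega>) * cnj (\<Prod>(i, j)\<in>G. X i j \<omega>)) = of_bool (F = G)"
proof -
  define S where "S = F \<times> {False} \<union> G \<times> {True}"
  have finS: "finite S" using assms by (simp add: S_def)
  have eq: "(\<Prod>(i, j)\<in>F. X i j \<omega>) * cnj (\<Prod>(i, j)\<in>G. X i j \<omega>) = (\<Prod>s\<in>S. entry (fst s) (snd s) \<omega>)" for \<omega>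
  proof -
    have "(\<Prod>s\<in>S. entry (fst s) (snd s) \<omega>)
        = (\<Prod>s\<in>F \<times> {False}. entry (fst s) (snd s) \<omega>) * (\<Prod>s\<in>G \<times> {True}. entry (fst s) (snd s) \<omega>)"
      unfolding S_def using assms by (intro prod.union_disjoint) auto
    also have "(\<Prod>s\<in>F \<times> {False}. entry (fst s) (snd s) \<omega>) = (\<Prod>(i, j)\<in>F. X i j \<omega>)"
      by (rule prod.reindex_bij_witness[of _ "\<lambda>e. (e, False)" fst]) (auto simp: entry_def)
    also have "(\<Prod>s\<in>G \<times> {True}. entry (fst s) (snd s) \<omega>) = (\<Prod>(i, j)\<in>G. cnj (X i j \<omega>))"
      by (rule prod.reindex_bij_witness[of _ "\<lambda>e. (e, True)" fst]) (auto simp: entry_def)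
    finally show ?thesis by (simp add: case_prod_beta)
  qed
  show "integrable P (\<lambda>\<omega>. (\<Prod>(i, j)\<in>F. X i j \<omega>) * cnj (\<Prod>(i, j)\<in>G. X i j \<omega>))"
    unfolding eq by (rule integrable_prod_entry[OF finS])
  have "expectation (\<lambda>\<omega>. \<Prod>s\<in>S. entry (fst s) (snd s) \<omega>) = of_bool (F = G)"
  proof (cases "F = G")
    case True
    have "(\<Prod>e\<in>fst ` S. mixed_moment (card {s \<in> S. fst s = e \<and> \<not> snd s}) (card {s \<in> S. fst s = e \<and> snd s})) = 1"
    proof (rule prod.neutral, rule ballI)
      fix e assume "e \<in> fst ` S"
      hence "e \<in> F" using True by (auto simp: S_def)
      hence 1: "{s \<in> S. fst s = e \<and> \<not> snd s} = {(e, False)}" "{s \<in> S. fst s = e \<and> snd s} = {(e, True)}"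
        using True by (auto simp: S_def)
      show "mixed_moment (card {s \<in> S. fst s = e \<and> \<not> snd s}) (card {s \<in> S. fst s = e \<and> snd s}) = 1"
        unfolding 1 by simp
    qed
    thus ?thesis using True by (simp add: expectation_prod_entry[OF finS])
  next
    case False
    then obtain e where "e \<in> F \<and> e \<notin> G \<or> e \<in> G \<and> e \<notin> F" by blast
    hence "\<exists>s0\<in>S. \<forall>s\<in>S. fst s = fst s0 \<longrightarrow> s = s0"
    proof
      assume "e \<in> F \<and> e \<notin> G"
      thus ?thesis by (intro bexI[of _ "(e, False)"]) (auto simp: S_def)
    next
      assume "e \<in> G \<and> e \<notin> F"
      thus ?thesis by (intro bexI[of _ "(e, True)"]) (auto simp: S_def)
    qed
    then obtain s0 where "s0 \<in> S" "\<And>s. s \<in> S \<Longrightarrow> fst s = fst s0 \<Longrightarrow> s = s0" by blast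
    from expectation_prod_entry_eq_0[OF finS this] show ?thesis using False by simp
  qed
  thus "expectation (\<lambda>\<omega>. (\<Prod>(i, j)\<in>F. X i j \<omega>) * cnj (\<Prod>(i, j)\<in>G. X i j \<omega>)) = of_bool (F = G)"
    unfolding eq .
qed

text \<open>Pythagoras for an orthonormal family; injectivity of \<open>E\<close> says that
  different indices give different monomials.\<close>

lemma
  fixes \<alpha> :: "'j \<Rightarrow> complex" and E :: "'j \<Rightarrow> (nat \<times> nat) set"
  assumes finJ: "finite J" and finE: "\<And>x. x \<in> J \<Longrightarrow> finite (E x)" and inj: "inj_on E J"
  shows integrable_multilinear_sq:
      "integrable P (\<lambda>\<omega>. (cmod (\<Sum>x\<in>J. \<alpha> x * (\<Prod>(i, j)\<in>E x. X i j \<omega>)))\<^sup>2)" (is ?I)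
    and expectation_multilinear_sq:
      "expectation (\<lambda>\<omega>. (cmod (\<Sum>x\<in>J. \<alpha> x * (\<Prod>(i, j)\<in>E x. X i j \<omega>)))\<^sup>2) = (\<Sum>x\<in>J. (cmod (\<alpha> x))\<^sup>2)" (is ?E)
proof -
  let ?Y = "\<lambda>x \<omega>. \<Prod>(i, j)\<in>E x. X i j \<omega>"
  have eq: "complex_of_real ((cmod (\<Sum>x\<in>J. \<alpha> x * ?Y x \<omega>))\<^sup>2) =
     (\<Sum>x\<in>J. \<Sum>y\<in>J. (\<alpha> x * cnj (\<alpha> y)) * (?Y x \<omega> * cnj (?Y y \<omega>)))" for \<omega>
    unfolding complex_norm_square by (simp add: sum_product mult_ac)
  have int: "integrable P (\<lambda>\<omega>. (\<alpha> x * cnj (\<alpha> y)) * (?Y x \<omega> * cnj (?Y y \<omega>)))" if "x \<in> J" "y \<in> J" for x y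
    using X_prod_orthogonal(1)[OF finE[OF that(1)] finE[OF that(2)]] by (intro integrable_mult_right)
  have "integrable P (\<lambda>\<omega>. complex_of_real ((cmod (\<Sum>x\<in>J. \<alpha> x * ?Y x \<omega>))\<^sup>2))"
    unfolding eq by (intro Bochner_Integration.integrable_sum int)
  thus ?I by (simp only: complex_of_real_integrable_eq)
  have "expectation (\<lambda>\<omega>. complex_of_real ((cmod (\<Sum>x\<in>J. \<alpha> x * ?Y x \<omega>))\<^sup>2)) =
      (\<Sum>x\<in>J. \<Sum>y\<in>J. (\<alpha> x * cnj (\<alpha> y)) * expectation (\<lambda>\<omega>. ?Y x \<omega> * cnj (?Y y \<omega>)))"
    unfolding eq using int by (simp add: Bochner_Integration.integral_sum)
  also have "\<dots> = (\<Sum>x\<in>J. \<Sum>y\<in>J. if x = y then \<alpha> x * cnj (\<alpha> x) else 0)"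
    by (intro sum.cong refl, subst X_prod_orthogonal(2)) (auto simp: finE inj_on_eq_iff[OF inj])
  also have "\<dots> = complex_of_real (\<Sum>x\<in>J. (cmod (\<alpha> x))\<^sup>2)"
    using finJ by (simp add: sum.delta complex_norm_square del: of_real_power)
  finally show ?E by (simp only: integral_complex_of_real of_real_eq_iff)
qed

end

text \<open>A k-element set T with a permutation of T is one term in the sum of all principal minors
  of order k. Because of the signs at the entries, \<open>det_coeff\<close> is (-1)^k times that
  sum.\<close>

definition perm_pairs :: "nat \<Rightarrow> nat \<Rightarrow> (nat set \<times> (nat \<Rightarrow> nat)) set" where
  "perm_pairs N k = (SIGMA T:{T. T \<subseteq> {..<N} \<and> card T = k}. {p. p permutes T})"

text \<open>The coefficients of \<open>w\<^sup>k\<close> in \<open>det (1 - w Y)\<close> and in the determinant of \<open>1 - w Y\<close> bordered by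
  the column \<open>v\<close>, the row \<open>u\<^sup>T\<close> and the corner \<open>0\<close>.\<close>

definition det_coeff :: "(nat \<Rightarrow> nat \<Rightarrow> complex) \<Rightarrow> nat \<Rightarrow> nat \<Rightarrow> complex" where
  "det_coeff y N k = (\<Sum>(T, p)\<in>perm_pairs N k. signof p * (\<Prod>i\<in>T. - y i (p i)))"

definition bordered_const :: "(nat \<Rightarrow> complex) \<Rightarrow> (nat \<Rightarrow> complex) \<Rightarrow> nat \<Rightarrow> nat \<Rightarrow> nat \<Rightarrow> complex" where
  "bordered_const u v N i j = (if i < N then (if j < N then of_bool (i = j) else v i)
     else (if j < N then u j else 0))"

definition bordered_lin :: "(nat \<Rightarrow> nat \<Rightarrow> complex) \<Rightarrow> nat \<Rightarrow> nat \<Rightarrow> nat \<Rightarrow> complex" where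
  "bordered_lin y N i j = (if i < N \<and> j < N then - y i j else 0)"

definition bordered_coeff where
  "bordered_coeff y u v N k =
    (\<Sum>(T, p)\<in>{T. T \<subseteq> {..<Suc N} \<and> card T = k} \<times> {p. p permutes {..<Suc N}}.
       signof p * (\<Prod>i\<in>{..<Suc N} - T. bordered_const u v N i (p i)) * (\<Prod>i\<in>T. bordered_lin y N i (p i)))"

lemma finite_perm_pairs: "finite (perm_pairs N k)"
  unfolding perm_pairs_def
  by (rule finite_SigmaI) (auto intro: finite_permutations finite_subset)

lemma card_perm_pairs: "card (perm_pairs N k) = (N choose k) * fact k"
proof -
  have "card (perm_pairs N k) = (\<Sum>T\<in>{T. T \<subseteq> {..<N} \<and> card T = k}. card {p. p permutes T})"
    unfolding perm_pairs_def by (rule card_SigmaI) (auto intro: finite_permutations finite_subset)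
  also have "\<dots> = (\<Sum>T\<in>{T. T \<subseteq> {..<N} \<and> card T = k}. fact k)"
    by (rule sum.cong) (auto intro!: card_permutations intro: finite_subset)
  also have "\<dots> = (N choose k) * fact k" by (simp add: n_subsets)
  finally show ?thesis .
qed

lemma prod_of_bool: "finite A \<Longrightarrow> (\<Prod>i\<in>A. of_bool (Q i) :: complex) = of_bool (\<forall>i\<in>A. Q i)"
  by (induction A rule: finite_induct) auto

text \<open>Outside T the factors are entries of the identity matrix, so a permutation survives only
  if it fixes every index outside T.\<close>

lemma det_one_minus_expansion:
  "det (Matrix.mat N N (\<lambda>(i, j). of_bool (i = j) + w * - y i j)) = (\<Sum>k\<le>N. w ^ k * det_coeff y N k)"
proof -
  have "(\<Sum>(T, p)\<in>{T. T \<subseteq> {..<N} \<and> card T = k} \<times> {p. p permutes {..<N}}.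
       signof p * (\<Prod>i\<in>{..<N} - T. of_bool (i = p i)) * (\<Prod>i\<in>T. - y i (p i))) = det_coeff y N k" for k
    unfolding det_coeff_def
  proof (rule sum.mono_neutral_cong_right)
    show "finite ({T. T \<subseteq> {..<N} \<and> card T = k} \<times> {p. p permutes {..<N}})"
      by (intro finite_cartesian_product) (auto intro: finite_permutations)
    show "perm_pairs N k \<subseteq> {T. T \<subseteq> {..<N} \<and> card T = k} \<times> {p. p permutes {..<N}}"
    proof
      fix x assume "x \<in> perm_pairs N k"
      then obtain T p where x: "x = (T, p)" "T \<subseteq> {..<N}" "card T = k" "p permutes T"
        by (auto simp: perm_pairs_def)
      thus "x \<in> {T. T \<subseteq> {..<N} \<and> card T = k} \<times> {p. p permutes {..<N}}"
        using permutes_subset[OF x(4,2)] by simp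
    qed
    show "\<forall>x\<in>{T. T \<subseteq> {..<N} \<and> card T = k} \<times> {p. p permutes {..<N}} - perm_pairs N k.
      (case x of (T, p) \<Rightarrow> signof p * (\<Prod>i\<in>{..<N} - T. of_bool (i = p i)) * (\<Prod>i\<in>T. - y i (p i))) = 0"
    proof safe
      fix T p assume *: "(T, p) \<notin> perm_pairs N (card T)" "p permutes {..<N}" "T \<subseteq> {..<N}"
      have "\<not> (\<forall>i\<in>{..<N} - T. i = p i)"
      proof
        assume h: "\<forall>i\<in>{..<N} - T. i = p i"
        have "p x = x" if x: "x \<in> {..<N} - T" for x
        proof -
          have "x = p x" using h x by (rule bspec)
          thus ?thesis by (rule sym)
        qed
        hence "p permutes T" by (rule permutes_superset[OF *(2)])
        thus False using * by (simp add: perm_pairs_def)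
      qed
      hence "(\<Prod>i\<in>{..<N} - T. of_bool (i = p i)) = (0 :: complex)"
        by (subst prod_of_bool) (simp_all only: finite_Diff finite_lessThan of_bool_eq)
      thus "signof p * (\<Prod>i\<in>{..<N} - T. of_bool (i = p i)) * (\<Prod>i\<in>T. - y i (p i)) = 0"
        by simp
    qed
    fix x assume x: "x \<in> perm_pairs N k"
    obtain T p where Tp: "x = (T, p)" by force
    hence "p permutes T" using x by (auto simp: perm_pairs_def)
    hence "\<forall>i\<in>{..<N} - T. i = p i" by (auto simp: permutes_not_in)
    hence "(\<Prod>i\<in>{..<N} - T. of_bool (i = p i)) = (1 :: complex)"
      by (subst prod_of_bool) (simp_all only: finite_Diff finite_lessThan of_bool_eq_1_iff)
    thus "(case x of (T, p) \<Rightarrow> signof p * (\<Prod>i\<in>{..<N} - T. of_bool (i = p i)) * (\<Prod>i\<in>T. - y i (p i))) =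
       (case x of (T, p) \<Rightarrow> signof p * (\<Prod>i\<in>T. - y i (p i)))"
      by (simp add: Tp)
  qed
  thus ?thesis
    using det_add_smult_expansion[of N "\<lambda>i j. of_bool (i = j)" w "\<lambda>i j. - y i j"] by simp
qed

text \<open>The surviving terms of the bordered determinant: the zero corner forces p to move N, row
  N takes an entry of u, one row outside T takes an entry of v, and the other rows outside T sit on
  the diagonal.\<close>

definition bordered_pairs :: "nat \<Rightarrow> nat \<Rightarrow> (nat set \<times> (nat \<Rightarrow> nat)) set" where
  "bordered_pairs N k = {(T, p). T \<subseteq> {..<N} \<and> card T = k \<and> p permutes {..<Suc N} \<and> p N \<noteq> N
     \<and> (\<forall>i\<in>T. p i \<noteq> N) \<and> (\<forall>i\<in>{..<N} - T. p i = i \<or> p i = N)}"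

lemma finite_bordered_pairs: "finite (bordered_pairs N k)"
  by (rule finite_subset[of _ "Pow {..<N} \<times> {p. p permutes {..<Suc N}}"])
    (auto simp: bordered_pairs_def intro: finite_permutations)

lemma bordered_pairsE:
  assumes "(T, p) \<in> bordered_pairs N k"
  obtains i where "i < N" "i \<notin> T" "p i = N" "inv_into UNIV p N = i" "p N < N"
    "\<And>x. x < N \<Longrightarrow> x \<notin> T \<Longrightarrow> x \<noteq> i \<Longrightarrow> p x = x" "p permutes {..<Suc N}" "T \<subseteq> {..<N}"
proof -
  have p: "p permutes {..<Suc N}" and T: "T \<subseteq> {..<N}" using assms by (auto simp: bordered_pairs_def)
  define i where "i = inv_into UNIV p N"
  have pi: "p i = N" using p by (simp add: i_def permutes_inverses)
  have pN: "p N \<noteq> N" using assms by (auto simp: bordered_pairs_def)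
  have "i \<in> {..<Suc N}" using pi p permutes_in_image[OF p, of i] by simp
  hence i: "i < N" using pi pN by (cases "i = N") auto
  have "p N \<in> {..<Suc N}" using permutes_in_image[OF p, of N] by simp
  hence pN: "p N < N" using pN by simp
  have px: "p x = x" if "x < N" "x \<notin> T" "x \<noteq> i" for x
  proof -
    have "p x \<noteq> N" using pi that(3) permutes_inj[OF p] by (metis injD)
    thus ?thesis using that assms by (auto simp: bordered_pairs_def)
  qed
  have iT: "i \<notin> T" using pi assms by (auto simp: bordered_pairs_def)
  show ?thesis by (rule that[OF i iT pi i_def[symmetric] pN px p T])
qed

lemma bordered_coeff_eq:
  "bordered_coeff y u v N k =
    (\<Sum>(T, p)\<in>bordered_pairs N k. signof p * (u (p N) * v (inv_into UNIV p N)) * (\<Prod>i\<in>T. - y i (p i)))"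
  unfolding bordered_coeff_def
proof (rule sum.mono_neutral_cong_right)
  let ?A = "{T. T \<subseteq> {..<Suc N} \<and> card T = k} \<times> {p. p permutes {..<Suc N}}"
  let ?t = "\<lambda>(T, p). signof p * (\<Prod>i\<in>{..<Suc N} - T. bordered_const u v N i (p i)) * (\<Prod>i\<in>T. bordered_lin y N i (p i))"
  show "finite ?A" by (intro finite_cartesian_product) (auto intro: finite_permutations)
  show "bordered_pairs N k \<subseteq> ?A" by (auto simp: bordered_pairs_def)
  show "\<forall>x\<in>?A - bordered_pairs N k. ?t x = 0"
  proof
    fix x assume x: "x \<in> ?A - bordered_pairs N k"
    obtain T p where Tp: "x = (T, p)" by force
    have T: "T \<subseteq> {..<Suc N}" "card T = k" "p permutes {..<Suc N}" "(T, p) \<notin> bordered_pairs N k"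
      using x Tp by auto
    have finT: "finite T" using T(1) finite_subset by blast
    \<comment> \<open>The four ways to meet a zero: row N or column N inside T hits a zero of
      \<open>bordered_lin\<close>, a fixed N hits the corner, and an off-diagonal entry outside T is
      a zero of the identity.\<close>
    consider "N \<in> T" | i where "i \<in> T" "p i = N" | "N \<notin> T" "p N = N"
       | i where "i < N" "i \<notin> T" "p i \<noteq> i" "p i \<noteq> N"
    proof -
      assume r: "N \<in> T \<Longrightarrow> thesis" "\<And>i. i \<in> T \<Longrightarrow> p i = N \<Longrightarrow> thesis" "N \<notin> T \<Longrightarrow> p N = N \<Longrightarrow> thesis"
        "\<And>i. i < N \<Longrightarrow> i \<notin> T \<Longrightarrow> p i \<noteq> i \<Longrightarrow> p i \<noteq> N \<Longrightarrow> thesis"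
      show thesis
      proof (rule ccontr)
        assume c: "\<not> thesis"
        have NT: "N \<notin> T" using c r(1) by blast
        moreover have "T \<subseteq> {..<N}" using T(1) NT by (auto simp: less_Suc_eq)
        ultimately have "(T, p) \<in> bordered_pairs N k"
          using T c r(2-4) by (auto simp: bordered_pairs_def)
        thus False using T(4) by simp
      qed
    qed
    thus "?t x = 0"
    proof cases
      case 1
      have "(\<Prod>i\<in>T. bordered_lin y N i (p i)) = 0"
        by (rule prod_zero[OF finT bexI[OF _ 1]]) (simp add: bordered_lin_def)
      thus ?thesis by (simp add: Tp)
    next
      case (2 i)
      have "(\<Prod>i\<in>T. bordered_lin y N i (p i)) = 0"
        by (rule prod_zero[OF finT bexI[OF _ 2(1)]]) (simp add: bordered_lin_def 2)
      thus ?thesis by (simp add: Tp)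
    next
      case 3
      have "(\<Prod>i\<in>{..<Suc N} - T. bordered_const u v N i (p i)) = 0"
        by (rule prod_zero[OF _ bexI[of _ N]]) (use 3 in \<open>auto simp: bordered_const_def\<close>)
      thus ?thesis by (simp add: Tp)
    next
      case (4 i)
      have "p i < N" using permutes_in_image[OF T(3), of i] 4 by auto
      hence "(\<Prod>i\<in>{..<Suc N} - T. bordered_const u v N i (p i)) = 0"
        by (intro prod_zero[OF _ bexI[of _ i]]) (use 4 in \<open>auto simp: bordered_const_def\<close>)
      thus ?thesis by (simp add: Tp)
    qed
  qed
  fix x assume x: "x \<in> bordered_pairs N k"
  obtain T p where Tp: "x = (T, p)" by force
  with x have "(T, p) \<in> bordered_pairs N k" by simp
  then obtain i where i: "i < N" "i \<notin> T" "p i = N" "inv_into UNIV p N = i" "p N < N"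
    "\<And>x. x < N \<Longrightarrow> x \<notin> T \<Longrightarrow> x \<noteq> i \<Longrightarrow> p x = x" "p permutes {..<Suc N}" "T \<subseteq> {..<N}"
    by (rule bordered_pairsE) blast
  have "(\<Prod>l\<in>{..<Suc N} - T. bordered_const u v N l (p l)) = (\<Prod>l\<in>{i, N}. bordered_const u v N l (p l))"
    by (rule prod.mono_neutral_right) (use i in \<open>auto simp: bordered_const_def less_Suc_eq\<close>)
  also have "\<dots> = u (p N) * v i" using i by (auto simp: bordered_const_def)
  finally have 1: "(\<Prod>l\<in>{..<Suc N} - T. bordered_const u v N l (p l)) = u (p N) * v (inv_into UNIV p N)"
    using i by simp
  have "(\<Prod>l\<in>T. bordered_lin y N l (p l)) = (\<Prod>l\<in>T. - y l (p l))"
  proof (rule prod.cong[OF refl])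
    fix l assume l: "l \<in> T"
    have "l < N" using l i by auto
    moreover have "p l \<noteq> N" using \<open>(T, p) \<in> bordered_pairs N k\<close> l by (auto simp: bordered_pairs_def)
    moreover have "p l \<in> {..<Suc N}" using permutes_in_image[OF i(7), of l] \<open>l < N\<close> by simp
    ultimately show "bordered_lin y N l (p l) = - y l (p l)" by (simp add: bordered_lin_def)
  qed
  thus "?t x = (case x of (T, p) \<Rightarrow> signof p * (u (p N) * v (inv_into UNIV p N)) * (\<Prod>i\<in>T. - y i (p i)))"
    by (simp add: Tp 1)
qed

lemma det_bordered_expansion:
  "det (Matrix.mat (Suc N) (Suc N) (\<lambda>(i, j). bordered_const u v N i j + w * bordered_lin y N i j))
     = (\<Sum>k\<le>Suc N. w ^ k * bordered_coeff y u v N k)"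
  unfolding bordered_coeff_def by (rule det_add_smult_expansion)

text \<open>The summands with \<open>p N = inv_into UNIV p N\<close> swap \<open>N\<close> with an index outside \<open>T\<close> and permute \<open>T\<close>.\<close>

lemma bordered_diag_eq:
  fixes y :: "nat \<Rightarrow> nat \<Rightarrow> complex" and u v :: "nat \<Rightarrow> complex"
  shows "(\<Sum>(T, p)\<in>{(T, p) \<in> bordered_pairs N k. p N = inv_into UNIV p N}.
      signof p * (u (p N) * v (inv_into UNIV p N)) * (\<Prod>i\<in>T. - y i (p i))) =
   (\<Sum>(T, p)\<in>perm_pairs N k. - signof p * (\<Sum>i\<in>{..<N} - T. u i * v i) * (\<Prod>i\<in>T. - y i (p i)))"
proof -
  let ?t = "Transposition.transpose :: nat \<Rightarrow> nat \<Rightarrow> nat \<Rightarrow> nat"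
  let ?J = "{(T, p) \<in> bordered_pairs N k. p N = inv_into UNIV p N}"
  have "(\<Sum>(T, p)\<in>perm_pairs N k. - signof p * (\<Sum>i\<in>{..<N} - T. u i * v i) * (\<Prod>i\<in>T. - y i (p i)))
      = (\<Sum>x\<in>perm_pairs N k. \<Sum>i\<in>{..<N} - fst x. - signof (snd x) * (u i * v i) * (\<Prod>l\<in>fst x. - y l (snd x l)))"
    by (intro sum.cong) (auto simp: sum_distrib_left sum_distrib_right)
  also have "\<dots> = (\<Sum>(x, i)\<in>(SIGMA x:perm_pairs N k. {..<N} - fst x).
      - signof (snd x) * (u i * v i) * (\<Prod>l\<in>fst x. - y l (snd x l)))"
    by (rule sum.Sigma) (auto simp: finite_perm_pairs)
  also have "\<dots> = (\<Sum>(T, p)\<in>?J. signof p * (u (p N) * v (inv_into UNIV p N)) * (\<Prod>i\<in>T. - y i (p i)))"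
  proof -
    \<comment> \<open>Composition with the transposition of i and N inserts the 2-cycle through N
      and flips the sign, whence the minus sign on the right-hand side.\<close>
    define fi where "fi z = ((fst z, snd z \<circ> ?t (snd z N) N), snd z N)" for z :: "nat set \<times> (nat \<Rightarrow> nat)"
    define fj where "fj z = (fst (fst z), snd (fst z) \<circ> ?t (snd z) N)" for z :: "(nat set \<times> (nat \<Rightarrow> nat)) \<times> nat"
    show ?thesis
    proof (rule sum.reindex_bij_witness[where i = fi and j = fj])
      fix z assume z: "z \<in> (SIGMA x:perm_pairs N k. {..<N} - fst x)"
      obtain T p i where Tpi: "z = ((T, p), i)" by (metis prod.collapse)
      have T: "T \<subseteq> {..<N}" "card T = k" "p permutes T" "i < N" "i \<notin> T"
        using z Tpi by (auto simp: perm_pairs_def)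
      have pid: "p x = x" if "x \<notin> T" for x using permutes_not_in[OF T(3) that] .
      have NT: "N \<notin> T" using T by auto
      define q where "q = p \<circ> ?t i N"
      have fjz: "fj z = (T, q)" by (simp add: fj_def Tpi q_def)
      have q: "q permutes {..<Suc N}" unfolding q_def
        by (rule permutes_compose[OF permutes_swap_id permutes_subset[OF T(3)]]) (use T in auto)
      have qN: "q N = i" "q i = N" using pid NT T by (auto simp: q_def)
      have qx: "q x = p x" if "x \<noteq> i" "x \<noteq> N" for x using that by (simp add: q_def transpose_apply_other)
      have invq: "inv_into UNIV q N = i" using qN q by (metis permutes_inverses(2))
      have qT: "\<forall>x\<in>T. q x \<noteq> N"
      proof
        fix x assume "x \<in> T"
        hence "q x = p x" using T NT by (intro qx) auto
        moreover have "p x \<in> T" using \<open>x \<in> T\<close> permutes_in_image[OF T(3)] by simp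
        ultimately show "q x \<noteq> N" using NT by auto
      qed
      have qo: "\<forall>x\<in>{..<N} - T. q x = x \<or> q x = N"
      proof
        fix x assume "x \<in> {..<N} - T"
        thus "q x = x \<or> q x = N" using qx[of x] pid[of x] qN by (cases "x = i") auto
      qed
      show "fj z \<in> ?J"
        using T q qN invq qT qo unfolding fjz by (simp add: bordered_pairs_def)
      show "fi (fj z) = z"
        unfolding fjz using qN(1) by (simp add: fi_def Tpi q_def o_assoc[symmetric])
      have "signof q = - (signof p :: complex)"
      proof -
        have "sign q = sign p * sign (?t i N)" unfolding q_def
          by (rule sign_compose) (use T(1,3) finite_subset in \<open>auto intro!: permutes_imp_permutation[of T]
             permutation_swap_id\<close>)
        thus ?thesis using T by (simp add: sign_swap_id)
      qed
      moreover have "(\<Prod>l\<in>T. - y l (q l)) = (\<Prod>l\<in>T. - y l (p l))"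
      proof (rule prod.cong[OF refl])
        fix l assume "l \<in> T"
        hence "q l = p l" using T NT by (intro qx) auto
        thus "- y l (q l) = - y l (p l)" by simp
      qed
      ultimately show "(case fj z of (T, p) \<Rightarrow>
            signof p * (u (p N) * v (inv_into UNIV p N)) * (\<Prod>i\<in>T. - y i (p i)))
          = (case z of (x, i) \<Rightarrow> - signof (snd x) * (u i * v i) * (\<Prod>l\<in>fst x. - y l (snd x l)))"
        unfolding fjz using qN invq by (simp add: Tpi)
    next
      fix z assume z: "z \<in> ?J"
      obtain T p where Tp: "z = (T, p)" by force
      with z have J: "(T, p) \<in> bordered_pairs N k" and pN: "p N = inv_into UNIV p N" by auto
      obtain i where i: "i < N" "i \<notin> T" "p i = N" "inv_into UNIV p N = i" "p N < N"
        "\<And>x. x < N \<Longrightarrow> x \<notin> T \<Longrightarrow> x \<noteq> i \<Longrightarrow> p x = x" "p permutes {..<Suc N}" "T \<subseteq> {..<N}"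
        by (rule bordered_pairsE[OF J]) blast
      define q where "q = p \<circ> ?t i N"
      have fiz: "fi z = ((T, q), i)" using pN i by (simp add: fi_def Tp q_def)
      have qi: "q i = i" "q N = N" using i pN by (auto simp: q_def)
      have "q permutes T"
      proof (rule permutes_superset)
        show "q permutes {..<Suc N}" unfolding q_def
          by (rule permutes_compose[OF permutes_swap_id i(7)]) (use i in auto)
        fix x assume x: "x \<in> {..<Suc N} - T"
        show "q x = x"
          using x qi i(6)[of x] by (cases "x = i"; cases "x = N") (auto simp: q_def transpose_apply_other less_Suc_eq)
      qed
      moreover have "card T = k" using J by (auto simp: bordered_pairs_def)
      ultimately show "fi z \<in> (SIGMA x:perm_pairs N k. {..<N} - fst x)"
        unfolding fiz using i by (auto simp: perm_pairs_def)
      show "fj (fi z) = z"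
        unfolding fiz by (simp add: fj_def Tp q_def o_assoc[symmetric])
    qed
  qed
  finally show ?thesis by simp
qed

section \<open>Recovering a term from its monomial\<close>

definition edge_graph :: "nat set \<times> (nat \<Rightarrow> nat) \<Rightarrow> (nat \<times> nat) set" where
  "edge_graph x = (\<lambda>i. (i, snd x i)) ` fst x"

lemma fst_edge_graph: "fst ` edge_graph x = fst x"
  by (force simp: edge_graph_def)

lemma edge_graph_eqD:
  assumes "edge_graph (T, p) = edge_graph (T', p')"
  shows "T = T'" and "\<And>i. i \<in> T \<Longrightarrow> p i = p' i"
proof -
  show T: "T = T'" using arg_cong[OF assms, of "image fst"] by (simp add: fst_edge_graph)
  fix i assume "i \<in> T"
  hence "(i, p i) \<in> edge_graph (T', p')" unfolding assms[symmetric] by (auto simp: edge_graph_def)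
  thus "p i = p' i" by (auto simp: edge_graph_def)
qed

lemma prod_scaled_eq:
  fixes x :: "nat \<Rightarrow> nat \<Rightarrow> complex"
  assumes "finite T"
  shows "(\<Prod>i\<in>T. - (x i (p i) / s)) = (- 1 / s) ^ card T * (\<Prod>(i, j)\<in>edge_graph (T, p). x i j)"
proof -
  have "(\<Prod>(i, j)\<in>edge_graph (T, p). x i j) = (\<Prod>i\<in>T. x i (p i))"
    unfolding edge_graph_def by (subst prod.reindex) (auto simp: inj_on_def)
  moreover have "(\<Prod>i\<in>T. - (x i (p i) / s)) = (\<Prod>i\<in>T. (- 1 / s) * x i (p i))"
    by (intro prod.cong) auto
  ultimately show ?thesis by (simp only: prod.distrib prod_constant)
qed

text \<open>The permutation is the identity outside T, so its edges on T determine it.\<close>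

lemma inj_on_edge_graph_perm_pairs: "inj_on edge_graph (perm_pairs N k)"
proof (rule inj_onI, clarsimp simp: perm_pairs_def)
  fix T p T' p' assume *: "p permutes T" "p' permutes T'" "edge_graph (T, p) = edge_graph (T', p')"
  have "T = T'" by (rule edge_graph_eqD[OF *(3)])
  moreover have "p x = p' x" for x
    using edge_graph_eqD[OF *(3)] * by (cases "x \<in> T") (auto simp: permutes_not_in)
  ultimately show "T = T' \<and> p = p'" by auto
qed

text \<open>If \<open>p N\<close> differs from the preimage i of N, the edges on T remember both: i
  is the only image outside T, and \<open>p N\<close> the only point of T that is not an image. In
  the diagonal case the swapped index leaves no trace in the monomial, which is why
  \<open>bordered_diag_eq\<close> first sums over it.\<close>

lemma inj_on_edge_graph_bordered:
  "inj_on edge_graph {(T, p) \<in> bordered_pairs N k. p N \<noteq> inv_into UNIV p N}"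
proof (rule inj_onI)
  have key: "p ` T - T = {inv_into UNIV p N} \<and> T - p ` T = {p N}"
    if J: "(T, p) \<in> bordered_pairs N k" and ne: "p N \<noteq> inv_into UNIV p N" for T p
  proof -
    obtain i where i: "i < N" "i \<notin> T" "p i = N" "inv_into UNIV p N = i" "p N < N"
      "\<And>x. x < N \<Longrightarrow> x \<notin> T \<Longrightarrow> x \<noteq> i \<Longrightarrow> p x = x" "p permutes {..<Suc N}" "T \<subseteq> {..<N}"
      by (rule bordered_pairsE[OF J]) blast
    have injp: "p x = p y \<longleftrightarrow> x = y" for x y using permutes_inj[OF i(7)] by (auto simp: inj_eq)
    have pNT: "p N \<in> T"
    proof (rule ccontr)
      assume "p N \<notin> T"
      hence "p (p N) = p N" using i ne by (intro i(6)) auto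
      thus False using injp i by simp
    qed
    obtain x where x: "p x = i" using permutes_surj[OF i(7)] by (metis surjD)
    have "x \<in> {..<Suc N}" using permutes_in_image[OF i(7), of x] x i by simp
    moreover have "x \<noteq> N" using x ne i by auto
    moreover have "x \<noteq> i" using x i by auto
    ultimately have xT: "x \<in> T" using i(6)[of x] x by (cases "x \<in> T") auto
    have "p ` T - T \<subseteq> {i}"
    proof
      fix y assume y: "y \<in> p ` T - T"
      then obtain z where z: "z \<in> T" "y = p z" by auto
      have "y < Suc N" using permutes_in_image[OF i(7), of z] z i by auto
      moreover have "y \<noteq> N" using z i injp[of z i] by auto
      ultimately have "y < N" by simp
      show "y \<in> {i}"
      proof (rule ccontr)
        assume "y \<notin> {i}"
        hence "p y = p z" using i(6)[OF \<open>y < N\<close>] y z by simp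
        thus False using injp[of y z] y z by simp
      qed
    qed
    moreover have "i \<in> p ` T - T" using x xT i by auto
    ultimately have 1: "p ` T - T = {i}" by auto
    have "T - p ` T \<subseteq> {p N}"
    proof
      fix y assume y: "y \<in> T - p ` T"
      obtain z where z: "p z = y" using permutes_surj[OF i(7)] by (metis surjD)
      have "z \<notin> T" using y z by auto
      have "y < N" using y i by auto
      hence "z < Suc N" using permutes_in_image[OF i(7), of z] z by simp
      show "y \<in> {p N}"
      proof (cases "z = N")
        case False
        hence "z < N" using \<open>z < Suc N\<close> by simp
        moreover have "z \<noteq> i" using z i \<open>y < N\<close> by auto
        ultimately have "p z = z" using \<open>z \<notin> T\<close> by (intro i(6))
        thus ?thesis using z y \<open>z \<notin> T\<close> by auto
      qed (use z in simp)
    qed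
    moreover have "p N \<notin> p ` T" using injp i(8) by auto
    ultimately have "T - p ` T = {p N}" using pNT by auto
    thus ?thesis using 1 i by simp
  qed
  fix x x' assume x: "x \<in> {(T, p) \<in> bordered_pairs N k. p N \<noteq> inv_into UNIV p N}"
    and x': "x' \<in> {(T, p) \<in> bordered_pairs N k. p N \<noteq> inv_into UNIV p N}"
    and eq: "edge_graph x = edge_graph x'"
  obtain T p T' p' where Tp: "x = (T, p)" "x' = (T', p')" by force
  have J: "(T, p) \<in> bordered_pairs N k" "p N \<noteq> inv_into UNIV p N"
    "(T', p') \<in> bordered_pairs N k" "p' N \<noteq> inv_into UNIV p' N" using x x' Tp by auto
  have TT: "T = T'" and pp: "\<And>i. i \<in> T \<Longrightarrow> p i = p' i"
    using edge_graph_eqD[OF eq[unfolded Tp]] by auto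
  have "p ` T = p' ` T'" using pp TT by auto
  hence N: "inv_into UNIV p N = inv_into UNIV p' N" "p N = p' N"
    using key[OF J(1,2)] key[OF J(3,4)] TT by auto
  obtain i where i: "i < N" "i \<notin> T" "p i = N" "inv_into UNIV p N = i" "p N < N"
      "\<And>x. x < N \<Longrightarrow> x \<notin> T \<Longrightarrow> x \<noteq> i \<Longrightarrow> p x = x" "p permutes {..<Suc N}" "T \<subseteq> {..<N}"
    by (rule bordered_pairsE[OF J(1)]) blast
  obtain i' where i': "i' < N" "i' \<notin> T'" "p' i' = N" "inv_into UNIV p' N = i'" "p' N < N"
      "\<And>x. x < N \<Longrightarrow> x \<notin> T' \<Longrightarrow> x \<noteq> i' \<Longrightarrow> p' x = x" "p' permutes {..<Suc N}" "T' \<subseteq> {..<N}"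
    by (rule bordered_pairsE[OF J(3)]) blast
  have "p y = p' y" for y
  proof -
    consider "y \<in> T" | "y = N" | "y = i" | "y < N" "y \<notin> T" "y \<noteq> i" | "y > N" by linarith
    thus ?thesis
    proof cases
      case 5
      thus ?thesis using permutes_not_in[OF i(7), of y] permutes_not_in[OF i'(7), of y] by simp
    qed (use pp N i i' TT in auto)
  qed
  thus "x = x'" using TT Tp by auto
qed

text \<open>The edges on T contain a path from j to i. Redirecting its last edge to j closes it and
  leaves a permutation of a k-element set containing j; there are at most k N^(k - 1) of
  these.\<close>

lemma card_bordered_fibre_le:
  assumes N: "N \<ge> 1" and i: "i < N" and j: "j < N"
  shows "card {(T, p) \<in> bordered_pairs N k. p N \<noteq> inv_into UNIV p N \<and> p N = j \<and> inv_into UNIV p N = i}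
    \<le> k * N ^ (k - 1)"
proof -
  let ?t = "Transposition.transpose :: nat \<Rightarrow> nat \<Rightarrow> nat \<Rightarrow> nat"
  let ?A = "{(T, p) \<in> bordered_pairs N k. p N \<noteq> inv_into UNIV p N \<and> p N = j \<and> inv_into UNIV p N = i}"
  let ?B = "SIGMA S:{S. S \<subseteq> {..<N} - {j} \<and> card S = k - 1}. {q. q permutes insert j S}"
  let ?f = "\<lambda>x. (fst x - {j}, ?t i j \<circ> snd x \<circ> ?t i N)"
  have sub: "j \<in> T \<and> ?t i j \<circ> p \<circ> ?t i N permutes T \<and> finite T \<and> card T = k \<and> T \<subseteq> {..<N}"
    if Tp: "(T, p) \<in> ?A" for T p
  proof -
    have J: "(T, p) \<in> bordered_pairs N k" and ne: "j \<noteq> i" and pN: "p N = j" "inv_into UNIV p N = i"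
      using Tp by auto
    obtain i' where i': "i' < N" "i' \<notin> T" "p i' = N" "inv_into UNIV p N = i'" "p N < N"
        "\<And>x. x < N \<Longrightarrow> x \<notin> T \<Longrightarrow> x \<noteq> i' \<Longrightarrow> p x = x" "p permutes {..<Suc N}" "T \<subseteq> {..<N}"
      by (rule bordered_pairsE[OF J]) blast
    have ii: "i' = i" using i' pN by simp
    have injp: "p x = p y \<longleftrightarrow> x = y" for x y using permutes_inj[OF i'(7)] by (auto simp: inj_eq)
    have jT: "j \<in> T"
    proof (rule ccontr)
      assume "j \<notin> T"
      hence "p j = j" using ne ii j by (intro i'(6)) auto
      thus False using injp[of j N] pN j by simp
    qed
    define q where "q = ?t i j \<circ> p \<circ> ?t i N"
    have "q permutes {..<Suc N}" unfolding q_def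
      by (intro permutes_compose permutes_swap_id i'(7)) (use i j in auto)
    moreover have "q x = x" if x: "x \<in> {..<Suc N} - T" for x
    proof -
      consider "x = i" | "x = N" | "x < N" "x \<noteq> i" using x by fastforce
      thus ?thesis
      proof cases
        case 1 thus ?thesis using pN by (simp add: q_def)
      next
        case 2
        thus ?thesis using i' ii i j by (simp add: q_def transpose_apply_other)
      next
        case 3
        hence "p x = x" using i'(6)[of x] x ii by simp
        moreover have "x \<noteq> j" using x jT by auto
        ultimately show ?thesis using 3 by (simp add: q_def transpose_apply_other)
      qed
    qed
    ultimately have "q permutes T" by (rule permutes_superset)
    thus ?thesis using jT J i'(8) finite_subset[OF i'(8)] by (auto simp: q_def bordered_pairs_def)
  qed
  have finB: "finite ?B"
    by (rule finite_SigmaI) (auto intro: finite_permutations finite_subset)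
  have "inj_on ?f ?A"
  proof (rule inj_onI)
    fix x y assume x: "x \<in> ?A" and y: "y \<in> ?A" and eq: "?f x = ?f y"
    have "snd x = ?t i j \<circ> (?t i j \<circ> snd x \<circ> ?t i N) \<circ> ?t i N" by (simp add: fun_eq_iff)
    also have "?t i j \<circ> snd x \<circ> ?t i N = ?t i j \<circ> snd y \<circ> ?t i N" using eq by simp
    also have "?t i j \<circ> (?t i j \<circ> snd y \<circ> ?t i N) \<circ> ?t i N = snd y" by (simp add: fun_eq_iff)
    finally have "snd x = snd y" .
    moreover have "j \<in> fst x" "j \<in> fst y"
      using sub[of "fst x" "snd x"] sub[of "fst y" "snd y"] x y by auto
    hence "fst x = fst y" using eq by auto
    ultimately show "x = y" by (simp add: prod_eq_iff)
  qed
  moreover have "?f ` ?A \<subseteq> ?B"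
  proof (rule image_subsetI)
    fix x assume x: "x \<in> ?A"
    have *: "j \<in> fst x \<and> ?t i j \<circ> snd x \<circ> ?t i N permutes fst x \<and> finite (fst x) \<and> card (fst x) = k \<and> fst x \<subseteq> {..<N}"
      using sub[of "fst x" "snd x"] x by simp
    hence "insert j (fst x - {j}) = fst x" by auto
    thus "?f x \<in> ?B" using * by auto
  qed
  ultimately have card: "card ?A \<le> card ?B" using finB by (rule card_inj_on_le)
  show ?thesis
  proof (cases "k = 0")
    case True
    have "?A = {}"
    proof (rule ccontr)
      assume "?A \<noteq> {}"
      then obtain T p where "(T, p) \<in> ?A" by force
      from sub[OF this] show False using True by auto
    qed
    thus ?thesis by (metis card.empty le0)
  next
    case False
    have "card ?B = (\<Sum>S\<in>{S. S \<subseteq> {..<N} - {j} \<and> card S = k - 1}. card {q. q permutes insert j S})"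
      by (rule card_SigmaI) (auto intro: finite_permutations finite_subset)
    also have "\<dots> = (\<Sum>S\<in>{S. S \<subseteq> {..<N} - {j} \<and> card S = k - 1}. fact k)"
    proof (rule sum.cong[OF refl])
      fix S assume S: "S \<in> {S. S \<subseteq> {..<N} - {j} \<and> card S = k - 1}"
      hence "finite S" "j \<notin> S" by (auto intro: finite_subset)
      hence "card (insert j S) = k" "finite (insert j S)" using S False by auto
      thus "card {q. q permutes insert j S} = fact k" by (rule card_permutations)
    qed
    also have "\<dots> = ((N - 1) choose (k - 1)) * fact k"
      using j by (simp add: n_subsets)
    also have "\<dots> = k * (((N - 1) choose (k - 1)) * fact (k - 1))"
      using False by (simp add: fact_reduce)
    also have "\<dots> \<le> k * (N - 1) ^ (k - 1)"
      by (intro mult_left_mono binomial_fact_pow) auto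
    also have "\<dots> \<le> k * N ^ (k - 1)" by (intro mult_left_mono power_mono) auto
    finally show ?thesis using card by linarith
  qed
qed

lemma sign_square_real [simp]: "(real_of_int (sign p))\<^sup>2 = 1"
  by (simp add: sign_def)

lemma norm_inverse_sqrt_power:
  "N \<ge> 1 \<Longrightarrow> (cmod ((- 1 / of_real (sqrt (real N)) :: complex) ^ k))\<^sup>2 = 1 / real N ^ k"
  by (simp add: norm_power norm_divide power_divide flip: power_mult)
    (simp add: power_mult mult.commute[of k 2])

section \<open>Second moments of the determinant coefficients\<close>

context iid_entries
begin

definition Y :: "nat \<Rightarrow> 'a \<Rightarrow> nat \<Rightarrow> nat \<Rightarrow> complex" where
  "Y N \<omega> i j = X i j \<omega> / of_real (sqrt (real N))"

text \<open>By orthonormality this is the number binom(N, k) k! of monomials divided by N^k.\<close>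

lemma det_coeff_second_moment:
  assumes N: "N \<ge> 1"
  shows "integrable P (\<lambda>\<omega>. (cmod (det_coeff (Y N \<omega>) N k))\<^sup>2)"
    and "expectation (\<lambda>\<omega>. (cmod (det_coeff (Y N \<omega>) N k))\<^sup>2) \<le> 1"
proof -
  define \<alpha> where "\<alpha> x = signof (snd x) * (- 1 / of_real (sqrt (real N)) :: complex) ^ k"
    for x :: "nat set \<times> (nat \<Rightarrow> nat)"
  have fin: "finite (edge_graph x)" if "x \<in> perm_pairs N k" for x
    using that finite_subset[OF _ finite_lessThan[of N]] by (auto simp: perm_pairs_def edge_graph_def)
  have eq: "det_coeff (Y N \<omega>) N k = (\<Sum>x\<in>perm_pairs N k. \<alpha> x * (\<Prod>(i, j)\<in>edge_graph x. X i j \<omega>))" for \<omega>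
    unfolding det_coeff_def
  proof (rule sum.cong[OF refl])
    fix x assume x: "x \<in> perm_pairs N k"
    obtain T p where Tp: "x = (T, p)" by force
    have "finite T" "card T = k" using x by (auto simp: Tp perm_pairs_def intro: finite_subset)
    thus "(case x of (T, p) \<Rightarrow> signof p * (\<Prod>i\<in>T. - Y N \<omega> i (p i)))
       = \<alpha> x * (\<Prod>(i, j)\<in>edge_graph x. X i j \<omega>)"
      using prod_scaled_eq[of T "\<lambda>i j. X i j \<omega>" p "of_real (sqrt (real N))"]
      by (simp add: Tp Y_def \<alpha>_def)
  qed
  show "integrable P (\<lambda>\<omega>. (cmod (det_coeff (Y N \<omega>) N k))\<^sup>2)"
    unfolding eq by (rule integrable_multilinear_sq[OF finite_perm_pairs fin inj_on_edge_graph_perm_pairs])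
  have "expectation (\<lambda>\<omega>. (cmod (det_coeff (Y N \<omega>) N k))\<^sup>2) = (\<Sum>x\<in>perm_pairs N k. (cmod (\<alpha> x))\<^sup>2)"
    unfolding eq by (rule expectation_multilinear_sq[OF finite_perm_pairs fin inj_on_edge_graph_perm_pairs])
  also have "\<dots> = (\<Sum>x\<in>perm_pairs N k. 1 / real N ^ k)"
    by (intro sum.cong refl)
      (simp only: \<alpha>_def norm_mult power_mult_distrib norm_inverse_sqrt_power[OF N], simp)
  also have "\<dots> = real ((N choose k) * fact k) / real N ^ k" by (simp add: card_perm_pairs)
  also have "\<dots> \<le> 1"
  proof -
    have "real ((N choose k) * fact k) \<le> real (N ^ k)"
      using binomial_fact_pow of_nat_le_iff by blast
    thus ?thesis using N by simp
  qed
  finally show "expectation (\<lambda>\<omega>. (cmod (det_coeff (Y N \<omega>) N k))\<^sup>2) \<le> 1" .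
qed

text \<open>For given \<open>p N\<close> and preimage of N there are at most k N^(k - 1) monomials
  of squared weight N^(-k), and the squares of the entries of u and v sum to 1. The gain 1 / N pays
  for the factor sqrt N that multiplies these coefficients later.\<close>

lemma bordered_offdiag_second_moment:
  fixes u v :: "nat \<Rightarrow> complex" and k :: nat
  assumes N: "N \<ge> 1" and u: "(\<Sum>i<N. (cmod (u i))\<^sup>2) = 1" and v: "(\<Sum>i<N. (cmod (v i))\<^sup>2) = 1"
  defines "Q \<equiv> (\<lambda>\<omega>. \<Sum>(T, p)\<in>{(T, p) \<in> bordered_pairs N k. p N \<noteq> inv_into UNIV p N}.
    signof p * (u (p N) * v (inv_into UNIV p N)) * (\<Prod>i\<in>T. - Y N \<omega> i (p i)))"
  shows "integrable P (\<lambda>\<omega>. (cmod (Q \<omega>))\<^sup>2)"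
    and "expectation (\<lambda>\<omega>. (cmod (Q \<omega>))\<^sup>2) \<le> real k / real N"
proof -
  let ?J = "{(T, p) \<in> bordered_pairs N k. p N \<noteq> inv_into UNIV p N}"
  define \<alpha> where "\<alpha> x = signof (snd x) * (u (snd x N) * v (inv_into UNIV (snd x) N)) *
     (- 1 / of_real (sqrt (real N)) :: complex) ^ k" for x :: "nat set \<times> (nat \<Rightarrow> nat)"
  have finJ: "finite ?J" by (rule finite_subset[OF _ finite_bordered_pairs[of N k]]) auto
  have finT: "finite (fst x)" "card (fst x) = k" if "x \<in> ?J" for x
    using that finite_subset[OF _ finite_lessThan[of N]] by (auto simp: bordered_pairs_def)
  have fin: "finite (edge_graph x)" if "x \<in> ?J" for x
    using finT(1)[OF that] by (simp add: edge_graph_def)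
  have eq: "Q \<omega> = (\<Sum>x\<in>?J. \<alpha> x * (\<Prod>(i, j)\<in>edge_graph x. X i j \<omega>))" for \<omega>
    unfolding Q_def
  proof (rule sum.cong[OF refl])
    fix x assume x: "x \<in> ?J"
    obtain T p where Tp: "x = (T, p)" by force
    have "finite T" "card T = k" using finT[OF x] by (auto simp: Tp)
    thus "(case x of (T, p) \<Rightarrow> signof p * (u (p N) * v (inv_into UNIV p N)) * (\<Prod>i\<in>T. - Y N \<omega> i (p i)))
       = \<alpha> x * (\<Prod>(i, j)\<in>edge_graph x. X i j \<omega>)"
      using prod_scaled_eq[of T "\<lambda>i j. X i j \<omega>" p "of_real (sqrt (real N))"]
      by (simp add: Tp Y_def \<alpha>_def)
  qed
  show "integrable P (\<lambda>\<omega>. (cmod (Q \<omega>))\<^sup>2)"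
    unfolding eq by (rule integrable_multilinear_sq[OF finJ fin inj_on_edge_graph_bordered])
  have "expectation (\<lambda>\<omega>. (cmod (Q \<omega>))\<^sup>2) = (\<Sum>x\<in>?J. (cmod (\<alpha> x))\<^sup>2)"
    unfolding eq by (rule expectation_multilinear_sq[OF finJ fin inj_on_edge_graph_bordered])
  also have "\<dots> = (\<Sum>x\<in>?J. (cmod (u (snd x N)))\<^sup>2 * (cmod (v (inv_into UNIV (snd x) N)))\<^sup>2 / real N ^ k)"
  proof (rule sum.cong[OF refl])
    fix x assume "x \<in> ?J"
    show "(cmod (\<alpha> x))\<^sup>2 = (cmod (u (snd x N)))\<^sup>2 * (cmod (v (inv_into UNIV (snd x) N)))\<^sup>2 / real N ^ k"
      by (simp only: \<alpha>_def norm_mult power_mult_distrib norm_inverse_sqrt_power[OF N], simp)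
  qed
  also have "\<dots> = (\<Sum>z\<in>{..<N} \<times> {..<N}. \<Sum>x\<in>{x \<in> ?J. (snd x N, inv_into UNIV (snd x) N) = z}.
      (cmod (u (snd x N)))\<^sup>2 * (cmod (v (inv_into UNIV (snd x) N)))\<^sup>2 / real N ^ k)"
  proof (rule sum.group[symmetric, OF finJ])
    show "(\<lambda>x. (snd x N, inv_into UNIV (snd x) N)) ` ?J \<subseteq> {..<N} \<times> {..<N}"
    proof (rule image_subsetI)
      fix x assume x: "x \<in> ?J"
      hence "(fst x, snd x) \<in> bordered_pairs N k" by auto
      thus "(snd x N, inv_into UNIV (snd x) N) \<in> {..<N} \<times> {..<N}"
        by (rule bordered_pairsE) simp
    qed
  qed auto
  also have "\<dots> \<le> (\<Sum>(j, i)\<in>{..<N} \<times> {..<N}. (cmod (u j))\<^sup>2 * (cmod (v i))\<^sup>2 * (real k / real N))"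
  proof (rule sum_mono)
    fix z assume z: "z \<in> {..<N} \<times> {..<N}"
    obtain j i where ji: "z = (j, i)" "j < N" "i < N" using z by auto
    let ?F = "{(T, p) \<in> bordered_pairs N k. p N \<noteq> inv_into UNIV p N \<and> p N = j \<and> inv_into UNIV p N = i}"
    have F: "{x \<in> ?J. (snd x N, inv_into UNIV (snd x) N) = z} = ?F" by (auto simp: ji)
    have "(\<Sum>x\<in>?F. (cmod (u (snd x N)))\<^sup>2 * (cmod (v (inv_into UNIV (snd x) N)))\<^sup>2 / real N ^ k)
        = (\<Sum>x\<in>?F. (cmod (u j))\<^sup>2 * (cmod (v i))\<^sup>2 / real N ^ k)"
      by (rule sum.cong) auto
    also have "\<dots> = real (card ?F) * ((cmod (u j))\<^sup>2 * (cmod (v i))\<^sup>2 / real N ^ k)" by simp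
    also have "\<dots> \<le> real (k * N ^ (k - 1)) * ((cmod (u j))\<^sup>2 * (cmod (v i))\<^sup>2 / real N ^ k)"
      by (intro mult_right_mono of_nat_mono card_bordered_fibre_le N ji) auto
    also have "\<dots> = (cmod (u j))\<^sup>2 * (cmod (v i))\<^sup>2 * (real k / real N)"
      using N by (cases k) (auto simp: field_simps)
    finally show "(\<Sum>x\<in>{x \<in> ?J. (snd x N, inv_into UNIV (snd x) N) = z}.
      (cmod (u (snd x N)))\<^sup>2 * (cmod (v (inv_into UNIV (snd x) N)))\<^sup>2 / real N ^ k)
      \<le> (case z of (j, i) \<Rightarrow> (cmod (u j))\<^sup>2 * (cmod (v i))\<^sup>2 * (real k / real N))"
      unfolding F by (simp add: ji)
  qed
  also have "\<dots> = (\<Sum>j<N. (cmod (u j))\<^sup>2) * (\<Sum>i<N. (cmod (v i))\<^sup>2) * (real k / real N)"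
  proof -
    have eq: "(\<Sum>j<N. (cmod (u j))\<^sup>2) * (\<Sum>i<N. (cmod (v i))\<^sup>2)
        = (\<Sum>(j, i)\<in>{..<N} \<times> {..<N}. (cmod (u j))\<^sup>2 * (cmod (v i))\<^sup>2)"
      by (simp only: sum_product sum.cartesian_product)
    show ?thesis unfolding eq by (simp only: sum_distrib_right case_prod_unfold)
  qed
  finally show "expectation (\<lambda>\<omega>. (cmod (Q \<omega>))\<^sup>2) \<le> real k / real N" using u v by simp
qed

text \<open>The sum of u_i v_i outside T differs from the full overlap by at most k B. In the
  application the overlap is of order N^(-1/2) and B of order 1 / N.\<close>

lemma bordered_diag_second_moment:
  fixes u v :: "nat \<Rightarrow> complex" and k :: nat
  assumes N: "N \<ge> 1" and B: "\<And>i. i < N \<Longrightarrow> cmod (u i * v i) \<le> B"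
  defines "Q \<equiv> (\<lambda>\<omega>. \<Sum>(T, p)\<in>perm_pairs N k.
    - signof p * (\<Sum>i\<in>{..<N} - T. u i * v i) * (\<Prod>i\<in>T. - Y N \<omega> i (p i)))"
  shows "integrable P (\<lambda>\<omega>. (cmod (Q \<omega>))\<^sup>2)"
    and "expectation (\<lambda>\<omega>. (cmod (Q \<omega>))\<^sup>2) \<le> (cmod (\<Sum>i<N. u i * v i) + real k * B)\<^sup>2"
proof -
  let ?J = "perm_pairs N k"
  define \<alpha> where "\<alpha> x = - signof (snd x) * (\<Sum>i\<in>{..<N} - fst x. u i * v i) *
     (- 1 / of_real (sqrt (real N)) :: complex) ^ k" for x :: "nat set \<times> (nat \<Rightarrow> nat)"
  have finT: "finite (fst x)" "card (fst x) = k" "fst x \<subseteq> {..<N}" if "x \<in> ?J" for x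
    using that finite_subset[OF _ finite_lessThan[of N]] by (auto simp: perm_pairs_def)
  have fin: "finite (edge_graph x)" if "x \<in> ?J" for x
    using finT(1)[OF that] by (simp add: edge_graph_def)
  have eq: "Q \<omega> = (\<Sum>x\<in>?J. \<alpha> x * (\<Prod>(i, j)\<in>edge_graph x. X i j \<omega>))" for \<omega>
    unfolding Q_def
  proof (rule sum.cong[OF refl])
    fix x assume x: "x \<in> ?J"
    obtain T p where Tp: "x = (T, p)" by force
    have "finite T" "card T = k" using finT[OF x] by (auto simp: Tp)
    thus "(case x of (T, p) \<Rightarrow> - signof p * (\<Sum>i\<in>{..<N} - T. u i * v i) * (\<Prod>i\<in>T. - Y N \<omega> i (p i)))
       = \<alpha> x * (\<Prod>(i, j)\<in>edge_graph x. X i j \<omega>)"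
      using prod_scaled_eq[of T "\<lambda>i j. X i j \<omega>" p "of_real (sqrt (real N))"]
      by (simp add: Tp Y_def \<alpha>_def)
  qed
  show "integrable P (\<lambda>\<omega>. (cmod (Q \<omega>))\<^sup>2)"
    unfolding eq by (rule integrable_multilinear_sq[OF finite_perm_pairs fin inj_on_edge_graph_perm_pairs])
  have "expectation (\<lambda>\<omega>. (cmod (Q \<omega>))\<^sup>2) = (\<Sum>x\<in>?J. (cmod (\<alpha> x))\<^sup>2)"
    unfolding eq by (rule expectation_multilinear_sq[OF finite_perm_pairs fin inj_on_edge_graph_perm_pairs])
  also have "\<dots> \<le> (\<Sum>x\<in>?J. (cmod (\<Sum>i<N. u i * v i) + real k * B)\<^sup>2 / real N ^ k)"
  proof (rule sum_mono)
    fix x assume x: "x \<in> ?J"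
    have 1: "(cmod (\<alpha> x))\<^sup>2 = (cmod (\<Sum>i\<in>{..<N} - fst x. u i * v i))\<^sup>2 / real N ^ k"
      by (simp only: \<alpha>_def norm_mult power_mult_distrib norm_inverse_sqrt_power[OF N], simp)
    have "(\<Sum>i\<in>{..<N} - fst x. u i * v i) = (\<Sum>i<N. u i * v i) - (\<Sum>i\<in>fst x. u i * v i)"
      using finT(3)[OF x] by (intro sum_diff) auto
    hence "cmod (\<Sum>i\<in>{..<N} - fst x. u i * v i) \<le> cmod (\<Sum>i<N. u i * v i) + cmod (\<Sum>i\<in>fst x. u i * v i)"
      by (simp add: norm_triangle_ineq4)
    also have "cmod (\<Sum>i\<in>fst x. u i * v i) \<le> (\<Sum>i\<in>fst x. B)"
      by (rule sum_norm_le) (use finT(3)[OF x] B in auto)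
    also have "\<dots> = real k * B" using finT(2)[OF x] by simp
    finally show "(cmod (\<alpha> x))\<^sup>2 \<le> (cmod (\<Sum>i<N. u i * v i) + real k * B)\<^sup>2 / real N ^ k"
      unfolding 1 by (intro divide_right_mono power_mono) auto
  qed
  also have "\<dots> = real ((N choose k) * fact k) / real N ^ k * (cmod (\<Sum>i<N. u i * v i) + real k * B)\<^sup>2"
    by (simp add: card_perm_pairs)
  also have "\<dots> \<le> 1 * (cmod (\<Sum>i<N. u i * v i) + real k * B)\<^sup>2"
  proof (rule mult_right_mono)
    have "real ((N choose k) * fact k) \<le> real (N ^ k)"
      using binomial_fact_pow of_nat_le_iff by blast
    thus "real ((N choose k) * fact k) / real N ^ k \<le> 1" using N by simp
  qed auto
  finally show "expectation (\<lambda>\<omega>. (cmod (Q \<omega>))\<^sup>2) \<le> (cmod (\<Sum>i<N. u i * v i) + real k * B)\<^sup>2" by simp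
qed

lemma bordered_coeff_second_moment:
  fixes u v :: "nat \<Rightarrow> complex" and k :: nat
  assumes N: "N \<ge> 1" and u: "(\<Sum>i<N. (cmod (u i))\<^sup>2) = 1" and v: "(\<Sum>i<N. (cmod (v i))\<^sup>2) = 1"
    and B: "\<And>i. i < N \<Longrightarrow> cmod (u i * v i) \<le> B"
  shows "integrable P (\<lambda>\<omega>. (cmod (bordered_coeff (Y N \<omega>) u v N k))\<^sup>2)"
    and "expectation (\<lambda>\<omega>. (cmod (bordered_coeff (Y N \<omega>) u v N k))\<^sup>2)
      \<le> 2 * (real k / real N) + 2 * (cmod (\<Sum>i<N. u i * v i) + real k * B)\<^sup>2"
proof -
  define Q1 where "Q1 \<omega> = (\<Sum>(T, p)\<in>{(T, p) \<in> bordered_pairs N k. p N \<noteq> inv_into UNIV p N}.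
    signof p * (u (p N) * v (inv_into UNIV p N)) * (\<Prod>i\<in>T. - Y N \<omega> i (p i)))" for \<omega>
  define Q2 where "Q2 \<omega> = (\<Sum>(T, p)\<in>perm_pairs N k.
    - signof p * (\<Sum>i\<in>{..<N} - T. u i * v i) * (\<Prod>i\<in>T. - Y N \<omega> i (p i)))" for \<omega>
  have eq: "bordered_coeff (Y N \<omega>) u v N k = Q1 \<omega> + Q2 \<omega>" for \<omega>
  proof -
    have "bordered_pairs N k = {(T, p) \<in> bordered_pairs N k. p N \<noteq> inv_into UNIV p N}
       \<union> {(T, p) \<in> bordered_pairs N k. p N = inv_into UNIV p N}" by auto
    hence "bordered_coeff (Y N \<omega>) u v N k = Q1 \<omega> + (\<Sum>(T, p)\<in>{(T, p) \<in> bordered_pairs N k. p N = inv_into UNIV p N}.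
      signof p * (u (p N) * v (inv_into UNIV p N)) * (\<Prod>i\<in>T. - Y N \<omega> i (p i)))"
      unfolding bordered_coeff_eq Q1_def
      by (subst sum.union_disjoint[symmetric])
        (auto intro: finite_subset[OF _ finite_bordered_pairs[of N k]])
    thus ?thesis by (simp only: bordered_diag_eq Q2_def)
  qed
  have m1: "integrable P (\<lambda>\<omega>. (cmod (Q1 \<omega>))\<^sup>2)" "expectation (\<lambda>\<omega>. (cmod (Q1 \<omega>))\<^sup>2) \<le> real k / real N"
    unfolding Q1_def by (rule bordered_offdiag_second_moment[OF N u v])+
  have m2: "integrable P (\<lambda>\<omega>. (cmod (Q2 \<omega>))\<^sup>2)"
    "expectation (\<lambda>\<omega>. (cmod (Q2 \<omega>))\<^sup>2) \<le> (cmod (\<Sum>i<N. u i * v i) + real k * B)\<^sup>2"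
    unfolding Q2_def by (rule bordered_diag_second_moment[OF N B]; assumption)+
  have int: "integrable P (\<lambda>\<omega>. 2 * (cmod (Q1 \<omega>))\<^sup>2 + 2 * (cmod (Q2 \<omega>))\<^sup>2)"
    using m1(1) m2(1) by simp
  have le: "(cmod (Q1 \<omega> + Q2 \<omega>))\<^sup>2 \<le> 2 * (cmod (Q1 \<omega>))\<^sup>2 + 2 * (cmod (Q2 \<omega>))\<^sup>2" for \<omega>
  proof -
    have "(cmod (Q1 \<omega> + Q2 \<omega>))\<^sup>2 \<le> (cmod (Q1 \<omega>) + cmod (Q2 \<omega>))\<^sup>2"
      by (intro power_mono norm_triangle_ineq) auto
    also have "\<dots> \<le> 2 * (cmod (Q1 \<omega>))\<^sup>2 + 2 * (cmod (Q2 \<omega>))\<^sup>2"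
      using sum_squares_bound[of "cmod (Q1 \<omega>)" "cmod (Q2 \<omega>)"] by (simp add: power2_sum)
    finally show ?thesis .
  qed
  have [measurable]: "(\<lambda>\<omega>. Y N \<omega> i j) \<in> borel_measurable P" for i j
    unfolding Y_def by measurable
  have meas: "(\<lambda>\<omega>. (cmod (Q1 \<omega> + Q2 \<omega>))\<^sup>2) \<in> borel_measurable P"
    unfolding Q1_def Q2_def case_prod_beta by measurable
  show int': "integrable P (\<lambda>\<omega>. (cmod (bordered_coeff (Y N \<omega>) u v N k))\<^sup>2)"
    unfolding eq by (rule Bochner_Integration.integrable_bound[OF int meas])
      (intro AE_I2, use le in \<open>simp add: abs_of_nonneg\<close>)
  have "expectation (\<lambda>\<omega>. (cmod (bordered_coeff (Y N \<omega>) u v N k))\<^sup>2)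
      \<le> expectation (\<lambda>\<omega>. 2 * (cmod (Q1 \<omega>))\<^sup>2 + 2 * (cmod (Q2 \<omega>))\<^sup>2)"
    by (rule integral_mono[OF int' int]) (simp add: eq le)
  also have "\<dots> = 2 * expectation (\<lambda>\<omega>. (cmod (Q1 \<omega>))\<^sup>2) + 2 * expectation (\<lambda>\<omega>. (cmod (Q2 \<omega>))\<^sup>2)"
    using m1(1) m2(1) by simp
  also have "\<dots> \<le> 2 * (real k / real N) + 2 * (cmod (\<Sum>i<N. u i * v i) + real k * B)\<^sup>2"
    using m1(2) m2(2) by (intro add_mono mult_left_mono) auto
  finally show "expectation (\<lambda>\<omega>. (cmod (bordered_coeff (Y N \<omega>) u v N k))\<^sup>2)
      \<le> 2 * (real k / real N) + 2 * (cmod (\<Sum>i<N. u i * v i) + real k * B)\<^sup>2" .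
qed

end

section \<open>Weak convergence of random sequences\<close>

text \<open>Every real-linear functional of finitely many complex coordinates has this form.\<close>

definition coord_linear :: "((nat \<Rightarrow> complex) \<Rightarrow> real) \<Rightarrow> bool" where
  "coord_linear l \<longleftrightarrow> (\<exists>n s. l = (\<lambda>x. Re (\<Sum>k<n. s k * x k)))"

lemma coord_linear_extend:
  assumes "coord_linear l"
  obtains n s where "\<And>m. m \<ge> n \<Longrightarrow> l = (\<lambda>x. Re (\<Sum>k<m. s k * x k))"
proof -
  obtain n s where l: "l = (\<lambda>x. Re (\<Sum>k<n. s k * x k))" using assms by (auto simp: coord_linear_def)
  show ?thesis
  proof (rule that[of n "\<lambda>k. if k < n then s k else 0"])
    fix m assume "m \<ge> n"
    have "(\<Sum>k<m. (if k < n then s k else 0) * x k) = (\<Sum>k<n. s k * x k)" for x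
      by (rule sum.mono_neutral_cong_right) (use \<open>m \<ge> n\<close> in auto)
    thus "l = (\<lambda>x. Re (\<Sum>k<m. (if k < n then s k else 0) * x k))" by (simp add: l)
  qed
qed

lemma coord_linear_add:
  assumes "coord_linear l" "coord_linear l'" shows "coord_linear (\<lambda>x. l x + l' x)"
proof -
  obtain n s where l: "\<And>m. m \<ge> n \<Longrightarrow> l = (\<lambda>x. Re (\<Sum>k<m. s k * x k))"
    using coord_linear_extend[OF assms(1)] by blast
  obtain n' s' where l': "\<And>m. m \<ge> n' \<Longrightarrow> l' = (\<lambda>x. Re (\<Sum>k<m. s' k * x k))"
    using coord_linear_extend[OF assms(2)] by blast
  have "(\<lambda>x. l x + l' x) = (\<lambda>x. Re (\<Sum>k<max n n'. (s k + s' k) * x k))"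
    using l[of "max n n'"] l'[of "max n n'"] by (simp add: sum.distrib ring_distribs fun_eq_iff)
  thus ?thesis unfolding coord_linear_def by (intro exI[of _ "max n n'"] exI[of _ "\<lambda>k. s k + s' k"])
qed

lemma coord_linear_uminus:
  assumes "coord_linear l" shows "coord_linear (\<lambda>x. - l x)"
proof -
  obtain n s where "l = (\<lambda>x. Re (\<Sum>k<n. s k * x k))" using assms by (auto simp: coord_linear_def)
  hence "(\<lambda>x. - l x) = (\<lambda>x. Re (\<Sum>k<n. (- s k) * x k))"
    by (simp add: sum_negf)
  thus ?thesis unfolding coord_linear_def by (intro exI[of _ n] exI[of _ "\<lambda>k. - s k"])
qed

lemma coord_linear_diff:
  "coord_linear l \<Longrightarrow> coord_linear l' \<Longrightarrow> coord_linear (\<lambda>x. l x - l' x)"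
  using coord_linear_add[of l "\<lambda>x. - l' x"] coord_linear_uminus[of l'] by simp

lemma coord_linear_0: "coord_linear (\<lambda>x. 0)"
  unfolding coord_linear_def by (intro exI[of _ 0]) simp

text \<open>Trigonometric polynomials in finitely many coordinates. The product-to-sum formulas make
  this span of cosines and sines an algebra, as Stone-Weierstrass requires, while expectations of
  its elements follow by linearity from characteristic functions.\<close>

inductive_set trig_algebra :: "((nat \<Rightarrow> complex) \<Rightarrow> real) set" where
  cos: "coord_linear l \<Longrightarrow> (\<lambda>x. cos (l x)) \<in> trig_algebra"
| sin: "coord_linear l \<Longrightarrow> (\<lambda>x. sin (l x)) \<in> trig_algebra"
| add: "f \<in> trig_algebra \<Longrightarrow> g \<in> trig_algebra \<Longrightarrow> (\<lambda>x. f x + g x) \<in> trig_algebra"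
| scale: "f \<in> trig_algebra \<Longrightarrow> (\<lambda>x. c * f x) \<in> trig_algebra"

lemma trig_const: "(\<lambda>_. c) \<in> trig_algebra"
  using scale[OF cos[OF coord_linear_0], of c] by simp

lemma trig_mult_cos:
  assumes "g \<in> trig_algebra" "coord_linear l"
  shows "(\<lambda>x. cos (l x) * g x) \<in> trig_algebra"
  using assms(1)
proof (induction rule: trig_algebra.induct)
  case (cos l')
  have "(\<lambda>x. (1/2) * (cos (l x - l' x) + cos (l x + l' x))) \<in> trig_algebra"
    by (intro trig_algebra.intros coord_linear_add coord_linear_diff cos assms)
  thus ?case by (simp add: cos_times_cos)
next
  case (sin l')
  have "(\<lambda>x. (1/2) * (sin (l x + l' x) + (-1) * sin (l x - l' x))) \<in> trig_algebra"
    by (intro trig_algebra.intros coord_linear_add coord_linear_diff sin assms)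
  thus ?case by (simp add: cos_times_sin)
next
  case (add f g)
  show ?case using trig_algebra.add[OF add(3,4)] by (simp add: ring_distribs)
next
  case (scale f c)
  show ?case using trig_algebra.scale[OF scale(2), of c] by (simp add: mult_ac)
qed

lemma trig_mult_sin:
  assumes "g \<in> trig_algebra" "coord_linear l"
  shows "(\<lambda>x. sin (l x) * g x) \<in> trig_algebra"
  using assms(1)
proof (induction rule: trig_algebra.induct)
  case (cos l')
  have "(\<lambda>x. (1/2) * (sin (l x + l' x) + sin (l x - l' x))) \<in> trig_algebra"
    by (intro trig_algebra.intros coord_linear_add coord_linear_diff cos assms)
  thus ?case by (simp add: sin_times_cos)
next
  case (sin l')
  have "(\<lambda>x. (1/2) * (cos (l x - l' x) + (-1) * cos (l x + l' x))) \<in> trig_algebra"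
    by (intro trig_algebra.intros coord_linear_add coord_linear_diff sin assms)
  thus ?case by (simp add: sin_times_sin)
next
  case (add f g)
  show ?case using trig_algebra.add[OF add(3,4)] by (simp add: ring_distribs)
next
  case (scale f c)
  show ?case using trig_algebra.scale[OF scale(2), of c] by (simp add: mult_ac)
qed

lemma trig_mult:
  assumes "f \<in> trig_algebra" "g \<in> trig_algebra"
  shows "(\<lambda>x. f x * g x) \<in> trig_algebra"
  using assms(1)
proof (induction rule: trig_algebra.induct)
  case (add f f')
  show ?case using trig_algebra.add[OF add(3,4)] by (simp add: ring_distribs)
next
  case (scale f c)
  show ?case using trig_algebra.scale[OF scale(2), of c] by (simp add: mult_ac)
qed (use trig_mult_cos trig_mult_sin assms in auto)

lemma continuous_on_coord: "continuous_on S (\<lambda>x::nat \<Rightarrow> complex. x k)"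
  by (rule continuous_on_subset[OF continuous_on_product_coordinates]) simp

lemma continuous_coord_linear:
  assumes "coord_linear l" shows "continuous_on S l"
proof -
  obtain n s where l: "l = (\<lambda>x. Re (\<Sum>k<n. s k * x k))" using assms by (auto simp: coord_linear_def)
  show ?thesis unfolding l by (intro continuous_intros continuous_on_coord)
qed

lemma continuous_trig: "f \<in> trig_algebra \<Longrightarrow> continuous_on S f"
  by (induction rule: trig_algebra.induct) (auto intro!: continuous_intros intro: continuous_coord_linear)

lemma bounded_trig:
  assumes "f \<in> trig_algebra" shows "\<exists>B. \<forall>x. \<bar>f x\<bar> \<le> B"
  using assms
proof (induction rule: trig_algebra.induct)
  case (add f g)
  then obtain B B' where "\<forall>x. \<bar>f x\<bar> \<le> B" "\<forall>x. \<bar>g x\<bar> \<le> B'" by blast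
  hence "\<forall>x. \<bar>f x + g x\<bar> \<le> B + B'" by (meson abs_triangle_ineq add_mono order_trans)
  thus ?case by blast
next
  case (scale f c)
  then obtain B where "\<forall>x. \<bar>f x\<bar> \<le> B" by blast
  hence "\<forall>x. \<bar>c * f x\<bar> \<le> \<bar>c\<bar> * B" by (simp add: abs_mult mult_left_mono)
  thus ?case by blast
qed (auto intro: exI[of _ 1])

lemma trig_separates:
  fixes x y :: "nat \<Rightarrow> complex"
  assumes "x \<noteq> y" shows "\<exists>f\<in>trig_algebra. f x \<noteq> f y"
proof -
  obtain k where k: "x k \<noteq> y k" using assms by auto
  define d where "d = x k - y k"
  have d: "d \<noteq> 0" using k by (simp add: d_def)
  \<comment> \<open>\<open>s\<close> is the inverse of d, so that l differs by exactly 1 between x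
    and y, and 1 is not a multiple of the period.\<close>
  define s where "s = cnj d / of_real ((cmod d)\<^sup>2)"
  have sd: "s * d = 1"
    using d by (simp add: s_def mult.commute[of "cnj d"] flip: complex_norm_square)
  define l where "l z = Re (\<Sum>j<Suc k. (if j = k then s else 0) * z j)" for z :: "nat \<Rightarrow> complex"
  have l: "coord_linear l" unfolding coord_linear_def l_def
    by (intro exI[of _ "Suc k"] exI[of _ "\<lambda>j. if j = k then s else 0"]) simp
  have lz: "l z = Re (s * z k)" for z by (simp add: l_def)
  have lxy: "l x - l y = 1"
  proof -
    have "s * x k - s * y k = 1" using sd by (simp add: d_def right_diff_distrib)
    thus ?thesis by (simp only: lz minus_complex.sel(1)[symmetric] one_complex.sel(1))
  qed
  show ?thesis
  proof (rule ccontr)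
    assume *: "\<not> ?thesis"
    have "cos (l x) = cos (l y)" "sin (l x) = sin (l y)"
      using * trig_algebra.cos[OF l] trig_algebra.sin[OF l] by auto
    hence "cos (l x - l y) = (cos (l y))\<^sup>2 + (sin (l y))\<^sup>2"
      by (simp add: cos_diff power2_eq_square)
    hence "cos (1 :: real) = 1" by (simp add: lxy)
    moreover have "cos (1 :: real) < cos 0"
      by (rule cos_monotone_0_pi) (use pi_gt3 in auto)
    ultimately show False by simp
  qed
qed

lemma trig_polynomial:
  fixes q :: "real \<Rightarrow> real"
  assumes "real_polynomial_function q" "g \<in> trig_algebra"
  shows "(\<lambda>x. q (g x)) \<in> trig_algebra"
  using assms(1)
proof (induction rule: real_polynomial_function.induct)
  case (linear f)
  obtain c where "f = (\<lambda>x. x * c)" using linear real_bounded_linear by blast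
  thus ?case using trig_algebra.scale[OF assms(2), of c] by (simp add: mult.commute)
qed (auto intro: trig_const trig_mult trig_algebra.add)

text \<open>A uniform approximant on \<open>K\<close> need not be bounded by \<open>B\<close> off \<open>K\<close>; composing it with a polynomial
  close to the clamping function repairs this without leaving the algebra.\<close>

lemma trig_approx:
  fixes F :: "(nat \<Rightarrow> complex) \<Rightarrow> real"
  assumes K: "compact K" and cont: "continuous_on K F" and B: "\<And>x. \<bar>F x\<bar> \<le> B" and e: "e > 0"
  obtains a where "a \<in> trig_algebra" "\<And>x. \<bar>a x\<bar> \<le> B + e" "\<And>x. x \<in> K \<Longrightarrow> \<bar>F x - a x\<bar> \<le> 2 * e"
proof -
  interpret function_ring_on trig_algebra K
    by unfold_locales (auto intro: K continuous_trig trig_algebra.add trig_mult trig_const trig_separates)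
  obtain g where g: "g \<in> trig_algebra" "\<And>x. x \<in> K \<Longrightarrow> \<bar>F x - g x\<bar> < e"
    using Stone_Weierstrass_basic[OF cont e] by blast
  obtain G where G: "\<And>x. \<bar>g x\<bar> \<le> G" using bounded_trig[OF g(1)] by blast
  define cl where "cl t = max (- B) (min B t)" for t :: real
  have "continuous_on {- G..G} cl" unfolding cl_def by (intro continuous_intros)
  then obtain q where q: "real_polynomial_function q" "\<And>t. t \<in> {- G..G} \<Longrightarrow> \<bar>cl t - q t\<bar> < e"
    using Stone_Weierstrass_real_polynomial_function[OF compact_Icc _ e] by blast
  show ?thesis
  proof (rule that[OF trig_polynomial[OF q(1) g(1)]])
    fix x
    have "g x \<in> {- G..G}" using G[of x] by (simp add: abs_le_iff)
    hence 1: "\<bar>cl (g x) - q (g x)\<bar> < e" by (rule q(2))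
    have "B \<ge> 0" using B[of x] by simp
    hence "\<bar>cl (g x)\<bar> \<le> B" by (auto simp: cl_def)
    thus "\<bar>q (g x)\<bar> \<le> B + e" using 1 by linarith
    assume "x \<in> K"
    hence "\<bar>F x - g x\<bar> < e" by (rule g(2))
    hence "\<bar>F x - cl (g x)\<bar> < e" using B[of x] e by (auto simp: cl_def)
    thus "\<bar>F x - q (g x)\<bar> \<le> 2 * e" using 1 by linarith
  qed
qed

text \<open>On K the error is at most 2 e; off K, an event of probability at most e, it is at most 2
  B + e.\<close>

lemma expectation_approx_le:
  fixes F a :: "(nat \<Rightarrow> complex) \<Rightarrow> real" and Z :: "'a \<Rightarrow> nat \<Rightarrow> complex"
  assumes "prob_space M" and [measurable]: "Z \<in> borel_measurable M" "F \<in> borel_measurable borel"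
      "a \<in> borel_measurable borel"
    and K: "compact K" and F: "\<And>x. \<bar>F x\<bar> \<le> B" and a: "\<And>x. \<bar>a x\<bar> \<le> B + e"
    and Fa: "\<And>x. x \<in> K \<Longrightarrow> \<bar>F x - a x\<bar> \<le> 2 * e" and e: "e > 0"
    and PK: "measure M {\<omega> \<in> space M. Z \<omega> \<notin> K} \<le> e"
  shows "\<bar>(\<integral>\<omega>. F (Z \<omega>) \<partial>M) - (\<integral>\<omega>. a (Z \<omega>) \<partial>M)\<bar> \<le> 2 * e + (2 * B + e) * e"
proof -
  interpret prob_space M by fact
  have B: "B \<ge> 0" using F[of undefined] by simp
  have [measurable]: "K \<in> sets borel" by (rule borel_closed[OF compact_imp_closed[OF K]])
  have iF: "integrable M (\<lambda>\<omega>. F (Z \<omega>))"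
    by (rule integrable_const_bound[of _ B]) (use F in auto)
  have ia: "integrable M (\<lambda>\<omega>. a (Z \<omega>))"
    by (rule integrable_const_bound[of _ "B + e"]) (use a in auto)
  have im: "integrable M (\<lambda>\<omega>. 2 * e + (2 * B + e) * indicator {\<omega> \<in> space M. Z \<omega> \<notin> K} \<omega>)"
    by (intro Bochner_Integration.integrable_add integrable_mult_right integrable_const)
      (auto simp: integrable_indicator_iff less_top[symmetric])
  have "\<bar>(\<integral>\<omega>. F (Z \<omega>) \<partial>M) - (\<integral>\<omega>. a (Z \<omega>) \<partial>M)\<bar> = \<bar>\<integral>\<omega>. F (Z \<omega>) - a (Z \<omega>) \<partial>M\<bar>"
    using iF ia by simp
  also have "\<dots> \<le> (\<integral>\<omega>. \<bar>F (Z \<omega>) - a (Z \<omega>)\<bar> \<partial>M)" by (rule integral_abs_bound)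
  also have "\<dots> \<le> (\<integral>\<omega>. 2 * e + (2 * B + e) * indicator {\<omega> \<in> space M. Z \<omega> \<notin> K} \<omega> \<partial>M)"
  proof (rule integral_mono[OF integrable_abs[OF Bochner_Integration.integrable_diff[OF iF ia]] im])
    fix \<omega> assume \<omega>: "\<omega> \<in> space M"
    show "\<bar>F (Z \<omega>) - a (Z \<omega>)\<bar> \<le> 2 * e + (2 * B + e) * indicator {\<omega> \<in> space M. Z \<omega> \<notin> K} \<omega>"
    proof (cases "Z \<omega> \<in> K")
      case True thus ?thesis using Fa by (simp add: indicator_def)
    next
      case False
      have "\<bar>F (Z \<omega>) - a (Z \<omega>)\<bar> \<le> B + (B + e)" using F[of "Z \<omega>"] a[of "Z \<omega>"] by linarith
      thus ?thesis using False \<omega> e by (simp add: indicator_def)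
    qed
  qed
  also have "\<dots> = 2 * e + (2 * B + e) * measure M {\<omega> \<in> space M. Z \<omega> \<notin> K}"
    by (subst Bochner_Integration.integral_add) (auto simp: prob_space integrable_indicator_iff less_top[symmetric])
  also have "\<dots> \<le> 2 * e + (2 * B + e) * e"
    using PK B e by (intro add_left_mono mult_left_mono) auto
  finally show ?thesis .
qed

text \<open>Continuity of F is asked only on compact sets that carry nearly all the mass of the
  limit and, for large N, of the sequence. There trigonometric polynomials approximate F, and their
  expectations converge. The sum over zeros is continuous in just this restricted sense.\<close>

lemma weak_limit_of_characteristic_functions:
  fixes F :: "(nat \<Rightarrow> complex) \<Rightarrow> real"
    and \<xi> :: "nat \<Rightarrow> 'a \<Rightarrow> nat \<Rightarrow> complex" and \<zeta> :: "'b \<Rightarrow> nat \<Rightarrow> complex"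
  assumes M: "prob_space M" and M': "prob_space M'"
    and [measurable]: "\<And>N. \<xi> N \<in> borel_measurable M" "\<zeta> \<in> borel_measurable M'"
    and char: "\<And>n s. (\<lambda>N. \<integral>\<omega>. iexp (Re (\<Sum>k<n. s k * \<xi> N \<omega> k)) \<partial>M) \<longlonglongrightarrow>
       (\<integral>\<omega>. iexp (Re (\<Sum>k<n. s k * \<zeta> \<omega> k)) \<partial>M')"
    and F [measurable]: "F \<in> borel_measurable borel" and B: "\<And>x. \<bar>F x\<bar> \<le> B"
    and tight: "\<And>e. e > 0 \<Longrightarrow> \<exists>K. compact K \<and> continuous_on K F \<and>
      (\<forall>\<^sub>F N in sequentially. measure M {\<omega> \<in> space M. \<xi> N \<omega> \<notin> K} \<le> e) \<and>
      measure M' {\<omega> \<in> space M'. \<zeta> \<omega> \<notin> K} \<le> e"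
  shows "(\<lambda>N. \<integral>\<omega>. F (\<xi> N \<omega>) \<partial>M) \<longlonglongrightarrow> (\<integral>\<omega>. F (\<zeta> \<omega>) \<partial>M')"
proof -
  interpret M: prob_space M by fact
  interpret M': prob_space M' by fact
  have meas_trig [measurable]: "f \<in> trig_algebra \<Longrightarrow> f \<in> borel_measurable borel" for f
    by (intro borel_measurable_continuous_onI continuous_trig)
  have trig_int: "integrable M (\<lambda>\<omega>. f (\<xi> N \<omega>))" if f: "f \<in> trig_algebra" for f N
  proof -
    obtain C where "\<forall>x. \<bar>f x\<bar> \<le> C" using bounded_trig[OF f] by blast
    thus ?thesis by (intro M.integrable_const_bound[of _ C]) (use f in auto)
  qed
  have trig_int': "integrable M' (\<lambda>\<omega>. f (\<zeta> \<omega>))" if f: "f \<in> trig_algebra" for f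
  proof -
    obtain C where "\<forall>x. \<bar>f x\<bar> \<le> C" using bounded_trig[OF f] by blast
    thus ?thesis by (intro M'.integrable_const_bound[of _ C]) (use f in auto)
  qed
  have meas_lin [measurable]: "coord_linear l \<Longrightarrow> l \<in> borel_measurable borel" for l
    by (intro borel_measurable_continuous_onI continuous_coord_linear)
  have char': "(\<lambda>N. \<integral>\<omega>. iexp (l (\<xi> N \<omega>)) \<partial>M) \<longlonglongrightarrow> (\<integral>\<omega>. iexp (l (\<zeta> \<omega>)) \<partial>M')" if "coord_linear l" for l
    using that char unfolding coord_linear_def by blast
  have int_iexp: "integrable M (\<lambda>\<omega>. iexp (l (\<xi> N \<omega>)))" "integrable M' (\<lambda>\<omega>. iexp (l (\<zeta> \<omega>)))"
    if [measurable]: "coord_linear l" for l N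
    by (auto intro!: M.integrable_const_bound[of _ 1] M'.integrable_const_bound[of _ 1])
  have conv: "(\<lambda>N. \<integral>\<omega>. f (\<xi> N \<omega>) \<partial>M) \<longlonglongrightarrow> (\<integral>\<omega>. f (\<zeta> \<omega>) \<partial>M')" if "f \<in> trig_algebra" for f
    using that
  proof (induction rule: trig_algebra.induct)
    case (cos l)
    have "(\<lambda>N. Re (\<integral>\<omega>. iexp (l (\<xi> N \<omega>)) \<partial>M)) \<longlonglongrightarrow> Re (\<integral>\<omega>. iexp (l (\<zeta> \<omega>)) \<partial>M')"
      by (intro tendsto_intros char' cos)
    thus ?case using int_iexp[OF cos] by (simp flip: integral_Re add: Re_exp)
  next
    case (sin l)
    have "(\<lambda>N. Im (\<integral>\<omega>. iexp (l (\<xi> N \<omega>)) \<partial>M)) \<longlonglongrightarrow> Im (\<integral>\<omega>. iexp (l (\<zeta> \<omega>)) \<partial>M')"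
      by (intro tendsto_intros char' sin)
    thus ?case using int_iexp[OF sin] by (simp flip: integral_Im add: Im_exp)
  next
    case (add f g)
    thus ?case using trig_int trig_int' by (auto intro!: tendsto_add)
  next
    case (scale f c)
    thus ?case by (auto intro!: tendsto_mult_left)
  qed
  have B0: "B \<ge> 0" using B[of undefined] by simp
  show ?thesis
  proof (rule tendstoI)
    fix r :: real assume r: "r > 0"
    \<comment> \<open>Two approximation errors of at most 3 e + 2 B e each, and e from the
      convergence for the approximant, add up to 7 e + 4 B e, which this choice keeps below
      r.\<close>
    define e where "e = min 1 (r / (8 + 4 * B))"
    have e: "e > 0" "e \<le> 1" using r B0 by (auto simp: e_def)
    have "e \<le> r / (8 + 4 * B)" by (simp add: e_def)
    hence "e * (8 + 4 * B) \<le> r" using B0 by (simp add: pos_le_divide_eq)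
    hence re: "7 * e + 4 * B * e < r" using e by (simp add: algebra_simps)
    obtain K where K: "compact K" "continuous_on K F"
      "\<forall>\<^sub>F N in sequentially. measure M {\<omega> \<in> space M. \<xi> N \<omega> \<notin> K} \<le> e"
      "measure M' {\<omega> \<in> space M'. \<zeta> \<omega> \<notin> K} \<le> e" using tight[OF e(1)] by blast
    obtain a where a: "a \<in> trig_algebra" "\<And>x. \<bar>a x\<bar> \<le> B + e" "\<And>x. x \<in> K \<Longrightarrow> \<bar>F x - a x\<bar> \<le> 2 * e"
      using trig_approx[OF K(1,2) B e(1)] by blast
    have "\<forall>\<^sub>F N in sequentially. dist (\<integral>\<omega>. a (\<xi> N \<omega>) \<partial>M) (\<integral>\<omega>. a (\<zeta> \<omega>) \<partial>M') < e"
      by (rule tendstoD[OF conv[OF a(1)] e(1)])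
    with K(3) show "\<forall>\<^sub>F N in sequentially. dist (\<integral>\<omega>. F (\<xi> N \<omega>) \<partial>M) (\<integral>\<omega>. F (\<zeta> \<omega>) \<partial>M') < r"
    proof eventually_elim
      case (elim N)
      have 1: "\<bar>(\<integral>\<omega>. F (\<xi> N \<omega>) \<partial>M) - (\<integral>\<omega>. a (\<xi> N \<omega>) \<partial>M)\<bar> \<le> 2 * e + (2 * B + e) * e"
        by (rule expectation_approx_le[OF M _ F meas_trig[OF a(1)] K(1) B a(2,3) e(1) elim(1)]) auto
      have 2: "\<bar>(\<integral>\<omega>. F (\<zeta> \<omega>) \<partial>M') - (\<integral>\<omega>. a (\<zeta> \<omega>) \<partial>M')\<bar> \<le> 2 * e + (2 * B + e) * e"
        by (rule expectation_approx_le[OF M' _ F meas_trig[OF a(1)] K(1) B a(2,3) e(1) K(4)]) auto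
      have "e * e \<le> e" using e by (simp add: mult_left_le)
      hence "2 * e + (2 * B + e) * e \<le> 3 * e + 2 * B * e" by (simp add: algebra_simps)
      thus ?case using 1 2 elim(2) re unfolding dist_real_def by linarith
    qed
  qed
qed

section \<open>Traces of powers\<close>

context iid_entries
begin

lemma cyc_expectation_eq_0:
  assumes "\<not> cyc_repeated k h" and "h \<in> (UNIV \<times> {..<k}) \<rightarrow>\<^sub>E {..<N}"
  shows "expectation (\<lambda>\<omega>. \<Prod>x\<in>UNIV \<times> {..<k}. entry (h x, h (cyc_next k x)) (fst x) \<omega>) = 0"
proof -
  define I where "I = (UNIV :: bool set) \<times> {..<k}"
  have "\<not> (\<forall>x\<in>I. \<exists>y\<in>I. y \<noteq> x \<and> h y = h x \<and> h (cyc_next k y) = h (cyc_next k x))"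
    using assms(1) unfolding cyc_repeated_def I_def .
  then obtain x where x: "x \<in> I"
    "\<And>y. y \<in> I \<Longrightarrow> y \<noteq> x \<Longrightarrow> \<not> (h y = h x \<and> h (cyc_next k y) = h (cyc_next k x))" by blast
  have "finite I" by (simp add: I_def)
  from expectation_prod_entry_eq_0[OF this x(1), of "\<lambda>x. (h x, h (cyc_next k x))" fst] x(2)
  show ?thesis unfolding I_def[symmetric] by blast
qed

lemma norm_pseudo_var_le: "cmod pseudo_var \<le> 1"
proof -
  have "cmod pseudo_var \<le> expectation (\<lambda>\<omega>. cmod ((X 0 0 \<omega>)\<^sup>2))"
    unfolding pseudo_var_def by (rule integral_norm_bound)
  thus ?thesis using var_one by (simp add: norm_power)
qed

text \<open>In the extremal case each edge is used exactly twice, so every factor is a second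
  moment, of modulus at most 1; no higher moment enters the leading term.\<close>

lemma cyc_expectation_extremal:
  assumes rep: "cyc_repeated k h" and eq: "card (h ` (UNIV \<times> {..<k})) = k"
  shows "cmod (expectation (\<lambda>\<omega>. \<Prod>x\<in>UNIV \<times> {..<k}. entry (h x, h (cyc_next k x)) (fst x) \<omega>)) \<le> 1"
proof -
  let ?I = "(UNIV :: bool set) \<times> {..<k}"
  let ?ed = "\<lambda>x. (h x, h (cyc_next k x))"
  have fin: "finite ?I" by simp
  have cardI: "card ?I \<le> 2 * card (h ` ?I)" using eq by (simp add: card_cartesian_product)
  have "cmod (mixed_moment (card {s \<in> ?I. ?ed s = e \<and> \<not> fst s}) (card {s \<in> ?I. ?ed s = e \<and> fst s})) \<le> 1"
    if e: "e \<in> ?ed ` ?I" for e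
  proof -
    obtain x where x: "x \<in> ?I" "e = ?ed x" using e by (elim imageE)
    obtain y where y: "y \<in> ?I" "y \<noteq> x" "h y = h x" "h (cyc_next k y) = h (cyc_next k x)"
      using rep[unfolded cyc_repeated_def, THEN bspec, OF x(1)] by (elim bexE conjE)
    have xy: "s = x \<or> s = y" if "s \<in> ?I" "?ed s = e" for s
    proof (cases "s = x")
      case False
      have "h s = h x" using that x by simp
      hence "s = y"
        by (intro two_to_one_if_card_eq[OF fin cyc_repeated_ex[OF rep] cardI, of s x y])
          (use that x y False in simp_all)
      thus ?thesis by simp
    qed simp
    have S: "{s \<in> ?I. ?ed s = e \<and> Q s} = {s \<in> {x, y}. Q s}" for Q
    proof (rule Collect_cong, rule iffI)
      fix s assume s: "s \<in> ?I \<and> ?ed s = e \<and> Q s"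
      hence "s = x \<or> s = y" by (intro xy) simp_all
      thus "s \<in> {x, y} \<and> Q s" using s by simp
    next
      fix s assume s: "s \<in> {x, y} \<and> Q s"
      hence "s = x \<or> s = y" by simp
      thus "s \<in> ?I \<and> ?ed s = e \<and> Q s" using s x y by (elim disjE) simp_all
    qed
    define p q where "p = card {s \<in> ?I. ?ed s = e \<and> \<not> fst s}" and "q = card {s \<in> ?I. ?ed s = e \<and> fst s}"
    have "(p, q) \<in> {(2, 0), (1, 1), (0, 2)}"
    proof -
      have "{s \<in> {x, y}. \<not> fst s} = (if fst x then if fst y then {} else {y} else if fst y then {x} else {x, y})"
        "{s \<in> {x, y}. fst s} = (if fst x then if fst y then {x, y} else {x} else if fst y then {y} else {})" by auto
      thus ?thesis unfolding p_def q_def S using y(2) by auto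
    qed
    thus ?thesis
      unfolding p_def[symmetric] q_def[symmetric] using norm_pseudo_var_le by (auto simp: mixed_moment_2_0 mixed_moment_0_2)
  qed
  thus ?thesis
    unfolding expectation_prod_entry[OF fin, of ?ed fst] prod_norm[symmetric]
    by (intro prod_le_1) auto
qed

text \<open>The trace of the k-th power of X / sqrt N, expanded over closed walks.\<close>

definition trace_power :: "nat \<Rightarrow> nat \<Rightarrow> 'a \<Rightarrow> complex" where
  "trace_power k N \<omega> = (\<Sum>f\<in>{..<k} \<rightarrow>\<^sub>E {..<N}. \<Prod>a<k. X (f a) (f (Suc a mod k)) \<omega> / of_real (sqrt (real N)))"

lemma trace_power_square:
  assumes k: "k \<ge> 1" and N: "N \<ge> 1"
  shows "complex_of_real ((cmod (trace_power k N \<omega>))\<^sup>2) = (\<Sum>h\<in>(UNIV \<times> {..<k}) \<rightarrow>\<^sub>E {..<N}.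
    (\<Prod>x\<in>UNIV \<times> {..<k}. entry (h x, h (cyc_next k x)) (fst x) \<omega>) / of_nat N ^ k)"
proof -
  let ?I = "(UNIV :: bool set) \<times> {..<k}"
  let ?F = "{..<k} \<rightarrow>\<^sub>E {..<N}"
  define s where "s = complex_of_real (sqrt (real N))"
  have s2: "s * s = of_nat N" unfolding s_def
    by (simp flip: of_real_mult)
  define w where "w f = (\<Prod>a<k. X (f a) (f (Suc a mod k)) \<omega>)" for f
  have tr: "trace_power k N \<omega> = (\<Sum>f\<in>?F. w f) / s ^ k"
    by (simp add: trace_power_def w_def s_def prod_dividef sum_divide_distrib)
  have "complex_of_real ((cmod (trace_power k N \<omega>))\<^sup>2) = (\<Sum>f\<in>?F. \<Sum>g\<in>?F. w f * cnj (w g)) / (s * s) ^ k"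
    unfolding complex_norm_square tr by (simp add: sum_product s_def power_mult_distrib)
  also have "(\<Sum>f\<in>?F. \<Sum>g\<in>?F. w f * cnj (w g)) = (\<Sum>(f, g)\<in>?F \<times> ?F. w f * cnj (w g))"
    by (simp add: sum.cartesian_product)
  also have "\<dots> = (\<Sum>h\<in>?I \<rightarrow>\<^sub>E {..<N}. \<Prod>x\<in>?I. entry (h x, h (cyc_next k x)) (fst x) \<omega>)"
  proof -
    \<comment> \<open>Two closed walks become one map on pairs of a flag and a time, with the flag
      \<open>True\<close> for the conjugated walk.\<close>
    define fi where "fi h = (restrict (\<lambda>a. h (False, a)) {..<k}, restrict (\<lambda>a. h (True, a)) {..<k})"
      for h :: "bool \<times> nat \<Rightarrow> nat"
    define fj where "fj z = restrict (\<lambda>x. if fst x then snd z (snd x) else fst z (snd x)) ?I"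
      for z :: "(nat \<Rightarrow> nat) \<times> (nat \<Rightarrow> nat)"
    have split: "(\<Prod>x\<in>?I. e x) = (\<Prod>a<k. e (False, a)) * (\<Prod>a<k. e (True, a))" for e :: "bool \<times> nat \<Rightarrow> complex"
      unfolding prod.cartesian_product' UNIV_bool by simp
    show ?thesis
    proof (rule sum.reindex_bij_witness[where i = fi and j = fj])
      fix z assume z: "z \<in> ?F \<times> ?F"
      show "fi (fj z) = z"
      proof (rule prod_eqI)
        show "fst (fi (fj z)) = fst z" using z
          by (intro extensionalityI[of _ "{..<k}"]) (auto simp: fi_def fj_def PiE_def)
        show "snd (fi (fj z)) = snd z" using z
          by (intro extensionalityI[of _ "{..<k}"]) (auto simp: fi_def fj_def PiE_def)
      qed
      show "fj z \<in> ?I \<rightarrow>\<^sub>E {..<N}"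
      proof
        fix x assume "x \<in> ?I"
        thus "fj z x \<in> {..<N}" using z by (auto simp: fj_def PiE_def Pi_def)
      qed (simp add: fj_def)
      have "(\<Prod>x\<in>?I. entry (fj z x, fj z (cyc_next k x)) (fst x) \<omega>) =
          (\<Prod>a<k. X (fst z a) (fst z (Suc a mod k)) \<omega>) * (\<Prod>a<k. cnj (X (snd z a) (snd z (Suc a mod k)) \<omega>))"
        unfolding split by (intro arg_cong2[of _ _ _ _ "(*)"] prod.cong refl) (auto simp: fj_def cyc_next_def entry_def)
      thus "(\<Prod>x\<in>?I. entry (fj z x, fj z (cyc_next k x)) (fst x) \<omega>) = (case z of (f, g) \<Rightarrow> w f * cnj (w g))"
        by (simp add: w_def case_prod_beta)
    next
      fix h assume h: "h \<in> ?I \<rightarrow>\<^sub>E {..<N}"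
      show "fi h \<in> ?F \<times> ?F" using h by (auto simp: fi_def)
      show "fj (fi h) = h"
      proof
        fix x show "fj (fi h) x = h x"
        proof (cases "x \<in> ?I")
          case True
          thus ?thesis by (cases x) (auto simp: fi_def fj_def)
        next
          case False
          thus ?thesis using PiE_arb[OF h False] by (simp add: fj_def)
        qed
      qed
    qed
  qed
  finally show ?thesis by (simp only: s2 sum_divide_distrib)
qed

text \<open>Labellings with k distinct values number at most 4 k^2 N^k and have expectation at most
  1. Those with fewer values lose a factor N, so the moments of the entries only enter a term of
  order 1 / N, though with a constant that grows fast in k.\<close>

lemma trace_power_second_moment:
  assumes k: "k \<ge> 1" and N: "N \<ge> 1"
  shows "integrable P (\<lambda>\<omega>. (cmod (trace_power k N \<omega>))\<^sup>2)"
    and "expectation (\<lambda>\<omega>. (cmod (trace_power k N \<omega>))\<^sup>2)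
      \<le> 4 * (real k)\<^sup>2 + real ((k - 1) ^ (2 * k)) * abs_moment_bound (2 * k) ^ (2 * k) / real N"
proof -
  let ?I = "(UNIV :: bool set) \<times> {..<k}"
  let ?W = "\<lambda>h \<omega>. \<Prod>x\<in>?I. entry (h x, h (cyc_next k x)) (fst x) \<omega>"
  let ?M = "abs_moment_bound (2 * k) ^ (2 * k)"
  have fin: "finite ?I" by simp
  have cardI: "card ?I = 2 * k" by (simp add: card_cartesian_product)
  have M: "?M \<ge> 0" using abs_moment_bound_ge_1[of "2 * k"] by simp
  have int: "integrable P (\<lambda>\<omega>. ?W h \<omega> / of_nat N ^ k)" for h
    using integrable_prod_entry[OF fin, of "\<lambda>x. (h x, h (cyc_next k x))" fst] by (rule integrable_divide)
  have "integrable P (\<lambda>\<omega>. complex_of_real ((cmod (trace_power k N \<omega>))\<^sup>2))"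
    unfolding trace_power_square[OF k N] by (intro Bochner_Integration.integrable_sum int)
  thus "integrable P (\<lambda>\<omega>. (cmod (trace_power k N \<omega>))\<^sup>2)"
    by (simp only: complex_of_real_integrable_eq)
  define H where "H = ?I \<rightarrow>\<^sub>E {..<N}"
  have finH: "finite H" unfolding H_def by (intro finite_PiE) auto
  define H1 where "H1 = {h \<in> H. cyc_repeated k h \<and> card (h ` ?I) = k}"
  define H2 where "H2 = {h \<in> H. card (h ` ?I) \<le> k - 1}"
  have bound: "cmod (expectation (?W h)) \<le> (if h \<in> H1 then 1 else if h \<in> H2 then ?M else 0)" if h: "h \<in> H" for h
  proof (cases "cyc_repeated k h")
    case False
    hence "expectation (?W h) = 0" using h by (intro cyc_expectation_eq_0) (auto simp: H_def)
    thus ?thesis using M by simp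
  next
    case True
    hence "card (h ` ?I) \<le> k" by (rule cyc_repeated_card_le)
    then consider "card (h ` ?I) = k" | "card (h ` ?I) \<le> k - 1" by linarith
    thus ?thesis
    proof cases
      case 1
      hence "h \<in> H1" using h True by (simp add: H1_def)
      thus ?thesis using cyc_expectation_extremal[OF True 1] by simp
    next
      case 2
      hence "h \<in> H2" "h \<notin> H1" using h k by (auto simp: H1_def H2_def)
      thus ?thesis
        using norm_expectation_prod_entry_le[OF fin, of "\<lambda>x. (h x, h (cyc_next k x))" fst] by (simp add: cardI)
    qed
  qed
  have "complex_of_real (expectation (\<lambda>\<omega>. (cmod (trace_power k N \<omega>))\<^sup>2)) = (\<Sum>h\<in>H. expectation (?W h) / of_nat N ^ k)"
    unfolding integral_complex_of_real[symmetric] trace_power_square[OF k N] H_def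
    by (subst Bochner_Integration.integral_sum[OF int]) simp
  hence "cmod (complex_of_real (expectation (\<lambda>\<omega>. (cmod (trace_power k N \<omega>))\<^sup>2))) = cmod (\<Sum>h\<in>H. expectation (?W h) / of_nat N ^ k)"
    by simp
  hence "expectation (\<lambda>\<omega>. (cmod (trace_power k N \<omega>))\<^sup>2) \<le> cmod (\<Sum>h\<in>H. expectation (?W h) / of_nat N ^ k)"
    by simp
  also have "\<dots> \<le> (\<Sum>h\<in>H. (if h \<in> H1 then 1 else if h \<in> H2 then ?M else 0) / real N ^ k)"
    by (rule sum_norm_le) (use bound in \<open>simp add: norm_divide norm_power divide_right_mono\<close>)
  also have "\<dots> \<le> (\<Sum>h\<in>H. (if h \<in> H1 then 1 else 0) / real N ^ k + (if h \<in> H2 then ?M else 0) / real N ^ k)"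
    by (intro sum_mono) (use M in \<open>auto simp: divide_right_mono\<close>)
  also have "\<dots> = real (card H1) / real N ^ k + real (card H2) * ?M / real N ^ k"
  proof -
    have "H \<inter> H1 = H1" "H \<inter> H2 = H2" by (auto simp: H1_def H2_def)
    thus ?thesis using finH
      by (simp add: sum.distrib sum_divide_distrib[symmetric] sum.If_cases del: sum_divide_distrib)
  qed
  also have "\<dots> \<le> 4 * (real k)\<^sup>2 + real ((k - 1) ^ (2 * k)) * ?M / real N"
  proof (rule add_mono)
    have "real (card H1) \<le> real (4 * k\<^sup>2 * N ^ k)"
      unfolding H1_def H_def using card_cyc_extremal_le[OF k] of_nat_le_iff by blast
    thus "real (card H1) / real N ^ k \<le> 4 * (real k)\<^sup>2" using N by (simp add: divide_simps)
    have "real (card H2) \<le> real ((k - 1) ^ (2 * k) * N ^ (k - 1))"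
      using card_PiE_image_le[OF fin N, of "k - 1"] unfolding H2_def H_def cardI of_nat_le_iff .
    hence "real (card H2) * ?M / real N ^ k \<le> real ((k - 1) ^ (2 * k) * N ^ (k - 1)) * ?M / real N ^ k"
      using M by (intro divide_right_mono mult_right_mono) auto
    also have "\<dots> = real ((k - 1) ^ (2 * k)) * ?M / real N"
      using k N by (cases k) (auto simp: field_simps)
    finally show "real (card H2) * ?M / real N ^ k \<le> real ((k - 1) ^ (2 * k)) * ?M / real N" .
  qed
  finally show "expectation (\<lambda>\<omega>. (cmod (trace_power k N \<omega>))\<^sup>2)
      \<le> 4 * (real k)\<^sup>2 + real ((k - 1) ^ (2 * k)) * ?M / real N" .
qed

end

section \<open>Joint Gaussian limit of bilinear forms\<close>

locale iid_rank_one = iid_entries +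
  fixes u v :: "nat \<Rightarrow> nat \<Rightarrow> real" and C :: real
  assumes u_unit: "N \<ge> 1 \<Longrightarrow> (\<Sum>i<N. (u N i)\<^sup>2) = 1"
    and v_unit: "N \<ge> 1 \<Longrightarrow> (\<Sum>i<N. (v N i)\<^sup>2) = 1"
    and u_le: "N \<ge> 1 \<Longrightarrow> i < N \<Longrightarrow> \<bar>u N i\<bar> \<le> C / sqrt (real N)"
    and v_le: "N \<ge> 1 \<Longrightarrow> i < N \<Longrightarrow> \<bar>v N i\<bar> \<le> C / sqrt (real N)"
    and C_ge_0: "C \<ge> 0"
begin

definition paths :: "nat \<Rightarrow> nat \<Rightarrow> (nat \<Rightarrow> nat) set" where
  "paths k N = {..k} \<rightarrow>\<^sub>E {..<N}"

definition path_weight :: "nat \<Rightarrow> nat \<Rightarrow> (nat \<Rightarrow> nat) \<Rightarrow> real" where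
  "path_weight k N g = sqrt (real N) * u N (g 0) * v N (g k) / sqrt (real N) ^ k"

definition path_prod :: "nat \<Rightarrow> bool \<Rightarrow> (nat \<Rightarrow> nat) \<Rightarrow> 'a \<Rightarrow> complex" where
  "path_prod k b g \<omega> = (\<Prod>j<k. entry (g j, g (Suc j)) b \<omega>)"

text \<open>\<open>path_sum N (k, b)\<close> is \<open>\<surd>N u\<^sup>T Y\<^sup>k v\<close> for \<open>Y = X / \<surd>N\<close>, conjugated if \<open>b\<close>.\<close>

definition path_sum :: "nat \<Rightarrow> nat \<times> bool \<Rightarrow> 'a \<Rightarrow> complex" where
  "path_sum N y \<omega> = (\<Sum>g\<in>paths (fst y) N. of_real (path_weight (fst y) N g) * path_prod (fst y) (snd y) g \<omega>)"

lemma finite_paths: "finite (paths k N)"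
  unfolding paths_def by (intro finite_PiE) auto

definition walks :: "nat set \<Rightarrow> (nat \<Rightarrow> nat \<times> bool) \<Rightarrow> nat \<Rightarrow> (nat \<Rightarrow> nat \<Rightarrow> nat) set" where
  "walks A x N = (\<Pi>\<^sub>E a\<in>A. paths (fst (x a)) N)"

lemma finite_walks: "finite A \<Longrightarrow> finite (walks A x N)"
  unfolding walks_def by (intro finite_PiE finite_paths)

definition walk_exp :: "nat set \<Rightarrow> (nat \<Rightarrow> nat \<times> bool) \<Rightarrow> (nat \<Rightarrow> nat \<Rightarrow> nat) \<Rightarrow> complex" where
  "walk_exp A x G = expectation (\<lambda>\<omega>. \<Prod>s\<in>(SIGMA a:A. {..<fst (x a)}).
     entry (G (fst s) (snd s), G (fst s) (Suc (snd s))) (snd (x (fst s))) \<omega>)"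

definition walk_weight :: "nat set \<Rightarrow> (nat \<Rightarrow> nat \<times> bool) \<Rightarrow> nat \<Rightarrow> (nat \<Rightarrow> nat \<Rightarrow> nat) \<Rightarrow> real" where
  "walk_weight A x N G = (\<Prod>a\<in>A. path_weight (fst (x a)) N (G a))"

definition moment :: "nat \<Rightarrow> nat set \<Rightarrow> (nat \<Rightarrow> nat \<times> bool) \<Rightarrow> complex" where
  "moment N A x = (\<Sum>G\<in>walks A x N. of_real (walk_weight A x N G) * walk_exp A x G)"

text \<open>Expanding the product of path sums gives a sum over families \<open>G\<close> with one
  path for each index in A.\<close>

lemma
  assumes fin: "finite A"
  shows integrable_prod_path_sum: "integrable P (\<lambda>\<omega>. \<Prod>a\<in>A. path_sum N (x a) \<omega>)"
    and expectation_prod_path_sum: "expectation (\<lambda>\<omega>. \<Prod>a\<in>A. path_sum N (x a) \<omega>) = moment N A x"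
proof -
  let ?S = "SIGMA a:A. {..<fst (x a)}"
  let ?W = "\<lambda>G \<omega>. \<Prod>s\<in>?S. entry (G (fst s) (snd s), G (fst s) (Suc (snd s))) (snd (x (fst s))) \<omega>"
  have finS: "finite ?S" using fin by simp
  have eq: "(\<Prod>a\<in>A. path_sum N (x a) \<omega>) = (\<Sum>G\<in>walks A x N. of_real (walk_weight A x N G) * ?W G \<omega>)" for \<omega>
  proof -
    have "(\<Prod>a\<in>A. path_sum N (x a) \<omega>) = (\<Sum>G\<in>walks A x N. \<Prod>a\<in>A.
        of_real (path_weight (fst (x a)) N (G a)) * path_prod (fst (x a)) (snd (x a)) (G a) \<omega>)"
      unfolding path_sum_def walks_def by (rule prod_sum_PiE[OF fin]) (simp add: finite_paths)
    also have "\<dots> = (\<Sum>G\<in>walks A x N. of_real (walk_weight A x N G) * ?W G \<omega>)"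
    proof (rule sum.cong[OF refl])
      fix G
      have "?W G \<omega> = (\<Prod>a\<in>A. path_prod (fst (x a)) (snd (x a)) (G a) \<omega>)"
        unfolding path_prod_def using fin by (subst prod.Sigma) (auto simp: case_prod_beta)
      thus "(\<Prod>a\<in>A. of_real (path_weight (fst (x a)) N (G a)) * path_prod (fst (x a)) (snd (x a)) (G a) \<omega>)
          = of_real (walk_weight A x N G) * ?W G \<omega>"
        by (simp add: walk_weight_def prod.distrib)
    qed
    finally show ?thesis .
  qed
  have int: "integrable P (?W G)" for G
    using integrable_prod_entry[OF finS, of "\<lambda>s. (G (fst s) (snd s), G (fst s) (Suc (snd s)))" "\<lambda>s. snd (x (fst s))"] .
  show "integrable P (\<lambda>\<omega>. \<Prod>a\<in>A. path_sum N (x a) \<omega>)"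
    unfolding eq by (intro Bochner_Integration.integrable_sum integrable_mult_right int)
  show "expectation (\<lambda>\<omega>. \<Prod>a\<in>A. path_sum N (x a) \<omega>) = moment N A x"
    unfolding eq moment_def walk_exp_def using int
    by (subst Bochner_Integration.integral_sum) (auto intro!: integrable_mult_right)
qed

lemma walk_exp_eq_0:
  assumes fin: "finite A" and "\<not> edges_repeated A (\<lambda>a. fst (x a)) G"
  shows "walk_exp A x G = 0"
proof -
  let ?S = "SIGMA a:A. {..<fst (x a)}"
  let ?ed = "\<lambda>s. (G (fst s) (snd s), G (fst s) (Suc (snd s)))"
  obtain a j where aj: "a \<in> A" "j < fst (x a)"
    "\<And>a' j'. a' \<in> A \<Longrightarrow> j' < fst (x a') \<Longrightarrow> (a', j') \<noteq> (a, j) \<Longrightarrow> \<not> (G a' j' = G a j \<and> G a' (Suc j') = G a (Suc j))"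
    using assms(2) unfolding edges_repeated_def by blast
  show ?thesis
    unfolding walk_exp_def
  proof (rule expectation_prod_entry_eq_0[where ed = ?ed and fl = "\<lambda>s. snd (x (fst s))"])
    show "finite ?S" "(a, j) \<in> ?S" using fin aj by auto
    fix s assume "s \<in> ?S" "?ed s = ?ed (a, j)"
    thus "s = (a, j)" using aj(3)[of "fst s" "snd s"] by (cases s) auto
  qed
qed

text \<open>Each of the k + 1 visits to a vertex costs N^(-1/2), the delocalisation of u and v
  accounting for the two ends. This balances the number of walks exactly when every vertex is
  visited twice.\<close>

lemma abs_path_weight_le:
  assumes N: "N \<ge> 1" and g: "g \<in> paths k N"
  shows "\<bar>path_weight k N g\<bar> \<le> C\<^sup>2 / sqrt (real N) ^ (k + 1)"
proof -
  have "g 0 < N" "g k < N" using g by (auto simp: paths_def)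
  hence "\<bar>u N (g 0)\<bar> * \<bar>v N (g k)\<bar> \<le> (C / sqrt (real N)) * (C / sqrt (real N))"
    using N C_ge_0 by (intro mult_mono u_le v_le) auto
  also have "\<dots> = C\<^sup>2 / real N" using N by (simp add: power2_eq_square)
  finally have "sqrt (real N) * (\<bar>u N (g 0)\<bar> * \<bar>v N (g k)\<bar>) / sqrt (real N) ^ k
     \<le> sqrt (real N) * (C\<^sup>2 / real N) / sqrt (real N) ^ k"
    by (intro divide_right_mono mult_left_mono) auto
  also have "sqrt (real N) * (C\<^sup>2 / real N) = C\<^sup>2 / sqrt (real N)"
    using N by (simp add: field_simps)
  finally show ?thesis by (simp add: path_weight_def abs_mult mult_ac)
qed

lemma abs_walk_weight_le:
  assumes N: "N \<ge> 1" and G: "G \<in> walks A x N"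
  shows "\<bar>walk_weight A x N G\<bar> \<le> (C\<^sup>2) ^ card A / sqrt (real N) ^ (\<Sum>a\<in>A. fst (x a) + 1)"
proof -
  have "\<bar>walk_weight A x N G\<bar> = (\<Prod>a\<in>A. \<bar>path_weight (fst (x a)) N (G a)\<bar>)"
    by (simp add: walk_weight_def abs_prod)
  also have "\<dots> \<le> (\<Prod>a\<in>A. C\<^sup>2 / sqrt (real N) ^ (fst (x a) + 1))"
    using G by (intro prod_mono conjI abs_path_weight_le N) (auto simp: walks_def)
  also have "\<dots> = (C\<^sup>2) ^ card A / sqrt (real N) ^ (\<Sum>a\<in>A. fst (x a) + 1)"
    by (simp add: prod_dividef power_sum)
  finally show ?thesis .
qed

text \<open>A family of walks is one map on the disjoint union of the time sets, to which
  \<open>card_PiE_image_le\<close> applies.\<close>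

lemma card_walks_le:
  assumes fin: "finite A" and N: "N \<ge> 1"
  shows "card {G \<in> walks A x N. card (walk_vertices A (\<lambda>a. fst (x a)) G) \<le> m}
    \<le> m ^ (\<Sum>a\<in>A. fst (x a) + 1) * N ^ m"
proof -
  let ?I = "SIGMA a:A. {..fst (x a)}"
  let ?f = "\<lambda>G. restrict (\<lambda>(a, j). G a j) ?I"
  let ?W = "{G \<in> walks A x N. card (walk_vertices A (\<lambda>a. fst (x a)) G) \<le> m}"
  have finI: "finite ?I" using fin by simp
  have "inj_on ?f ?W"
  proof (rule inj_onI)
    fix G H assume G: "G \<in> ?W" and H: "H \<in> ?W" and eq: "?f G = ?f H"
    show "G = H"
    proof
      fix a show "G a = H a"
      proof (cases "a \<in> A")
        case True
        hence Ga: "G a \<in> {..fst (x a)} \<rightarrow>\<^sub>E {..<N}" "H a \<in> {..fst (x a)} \<rightarrow>\<^sub>E {..<N}"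
          using G H by (auto simp: walks_def paths_def)
        show ?thesis
        proof
          fix j show "G a j = H a j"
          proof (cases "j \<in> {..fst (x a)}")
            case j: True
            thus ?thesis using fun_cong[OF eq, of "(a, j)"] True by simp
          next
            case False
            thus ?thesis using PiE_arb[OF Ga(1) False] PiE_arb[OF Ga(2) False] by simp
          qed
        qed
      next
        case False
        have "G \<in> walks A x N" "H \<in> walks A x N" using G H by auto
        thus ?thesis unfolding walks_def using PiE_arb[OF _ False] by metis
      qed
    qed
  qed
  moreover have "?f ` ?W \<subseteq> {f \<in> ?I \<rightarrow>\<^sub>E {..<N}. card (f ` ?I) \<le> m}"
  proof (rule image_subsetI)
    fix G assume G: "G \<in> ?W"
    have "?f G ` ?I = walk_vertices A (\<lambda>a. fst (x a)) G"
      unfolding walk_vertices_def by (rule image_cong) auto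
    moreover have "?f G \<in> ?I \<rightarrow>\<^sub>E {..<N}"
    proof
      fix s assume "s \<in> ?I"
      thus "?f G s \<in> {..<N}" using G by (auto simp: walks_def paths_def PiE_def Pi_def)
    qed simp
    ultimately show "?f G \<in> {f \<in> ?I \<rightarrow>\<^sub>E {..<N}. card (f ` ?I) \<le> m}" using G by simp
  qed
  ultimately have "card ?W \<le> card {f \<in> ?I \<rightarrow>\<^sub>E {..<N}. card (f ` ?I) \<le> m}"
  proof (rule card_inj_on_le)
    show "finite {f \<in> ?I \<rightarrow>\<^sub>E {..<N}. card (f ` ?I) \<le> m}"
      by (rule finite_subset[of _ "?I \<rightarrow>\<^sub>E {..<N}"]) (use finI in \<open>auto intro: finite_PiE\<close>)
  qed
  also have "\<dots> \<le> m ^ card ?I * N ^ m" by (rule card_PiE_image_le[OF finI N])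
  finally show ?thesis using fin by simp
qed

text \<open>The three factors bound the weights, the expectations and the number of families, with
  all powers of N removed.\<close>

definition moment_const :: "nat set \<Rightarrow> (nat \<Rightarrow> nat \<times> bool) \<Rightarrow> real" where
  "moment_const A x = (C\<^sup>2) ^ card A * abs_moment_bound (\<Sum>a\<in>A. fst (x a)) ^ (\<Sum>a\<in>A. fst (x a))
     * real (\<Sum>a\<in>A. fst (x a) + 1) ^ (\<Sum>a\<in>A. fst (x a) + 1)"

lemma moment_const_ge_0: "moment_const A x \<ge> 0"
  unfolding moment_const_def using abs_moment_bound_ge_1 C_ge_0
  by (intro mult_nonneg_nonneg zero_le_power of_nat_0_le_iff) (auto intro: order_trans[OF zero_le_one])

text \<open>Power counting: if twice the number of vertices falls short of the number of visits by
  d, the choices of vertices leave a factor N^(-d/2) uncompensated.\<close>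

lemma sum_walks_le:
  assumes fin: "finite A" and N: "N \<ge> 1" and R: "R \<subseteq> walks A x N"
    and vert: "\<And>G. G \<in> R \<Longrightarrow> edges_repeated A (\<lambda>a. fst (x a)) G \<Longrightarrow>
      2 * card (walk_vertices A (\<lambda>a. fst (x a)) G) + d \<le> (\<Sum>a\<in>A. fst (x a) + 1)"
  shows "(\<Sum>G\<in>R. \<bar>walk_weight A x N G\<bar> * cmod (walk_exp A x G)) \<le> moment_const A x / sqrt (real N) ^ d"
proof -
  define L where "L = (\<Sum>a\<in>A. fst (x a) + 1)"
  define K where "K = (\<Sum>a\<in>A. fst (x a))"
  define m where "m = (L - d) div 2"
  define M where "M = abs_moment_bound K ^ K"
  let ?V = "\<lambda>G. walk_vertices A (\<lambda>a. fst (x a)) G"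
  define R' where "R' = {G \<in> R. edges_repeated A (\<lambda>a. fst (x a)) G}"
  have finR: "finite R" by (rule finite_subset[OF R finite_walks[OF fin]])
  have M0: "M \<ge> 0" unfolding M_def using abs_moment_bound_ge_1[of K] by simp
  have "(\<Sum>G\<in>R. \<bar>walk_weight A x N G\<bar> * cmod (walk_exp A x G))
      = (\<Sum>G\<in>R'. \<bar>walk_weight A x N G\<bar> * cmod (walk_exp A x G))"
    by (rule sum.mono_neutral_right) (use finR walk_exp_eq_0[OF fin] in \<open>auto simp: R'_def\<close>)
  also have "\<dots> \<le> (\<Sum>G\<in>R'. (C\<^sup>2) ^ card A / sqrt (real N) ^ L * M)"
  proof (intro sum_mono mult_mono)
    fix G assume "G \<in> R'"
    hence G: "G \<in> walks A x N" using R by (auto simp: R'_def)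
    show "\<bar>walk_weight A x N G\<bar> \<le> (C\<^sup>2) ^ card A / sqrt (real N) ^ L"
      unfolding L_def by (rule abs_walk_weight_le[OF N G])
    have "finite (SIGMA a:A. {..<fst (x a)})" "card (SIGMA a:A. {..<fst (x a)}) = K"
      using fin by (auto simp: K_def)
    thus "cmod (walk_exp A x G) \<le> M"
      unfolding walk_exp_def M_def
      using norm_expectation_prod_entry_le[of "SIGMA a:A. {..<fst (x a)}"
          "\<lambda>s. (G (fst s) (snd s), G (fst s) (Suc (snd s)))" "\<lambda>s. snd (x (fst s))"] by simp
  qed auto
  also have "\<dots> = real (card R') * ((C\<^sup>2) ^ card A / sqrt (real N) ^ L * M)" by simp
  also have "\<dots> \<le> (real L ^ L * (sqrt (real N) ^ L / sqrt (real N) ^ d)) * ((C\<^sup>2) ^ card A / sqrt (real N) ^ L * M)"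
  proof (cases "R' = {}")
    case False
    then obtain G0 where "G0 \<in> R'" by auto
    hence Ld: "d \<le> L" using vert[of G0] by (auto simp: R'_def L_def)
    have sub: "R' \<subseteq> {G \<in> walks A x N. card (?V G) \<le> m}"
    proof
      fix G assume "G \<in> R'"
      hence "G \<in> walks A x N" "2 * card (?V G) + d \<le> L" using R vert by (auto simp: R'_def L_def)
      thus "G \<in> {G \<in> walks A x N. card (?V G) \<le> m}" by (simp add: m_def)
    qed
    have "card R' \<le> card {G \<in> walks A x N. card (?V G) \<le> m}"
      using sub finite_walks[OF fin] by (intro card_mono) auto
    also have "\<dots> \<le> m ^ L * N ^ m" unfolding L_def by (rule card_walks_le[OF fin N])
    also have "\<dots> \<le> L ^ L * N ^ m" by (intro mult_right_mono power_mono) (auto simp: m_def)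
    finally have "real (card R') \<le> real (L ^ L * N ^ m)" by (rule of_nat_mono)
    also have "\<dots> = real L ^ L * sqrt (real N) ^ (2 * m)"
      by (simp add: power_mult)
    also have "\<dots> \<le> real L ^ L * sqrt (real N) ^ (L - d)"
      using N by (intro mult_left_mono power_increasing) (auto simp: m_def)
    also have "sqrt (real N) ^ (L - d) = sqrt (real N) ^ L / sqrt (real N) ^ d"
      using N Ld by (simp add: power_diff)
    finally show ?thesis using M0 by (intro mult_right_mono) auto
  qed (use M0 in auto)
  also have "\<dots> = moment_const A x / sqrt (real N) ^ d"
    unfolding moment_const_def L_def[symmetric] K_def[symmetric] M_def using N by (simp add: mult_ac)
  finally show ?thesis .
qed

definition pair_cov :: "bool \<Rightarrow> bool \<Rightarrow> complex" where
  "pair_cov b b' = (if b = b' then (if b then cnj pseudo_var else pseudo_var) else 1)"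

text \<open>The limiting covariance of two path sums. Only walks of equal length can coincide, and
  each of their common edges then contributes a second moment of an entry.\<close>

definition path_cov :: "nat \<times> bool \<Rightarrow> nat \<times> bool \<Rightarrow> complex" where
  "path_cov y z = (if fst y = fst z then pair_cov (snd y) (snd z) ^ fst y else 0)"

lemma norm_path_cov_le: "cmod (path_cov y z) \<le> 1"
  using norm_pseudo_var_le
  by (auto simp: path_cov_def pair_cov_def norm_power intro: power_le_one)

text \<open>The squared weight is a product over vertices: the end points sum to the squared norms
  of u and v, and each of the k - 1 inner vertices gives N, which cancels the prefactor N /
  N^k.\<close>

lemma sum_path_weight_sq:
  assumes N: "N \<ge> 1" and k: "k \<ge> 1"
  shows "(\<Sum>g\<in>paths k N. (path_weight k N g)\<^sup>2) = 1"
proof -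
  define h where "h j i = (if j = 0 then (u N i)\<^sup>2 else if j = k then (v N i)\<^sup>2 else 1)" for j i
  have "(\<Sum>g\<in>paths k N. (path_weight k N g)\<^sup>2) = (\<Sum>g\<in>paths k N. real N / real N ^ k * (\<Prod>j\<in>{..k}. h j (g j)))"
  proof (rule sum.cong[OF refl])
    fix g
    have "(\<Prod>j\<in>{..k}. h j (g j)) = (\<Prod>j\<in>{0, k}. h j (g j))"
      by (rule prod.mono_neutral_right) (auto simp: h_def)
    also have "\<dots> = (u N (g 0))\<^sup>2 * (v N (g k))\<^sup>2" using k by (auto simp: h_def)
    finally show "(path_weight k N g)\<^sup>2 = real N / real N ^ k * (\<Prod>j\<in>{..k}. h j (g j))"
      by (simp add: path_weight_def power_mult_distrib power_divide flip: power_mult)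
        (simp add: power_mult mult.commute[of k 2])
  qed
  also have "\<dots> = real N / real N ^ k * (\<Prod>j\<in>{..k}. \<Sum>i<N. h j i)"
    unfolding paths_def by (simp add: sum_distrib_left prod_sum_PiE)
  also have "(\<Prod>j\<in>{..k}. \<Sum>i<N. h j i) = (\<Prod>j\<in>{..k} - {0, k}. \<Sum>i<N. h j i) * (\<Prod>j\<in>{0, k}. \<Sum>i<N. h j i)"
    using k by (intro prod.subset_diff) auto
  also have "(\<Prod>j\<in>{0, k}. \<Sum>i<N. h j i) = 1" using k N u_unit v_unit by (auto simp: h_def)
  also have "(\<Prod>j\<in>{..k} - {0, k}. \<Sum>i<N. h j i) = (\<Prod>j\<in>{..k} - {0, k}. real N)"
    by (rule prod.cong) (auto simp: h_def)
  also have "\<dots> = real N ^ (k - 1)"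
  proof -
    have "card ({..k} - {0, k}) = k - 1" using k by (subst card_Diff_subset) auto
    thus ?thesis by simp
  qed
  finally show ?thesis using k N by (cases k) auto
qed

text \<open>The vertex at time j is a function of the others, so only k vertices are free.\<close>

lemma card_paths_fixed_le:
  assumes j: "j \<le> k"
  shows "card {g \<in> paths k N. g j = f (restrict g ({..k} - {j}))} \<le> N ^ k"
proof -
  let ?A = "{g \<in> paths k N. g j = f (restrict g ({..k} - {j}))}"
  have "inj_on (\<lambda>g. restrict g ({..k} - {j})) ?A"
  proof (rule inj_onI)
    fix g h assume gh: "g \<in> ?A" "h \<in> ?A" "restrict g ({..k} - {j}) = restrict h ({..k} - {j})"
    show "g = h"
    proof
      fix i
      consider "i = j" | "i \<in> {..k} - {j}" | "i \<notin> {..k}" using j by auto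
      thus "g i = h i"
      proof cases
        case 1 thus ?thesis using gh by simp
      next
        case 2 thus ?thesis using fun_cong[OF gh(3), of i] by simp
      next
        case 3
        have "g \<in> {..k} \<rightarrow>\<^sub>E {..<N}" "h \<in> {..k} \<rightarrow>\<^sub>E {..<N}" using gh by (auto simp: paths_def)
        thus ?thesis using PiE_arb[OF _ 3] by metis
      qed
    qed
  qed
  moreover have "(\<lambda>g. restrict g ({..k} - {j})) ` ?A \<subseteq> ({..k} - {j}) \<rightarrow>\<^sub>E {..<N}"
    by (auto simp: paths_def PiE_def Pi_def)
  ultimately have "card ?A \<le> card (({..k} - {j}) \<rightarrow>\<^sub>E {..<N})"
    by (intro card_inj_on_le[where f = "\<lambda>g. restrict g ({..k} - {j})"] finite_PiE) auto
  also have "\<dots> = N ^ k" using j by (simp add: card_PiE)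
  finally show ?thesis .
qed

definition good_paths :: "nat \<Rightarrow> nat \<Rightarrow> nat set \<Rightarrow> (nat \<Rightarrow> nat) set" where
  "good_paths k N V = {g \<in> paths k N. inj_on g {..k} \<and> g ` {..k} \<inter> V = {}}"

text \<open>A bad path has two equal vertices or a vertex in V, and either coincidence costs one
  free vertex.\<close>

lemma card_bad_paths_le:
  assumes V: "finite V"
  shows "card (paths k N - good_paths k N V) \<le> (Suc k * Suc k + Suc k * card V) * N ^ k"
proof -
  define F where "F i j = {g \<in> paths k N. g j = (restrict g ({..k} - {j})) i}" for i j
  define H where "H j x = {g \<in> paths k N. g j = x}" for j x
  have "paths k N - good_paths k N V \<subseteq> (\<Union>(i, j)\<in>{(i, j) \<in> {..k} \<times> {..k}. i \<noteq> j}. F i j) \<union> (\<Union>(j, x)\<in>{..k} \<times> V. H j x)"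
  proof
    fix g assume g: "g \<in> paths k N - good_paths k N V"
    hence "\<not> inj_on g {..k} \<or> g ` {..k} \<inter> V \<noteq> {}" by (auto simp: good_paths_def)
    thus "g \<in> (\<Union>(i, j)\<in>{(i, j) \<in> {..k} \<times> {..k}. i \<noteq> j}. F i j) \<union> (\<Union>(j, x)\<in>{..k} \<times> V. H j x)"
    proof
      assume "\<not> inj_on g {..k}"
      then obtain i j where ij: "i \<le> k" "j \<le> k" "i \<noteq> j" "g i = g j" by (auto simp: inj_on_def)
      hence "g \<in> F i j" using g by (auto simp: F_def)
      thus ?thesis using ij by (intro UnI1 UN_I[of "(i, j)"]) auto
    next
      assume "g ` {..k} \<inter> V \<noteq> {}"
      then obtain j where "j \<le> k" "g j \<in> V" by auto
      thus ?thesis using g by (intro UnI2 UN_I[of "(j, g j)"]) (auto simp: H_def)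
    qed
  qed
  moreover have fin: "finite {(i, j) \<in> {..k} \<times> {..k}. i \<noteq> j}"
    by (rule finite_subset[of _ "{..k} \<times> {..k}"]) auto
  ultimately have "card (paths k N - good_paths k N V) \<le>
      card (\<Union>(i, j)\<in>{(i, j) \<in> {..k} \<times> {..k}. i \<noteq> j}. F i j) + card (\<Union>(j, x)\<in>{..k} \<times> V. H j x)"
    using V finite_paths by (intro order_trans[OF card_mono card_Un_le]) (auto simp: F_def H_def)
  also have "card (\<Union>(i, j)\<in>{(i, j) \<in> {..k} \<times> {..k}. i \<noteq> j}. F i j) \<le> (\<Sum>z\<in>{(i, j) \<in> {..k} \<times> {..k}. i \<noteq> j}. N ^ k)"
  proof (rule order_trans[OF card_UN_le[OF fin]], rule sum_mono)
    fix z assume "z \<in> {(i, j) \<in> {..k} \<times> {..k}. i \<noteq> j}"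
    then obtain i j where z: "z = (i, j)" "i \<le> k" "j \<le> k" "i \<noteq> j" by auto
    show "card (case z of (i, j) \<Rightarrow> F i j) \<le> N ^ k"
      unfolding z prod.case F_def by (rule card_paths_fixed_le[OF z(3), where f = "\<lambda>g. g i"])
  qed
  also have "(\<Sum>z\<in>{(i, j) \<in> {..k} \<times> {..k}. i \<noteq> j}. N ^ k) \<le> (\<Sum>z\<in>{..k} \<times> {..k}. N ^ k)"
    by (rule sum_mono2) auto
  also have "card (\<Union>(j, x)\<in>{..k} \<times> V. H j x) \<le> (\<Sum>z\<in>{..k} \<times> V. N ^ k)"
  proof (rule order_trans[OF card_UN_le], use V in simp, rule sum_mono)
    fix z assume "z \<in> {..k} \<times> V"
    then obtain j x where z: "z = (j, x)" "j \<le> k" by auto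
    show "card (case z of (j, x) \<Rightarrow> H j x) \<le> N ^ k"
      unfolding z prod.case H_def by (rule card_paths_fixed_le[OF z(2), where f = "\<lambda>_. x"])
  qed
  finally show ?thesis by (simp add: ring_distribs card_cartesian_product)
qed

text \<open>The O(N^k) bad paths have squared weight O(N^(-k - 1)) each, so the good ones carry
  total weight 1 - O(1 / N).\<close>

lemma sum_good_path_weight:
  assumes N: "N \<ge> 1" and k: "k \<ge> 1" and V: "finite V" "card V \<le> l"
  shows "\<bar>(\<Sum>g\<in>good_paths k N V. (path_weight k N g)\<^sup>2) - 1\<bar> \<le> C ^ 4 * real (Suc k * Suc k + Suc k * l) / real N"
proof -
  have sub: "good_paths k N V \<subseteq> paths k N" by (auto simp: good_paths_def)
  have "(\<Sum>g\<in>good_paths k N V. (path_weight k N g)\<^sup>2) - 1 = - (\<Sum>g\<in>paths k N - good_paths k N V. (path_weight k N g)\<^sup>2)"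
    using sum.subset_diff[OF sub finite_paths, of "\<lambda>g. (path_weight k N g)\<^sup>2"] sum_path_weight_sq[OF N k] by simp
  hence "\<bar>(\<Sum>g\<in>good_paths k N V. (path_weight k N g)\<^sup>2) - 1\<bar> = (\<Sum>g\<in>paths k N - good_paths k N V. (path_weight k N g)\<^sup>2)"
    by (simp add: sum_nonneg)
  also have "\<dots> \<le> (\<Sum>g\<in>paths k N - good_paths k N V. C ^ 4 / real N ^ (k + 1))"
  proof (rule sum_mono)
    fix g assume "g \<in> paths k N - good_paths k N V"
    hence "\<bar>path_weight k N g\<bar>\<^sup>2 \<le> (C\<^sup>2 / sqrt (real N) ^ (k + 1))\<^sup>2"
      by (intro power_mono abs_path_weight_le N) auto
    also have "\<dots> = C ^ 4 / (sqrt (real N) ^ 2) ^ (k + 1)"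
      unfolding power_divide power_mult[symmetric] by (simp add: mult.commute)
    finally show "(path_weight k N g)\<^sup>2 \<le> C ^ 4 / real N ^ (k + 1)" by simp
  qed
  also have "\<dots> = real (card (paths k N - good_paths k N V)) * (C ^ 4 / real N ^ (k + 1))" by simp
  also have "\<dots> \<le> real ((Suc k * Suc k + Suc k * l) * N ^ k) * (C ^ 4 / real N ^ (k + 1))"
  proof (intro mult_right_mono of_nat_mono)
    have "card (paths k N - good_paths k N V) \<le> (Suc k * Suc k + Suc k * card V) * N ^ k"
      by (rule card_bad_paths_le[OF V(1)])
    also have "\<dots> \<le> (Suc k * Suc k + Suc k * l) * N ^ k"
      using V(2) by (intro mult_right_mono add_left_mono mult_left_mono) auto
    finally show "card (paths k N - good_paths k N V) \<le> (Suc k * Suc k + Suc k * l) * N ^ k" .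
  qed auto
  also have "\<dots> = C ^ 4 * real (Suc k * Suc k + Suc k * l) / real N"
    unfolding of_nat_mult[of _ "N ^ k"] using N by (simp add: divide_simps)
  finally show ?thesis .
qed

end

section \<open>Splitting off a pair of coinciding walks\<close>

context iid_rank_one
begin

definition paired_walks :: "nat set \<Rightarrow> (nat \<Rightarrow> nat \<times> bool) \<Rightarrow> nat \<Rightarrow> nat \<Rightarrow> nat \<Rightarrow> (nat \<Rightarrow> nat \<Rightarrow> nat) set" where
  "paired_walks A x N a0 b = {G \<in> walks A x N. fst (x b) = fst (x a0) \<and> G b = G a0 \<and>
     inj_on (G a0) {..fst (x a0)} \<and>
     (\<forall>a\<in>A - {a0, b}. \<forall>j\<le>fst (x a). G a j \<notin> G a0 ` {..fst (x a0)})}"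

text \<open>Along an injective path the k edges are distinct, and each is used once by a0 and once
  by b.\<close>

lemma pair_expectation:
  fixes a0 b :: nat and g :: "nat \<Rightarrow> nat" and x :: "nat \<Rightarrow> nat \<times> bool"
  assumes ab: "a0 \<noteq> b" and inj: "inj_on g {..k}"
  shows "expectation (\<lambda>\<omega>. \<Prod>s\<in>{a0, b} \<times> {..<k}. entry (g (snd s), g (Suc (snd s))) (snd (x (fst s))) \<omega>)
     = pair_cov (snd (x a0)) (snd (x b)) ^ k"
proof -
  let ?S = "{a0, b} \<times> {..<k}"
  let ?ed = "\<lambda>s :: nat \<times> nat. (g (snd s), g (Suc (snd s)))"
  let ?fl = "\<lambda>s :: nat \<times> nat. snd (x (fst s))"
  have finS: "finite ?S" by simp
  have inj': "inj_on (\<lambda>j. (g j, g (Suc j))) {..<k}"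
    using inj by (auto simp: inj_on_def)
  have im: "?ed ` ?S = (\<lambda>j. (g j, g (Suc j))) ` {..<k}" by (auto simp: image_iff)
  have "expectation (\<lambda>\<omega>. \<Prod>s\<in>?S. entry (?ed s) (?fl s) \<omega>) =
      (\<Prod>j<k. mixed_moment (card {s \<in> ?S. ?ed s = (g j, g (Suc j)) \<and> \<not> ?fl s})
        (card {s \<in> ?S. ?ed s = (g j, g (Suc j)) \<and> ?fl s}))"
    unfolding expectation_prod_entry[OF finS] im by (subst prod.reindex[OF inj']) simp
  also have "\<dots> = (\<Prod>j<k. pair_cov (snd (x a0)) (snd (x b)))"
  proof (rule prod.cong[OF refl])
    fix j assume j: "j \<in> {..<k}"
    have iff: "s \<in> ?S \<and> ?ed s = (g j, g (Suc j)) \<longleftrightarrow> s = (a0, j) \<or> s = (b, j)" for s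
      using j inj_onD[OF inj, of "snd s" j] by (cases s) auto
    have *: "{s \<in> ?S. ?ed s = (g j, g (Suc j)) \<and> Q s} = {s. (s = (a0, j) \<or> s = (b, j)) \<and> Q s}" for Q
      unfolding iff[symmetric] conj_assoc by (rule refl)
    have 1: "{s. (s = (a0, j) \<or> s = (b, j)) \<and> \<not> ?fl s} =
      (if snd (x a0) then if snd (x b) then {} else {(b, j)} else if snd (x b) then {(a0, j)} else {(a0, j), (b, j)})"
      and 2: "{s. (s = (a0, j) \<or> s = (b, j)) \<and> ?fl s} =
      (if snd (x a0) then if snd (x b) then {(a0, j), (b, j)} else {(a0, j)} else if snd (x b) then {(b, j)} else {})"
      by (cases "snd (x a0)"; cases "snd (x b)"; auto)+
    show "mixed_moment (card {s \<in> ?S. ?ed s = (g j, g (Suc j)) \<and> \<not> ?fl s})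
        (card {s \<in> ?S. ?ed s = (g j, g (Suc j)) \<and> ?fl s}) = pair_cov (snd (x a0)) (snd (x b))"
      unfolding * 1 2 using ab mixed_moment_2_0 mixed_moment_0_2
      by (auto simp: pair_cov_def numeral_2_eq_2)
  qed
  finally show ?thesis by simp
qed

text \<open>The common path of a0 and b shares no vertex, hence no edge, with the other walks, so
  the expectation factors.\<close>

lemma walk_exp_paired:
  assumes fin: "finite A" and a0: "a0 \<in> A" and b: "b \<in> A" "b \<noteq> a0"
    and G: "G \<in> paired_walks A x N a0 b"
  shows "walk_exp A x G = path_cov (x a0) (x b) * walk_exp (A - {a0, b}) x G"
proof -
  let ?ed = "\<lambda>s. (G (fst s) (snd s), G (fst s) (Suc (snd s)))"
  let ?fl = "\<lambda>s :: nat \<times> nat. snd (x (fst s))"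
  let ?k = "fst (x a0)"
  define S where "S = {a0, b} \<times> {..<?k}"
  define T where "T = (SIGMA a:A - {a0, b}. {..<fst (x a)})"
  have Gb: "G b = G a0" and kb: "fst (x b) = ?k" and inj: "inj_on (G a0) {..?k}"
    and disj: "\<And>a j. a \<in> A - {a0, b} \<Longrightarrow> j \<le> fst (x a) \<Longrightarrow> G a j \<notin> G a0 ` {..?k}"
    using G by (auto simp: paired_walks_def)
  have ST: "(SIGMA a:A. {..<fst (x a)}) = S \<union> T" using a0 b kb by (auto simp: S_def T_def)
  have edS: "?ed s = (G a0 (snd s), G a0 (Suc (snd s)))" if "s \<in> S" for s
    using that Gb by (auto simp: S_def)
  have "walk_exp A x G = expectation (\<lambda>\<omega>. \<Prod>s\<in>S. entry (?ed s) (?fl s) \<omega>) *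
      expectation (\<lambda>\<omega>. \<Prod>s\<in>T. entry (?ed s) (?fl s) \<omega>)"
    unfolding walk_exp_def ST
  proof (rule expectation_prod_entry_Un)
    show "finite S" "finite T" "S \<inter> T = {}" using fin by (auto simp: S_def T_def)
    show "?ed ` S \<inter> ?ed ` T = {}"
    proof (rule ccontr)
      assume "?ed ` S \<inter> ?ed ` T \<noteq> {}"
      then obtain s t where st: "s \<in> S" "t \<in> T" "?ed s = ?ed t" by auto
      have "G (fst t) (snd t) \<notin> G a0 ` {..?k}" by (rule disj) (use st in \<open>auto simp: T_def\<close>)
      moreover have "snd s \<le> ?k" using st by (auto simp: S_def)
      hence "G a0 (snd s) \<in> G a0 ` {..?k}" by simp
      moreover have "G (fst t) (snd t) = G a0 (snd s)" using st(3) edS[OF st(1)] by simp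
      ultimately show False by simp
    qed
  qed
  also have "expectation (\<lambda>\<omega>. \<Prod>s\<in>S. entry (?ed s) (?fl s) \<omega>) =
      expectation (\<lambda>\<omega>. \<Prod>s\<in>S. entry (G a0 (snd s), G a0 (Suc (snd s))) (?fl s) \<omega>)"
    by (simp add: edS)
  also have "\<dots> = path_cov (x a0) (x b)"
    unfolding S_def using pair_expectation[OF b(2)[symmetric] inj, of x] kb by (simp add: path_cov_def)
  finally show ?thesis by (simp add: walk_exp_def T_def)
qed

lemma walk_exp_cong:
  assumes "\<And>a j. a \<in> A \<Longrightarrow> j \<le> fst (x a) \<Longrightarrow> G a j = H a j"
  shows "walk_exp A x G = walk_exp A x H"
proof -
  have *: "entry (G (fst s) (snd s), G (fst s) (Suc (snd s))) c = entry (H (fst s) (snd s), H (fst s) (Suc (snd s))) c"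
    if s: "s \<in> (SIGMA a:A. {..<fst (x a)})" for s c
  proof -
    have "fst s \<in> A" "snd s \<le> fst (x (fst s))" "Suc (snd s) \<le> fst (x (fst s))" using s by auto
    thus ?thesis by (simp only: assms)
  qed
  show ?thesis unfolding walk_exp_def by (simp only: * cong: prod.cong)
qed

text \<open>Given the other walks, the common path of a0 and b ranges over the paths that are good
  with respect to their vertices. Its weight enters squared, once for each of the two walks.\<close>

lemma sum_paired_walks:
  assumes fin: "finite A" and a0: "a0 \<in> A" and b: "b \<in> A" "b \<noteq> a0"
  shows "(\<Sum>G\<in>paired_walks A x N a0 b. of_real (walk_weight A x N G) * walk_exp A x G) =
    path_cov (x a0) (x b) * (\<Sum>G\<in>walks (A - {a0, b}) x N. of_real (walk_weight (A - {a0, b}) x N G) *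
       walk_exp (A - {a0, b}) x G * of_real (\<Sum>g\<in>good_paths (fst (x a0)) N
         (walk_vertices (A - {a0, b}) (\<lambda>a. fst (x a)) G). (path_weight (fst (x a0)) N g)\<^sup>2))"
proof (cases "fst (x b) = fst (x a0)")
  case False
  hence "paired_walks A x N a0 b = {}" by (auto simp: paired_walks_def)
  thus ?thesis using False by (simp add: path_cov_def)
next
  case kb: True
  define A' where "A' = A - {a0, b}"
  define k where "k = fst (x a0)"
  let ?V = "walk_vertices A' (\<lambda>a. fst (x a))"
  have A: "A = insert a0 (insert b A')" "a0 \<notin> insert b A'" "b \<notin> A'" "finite A'"
    using a0 b fin by (auto simp: A'_def)
  have V_iff: "g ` {..k} \<inter> ?V G = {} \<longleftrightarrow> (\<forall>a\<in>A'. \<forall>j\<le>fst (x a). G a j \<notin> g ` {..k})" for g G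
  proof -
    have "g ` {..k} \<inter> ?V G = {} \<longleftrightarrow> (\<forall>y\<in>?V G. y \<notin> g ` {..k})" by blast
    moreover have "(\<forall>y\<in>?V G. Q y) \<longleftrightarrow> (\<forall>a\<in>A'. \<forall>j\<le>fst (x a). Q (G a j))" for Q
      by (auto simp: walk_vertices_def)
    ultimately show ?thesis by (simp only:)
  qed
  have "(\<Sum>G\<in>walks A' x N. of_real (walk_weight A' x N G) * walk_exp A' x G *
        complex_of_real (\<Sum>g\<in>good_paths k N (?V G). (path_weight k N g)\<^sup>2)) =
      (\<Sum>(G, g)\<in>(SIGMA G:walks A' x N. good_paths k N (?V G)).
        of_real (walk_weight A' x N G) * walk_exp A' x G * of_real ((path_weight k N g)\<^sup>2))"
    using A(4) finite_paths by (subst sum.Sigma[symmetric])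
      (auto simp: finite_walks good_paths_def sum_distrib_left)
  hence 1: "path_cov (x a0) (x b) * (\<Sum>G\<in>walks A' x N. of_real (walk_weight A' x N G) * walk_exp A' x G *
        complex_of_real (\<Sum>g\<in>good_paths k N (?V G). (path_weight k N g)\<^sup>2)) =
      (\<Sum>(G, g)\<in>(SIGMA G:walks A' x N. good_paths k N (?V G)). path_cov (x a0) (x b) *
        (of_real (walk_weight A' x N G) * walk_exp A' x G * of_real ((path_weight k N g)\<^sup>2)))"
    by (simp add: sum_distrib_left case_prod_unfold)
  have 2: "(\<Sum>(G, g)\<in>(SIGMA G:walks A' x N. good_paths k N (?V G)). path_cov (x a0) (x b) *
        (of_real (walk_weight A' x N G) * walk_exp A' x G * of_real ((path_weight k N g)\<^sup>2)))
      = (\<Sum>G\<in>paired_walks A x N a0 b. of_real (walk_weight A x N G) * walk_exp A x G)"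
  proof -
    define fi where "fi G = (restrict G A', G a0)" for G :: "nat \<Rightarrow> nat \<Rightarrow> nat"
    define fj where "fj z = ((fst z)(a0 := snd z, b := snd z))" for z :: "(nat \<Rightarrow> nat \<Rightarrow> nat) \<times> (nat \<Rightarrow> nat)"
    show ?thesis
    proof (rule sum.reindex_bij_witness[where i = fi and j = fj])
      fix z assume z: "z \<in> (SIGMA G:walks A' x N. good_paths k N (?V G))"
      obtain G g where Gg: "z = (G, g)" by force
      have G: "G \<in> walks A' x N" and g: "g \<in> good_paths k N (?V G)" using z Gg by auto
      define H where "H = G(a0 := g, b := g)"
      have Hz: "fj z = H" by (simp add: fj_def Gg H_def)
      have HA: "H a = G a" if "a \<in> A'" for a using that A by (auto simp: H_def)
      have Ha: "H a0 = g" "H b = g" using b by (auto simp: H_def)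
      have gp: "g \<in> paths k N" "inj_on g {..k}" "g ` {..k} \<inter> ?V G = {}" using g by (auto simp: good_paths_def)
      have Hw: "H \<in> walks A x N"
        unfolding walks_def
      proof
        fix a assume "a \<in> A"
        then consider "a = a0" | "a = b" | "a \<in> A'" using A by auto
        thus "H a \<in> paths (fst (x a)) N"
          using Ha HA gp(1) kb G by cases (auto simp: k_def walks_def)
      next
        fix a assume "a \<notin> A"
        hence "a \<noteq> a0" "a \<noteq> b" "a \<notin> A'" using A a0 b by auto
        thus "H a = undefined" using G PiE_arb[of G A' _ a] by (simp add: H_def walks_def)
      qed
      show Hp: "fj z \<in> paired_walks A x N a0 b"
        unfolding Hz paired_walks_def using Hw Ha HA kb gp V_iff[of g G] by (auto simp: A'_def[symmetric] k_def[symmetric])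
      have "restrict H A' = G"
      proof
        fix a show "restrict H A' a = G a"
          using HA G PiE_arb[of G A' _ a] by (cases "a \<in> A'") (auto simp: walks_def)
      qed
      thus "fi (fj z) = z" unfolding Hz by (simp add: fi_def Ha Gg)
      have "walk_weight A x N H = path_weight k N g * (path_weight k N g * walk_weight A' x N H)"
        unfolding walk_weight_def A(1) using A(2-4) Ha kb by (simp add: k_def)
      also have "walk_weight A' x N H = walk_weight A' x N G"
        unfolding walk_weight_def by (intro prod.cong) (auto simp: HA)
      finally have 1: "walk_weight A x N H = (path_weight k N g)\<^sup>2 * walk_weight A' x N G"
        by (simp add: power2_eq_square)
      have "walk_exp A x H = path_cov (x a0) (x b) * walk_exp A' x H"
        unfolding A'_def by (rule walk_exp_paired[OF fin a0 b Hp[unfolded Hz]])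
      also have "walk_exp A' x H = walk_exp A' x G" by (rule walk_exp_cong) (simp add: HA)
      finally show "of_real (walk_weight A x N (fj z)) * walk_exp A x (fj z) = (case z of (G, g) \<Rightarrow> path_cov (x a0) (x b) *
        (of_real (walk_weight A' x N G) * walk_exp A' x G * of_real ((path_weight k N g)\<^sup>2)))"
        unfolding Hz 1 by (simp add: Gg mult_ac)
    next
      fix G assume G: "G \<in> paired_walks A x N a0 b"
      hence Gw: "G \<in> walks A x N" and Gb: "G b = G a0" by (simp_all add: paired_walks_def)
      have GaA: "\<And>a. a \<in> A \<Longrightarrow> G a \<in> paths (fst (x a)) N" using Gw by (auto simp: walks_def)
      have "restrict G A' \<in> walks A' x N"
        unfolding walks_def using GaA A by auto
      moreover have "?V (restrict G A') = ?V G"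
        unfolding walk_vertices_def by (rule image_cong) auto
      moreover have "\<forall>a\<in>A'. \<forall>j\<le>fst (x a). G a j \<notin> G a0 ` {..k}"
        using G by (auto simp: paired_walks_def A'_def k_def)
      hence "G a0 \<in> good_paths k N (?V G)"
        using G GaA[OF a0] V_iff[of "G a0" G] by (simp add: good_paths_def paired_walks_def k_def)
      ultimately show "fi G \<in> (SIGMA G:walks A' x N. good_paths k N (?V G))" by (simp add: fi_def)
      show "fj (fi G) = G"
      proof
        fix a
        consider "a = a0" | "a = b" "a \<noteq> a0" | "a \<in> A'" "a \<noteq> a0" "a \<noteq> b" | "a \<notin> A" "a \<noteq> a0" "a \<noteq> b" "a \<notin> A'" using A by auto
        thus "fj (fi G) a = G a"
        proof cases
          case 4
          thus ?thesis using Gw PiE_arb[of G A _ a] by (simp add: fj_def fi_def walks_def)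
        qed (use Gb b in \<open>simp_all add: fj_def fi_def\<close>)
      qed
    qed
  qed
  show ?thesis by (rule trans[OF 1 2, symmetric, unfolded A'_def k_def])
qed

text \<open>Wick's formula, in the form of a recursion on the number of factors: up to \<open>O(1 / \<surd>N)\<close> the
  walk \<open>a0\<close> is traversed by exactly one other walk \<open>b\<close>, and the two are disjoint from the rest.\<close>

lemma moment_recursion:
  assumes fin: "finite A" and a0: "a0 \<in> A" and pos: "\<And>a. a \<in> A \<Longrightarrow> fst (x a) \<ge> 1"
  shows "\<exists>D. \<forall>N\<ge>1. cmod (moment N A x - (\<Sum>b\<in>A - {a0}. path_cov (x a0) (x b) * moment N (A - {a0, b}) x))
     \<le> D / sqrt (real N)"
proof -
  let ?k = "\<lambda>a. fst (x a)"
  let ?f = "\<lambda>N G. of_real (walk_weight A x N G) * walk_exp A x G"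
  define l where "l = (\<Sum>a\<in>A. ?k a + 1)"
  define E where "E = C ^ 4 * real (Suc (?k a0) * Suc (?k a0) + Suc (?k a0) * l)"
  define D where "D = moment_const A x + (\<Sum>b\<in>A - {a0}. moment_const (A - {a0, b}) x * E)"
  have E0: "E \<ge> 0" using C_ge_0 by (simp add: E_def)
  have "cmod (moment N A x - (\<Sum>b\<in>A - {a0}. path_cov (x a0) (x b) * moment N (A - {a0, b}) x)) \<le> D / sqrt (real N)"
    if N: "N \<ge> 1" for N
  proof -
    define R where "R = walks A x N - (\<Union>b\<in>A - {a0}. paired_walks A x N a0 b)"
    have finW: "finite (walks A x N)" by (rule finite_walks[OF fin])
    have sub: "paired_walks A x N a0 b \<subseteq> walks A x N" for b by (auto simp: paired_walks_def)
    have disj: "paired_walks A x N a0 b \<inter> paired_walks A x N a0 b' = {}" if "b \<in> A - {a0}" "b' \<in> A - {a0}" "b \<noteq> b'" for b b'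
    proof -
      have False if "G \<in> paired_walks A x N a0 b" "G \<in> paired_walks A x N a0 b'" for G
      proof -
        have "\<forall>a\<in>A - {a0, b}. \<forall>j\<le>?k a. G a j \<notin> G a0 ` {..?k a0}"
          using that(1) by (simp add: paired_walks_def)
        moreover have "b' \<in> A - {a0, b}" using \<open>b' \<in> A - {a0}\<close> \<open>b \<noteq> b'\<close> by auto
        ultimately have "G b' 0 \<notin> G a0 ` {..?k a0}" by blast
        moreover have "G b' = G a0" using that by (simp add: paired_walks_def)
        ultimately show False by auto
      qed
      thus ?thesis by blast
    qed
    have "moment N A x = (\<Sum>G\<in>R. ?f N G) + (\<Sum>G\<in>(\<Union>b\<in>A - {a0}. paired_walks A x N a0 b). ?f N G)"
      unfolding moment_def R_def using sub by (intro sum.subset_diff finW) auto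
    also have "(\<Sum>G\<in>(\<Union>b\<in>A - {a0}. paired_walks A x N a0 b). ?f N G) =
        (\<Sum>b\<in>A - {a0}. \<Sum>G\<in>paired_walks A x N a0 b. ?f N G)"
      using fin disj finite_subset[OF sub finW] by (intro sum.UNION_disjoint) auto
    finally have eq: "moment N A x - (\<Sum>b\<in>A - {a0}. path_cov (x a0) (x b) * moment N (A - {a0, b}) x) =
      (\<Sum>G\<in>R. ?f N G) + (\<Sum>b\<in>A - {a0}. (\<Sum>G\<in>paired_walks A x N a0 b. ?f N G) - path_cov (x a0) (x b) * moment N (A - {a0, b}) x)"
      by (simp add: sum_subtractf)
    have "cmod (\<Sum>G\<in>R. ?f N G) \<le> (\<Sum>G\<in>R. \<bar>walk_weight A x N G\<bar> * cmod (walk_exp A x G))"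
      by (rule sum_norm_le) (simp add: norm_mult)
    also have "\<dots> \<le> moment_const A x / sqrt (real N) ^ 1"
    proof (rule sum_walks_le[OF fin N])
      show "R \<subseteq> walks A x N" by (auto simp: R_def)
      fix G assume G: "G \<in> R" and rep: "edges_repeated A ?k G"
      have le: "2 * card (walk_vertices A ?k G) \<le> (\<Sum>a\<in>A. ?k a + 1)"
        by (rule card_walk_vertices_le[OF fin rep pos])
      \<comment> \<open>Equality would pair a0 with some b and exclude \<open>G\<close> from R. So
        the vertex count falls short by at least one, which is worth a factor N^(-1/2).\<close>
      have "2 * card (walk_vertices A ?k G) \<noteq> (\<Sum>a\<in>A. ?k a + 1)"
      proof
        assume "2 * card (walk_vertices A ?k G) = (\<Sum>a\<in>A. ?k a + 1)"
        hence ge: "(\<Sum>a\<in>A. ?k a + 1) \<le> 2 * card (walk_vertices A ?k G)" by simp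
        obtain b where b: "b \<in> A" "b \<noteq> a0" "?k b = ?k a0" "\<And>j. j \<le> ?k a0 \<Longrightarrow> G b j = G a0 j"
          "inj_on (G a0) {..?k a0}" "\<And>a j. a \<in> A \<Longrightarrow> a \<noteq> a0 \<Longrightarrow> a \<noteq> b \<Longrightarrow> j \<le> ?k a \<Longrightarrow> G a j \<notin> G a0 ` {..?k a0}"
          using extremal_walks_paired[OF fin rep pos ge a0] by blast
        have Gw: "G \<in> walks A x N" using G by (simp add: R_def)
        have "G a0 \<in> paths (?k a0) N" "G b \<in> paths (?k b) N"
          using Gw a0 b(1) unfolding walks_def by (blast intro: PiE_mem)+
        hence p: "G a0 \<in> {..?k a0} \<rightarrow>\<^sub>E {..<N}" "G b \<in> {..?k a0} \<rightarrow>\<^sub>E {..<N}"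
          by (simp_all only: b(3) paths_def)
        have "G b = G a0"
        proof
          fix j show "G b j = G a0 j"
            using b(4)[of j] PiE_arb[OF p(1), of j] PiE_arb[OF p(2), of j] by (cases "j \<le> ?k a0") auto
        qed
        hence "G \<in> paired_walks A x N a0 b" using Gw b by (auto simp: paired_walks_def)
        thus False using G b by (auto simp: R_def)
      qed
      thus "2 * card (walk_vertices A ?k G) + 1 \<le> (\<Sum>a\<in>A. ?k a + 1)" using le by linarith
    qed
    finally have R: "cmod (\<Sum>G\<in>R. ?f N G) \<le> moment_const A x / sqrt (real N)" by simp
    have B: "cmod ((\<Sum>G\<in>paired_walks A x N a0 b. ?f N G) - path_cov (x a0) (x b) * moment N (A - {a0, b}) x)
        \<le> moment_const (A - {a0, b}) x * E / sqrt (real N)" if b: "b \<in> A - {a0}" for b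
    proof -
      define A' where "A' = A - {a0, b}"
      let ?g = "\<lambda>G. \<Sum>g\<in>good_paths (?k a0) N (walk_vertices A' ?k G). (path_weight (?k a0) N g)\<^sup>2"
      have finA': "finite A'" using fin by (simp add: A'_def)
      have "(\<Sum>G\<in>paired_walks A x N a0 b. ?f N G) = path_cov (x a0) (x b) *
          (\<Sum>G\<in>walks A' x N. of_real (walk_weight A' x N G) * walk_exp A' x G * of_real (?g G))"
        unfolding A'_def using b by (intro sum_paired_walks[OF fin a0]) auto
      \<comment> \<open>The good paths have total squared weight 1 up to O(1 / N), uniformly in
        \<open>G\<close>; replacing it by 1 leaves the moment of the remaining walks.\<close>
      hence dif: "(\<Sum>G\<in>paired_walks A x N a0 b. ?f N G) - path_cov (x a0) (x b) * moment N A' x =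
          path_cov (x a0) (x b) * (\<Sum>G\<in>walks A' x N. of_real (walk_weight A' x N G) * walk_exp A' x G * of_real (?g G - 1))"
        by (simp add: moment_def right_diff_distrib sum_subtractf)
      have "cmod ((\<Sum>G\<in>paired_walks A x N a0 b. ?f N G) - path_cov (x a0) (x b) * moment N A' x)
          \<le> 1 * (\<Sum>G\<in>walks A' x N. \<bar>walk_weight A' x N G\<bar> * cmod (walk_exp A' x G) * (E / real N))"
        unfolding dif norm_mult[of "path_cov (x a0) (x b)"]
      proof (intro mult_mono norm_path_cov_le sum_norm_le)
        fix G assume "G \<in> walks A' x N"
        have "card (walk_vertices A' ?k G) \<le> card (SIGMA a:A'. {..?k a})"
          unfolding walk_vertices_def using finA' by (intro card_image_le) auto
        also have "\<dots> = (\<Sum>a\<in>A'. ?k a + 1)" using finA' by simp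
        also have "\<dots> \<le> l" unfolding l_def A'_def using fin by (intro sum_mono2) auto
        finally have "\<bar>?g G - 1\<bar> \<le> E / real N"
          unfolding E_def by (intro sum_good_path_weight[OF N pos[OF a0] finite_walk_vertices[OF finA']])
        thus "cmod (of_real (walk_weight A' x N G) * walk_exp A' x G * of_real (?g G - 1))
           \<le> \<bar>walk_weight A' x N G\<bar> * cmod (walk_exp A' x G) * (E / real N)"
          unfolding norm_mult norm_of_real by (intro mult_left_mono) auto
      qed (simp_all del: norm_mult)
      also have "\<dots> = (\<Sum>G\<in>walks A' x N. \<bar>walk_weight A' x N G\<bar> * cmod (walk_exp A' x G)) * (E / real N)"
        by (simp only: mult_1_left sum_distrib_right)
      also have "\<dots> \<le> moment_const A' x / sqrt (real N) ^ 0 * (E / real N)"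
      proof (intro mult_right_mono sum_walks_le[OF finA' N subset_refl])
        fix G assume rep: "edges_repeated A' ?k G"
        have "2 * card (walk_vertices A' ?k G) \<le> (\<Sum>a\<in>A'. ?k a + 1)"
          by (rule card_walk_vertices_le[OF finA' rep pos]) (auto simp: A'_def)
        thus "2 * card (walk_vertices A' ?k G) + 0 \<le> (\<Sum>a\<in>A'. ?k a + 1)" by simp
      qed (use E0 in auto)
      also have "\<dots> = moment_const A' x * E / real N" by simp
      also have "\<dots> \<le> moment_const A' x * E / sqrt (real N)"
      proof (rule divide_left_mono)
        have "sqrt (real N) * 1 \<le> sqrt (real N) * sqrt (real N)" using N by (intro mult_left_mono) auto
        thus "sqrt (real N) \<le> real N" by simp
      qed (use N E0 moment_const_ge_0 in auto)
      finally show ?thesis by (simp add: A'_def)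
    qed
    have "cmod (moment N A x - (\<Sum>b\<in>A - {a0}. path_cov (x a0) (x b) * moment N (A - {a0, b}) x)) \<le>
       moment_const A x / sqrt (real N) + (\<Sum>b\<in>A - {a0}. moment_const (A - {a0, b}) x * E / sqrt (real N))"
      unfolding eq by (intro norm_triangle_mono R sum_norm_le B)
    also have "\<dots> = D / sqrt (real N)" by (simp add: D_def add_divide_distrib sum_divide_distrib)
    finally show ?thesis .
  qed
  thus ?thesis by blast
qed

end

lemma sum_PiE_insert:
  assumes "a \<notin> A"
  shows "sum f (insert a A \<rightarrow>\<^sub>E J) = (\<Sum>y\<in>J. \<Sum>x\<in>A \<rightarrow>\<^sub>E J. f (x(a := y)))"
proof -
  have "sum f (insert a A \<rightarrow>\<^sub>E J) = sum f ((\<lambda>(y, g). g(a := y)) ` (J \<times> (A \<rightarrow>\<^sub>E J)))"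
    by (simp only: PiE_insert_eq)
  also have "\<dots> = (\<Sum>z\<in>J \<times> (A \<rightarrow>\<^sub>E J). f ((snd z)(a := fst z)))"
    by (subst sum.reindex) (use assms inj_combinator[of a A "\<lambda>_. J"] in \<open>auto simp: case_prod_unfold\<close>)
  also have "\<dots> = (\<Sum>y\<in>J. \<Sum>x\<in>A \<rightarrow>\<^sub>E J. f (x(a := y)))"
    by (simp add: sum.cartesian_product case_prod_unfold)
  finally show ?thesis .
qed

section \<open>Moments of real linear combinations\<close>

context iid_rank_one
begin

lemma path_sum_measurable [measurable]: "path_sum N y \<in> borel_measurable P"
  unfolding path_sum_def[abs_def] path_prod_def by measurable

lemma path_sum_cnj: "path_sum N (k, True) \<omega> = cnj (path_sum N (k, False) \<omega>)"
  by (simp add: path_sum_def path_prod_def entry_def)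

lemma moment_cong:
  assumes "\<And>a. a \<in> A \<Longrightarrow> x a = x' a"
  shows "moment N A x = moment N A x'"
proof -
  have "walks A x N = walks A x' N" unfolding walks_def by (rule PiE_cong) (simp add: assms)
  moreover have "walk_weight A x N G = walk_weight A x' N G" for G
    unfolding walk_weight_def by (rule prod.cong) (simp_all add: assms)
  moreover have "walk_exp A x G = walk_exp A x' G" for G
  proof -
    have "(SIGMA a:A. {..<fst (x a)}) = (SIGMA a:A. {..<fst (x' a)})"
      by (rule Sigma_cong) (simp_all add: assms)
    moreover have "x (fst s) = x' (fst s)" if "s \<in> (SIGMA a:A. {..<fst (x' a)})" for s
      using that by (intro assms) auto
    ultimately show ?thesis unfolding walk_exp_def by (simp cong: prod.cong)
  qed
  ultimately show ?thesis by (simp add: moment_def)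
qed

definition lin_comb :: "(nat \<Rightarrow> complex) \<Rightarrow> nat \<Rightarrow> nat \<Rightarrow> 'a \<Rightarrow> real" where
  "lin_comb s n N \<omega> = Re (\<Sum>k<n. s k * path_sum N (Suc k, False) \<omega>)"

definition lin_idx :: "nat \<Rightarrow> (nat \<times> bool) set" where
  "lin_idx n = {..<n} \<times> UNIV"

text \<open>A real part is half the sum with the conjugate, hence the factor 1/2 and the conjugation
  flag in the index.\<close>

definition lin_coeff :: "(nat \<Rightarrow> complex) \<Rightarrow> nat \<times> bool \<Rightarrow> complex" where
  "lin_coeff s y = (if snd y then cnj (s (fst y)) / 2 else s (fst y) / 2)"

text \<open>Coordinate k belongs to walks of length k + 1, because the path sum of length 0 is not
  random.\<close>

definition shift_idx :: "nat \<times> bool \<Rightarrow> nat \<times> bool" where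
  "shift_idx y = (Suc (fst y), snd y)"

definition lin_moment :: "(nat \<Rightarrow> complex) \<Rightarrow> nat \<Rightarrow> nat \<Rightarrow> nat set \<Rightarrow> complex" where
  "lin_moment s n N A = (\<Sum>x\<in>A \<rightarrow>\<^sub>E lin_idx n. (\<Prod>a\<in>A. lin_coeff s (x a)) * moment N A (\<lambda>a. shift_idx (x a)))"

text \<open>The variance of the real part of the sum of s_k \<gamma>_k for independent centered
  Gaussians with E |\<gamma>_k|^2 = 1 and E \<gamma>_k^2 =
  \<open>pseudo_var ^ Suc k\<close>.\<close>

definition lin_variance :: "(nat \<Rightarrow> complex) \<Rightarrow> nat \<Rightarrow> real" where
  "lin_variance s n = (\<Sum>k<n. ((cmod (s k))\<^sup>2 + Re ((s k)\<^sup>2 * pseudo_var ^ Suc k)) / 2)"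

lemma finite_lin_idx: "finite (lin_idx n)" by (simp add: lin_idx_def)

lemma sum_lin_idx: "(\<Sum>y\<in>lin_idx n. f y) = (\<Sum>k<n. f (k, False) + f (k, True))"
  for f :: "nat \<times> bool \<Rightarrow> 'c::comm_monoid_add"
  unfolding lin_idx_def sum.cartesian_product' UNIV_bool by simp

lemma lin_comb_eq:
  "complex_of_real (lin_comb s n N \<omega>) = (\<Sum>y\<in>lin_idx n. lin_coeff s y * path_sum N (shift_idx y) \<omega>)"
proof -
  have half: "complex_of_real (Re z) = z / 2 + cnj z / 2" for z
    by (simp add: complex_eq_iff)
  show ?thesis
    unfolding lin_comb_def sum_lin_idx half
    by (simp add: lin_coeff_def shift_idx_def path_sum_cnj sum.distrib sum_divide_distrib)
qed

lemma
  assumes fin: "finite A"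
  shows integrable_lin_comb_power: "integrable P (\<lambda>\<omega>. lin_comb s n N \<omega> ^ card A)"
    and expectation_lin_comb_power: "complex_of_real (expectation (\<lambda>\<omega>. lin_comb s n N \<omega> ^ card A)) = lin_moment s n N A"
proof -
  have eq: "complex_of_real (lin_comb s n N \<omega> ^ card A) =
     (\<Sum>x\<in>A \<rightarrow>\<^sub>E lin_idx n. (\<Prod>a\<in>A. lin_coeff s (x a)) * (\<Prod>a\<in>A. path_sum N (shift_idx (x a)) \<omega>))" for \<omega>
  proof -
    have "complex_of_real (lin_comb s n N \<omega> ^ card A) = (\<Prod>a\<in>A. \<Sum>y\<in>lin_idx n. lin_coeff s y * path_sum N (shift_idx y) \<omega>)"
      by (simp add: lin_comb_eq)
    also have "\<dots> = (\<Sum>x\<in>A \<rightarrow>\<^sub>E lin_idx n. \<Prod>a\<in>A. lin_coeff s (x a) * path_sum N (shift_idx (x a)) \<omega>)"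
      by (rule prod_sum_PiE[OF fin finite_lin_idx])
    finally show ?thesis by (simp add: prod.distrib)
  qed
  have int: "integrable P (\<lambda>\<omega>. (\<Prod>a\<in>A. lin_coeff s (x a)) * (\<Prod>a\<in>A. path_sum N (shift_idx (x a)) \<omega>))" for x
    by (intro integrable_mult_right integrable_prod_path_sum[OF fin])
  have "integrable P (\<lambda>\<omega>. complex_of_real (lin_comb s n N \<omega> ^ card A))"
    unfolding eq by (intro Bochner_Integration.integrable_sum int)
  thus "integrable P (\<lambda>\<omega>. lin_comb s n N \<omega> ^ card A)" by (simp only: complex_of_real_integrable_eq)
  have "expectation (\<lambda>\<omega>. complex_of_real (lin_comb s n N \<omega> ^ card A)) = lin_moment s n N A"
    unfolding eq lin_moment_def
    by (subst Bochner_Integration.integral_sum[OF int]) (simp add: expectation_prod_path_sum[OF fin])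
  thus "complex_of_real (expectation (\<lambda>\<omega>. lin_comb s n N \<omega> ^ card A)) = lin_moment s n N A"
    by (simp only: integral_complex_of_real)
qed

lemma lin_variance_eq:
  "(\<Sum>y\<in>lin_idx n. \<Sum>z\<in>lin_idx n. lin_coeff s y * lin_coeff s z * path_cov (shift_idx y) (shift_idx z)) = of_real (lin_variance s n)"
proof -
  have "(\<Sum>y\<in>lin_idx n. \<Sum>z\<in>lin_idx n. lin_coeff s y * lin_coeff s z * path_cov (shift_idx y) (shift_idx z))
      = (\<Sum>y\<in>lin_idx n. \<Sum>l<n. if fst y = l then lin_coeff s y * (lin_coeff s (l, False) * pair_cov (snd y) False ^ Suc l
          + lin_coeff s (l, True) * pair_cov (snd y) True ^ Suc l) else 0)"
    by (rule sum.cong[OF refl], subst sum_lin_idx, rule sum.cong[OF refl])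
      (auto simp: path_cov_def shift_idx_def algebra_simps)
  also have "\<dots> = (\<Sum>y\<in>lin_idx n. lin_coeff s y * (lin_coeff s (fst y, False) * pair_cov (snd y) False ^ Suc (fst y)
          + lin_coeff s (fst y, True) * pair_cov (snd y) True ^ Suc (fst y)))"
    by (rule sum.cong) (auto simp: lin_idx_def)
  also have "\<dots> = (\<Sum>k<n. of_real (((cmod (s k))\<^sup>2 + Re ((s k)\<^sup>2 * pseudo_var ^ Suc k)) / 2))"
    unfolding sum_lin_idx
  proof (rule sum.cong[OF refl])
    fix k
    define p q where "p = pseudo_var ^ Suc k" and "q = cnj pseudo_var ^ Suc k"
    have q: "q = cnj p" by (simp add: p_def q_def)
    have pair_cov: "pair_cov False False ^ Suc k = p" "pair_cov True True ^ Suc k = q"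
      "pair_cov False True ^ Suc k = 1" "pair_cov True False ^ Suc k = 1"
      unfolding p_def q_def pair_cov_def by simp_all
    have "complex_of_real (((cmod (s k))\<^sup>2 + Re t) / 2) = (s k * cnj (s k)) / 2 + (t + cnj t) / 4" for t
      by (simp add: complex_eq_iff cmod_def power2_eq_square field_simps)
    from this[of "(s k)\<^sup>2 * p"]
    have E: "complex_of_real (((cmod (s k))\<^sup>2 + Re ((s k)\<^sup>2 * p)) / 2) =
        (s k * cnj (s k)) / 2 + ((s k)\<^sup>2 * p + (cnj (s k))\<^sup>2 * q) / 4"
      by (simp only: q complex_cnj_mult complex_cnj_power)
    show "lin_coeff s (k, False) * (lin_coeff s (fst (k, False), False) * pair_cov (snd (k, False)) False ^ Suc (fst (k, False))
          + lin_coeff s (fst (k, False), True) * pair_cov (snd (k, False)) True ^ Suc (fst (k, False))) +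
        lin_coeff s (k, True) * (lin_coeff s (fst (k, True), False) * pair_cov (snd (k, True)) False ^ Suc (fst (k, True))
          + lin_coeff s (fst (k, True), True) * pair_cov (snd (k, True)) True ^ Suc (fst (k, True))) =
        of_real (((cmod (s k))\<^sup>2 + Re ((s k)\<^sup>2 * pseudo_var ^ Suc k)) / 2)"
      unfolding p_def[symmetric] E fst_conv snd_conv pair_cov
      by (simp add: lin_coeff_def power2_eq_square field_simps)
  qed
  finally show ?thesis by (simp add: lin_variance_def)
qed

text \<open>When the recursion for mixed moments is summed over all indices, those at a0 and b
  decouple from the others and add up to the variance.\<close>

lemma lin_moment_recursion:
  assumes fin: "finite A" and a0: "a0 \<in> A"
  shows "\<exists>D. \<forall>N\<ge>1. cmod (lin_moment s n N A - (\<Sum>b\<in>A - {a0}. of_real (lin_variance s n) * lin_moment s n N (A - {a0, b})))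
     \<le> D / sqrt (real N)"
proof -
  let ?X = "A \<rightarrow>\<^sub>E lin_idx n"
  let ?c = "\<lambda>A x. \<Prod>a\<in>A. lin_coeff s (x a)"
  have finX: "finite ?X" by (intro finite_PiE fin finite_lin_idx)
  have "\<forall>x. \<exists>D. \<forall>N\<ge>1. cmod (moment N A (\<lambda>a. shift_idx (x a)) - (\<Sum>b\<in>A - {a0}. path_cov (shift_idx (x a0)) (shift_idx (x b)) *
      moment N (A - {a0, b}) (\<lambda>a. shift_idx (x a)))) \<le> D / sqrt (real N)"
    by (intro allI moment_recursion[OF fin a0]) (simp add: shift_idx_def)
  from choice[OF this] obtain D where "\<forall>x. \<forall>N\<ge>1. cmod (moment N A (\<lambda>a. shift_idx (x a)) - (\<Sum>b\<in>A - {a0}. path_cov (shift_idx (x a0)) (shift_idx (x b)) *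
      moment N (A - {a0, b}) (\<lambda>a. shift_idx (x a)))) \<le> D x / sqrt (real N)" by (elim exE)
  hence D: "\<And>x N. N \<ge> 1 \<Longrightarrow> cmod (moment N A (\<lambda>a. shift_idx (x a)) - (\<Sum>b\<in>A - {a0}. path_cov (shift_idx (x a0)) (shift_idx (x b)) *
      moment N (A - {a0, b}) (\<lambda>a. shift_idx (x a)))) \<le> D x / sqrt (real N)"
    by (elim allE impE)
  have key: "(\<Sum>x\<in>?X. ?c A x * (path_cov (shift_idx (x a0)) (shift_idx (x b)) * moment N (A - {a0, b}) (\<lambda>a. shift_idx (x a))))
     = of_real (lin_variance s n) * lin_moment s n N (A - {a0, b})" if b: "b \<in> A - {a0}" for b N
  proof -
    define A' where "A' = A - {a0, b}"
    have A: "A = insert a0 (insert b A')" "a0 \<notin> insert b A'" "b \<notin> A'" "finite A'" "a0 \<noteq> b"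
      using a0 b fin by (auto simp: A'_def)
    have "(\<Sum>x\<in>?X. ?c A x * (path_cov (shift_idx (x a0)) (shift_idx (x b)) * moment N A' (\<lambda>a. shift_idx (x a))))
      = (\<Sum>y\<in>lin_idx n. \<Sum>z\<in>lin_idx n. \<Sum>x\<in>A' \<rightarrow>\<^sub>E lin_idx n.
          (lin_coeff s y * lin_coeff s z * path_cov (shift_idx y) (shift_idx z)) * (?c A' x * moment N A' (\<lambda>a. shift_idx (x a))))"
    proof -
      have c: "?c A (x(b := z, a0 := y)) = lin_coeff s y * (lin_coeff s z * ?c A' x)" for x y z
      proof -
        have "?c A' (x(b := z, a0 := y)) = ?c A' x"
          by (rule prod.cong) (use A in auto)
        thus ?thesis unfolding A(1) using A(2-5) by simp
      qed
      have m: "moment N A' (\<lambda>a. shift_idx ((x(b := z, a0 := y)) a)) = moment N A' (\<lambda>a. shift_idx (x a))" for x y z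
        by (rule moment_cong) (use A in auto)
      have "(\<Sum>x\<in>insert a0 (insert b A') \<rightarrow>\<^sub>E lin_idx n. ?c A x * (path_cov (shift_idx (x a0)) (shift_idx (x b)) * moment N A' (\<lambda>a. shift_idx (x a))))
        = (\<Sum>y\<in>lin_idx n. \<Sum>z\<in>lin_idx n. \<Sum>x\<in>A' \<rightarrow>\<^sub>E lin_idx n. ?c A (x(b := z, a0 := y)) *
            (path_cov (shift_idx y) (shift_idx z) * moment N A' (\<lambda>a. shift_idx ((x(b := z, a0 := y)) a))))"
        using A(5) by (simp only: sum_PiE_insert[OF A(2)] sum_PiE_insert[OF A(3)] fun_upd_same fun_upd_other[of b a0])
      thus ?thesis unfolding c m A(1)[symmetric] by (simp only: mult_ac)
    qed
    also have "\<dots> = (\<Sum>y\<in>lin_idx n. \<Sum>z\<in>lin_idx n. lin_coeff s y * lin_coeff s z * path_cov (shift_idx y) (shift_idx z) * lin_moment s n N A')"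
      by (simp only: lin_moment_def sum_distrib_left)
    also have "\<dots> = (\<Sum>y\<in>lin_idx n. \<Sum>z\<in>lin_idx n. lin_coeff s y * lin_coeff s z * path_cov (shift_idx y) (shift_idx z)) * lin_moment s n N A'"
      by (simp only: sum_distrib_right)
    finally show ?thesis unfolding lin_variance_eq A'_def .
  qed
  have "cmod (lin_moment s n N A - (\<Sum>b\<in>A - {a0}. of_real (lin_variance s n) * lin_moment s n N (A - {a0, b})))
     \<le> (\<Sum>x\<in>?X. cmod (?c A x) * D x) / sqrt (real N)" if N: "N \<ge> 1" for N
  proof -
    have "(\<Sum>b\<in>A - {a0}. of_real (lin_variance s n) * lin_moment s n N (A - {a0, b})) =
       (\<Sum>b\<in>A - {a0}. \<Sum>x\<in>?X. ?c A x * (path_cov (shift_idx (x a0)) (shift_idx (x b)) * moment N (A - {a0, b}) (\<lambda>a. shift_idx (x a))))"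
      by (rule sum.cong) (simp_all add: key)
    also have "\<dots> = (\<Sum>x\<in>?X. ?c A x * (\<Sum>b\<in>A - {a0}. path_cov (shift_idx (x a0)) (shift_idx (x b)) * moment N (A - {a0, b}) (\<lambda>a. shift_idx (x a))))"
      by (subst sum.swap) (simp only: sum_distrib_left)
    finally have eq: "lin_moment s n N A - (\<Sum>b\<in>A - {a0}. of_real (lin_variance s n) * lin_moment s n N (A - {a0, b})) =
      (\<Sum>x\<in>?X. ?c A x * (moment N A (\<lambda>a. shift_idx (x a)) - (\<Sum>b\<in>A - {a0}. path_cov (shift_idx (x a0)) (shift_idx (x b)) *
      moment N (A - {a0, b}) (\<lambda>a. shift_idx (x a)))))"
      unfolding lin_moment_def[of s n N A] by (simp only: right_diff_distrib sum_subtractf)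
    have "cmod (lin_moment s n N A - (\<Sum>b\<in>A - {a0}. of_real (lin_variance s n) * lin_moment s n N (A - {a0, b})))
      \<le> (\<Sum>x\<in>?X. cmod (?c A x) * (D x / sqrt (real N)))"
      unfolding eq
    proof (rule sum_norm_le)
      fix x
      show "cmod (?c A x * (moment N A (\<lambda>a. shift_idx (x a)) - (\<Sum>b\<in>A - {a0}. path_cov (shift_idx (x a0)) (shift_idx (x b)) *
        moment N (A - {a0, b}) (\<lambda>a. shift_idx (x a))))) \<le> cmod (?c A x) * (D x / sqrt (real N))"
        unfolding norm_mult[of "?c A x"] by (rule mult_left_mono[OF D[OF N]]) simp
    qed
    thus ?thesis by (simp only: sum_divide_distrib times_divide_eq_right)
  qed
  thus ?thesis by blast
qed

text \<open>In the limit all n - 1 partners of a0 contribute equally, and the recursion becomes m_n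
  = (n - 1) v m_(n-2), that of the Gaussian moments.\<close>

lemma lin_moment_tendsto:
  "finite A \<Longrightarrow> (\<lambda>N. lin_moment s n N A) \<longlonglongrightarrow> of_real (gaussian_moment (lin_variance s n) (card A))"
proof (induction "card A" arbitrary: A rule: less_induct)
  case (less A)
  show ?case
  proof (cases "A = {}")
    case True
    have "lin_moment s n N {} = 1" for N
      using expectation_lin_comb_power[of "{}" s n N] by (simp add: prob_space)
    thus ?thesis using True by simp
  next
    case False
    then obtain a0 where a0: "a0 \<in> A" by auto
    let ?v = "lin_variance s n"
    define B where "B N = (\<Sum>b\<in>A - {a0}. of_real ?v * lin_moment s n N (A - {a0, b}))" for N
    obtain D where D: "\<And>N. N \<ge> 1 \<Longrightarrow> cmod (lin_moment s n N A - B N) \<le> D / sqrt (real N)"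
      using lin_moment_recursion[OF less(2) a0, of s n] unfolding B_def by blast
    have card': "card (A - {a0, b}) = card A - 2" if "b \<in> A - {a0}" for b
      using that a0 less(2) by (subst card_Diff_subset) auto
    have pos: "card A > 0" using a0 less(2) by (auto simp: card_gt_0_iff)
    have "B \<longlonglongrightarrow> (\<Sum>b\<in>A - {a0}. of_real ?v * of_real (gaussian_moment ?v (card (A - {a0, b}))))"
      unfolding B_def
    proof (intro tendsto_sum tendsto_mult tendsto_const less(1))
      fix b assume "b \<in> A - {a0}"
      show "card (A - {a0, b}) < card A" by (rule psubset_card_mono[OF less(2)]) (use a0 in auto)
    qed (use less(2) in auto)
    also have "(\<Sum>b\<in>A - {a0}. of_real ?v * complex_of_real (gaussian_moment ?v (card (A - {a0, b})))) =
        (\<Sum>b\<in>A - {a0}. of_real ?v * of_real (gaussian_moment ?v (card A - 2)))"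
      by (rule sum.cong) (simp_all add: card')
    also have "\<dots> = of_real (real (card A - 1) * ?v * gaussian_moment ?v (card A - 2))"
      using a0 less(2) by simp
    also have "real (card A - 1) * ?v * gaussian_moment ?v (card A - 2) = gaussian_moment ?v (card A)"
    proof -
      consider "card A = 1" | m where "card A = Suc (Suc m)" using pos by (cases "card A"; cases "card A - 1") auto
      thus ?thesis by cases (simp_all add: gaussian_moment_rec)
    qed
    finally have B: "B \<longlonglongrightarrow> of_real (gaussian_moment ?v (card A))" .
    have "(\<lambda>N. lin_moment s n N A - B N) \<longlonglongrightarrow> 0"
    proof (rule Lim_null_comparison)
      show "\<forall>\<^sub>F N in sequentially. cmod (lin_moment s n N A - B N) \<le> D / sqrt (real N)"
        using eventually_ge_at_top[of 1] by eventually_elim (rule D)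
      have "(\<lambda>N. D * inverse (sqrt (real N))) \<longlonglongrightarrow> D * 0"
        by (intro tendsto_mult_left tendsto_inverse_0_at_top filterlim_compose[OF sqrt_at_top] filterlim_real_sequentially)
      thus "(\<lambda>N. D / sqrt (real N)) \<longlonglongrightarrow> 0" by (simp add: divide_inverse)
    qed
    from tendsto_add[OF this B] show ?thesis by simp
  qed
qed

lemma lin_comb_char_tendsto:
  "(\<lambda>N. expectation (\<lambda>\<omega>. iexp (lin_comb s n N \<omega>))) \<longlonglongrightarrow> exp (- lin_variance s n / 2)"
proof (rule cos_sin_tendsto_of_moments)
  show "lin_comb s n N \<in> borel_measurable P" for N unfolding lin_comb_def[abs_def] by measurable
  show "integrable P (\<lambda>\<omega>. lin_comb s n N \<omega> ^ m)" for N m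
    using integrable_lin_comb_power[of "{..<m}" s n N] by simp
  show "(\<lambda>N. expectation (\<lambda>\<omega>. lin_comb s n N \<omega> ^ m)) \<longlonglongrightarrow> gaussian_moment (lin_variance s n) m" for m
  proof -
    have "(\<lambda>N. complex_of_real (expectation (\<lambda>\<omega>. lin_comb s n N \<omega> ^ m))) \<longlonglongrightarrow> of_real (gaussian_moment (lin_variance s n) m)"
      using lin_moment_tendsto[of "{..<m}" s n] expectation_lin_comb_power[of "{..<m}" s n] by simp
    thus ?thesis by (simp only: tendsto_of_real_iff)
  qed
qed

end

section \<open>Zeros of random Laurent series\<close>

lemma zorder_pos_of_zero:
  assumes "F holomorphic_on S" "open S" "connected S" "z \<in> S" "\<exists>w\<in>S. F w \<noteq> 0"
  shows "(if F z = 0 then zorder F z > 0 else zorder F z = 0)"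
  using zorder_exist_zero[OF assms] by simp

text \<open>Hurwitz's theorem with multiplicities: |F| has a positive minimum on the circle, and
  Rouche's theorem applies as soon as \<open>G n\<close> is closer to F than that.\<close>

lemma sum_zero_points_ball_tendsto:
  fixes F :: "complex \<Rightarrow> complex" and G :: "nat \<Rightarrow> complex \<Rightarrow> complex"
  assumes S: "open S" "connected S" and F: "F holomorphic_on S" and G: "\<And>n. G n holomorphic_on S"
    and Gnz: "\<And>n. \<exists>w\<in>S. G n w \<noteq> 0"
    and lim: "\<And>K. compact K \<Longrightarrow> K \<subseteq> S \<Longrightarrow> uniform_limit K G F sequentially"
    and r: "r > 0" "cball z r \<subseteq> S" and nz: "\<And>w. w \<in> cball z r \<Longrightarrow> w \<noteq> z \<Longrightarrow> F w \<noteq> 0"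
  shows "\<forall>\<^sub>F n in sequentially. finite {w \<in> ball z r. G n w = 0} \<and>
    (\<Sum>w\<in>{w \<in> ball z r. G n w = 0}. zero_points (G n) w) = zero_points F z"
proof -
  let ?\<gamma> = "circlepath z r"
  have sph: "path_image ?\<gamma> = sphere z r" using r by simp
  have sphS: "sphere z r \<subseteq> S" using r by auto
  have sph_ne: "sphere z r \<noteq> {}" using r by simp
  have "continuous_on (sphere z r) (\<lambda>w. cmod (F w))"
    by (intro continuous_intros holomorphic_on_imp_continuous_on holomorphic_on_subset[OF F] sphS)
  then obtain w0 where w0: "w0 \<in> sphere z r" "\<And>w. w \<in> sphere z r \<Longrightarrow> cmod (F w0) \<le> cmod (F w)"
    using continuous_attains_inf[OF compact_sphere sph_ne] by metis
  have "w0 \<noteq> z" using w0 r by auto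
  hence m: "cmod (F w0) > 0" using nz[of w0] w0 by auto
  \<comment> \<open>Only finitely many zeros of F lie in a compact neighbourhood of the disc, and
    those other than z are at distance more than r, so the disc can be enlarged without meeting a
    new zero.\<close>
  obtain R where R: "R > r" "ball z R \<subseteq> S" "\<And>w. w \<in> ball z R \<Longrightarrow> w \<noteq> z \<Longrightarrow> F w \<noteq> 0"
  proof -
    obtain \<rho> where \<rho>: "\<rho> > r" "ball z \<rho> \<subseteq> S"
    proof -
      have "compact (cball z r)" by simp
      from compact_subset_open_imp_ball_epsilon_subset[OF this S(1) r(2)]
      obtain e where e: "e > 0" "(\<Union>x\<in>cball z r. ball x e) \<subseteq> S" by blast
      have "ball z (r + e) \<subseteq> (\<Union>x\<in>cball z r. ball x e)"
      proof
        fix w assume w: "w \<in> ball z (r + e)"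
        show "w \<in> (\<Union>x\<in>cball z r. ball x e)"
        proof (cases "dist z w < r")
          case True thus ?thesis using e(1) by (intro UN_I[of w]) auto
        next
          case False
          define y where "y = z + of_real (r / dist z w) * (w - z)"
          have d: "dist z w > 0" using False r by linarith
          have "dist z y = r" using d r by (simp add: y_def dist_norm norm_mult norm_divide norm_minus_commute)
          moreover have "dist y w = dist z w - r"
          proof -
            have "y - w = - (of_real (1 - r / dist z w) * (w - z))"
              by (simp add: y_def algebra_simps)
            hence "dist y w = \<bar>1 - r / dist z w\<bar> * dist z w"
              by (simp add: dist_norm norm_mult norm_minus_commute del: of_real_diff)
            also have "\<dots> = dist z w - r" using d False by (simp add: abs_if field_simps)
            finally show ?thesis .
          qed
          ultimately show ?thesis using w by (intro UN_I[of y]) auto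
        qed
      qed
      thus ?thesis using that[of "r + e"] e by auto
    qed
    show ?thesis
    proof (cases "\<exists>w\<in>ball z \<rho>. w \<noteq> z \<and> F w = 0")
      case False thus ?thesis using that[OF \<rho>] by blast
    next
      case True
      define \<rho>' where "\<rho>' = (r + \<rho>) / 2"
      have \<rho>': "r < \<rho>'" "\<rho>' < \<rho>" using \<rho> by (auto simp: \<rho>'_def)
      have cS: "cball z \<rho>' \<subseteq> S" using \<rho> \<rho>' by (auto simp: subset_iff)
      have "w0 \<in> S" using w0 sphS by auto
      have nc: "\<not> F constant_on S"
      proof
        assume "F constant_on S"
        then obtain c where c: "\<And>x. x \<in> S \<Longrightarrow> F x = c" unfolding constant_on_def by blast
        from True obtain w where "w \<in> ball z \<rho>" "F w = 0" by blast
        thus False using c[of w] c[of w0] \<open>w0 \<in> S\<close> \<rho> m by auto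
      qed
      have fin: "finite {w \<in> cball z \<rho>'. F w = 0}"
        by (rule holomorphic_compact_finite_zeros[OF F S compact_cball cS nc])
      define Zs where "Zs = {w \<in> cball z \<rho>'. F w = 0} - {z}"
      have finZ: "finite Zs" using fin by (simp add: Zs_def)
      have far: "dist z w > r" if "w \<in> Zs" for w
        using that nz[of w] by (force simp: Zs_def)
      define R where "R = Min (insert \<rho>' (dist z ` Zs))"
      have "R > r" unfolding R_def using finZ far \<rho>' by (subst Min_gr_iff) auto
      have "R \<le> \<rho>'" unfolding R_def using finZ by (intro Min_le) auto
      have Rle: "R \<le> dist z w" if "w \<in> Zs" for w unfolding R_def using finZ that by (intro Min_le) auto
      show ?thesis
      proof (rule that[OF \<open>R > r\<close>])
        show "ball z R \<subseteq> S" using \<open>R \<le> \<rho>'\<close> cS by (auto simp: subset_iff)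
        fix w assume w: "w \<in> ball z R" "w \<noteq> z"
        show "F w \<noteq> 0"
        proof
          assume "F w = 0"
          hence "w \<in> Zs" using w \<open>R \<le> \<rho>'\<close> by (auto simp: Zs_def)
          thus False using Rle[of w] w by auto
        qed
      qed
    qed
  qed
  have B: "open (ball z R)" "connected (ball z R)" by auto
  have FB: "F holomorphic_on ball z R" and GB: "\<And>n. G n holomorphic_on ball z R"
    using F G R(2) holomorphic_on_subset by blast+
  have cB: "cball z r \<subseteq> ball z R" using R(1) by auto
  have "\<forall>\<^sub>F n in sequentially. \<forall>w\<in>sphere z r. dist (G n w) (F w) < cmod (F w0)"
    using uniform_limitD[OF lim[OF compact_sphere sphS] m] .
  thus ?thesis
  proof eventually_elim
    case (elim n)
    have less: "cmod (F w) > cmod (G n w - F w)" if "w \<in> sphere z r" for w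
      using elim[rule_format, OF that] w0(2)[OF that] by (simp add: dist_norm)
    have w0S: "w0 \<in> S" using w0 sphS by auto
    have Gw0: "G n w0 \<noteq> 0" using less[OF w0(1)] by auto
    have finG: "finite {w \<in> cball z r. G n w = 0}"
    proof (cases "\<exists>w\<in>cball z r. G n w = 0")
      case True
      have "\<not> G n constant_on ball z R"
      proof
        assume "G n constant_on ball z R"
        then obtain c where c: "\<And>x. x \<in> ball z R \<Longrightarrow> G n x = c" unfolding constant_on_def by blast
        from True obtain w where "w \<in> cball z r" "G n w = 0" by blast
        thus False using c[of w] c[of w0] w0 cB Gw0 by auto
      qed
      thus ?thesis by (intro holomorphic_compact_finite_zeros[OF GB B compact_cball cB])
    next
      case False
      hence "{w \<in> cball z r. G n w = 0} = {}" by auto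
      thus ?thesis by (simp only: finite.emptyI)
    qed
    text \<open>Rouche's theorem is applied on a disc slightly larger than \<open>cball z r\<close> on which \<open>G n\<close> has
      finitely many zeros; those outside \<open>cball z r\<close> have winding number 0.\<close>
    define R' where "R' = (r + R) / 2"
    have R': "r < R'" "R' < R" using R by (auto simp: R'_def)
    have cR': "cball z R' \<subseteq> ball z R" using R' by auto
    have w0R': "w0 \<in> ball z R'" using w0 R' by auto
    have finG': "finite {w \<in> cball z R'. G n w = 0}"
    proof (cases "\<exists>w\<in>cball z R'. G n w = 0")
      case True
      have "\<not> G n constant_on ball z R"
      proof
        assume "G n constant_on ball z R"
        then obtain c where c: "\<And>x. x \<in> ball z R \<Longrightarrow> G n x = c" unfolding constant_on_def by blast
        from True obtain w where w: "w \<in> cball z R'" "G n w = 0" by blast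
        have "w \<in> ball z R" "w0 \<in> ball z R" using w(1) cR' w0(1) R(1) by (blast, auto)
        thus False using c[of w] c[of w0] Gw0 w(2) by simp
      qed
      thus ?thesis by (intro holomorphic_compact_finite_zeros[OF GB B compact_cball cR'])
    next
      case False
      hence "{w \<in> cball z R'. G n w = 0} = {}" by auto
      thus ?thesis by (simp only: finite.emptyI)
    qed
    let ?s = "ball z R'"
    have zF: "{p \<in> ?s. F p = 0} = (if F z = 0 then {z} else {})"
    proof -
      have "p = z" if "p \<in> ?s" "F p = 0" for p using R(3)[of p] that R' by force
      moreover have "z \<in> ?s" using r(1) R' by simp
      ultimately show ?thesis by auto
    qed
    have "(\<Sum>p\<in>{p\<in>?s. F p + (G n p - F p) = 0}. winding_number ?\<gamma> p * zorder (\<lambda>p. F p + (G n p - F p)) p)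
          = (\<Sum>p\<in>{p\<in>?s. F p = 0}. winding_number ?\<gamma> p * zorder F p)"
    proof (rule Rouche_theorem)
      show "finite {p \<in> ?s. F p + (G n p - F p) = 0}" by (rule finite_subset[OF _ finG']) auto
      show "finite {p \<in> ?s. F p = 0}" unfolding zF by auto
      show "F holomorphic_on ?s" "(\<lambda>p. G n p - F p) holomorphic_on ?s"
      proof -
        have "?s \<subseteq> ball z R" using R' by (intro subset_ball) simp
        hence "F holomorphic_on ?s" "G n holomorphic_on ?s" using FB GB holomorphic_on_subset by blast+
        thus "F holomorphic_on ?s" "(\<lambda>p. G n p - F p) holomorphic_on ?s" by (auto intro!: holomorphic_intros)
      qed
      show "path_image ?\<gamma> \<subseteq> ?s" unfolding sph using R' by auto
      show "\<forall>w\<in>path_image ?\<gamma>. cmod (G n w - F w) < cmod (F w)" unfolding sph using less by auto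
      show "\<forall>w. w \<notin> ?s \<longrightarrow> winding_number ?\<gamma> w = 0"
      proof (intro allI impI winding_number_zero_outside[of _ "cball z r"])
        fix w assume "w \<notin> ?s"
        thus "w \<notin> cball z r" using R' by auto
      qed (use r sph in auto)
    qed auto
    hence "(\<Sum>p\<in>{p\<in>?s. G n p = 0}. winding_number ?\<gamma> p * zorder (G n) p)
          = (\<Sum>p\<in>{p\<in>?s. F p = 0}. winding_number ?\<gamma> p * zorder F p)" by simp
    also have "(\<Sum>p\<in>{p\<in>?s. F p = 0}. winding_number ?\<gamma> p * zorder F p) = of_nat (zero_points F z)"
    proof (cases "F z = 0")
      case True
      have "\<exists>w\<in>S. F w \<noteq> 0" using w0S m by auto
      moreover have "z \<in> S" by (rule subsetD[OF r(2)]) (use r(1) in simp)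
      ultimately have "zorder F z > 0" using zorder_pos_of_zero[OF F S, of z] True by simp
      thus ?thesis unfolding zF using True r by (simp add: zero_points_def winding_number_circlepath_centre)
    next
      case False
      thus ?thesis unfolding zF by (simp add: zero_points_def)
    qed
    also have "(\<Sum>p\<in>{p\<in>?s. G n p = 0}. winding_number ?\<gamma> p * zorder (G n) p)
        = (\<Sum>p\<in>{p\<in>ball z r. G n p = 0}. of_nat (zero_points (G n) p))"
    proof (rule sum.mono_neutral_cong_right)
      show "finite {p \<in> ?s. G n p = 0}" by (rule finite_subset[OF _ finG']) auto
      show "{p \<in> ball z r. G n p = 0} \<subseteq> {p \<in> ?s. G n p = 0}" using R' by auto
      show "\<forall>p\<in>{p \<in> ?s. G n p = 0} - {p \<in> ball z r. G n p = 0}. winding_number ?\<gamma> p * zorder (G n) p = 0"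
      proof
        fix p assume p: "p \<in> {p \<in> ?s. G n p = 0} - {p \<in> ball z r. G n p = 0}"
        have "p \<notin> sphere z r" using p less[of p] by auto
        hence "p \<notin> cball z r" using p by auto
        hence "winding_number ?\<gamma> p = 0"
          by (intro winding_number_zero_outside[of _ "cball z r"]) (use r sph in auto)
        thus "winding_number ?\<gamma> p * zorder (G n) p = 0" by simp
      qed
      fix p assume p: "p \<in> {p \<in> ball z r. G n p = 0}"
      have "p \<in> S" using p r by auto
      hence "zorder (G n) p > 0" using zorder_pos_of_zero[OF G S _ Gnz[of n], of p] p by auto
      moreover have "winding_number ?\<gamma> p = 1"
        by (rule winding_number_circlepath) (use p in \<open>auto simp: dist_norm norm_minus_commute\<close>)
      ultimately show "winding_number ?\<gamma> p * zorder (G n) p = of_nat (zero_points (G n) p)"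
        using p by (simp add: zero_points_def)
    qed
    finally have "complex_of_nat (\<Sum>p\<in>{p\<in>ball z r. G n p = 0}. zero_points (G n) p) = of_nat (zero_points F z)"
      by simp
    hence "(\<Sum>w\<in>{w \<in> ball z r. G n w = 0}. zero_points (G n) w) = zero_points F z"
      by (simp only: of_nat_eq_iff)
    moreover have "finite {w \<in> ball z r. G n w = 0}" by (rule finite_subset[OF _ finG]) auto
    ultimately show ?case by simp
  qed
qed

lemma finite_zeros_compact:
  fixes F :: "complex \<Rightarrow> complex"
  assumes "open S" "connected S" "F holomorphic_on S" "\<exists>w\<in>S. F w \<noteq> 0" "compact K" "K \<subseteq> S"
  shows "finite {w \<in> K. F w = 0}"
proof (cases "\<exists>w\<in>K. F w = 0")
  case True
  have "\<not> F constant_on S"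
  proof
    assume "F constant_on S"
    then obtain c where c: "\<And>x. x \<in> S \<Longrightarrow> F x = c" unfolding constant_on_def by blast
    from True obtain w where "w \<in> K" "F w = 0" by blast
    thus False using c assms by auto
  qed
  thus ?thesis by (intro holomorphic_compact_finite_zeros[OF assms(3,1,2,5,6)])
next
  case False
  hence "{w \<in> K. F w = 0} = {}" by auto
  thus ?thesis by (simp only: finite.emptyI)
qed

lemma sum_over_points_eq_sum:
  fixes \<phi> :: "complex \<Rightarrow> real"
  assumes "finite Z" "Z \<subseteq> S" "\<And>w. w \<in> S \<Longrightarrow> w \<notin> Z \<Longrightarrow> F w = 0 \<Longrightarrow> \<phi> w = 0"
  shows "sum_over_points S (zero_points F) \<phi> = (\<Sum>w\<in>Z. real (zero_points F w) * \<phi> w)"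
proof -
  have "sum_over_points S (zero_points F) \<phi> = (\<Sum>\<^sub>\<infinity>w\<in>Z. real (zero_points F w) * \<phi> w)"
    unfolding sum_over_points_def
    by (rule infsum_cong_neutral) (use assms in \<open>auto simp: zero_points_def\<close>)
  thus ?thesis using assms(1) by simp
qed

text \<open>Outside small discs around the zeros of F, \<open>G n\<close> eventually has no zeros in
  K. Inside each disc the number of zeros agrees, and \<phi> varies little.\<close>

lemma sum_over_points_tendsto:
  fixes F :: "complex \<Rightarrow> complex" and G :: "nat \<Rightarrow> complex \<Rightarrow> complex" and \<phi> :: "complex \<Rightarrow> real"
  assumes S: "open S" "connected S" and F: "F holomorphic_on S" and G: "\<And>n. G n holomorphic_on S"
    and Fnz: "\<exists>w\<in>S. F w \<noteq> 0" and Gnz: "\<And>n. \<exists>w\<in>S. G n w \<noteq> 0"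
    and lim: "\<And>K. compact K \<Longrightarrow> K \<subseteq> S \<Longrightarrow> uniform_limit K G F sequentially"
    and \<phi>: "continuous_on S \<phi>" and K: "compact K" "K \<subseteq> S" "\<And>w. w \<in> S - K \<Longrightarrow> \<phi> w = 0"
  shows "(\<lambda>n. sum_over_points S (zero_points (G n)) \<phi>) \<longlonglongrightarrow> sum_over_points S (zero_points F) \<phi>"
proof (rule tendstoI)
  fix e :: real assume e: "e > 0"
  define Z where "Z = {w \<in> K. F w = 0}"
  have finZ: "finite Z" unfolding Z_def by (rule finite_zeros_compact[OF S F Fnz K(1,2)])
  have ZS: "Z \<subseteq> S" using K by (auto simp: Z_def)
  define M where "M = real (\<Sum>z\<in>Z. zero_points F z)"
  \<comment> \<open>M counts the zeros of F in K, and each of them contributes an error of at most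
    d.\<close>
  define d where "d = e / (M + 1)"
  have M: "M \<ge> 0" by (simp add: M_def sum_nonneg)
  have d: "d > 0" "M * d < e" using e M by (auto simp: d_def field_simps)
  have "\<exists>r>0. cball z r \<subseteq> S \<and> (\<forall>w\<in>cball z r. w \<noteq> z \<longrightarrow> F w \<noteq> 0) \<and> (\<forall>w\<in>cball z r. \<bar>\<phi> w - \<phi> z\<bar> < d)" if z: "z \<in> Z" for z
  proof -
    have zS: "z \<in> S" "F z = 0" using z ZS by (auto simp: Z_def)
    obtain \<beta> where \<beta>: "\<beta> \<in> S" "F \<beta> \<noteq> 0" using Fnz by blast
    obtain r1 where r1: "r1 > 0" "ball z r1 \<subseteq> S" "\<And>w. w \<in> ball z r1 - {z} \<Longrightarrow> F w \<noteq> 0"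
      using isolated_zeros[OF F S zS(1,2) \<beta>] by metis
    obtain r2 where r2: "r2 > 0" "\<And>w. w \<in> S \<Longrightarrow> dist w z < r2 \<Longrightarrow> dist (\<phi> w) (\<phi> z) < d"
      using \<phi>[unfolded continuous_on_iff, rule_format, OF zS(1) d(1)] by blast
    define r where "r = min r1 r2 / 2"
    have r: "r > 0" "r < r1" "r < r2" using r1 r2 by (auto simp: r_def)
    have "cball z r \<subseteq> ball z r1" using r by auto
    moreover have "dist w z < r2" if "w \<in> cball z r" for w using that r by (simp add: dist_commute)
    ultimately show ?thesis using r r1 r2 by (intro exI[of _ r]) (fastforce simp: dist_real_def)
  qed
  then obtain \<rho> where \<rho>: "\<And>z. z \<in> Z \<Longrightarrow> \<rho> z > 0" "\<And>z. z \<in> Z \<Longrightarrow> cball z (\<rho> z) \<subseteq> S"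
    "\<And>z w. z \<in> Z \<Longrightarrow> w \<in> cball z (\<rho> z) \<Longrightarrow> w \<noteq> z \<Longrightarrow> F w \<noteq> 0"
    "\<And>z w. z \<in> Z \<Longrightarrow> w \<in> cball z (\<rho> z) \<Longrightarrow> \<bar>\<phi> w - \<phi> z\<bar> < d" by metis
  \<comment> \<open>Two zeros are farther apart than either of their radii, so discs of half the
    radii are disjoint.\<close>
  define r where "r z = \<rho> z / 2" for z
  have r: "r z > 0" "cball z (r z) \<subseteq> cball z (\<rho> z)" if "z \<in> Z" for z using \<rho>(1)[OF that] by (auto simp: r_def)
  have disj: "ball z (r z) \<inter> ball z' (r z') = {}" if zz: "z \<in> Z" "z' \<in> Z" "z \<noteq> z'" for z z'
  proof -
    have "F z = 0" "F z' = 0" using zz by (auto simp: Z_def)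
    hence "z' \<notin> cball z (\<rho> z)" "z \<notin> cball z' (\<rho> z')" using \<rho>(3) zz by metis+
    hence "dist z z' > \<rho> z" "dist z z' > \<rho> z'" by (auto simp: dist_commute)
    hence "r z + r z' \<le> dist z z'" by (simp add: r_def)
    thus ?thesis by (rule disjoint_ballI)
  qed
  define U where "U = (\<Union>z\<in>Z. ball z (r z))"
  have KU: "compact (K - U)" unfolding U_def using K(1) by (intro compact_diff open_UN) auto
  have ev1: "\<forall>\<^sub>F n in sequentially. \<forall>w\<in>K - U. G n w \<noteq> 0"
  proof (cases "K - U = {}")
    case False
    have KUS: "K - U \<subseteq> S" using K by auto
    have "continuous_on (K - U) (\<lambda>w. cmod (F w))"
      by (intro continuous_intros holomorphic_on_imp_continuous_on holomorphic_on_subset[OF F] KUS)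
    then obtain w0 where w0: "w0 \<in> K - U" "\<And>w. w \<in> K - U \<Longrightarrow> cmod (F w0) \<le> cmod (F w)"
      using continuous_attains_inf[OF KU False] by metis
    have "F w0 \<noteq> 0"
    proof
      assume "F w0 = 0"
      hence "w0 \<in> Z" using w0 by (auto simp: Z_def)
      moreover have "w0 \<in> ball w0 (r w0)" using r(1)[OF \<open>w0 \<in> Z\<close>] by simp
      ultimately have "w0 \<in> U" unfolding U_def by blast
      thus False using w0 by simp
    qed
    hence "\<forall>\<^sub>F n in sequentially. \<forall>w\<in>K - U. dist (G n w) (F w) < cmod (F w0)"
      using uniform_limitD[OF lim[OF KU KUS]] by simp
    thus ?thesis
    proof eventually_elim
      case (elim n)
      show ?case
      proof (intro ballI notI)
        fix w assume w: "w \<in> K - U" "G n w = 0"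
        thus False using elim w0(2)[OF w(1)] by (force simp: dist_norm)
      qed
    qed
  next
    case True
    show ?thesis unfolding True by simp
  qed
  have "\<forall>\<^sub>F n in sequentially. \<forall>z\<in>Z. finite {w \<in> ball z (r z). G n w = 0} \<and>
    (\<Sum>w\<in>{w \<in> ball z (r z). G n w = 0}. zero_points (G n) w) = zero_points F z"
  proof (intro eventually_ball_finite finZ ballI)
    fix z assume z: "z \<in> Z"
    show "\<forall>\<^sub>F n in sequentially. finite {w \<in> ball z (r z). G n w = 0} \<and>
      (\<Sum>w\<in>{w \<in> ball z (r z). G n w = 0}. zero_points (G n) w) = zero_points F z"
    proof (rule sum_zero_points_ball_tendsto[OF S F G Gnz lim r(1)[OF z]])
      show "cball z (r z) \<subseteq> S" using r(2)[OF z] \<rho>(2)[OF z] by auto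
      show "F w \<noteq> 0" if "w \<in> cball z (r z)" "w \<noteq> z" for w
        using \<rho>(3)[OF z] r(2)[OF z] that by blast
    qed
  qed
  with ev1 show "\<forall>\<^sub>F n in sequentially. dist (sum_over_points S (zero_points (G n)) \<phi>) (sum_over_points S (zero_points F) \<phi>) < e"
  proof eventually_elim
    case (elim n)
    define W where "W z = {w \<in> ball z (r z). G n w = 0}" for z
    have W: "finite (W z)" "(\<Sum>w\<in>W z. zero_points (G n) w) = zero_points F z" if "z \<in> Z" for z
      using elim(2) that by (auto simp: W_def)
    have WS: "W z \<subseteq> S" if "z \<in> Z" for z
      using r(2)[OF that] \<rho>(2)[OF that] by (fastforce simp: W_def)
    have "sum_over_points S (zero_points (G n)) \<phi> = (\<Sum>w\<in>(\<Union>z\<in>Z. W z). real (zero_points (G n) w) * \<phi> w)"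
    proof (rule sum_over_points_eq_sum)
      show "finite (\<Union>z\<in>Z. W z)" using finZ W by auto
      show "(\<Union>z\<in>Z. W z) \<subseteq> S" using WS by auto
      fix w assume w: "w \<in> S" "w \<notin> (\<Union>z\<in>Z. W z)" "G n w = 0"
      show "\<phi> w = 0"
      proof (rule ccontr)
        assume "\<phi> w \<noteq> 0"
        hence "w \<in> K" using K(3) w by blast
        moreover have "w \<notin> U" using w by (auto simp: U_def W_def)
        ultimately show False using elim(1) w by auto
      qed
    qed
    also have "\<dots> = (\<Sum>z\<in>Z. \<Sum>w\<in>W z. real (zero_points (G n) w) * \<phi> w)"
    proof (rule sum.UNION_disjoint)
      show "\<forall>i\<in>Z. \<forall>j\<in>Z. i \<noteq> j \<longrightarrow> W i \<inter> W j = {}" using disj by (fastforce simp: W_def)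
    qed (use finZ W in auto)
    finally have 1: "sum_over_points S (zero_points (G n)) \<phi> = (\<Sum>z\<in>Z. \<Sum>w\<in>W z. real (zero_points (G n) w) * \<phi> w)" .
    have "sum_over_points S (zero_points F) \<phi> = (\<Sum>z\<in>Z. real (zero_points F z) * \<phi> z)"
      by (rule sum_over_points_eq_sum[OF finZ ZS]) (use K(3) in \<open>auto simp: Z_def\<close>)
    also have "\<dots> = (\<Sum>z\<in>Z. \<Sum>w\<in>W z. real (zero_points (G n) w) * \<phi> z)"
    proof (rule sum.cong[OF refl])
      fix z assume "z \<in> Z"
      from W(2)[OF this, symmetric] show "real (zero_points F z) * \<phi> z = (\<Sum>w\<in>W z. real (zero_points (G n) w) * \<phi> z)"
        by (simp add: sum_distrib_right)
    qed
    finally have "sum_over_points S (zero_points (G n)) \<phi> - sum_over_points S (zero_points F) \<phi>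
      = (\<Sum>z\<in>Z. \<Sum>w\<in>W z. real (zero_points (G n) w) * (\<phi> w - \<phi> z))"
      unfolding 1 by (simp add: sum_subtractf right_diff_distrib)
    hence "\<bar>sum_over_points S (zero_points (G n)) \<phi> - sum_over_points S (zero_points F) \<phi>\<bar>
      \<le> (\<Sum>z\<in>Z. \<Sum>w\<in>W z. \<bar>real (zero_points (G n) w) * (\<phi> w - \<phi> z)\<bar>)"
      by (simp only:) (intro order_trans[OF sum_abs] sum_mono sum_abs)
    also have "\<dots> \<le> (\<Sum>z\<in>Z. \<Sum>w\<in>W z. real (zero_points (G n) w) * d)"
    proof (intro sum_mono)
      fix z w assume z: "z \<in> Z" and w: "w \<in> W z"
      have "w \<in> cball z (r z)" using w by (simp add: W_def)
      hence "w \<in> cball z (\<rho> z)" using r(2)[OF z] by blast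
      hence "\<bar>\<phi> w - \<phi> z\<bar> \<le> d" using \<rho>(4)[OF z] by fastforce
      thus "\<bar>real (zero_points (G n) w) * (\<phi> w - \<phi> z)\<bar> \<le> real (zero_points (G n) w) * d"
        by (simp add: abs_mult mult_left_mono)
    qed
    also have "\<dots> = M * d"
    proof -
      have "(\<Sum>w\<in>W z. real (zero_points (G n) w) * d) = real (zero_points F z) * d" if "z \<in> Z" for z
        unfolding W(2)[OF that, symmetric] by (simp add: sum_distrib_right)
      thus ?thesis by (simp add: M_def sum_distrib_right)
    qed
    finally show ?case using d(2) by (simp add: dist_real_def)
  qed
qed

section \<open>Laurent series with geometrically bounded coefficients\<close>

definition laurent :: "(nat \<Rightarrow> complex) \<Rightarrow> complex \<Rightarrow> complex" where
  "laurent \<xi> z = (\<Sum>k. \<xi> k * z powi (- int k))"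

text \<open>Cauchy's estimates for the Taylor coefficients of a function bounded by B on the disc of
  radius 1 / R.\<close>

definition coeff_bound :: "real \<Rightarrow> real \<Rightarrow> (nat \<Rightarrow> complex) set" where
  "coeff_bound R B = {\<xi>. \<forall>k. cmod (\<xi> k) \<le> B * R ^ k}"

lemma powi_uminus: "z powi (- int k) = inverse z ^ k" for z :: complex
  by (simp add: power_int_minus power_inverse)

lemma laurent_eq: "laurent \<xi> z = (\<Sum>k. \<xi> k * inverse z ^ k)"
  by (simp add: laurent_def powi_uminus)

lemma coeff_bound_summable:
  assumes "\<xi> \<in> coeff_bound R B" "R > 0" "cmod w < 1 / R"
  shows "summable (\<lambda>k. norm (\<xi> k * w ^ k))"
proof (rule summable_comparison_test')
  show "summable (\<lambda>k. B * (R * cmod w) ^ k)"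
    using assms by (intro summable_mult summable_geometric) (simp add: field_simps)
  show "norm (norm (\<xi> k * w ^ k)) \<le> B * (R * cmod w) ^ k" for k
    using assms(1) by (simp add: coeff_bound_def norm_mult norm_power power_mult_distrib mult_right_mono flip: mult.assoc)
qed

lemma coeff_bound_sums:
  assumes "\<xi> \<in> coeff_bound R B" "R > 0" "cmod w < 1 / R"
  shows "(\<lambda>k. \<xi> k * w ^ k) sums (\<Sum>k. \<xi> k * w ^ k)"
  using summable_norm_cancel[OF coeff_bound_summable[OF assms]] by (rule summable_sums)

lemma powser_holomorphic:
  assumes "\<xi> \<in> coeff_bound R B" "R > 0"
  shows "(\<lambda>w. \<Sum>k. \<xi> k * w ^ k) holomorphic_on ball 0 (1 / R)"
proof (rule power_series_holomorphic)
  fix w :: complex assume "w \<in> ball 0 (1 / R)"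
  thus "(\<lambda>n. \<xi> n * (w - 0) ^ n) sums (\<Sum>k. \<xi> k * w ^ k)"
    using coeff_bound_sums[OF assms, of w] by simp
qed

lemma inverse_in_ball: "z \<in> - cball 0 R \<Longrightarrow> R > 0 \<Longrightarrow> inverse z \<in> ball (0::complex) (1 / R)"
  using less_imp_inverse_less[of R "cmod z"] by (simp add: norm_inverse divide_inverse)

lemma laurent_holomorphic:
  assumes "\<xi> \<in> coeff_bound R B" "R > 0"
  shows "laurent \<xi> holomorphic_on - cball 0 R"
proof -
  have "(\<lambda>w. \<Sum>k. \<xi> k * w ^ k) \<circ> inverse holomorphic_on - cball 0 R"
  proof (rule holomorphic_on_compose_gen[OF _ powser_holomorphic[OF assms]])
    show "inverse holomorphic_on - cball (0::complex) R"
      using assms(2) by (intro holomorphic_intros) auto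
    show "inverse ` (- cball 0 R) \<subseteq> ball (0::complex) (1 / R)" using inverse_in_ball assms(2) by blast
  qed
  thus ?thesis by (rule holomorphic_transform) (simp add: laurent_eq)
qed

text \<open>A nonzero coefficient keeps the power series in 1 / z from vanishing in a punctured
  neighbourhood of 0.\<close>

lemma laurent_not_identically_zero:
  assumes \<xi>: "\<xi> \<in> coeff_bound R B" and R: "R > 0" and nz: "\<xi> m \<noteq> 0"
  shows "\<exists>z\<in>- cball 0 R. laurent \<xi> z \<noteq> 0"
proof -
  \<comment> \<open>The extra factor w makes the series vanish at 0, the form in which
    \<open>powser_0_nonzero\<close> provides an isolated zero.\<close>
  define a where "a k = (if k = 0 then 0 else \<xi> (k - 1))" for k
  define f where "f w = w * (\<Sum>k. \<xi> k * w ^ k)" for w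
  have "(\<lambda>n. a n * (w - 0) ^ n) sums f w" if "norm (w - 0) < 1 / R" for w
  proof -
    have "(\<lambda>k. w * (\<xi> k * w ^ k)) sums f w"
      unfolding f_def by (rule sums_mult[OF coeff_bound_sums[OF \<xi> R]]) (use that in simp)
    hence "(\<lambda>k. a (Suc k) * w ^ Suc k) sums f w" by (simp add: a_def mult_ac)
    thus ?thesis by (subst (asm) sums_Suc_iff) (simp add: a_def)
  qed
  moreover have "f 0 = 0" "a (Suc m) \<noteq> 0" using nz by (auto simp: f_def a_def)
  ultimately obtain s where s: "0 < s" "\<And>z. z \<in> cball 0 s - {0} \<Longrightarrow> f z \<noteq> 0"
    using powser_0_nonzero[of "1 / R" 0 a f "Suc m"] R by auto
  define t where "t = min s (1 / (2 * R))"
  have t: "t > 0" "t \<le> s" "t < 1 / R" using s R by (auto simp: t_def min_def field_simps)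
  define z where "z = inverse (complex_of_real t)"
  have "f (of_real t) \<noteq> 0" using t by (intro s) auto
  hence "laurent \<xi> z \<noteq> 0" by (auto simp: f_def laurent_eq z_def)
  have "cmod z = 1 / t" using t by (simp add: z_def norm_inverse divide_inverse)
  moreover have "R < 1 / t" using t R by (simp add: field_simps)
  ultimately have "z \<in> - cball 0 R" by simp
  with \<open>laurent \<xi> z \<noteq> 0\<close> show ?thesis by blast
qed

lemma connected_outside_cball: "connected (- cball (0::complex) R)"
  by (rule connected_complement_bounded_convex) (auto simp: DIM_complex)

text \<open>The coefficient bounds make the tails uniformly small on K, and the heads converge
  coordinate by coordinate.\<close>

lemma laurent_uniform_limit:
  fixes X :: "nat \<Rightarrow> nat \<Rightarrow> complex"
  assumes X: "\<And>n. X n \<in> coeff_bound R B" and \<xi>: "\<xi> \<in> coeff_bound R B" and R: "R \<ge> 1"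
    and lim: "\<And>k. (\<lambda>n. X n k) \<longlonglongrightarrow> \<xi> k" and K: "compact K" "K \<subseteq> - cball 0 R"
  shows "uniform_limit K (\<lambda>n. laurent (X n)) (laurent \<xi>) sequentially"
proof (cases "K = {}")
  case False
  have "continuous_on K (\<lambda>z. cmod (inverse z))"
    using K R by (intro continuous_intros) auto
  then obtain z0 where z0: "z0 \<in> K" "\<And>z. z \<in> K \<Longrightarrow> cmod (inverse z) \<le> cmod (inverse z0)"
    using continuous_attains_sup[OF K(1) False] by metis
  define t where "t = cmod (inverse z0)"
  have t: "t \<ge> 0" "t < 1 / R" using inverse_in_ball[of z0 R] z0 K R by (auto simp: t_def)
  \<comment> \<open>A compact set outside the closed disc keeps away from its boundary, so q < 1 and
    the tails are dominated by a geometric series.\<close>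
  define q where "q = R * t"
  have q: "0 \<le> q" "q < 1" using t R by (auto simp: q_def field_simps)
  have tR: "1 / R \<le> 1" using R by simp
  have t1: "t \<le> 1" using t tR by linarith
  have B: "B \<ge> 0" using \<xi>[unfolded coeff_bound_def, simplified, rule_format, of 0] norm_ge_zero order_trans
    by (metis power_0 mult_1_right)
  show ?thesis
  proof (rule uniform_limitI)
    fix e :: real assume e: "e > 0"
    have "(\<lambda>m. 2 * B * (q ^ m / (1 - q))) \<longlonglongrightarrow> 2 * B * (0 / (1 - q))"
      using q by (intro tendsto_mult_left tendsto_divide LIMSEQ_power_zero tendsto_const) auto
    hence "\<forall>\<^sub>F m in sequentially. 2 * B * (q ^ m / (1 - q)) < e / 2"
      by (rule order_tendstoD) (use e in simp)
    then obtain m where m: "2 * B * (q ^ m / (1 - q)) < e / 2"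
      using eventually_happens'[OF sequentially_bot] by blast
    have "(\<lambda>n. \<Sum>k<m. cmod (X n k - \<xi> k)) \<longlonglongrightarrow> (\<Sum>k<m. cmod (\<xi> k - \<xi> k))"
      by (intro tendsto_intros lim)
    hence "\<forall>\<^sub>F n in sequentially. (\<Sum>k<m. cmod (X n k - \<xi> k)) < e / 2"
      by (rule order_tendstoD) (use e in simp)
    thus "\<forall>\<^sub>F n in sequentially. \<forall>z\<in>K. dist (laurent (X n) z) (laurent \<xi> z) < e"
    proof eventually_elim
      case (elim n)
      show ?case
      proof
        fix z assume z: "z \<in> K"
        define w where "w = inverse z"
        have w: "cmod w \<le> t" using z0(2)[OF z] by (simp add: w_def t_def)
        hence wR: "cmod w < 1 / R" using t by simp
        have R0: "R > 0" using R by simp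
        have Dsum: "summable (\<lambda>k. (X n k - \<xi> k) * w ^ k)"
          using summable_diff[OF sums_summable[OF coeff_bound_sums[OF X R0 wR]] sums_summable[OF coeff_bound_sums[OF \<xi> R0 wR]]]
          by (simp add: left_diff_distrib)
        have bnd: "cmod ((X n k - \<xi> k) * w ^ k) \<le> 2 * B * q ^ k" for k
        proof -
          have "cmod (X n k - \<xi> k) \<le> B * R ^ k + B * R ^ k"
            using X[of n] \<xi> by (intro order_trans[OF norm_triangle_ineq4] add_mono) (auto simp: coeff_bound_def)
          hence "cmod ((X n k - \<xi> k) * w ^ k) \<le> (2 * B * R ^ k) * t ^ k"
            unfolding norm_mult norm_power using w t B R by (intro mult_mono power_mono) auto
          thus ?thesis by (simp add: q_def power_mult_distrib mult_ac)
        qed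
        have "laurent (X n) z - laurent \<xi> z = (\<Sum>k. (X n k - \<xi> k) * w ^ k)"
          unfolding laurent_eq w_def[symmetric] left_diff_distrib
          by (rule suminf_diff[OF sums_summable[OF coeff_bound_sums[OF X R0 wR]] sums_summable[OF coeff_bound_sums[OF \<xi> R0 wR]]])
        also have "\<dots> = (\<Sum>k. (X n (k + m) - \<xi> (k + m)) * w ^ (k + m)) + (\<Sum>k<m. (X n k - \<xi> k) * w ^ k)"
          by (rule suminf_split_initial_segment[OF Dsum])
        finally have "cmod (laurent (X n) z - laurent \<xi> z) \<le>
          cmod (\<Sum>k. (X n (k + m) - \<xi> (k + m)) * w ^ (k + m)) + cmod (\<Sum>k<m. (X n k - \<xi> k) * w ^ k)"
          by (simp add: norm_triangle_ineq)
        also have "cmod (\<Sum>k. (X n (k + m) - \<xi> (k + m)) * w ^ (k + m)) \<le> (\<Sum>k. 2 * B * q ^ (k + m))"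
          by (rule norm_suminf_le[OF bnd]) (use q in \<open>simp add: power_add summable_mult summable_mult2 summable_geometric\<close>)
        also have "(\<Sum>k. 2 * B * q ^ (k + m)) = 2 * B * (q ^ m / (1 - q))"
        proof (rule sums_unique[symmetric])
          have "(\<lambda>k. 2 * B * q ^ m * q ^ k) sums (2 * B * q ^ m * (1 / (1 - q)))"
            using q by (intro sums_mult geometric_sums) auto
          thus "(\<lambda>k. 2 * B * q ^ (k + m)) sums (2 * B * (q ^ m / (1 - q)))"
            by (simp add: power_add mult_ac)
        qed
        also have "cmod (\<Sum>k<m. (X n k - \<xi> k) * w ^ k) \<le> (\<Sum>k<m. cmod (X n k - \<xi> k))"
        proof (rule sum_norm_le)
          fix k
          have "cmod w ^ k \<le> 1" using w t1 by (intro power_le_one) auto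
          thus "cmod ((X n k - \<xi> k) * w ^ k) \<le> cmod (X n k - \<xi> k)"
            by (simp add: norm_mult norm_power mult_left_le)
        qed
        finally show "dist (laurent (X n) z) (laurent \<xi> z) < e" using m elim by (simp add: dist_norm)
      qed
    qed
  qed
qed simp

section \<open>The sum over the zeros as a function of the coefficients\<close>

definition zero_sum :: "real \<Rightarrow> (complex \<Rightarrow> real) \<Rightarrow> (nat \<Rightarrow> complex) \<Rightarrow> real" where
  "zero_sum R \<phi> \<xi> = sum_over_points (- cball 0 R) (zero_points (laurent \<xi>)) \<phi>"

definition test_fun :: "real \<Rightarrow> (complex \<Rightarrow> real) \<Rightarrow> bool" where
  "test_fun R \<phi> \<longleftrightarrow> continuous_on (- cball 0 R) \<phi> \<and>
     (\<exists>K. compact K \<and> K \<subseteq> - cball 0 R \<and> (\<forall>z\<in>- cball 0 R - K. \<phi> z = 0))"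

text \<open>Under a common coefficient bound, coordinatewise convergence is locally uniform
  convergence of the Laurent series. Without the zero sequence the limit is not identically zero, so
  the Hurwitz argument applies.\<close>

lemma continuous_on_zero_sum:
  assumes R: "R \<ge> 1" and \<phi>: "test_fun R \<phi>"
  shows "continuous_on (coeff_bound R B - {\<lambda>_. 0}) (zero_sum R \<phi>)"
  unfolding continuous_on_sequentially
proof (intro allI ballI impI)
  fix X \<xi> assume \<xi>: "\<xi> \<in> coeff_bound R B - {\<lambda>_. 0}"
    and X: "(\<forall>n. X n \<in> coeff_bound R B - {\<lambda>_. 0}) \<and> X \<longlonglongrightarrow> \<xi>"
  have R0: "R > 0" using R by simp
  obtain K where K: "compact K" "K \<subseteq> - cball 0 R" "\<And>z. z \<in> - cball 0 R - K \<Longrightarrow> \<phi> z = 0"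
    and cont: "continuous_on (- cball 0 R) \<phi>" using \<phi> unfolding test_fun_def by blast
  have coord: "(\<lambda>n. X n k) \<longlonglongrightarrow> \<xi> k" for k
  proof -
    have "continuous_on UNIV (\<lambda>x::nat \<Rightarrow> complex. x k)" by (rule continuous_on_product_coordinates)
    hence "isCont (\<lambda>x::nat \<Rightarrow> complex. x k) \<xi>"
      using continuous_on_eq_continuous_at[OF open_UNIV] by blast
    thus ?thesis by (rule isCont_tendsto_compose) (use X in blast)
  qed
  have nz: "\<exists>w\<in>- cball 0 R. laurent \<eta> w \<noteq> 0" if \<eta>: "\<eta> \<in> coeff_bound R B - {\<lambda>_. 0}" for \<eta>
  proof -
    obtain m where "\<eta> m \<noteq> 0" using \<eta> by (auto simp: fun_eq_iff)
    thus ?thesis using laurent_not_identically_zero[of \<eta> R B m] \<eta> R0 by auto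
  qed
  have "(\<lambda>n. sum_over_points (- cball 0 R) (zero_points (laurent (X n))) \<phi>) \<longlonglongrightarrow>
    sum_over_points (- cball 0 R) (zero_points (laurent \<xi>)) \<phi>"
  proof (rule sum_over_points_tendsto[OF _ connected_outside_cball])
    show "laurent \<xi> holomorphic_on - cball 0 R" "\<And>n. laurent (X n) holomorphic_on - cball 0 R"
      using \<xi> X R0 by (auto intro!: laurent_holomorphic)
    show "\<exists>w\<in>- cball 0 R. laurent \<xi> w \<noteq> 0" by (rule nz[OF \<xi>])
    show "\<exists>w\<in>- cball 0 R. laurent (X n) w \<noteq> 0" for n by (rule nz) (use X in blast)
    show "uniform_limit K' (\<lambda>n. laurent (X n)) (laurent \<xi>) sequentially" if "compact K'" "K' \<subseteq> - cball 0 R" for K'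
      by (rule laurent_uniform_limit[of X R B \<xi>, OF _ _ R coord that]) (use X \<xi> in blast)+
  qed (use K cont in auto)
  thus "(zero_sum R \<phi> \<circ> X) \<longlonglongrightarrow> zero_sum R \<phi> \<xi>" by (simp add: zero_sum_def o_def)
qed

lemma closed_coeff_bound: "closed (coeff_bound R B)"
proof -
  have "coeff_bound R B = (\<Inter>k. {\<xi>. cmod (\<xi> k) \<le> B * R ^ k})" by (auto simp: coeff_bound_def)
  moreover have "closed {\<xi> :: nat \<Rightarrow> complex. cmod (\<xi> k) \<le> B * R ^ k}" for k
    by (intro closed_Collect_le continuous_intros continuous_on_product_coordinates)
  ultimately show ?thesis by auto
qed

text \<open>Tychonoff's theorem for a product of closed discs.\<close>

lemma compact_coeff_bound: "compact (coeff_bound R B)"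
proof -
  have "coeff_bound R B = PiE UNIV (\<lambda>k. cball 0 (B * R ^ k))"
    by (auto simp: coeff_bound_def PiE_UNIV_domain)
  moreover have "compactin (product_topology (\<lambda>_. euclidean) UNIV) (PiE UNIV (\<lambda>k. cball (0::complex) (B * R ^ k)))"
    by (subst compactin_PiE) auto
  ultimately show ?thesis by (simp add: euclidean_product_topology)
qed

text \<open>Where \<open>zero_sum\<close> is meaningful: the series converges outside the disc and
  is not identically zero. The bounds run over naturals to keep the union countable.\<close>

definition tame :: "real \<Rightarrow> (nat \<Rightarrow> complex) set" where
  "tame R = (\<Union>n::nat. coeff_bound R (real n)) - {\<lambda>_. 0}"

lemma coeff_bound_mono: "B \<le> B' \<Longrightarrow> R \<ge> 0 \<Longrightarrow> coeff_bound R B \<subseteq> coeff_bound R B'"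
  by (auto simp: coeff_bound_def intro!: order_trans[OF _ mult_right_mono[of B B']])

lemma coeff_bound_subset_tame: "R \<ge> 0 \<Longrightarrow> coeff_bound R B - {\<lambda>_. 0} \<subseteq> tame R"
  using coeff_bound_mono[of B "real (nat \<lceil>B\<rceil>)" R] real_nat_ceiling_ge[of B] unfolding tame_def by blast

text \<open>\<open>tame\<close> is an increasing union of Borel sets on each of which
  \<open>zero_sum\<close> is continuous, so the truncated function is a pointwise limit of
  measurable ones.\<close>

lemma borel_measurable_zero_sum:
  assumes R: "R \<ge> 1" and \<phi>: "test_fun R \<phi>"
  shows "(\<lambda>\<xi>. indicator (tame R) \<xi> *\<^sub>R zero_sum R \<phi> \<xi>) \<in> borel_measurable borel"
proof (rule borel_measurable_LIMSEQ_metric)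
  define A where "A n = coeff_bound R (real n) - {\<lambda>_. 0}" for n
  show "(\<lambda>\<xi>. indicator (A n) \<xi> *\<^sub>R zero_sum R \<phi> \<xi>) \<in> borel_measurable borel" for n
    unfolding A_def by (intro borel_measurable_continuous_on_indicator continuous_on_zero_sum R \<phi>
        sets.Diff borel_closed closed_coeff_bound) auto
  fix \<xi> :: "nat \<Rightarrow> complex"
  show "(\<lambda>n. indicator (A n) \<xi> *\<^sub>R zero_sum R \<phi> \<xi>) \<longlonglongrightarrow> indicator (tame R) \<xi> *\<^sub>R zero_sum R \<phi> \<xi>"
  proof (cases "\<xi> \<in> tame R")
    case True
    then obtain m where m: "\<xi> \<in> A m" by (auto simp: tame_def A_def)
    have "\<xi> \<in> A n" if "n \<ge> m" for n
      using m coeff_bound_mono[of "real m" "real n" R] that R by (auto simp: A_def)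
    hence "\<forall>\<^sub>F n in sequentially. indicator (A n) \<xi> *\<^sub>R zero_sum R \<phi> \<xi> = indicator (tame R) \<xi> *\<^sub>R zero_sum R \<phi> \<xi>"
      using True by (intro eventually_sequentiallyI[of m]) simp
    thus ?thesis by (rule tendsto_eventually)
  next
    case False
    hence "\<xi> \<notin> A n" for n by (auto simp: tame_def A_def)
    thus ?thesis using False by simp
  qed
qed

text \<open>The factor is absorbed into the nonvanishing part of F at z. It will be a power of z, or
  a constant divided by the determinant of 1 - Y / z.\<close>

lemma zero_points_mult:
  assumes S: "open S" "connected S" "z \<in> S" and F: "F holomorphic_on S" "\<exists>w\<in>S. F w \<noteq> 0"
    and c: "c holomorphic_on S" "\<And>w. w \<in> S \<Longrightarrow> c w \<noteq> 0"
    and H: "\<And>w. w \<in> S \<Longrightarrow> H w = c w * F w"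
  shows "zero_points H z = zero_points F z"
proof -
  define n where "n = zorder F z"
  define g where "g = zor_poly F z"
  obtain r where r: "r > 0" "cball z r \<subseteq> S" "g holomorphic_on cball z r"
      "\<And>w. w \<in> cball z r \<Longrightarrow> F w = g w * (w - z) ^ nat n \<and> g w \<noteq> 0"
    and n: "if F z = 0 then n > 0 else n = 0"
    using zorder_exist_zero[OF F(1) S F(2)] unfolding n_def g_def by blast
  have "zorder H z = n"
  proof (rule zorder_eqI)
    show "open (ball z r)" "z \<in> ball z r" using r by auto
    have "ball z r \<subseteq> S" "ball z r \<subseteq> cball z r" using r by auto
    thus "(\<lambda>w. c w * g w) holomorphic_on ball z r"
      using r(3) c(1) by (auto intro!: holomorphic_intros intro: holomorphic_on_subset)
    show "c z * g z \<noteq> 0" using r(4)[of z] c(2)[OF S(3)] r(1) by simp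
    fix w assume w: "w \<in> ball z r" "w \<noteq> z"
    hence w': "w \<in> cball z r" "w \<in> S" using r(2) by auto
    have "(w - z) powi n = (w - z) ^ nat n" using n by (auto simp: power_int_def split: if_splits)
    thus "H w = c w * g w * (w - z) powi n" using r(4)[OF w'(1)] H[OF w'(2)] by simp
  qed
  moreover have "H z = 0 \<longleftrightarrow> F z = 0" using H c(2) S(3) by simp
  ultimately show ?thesis by (simp add: zero_points_def n_def)
qed

lemma zero_points_poly:
  fixes p :: "complex Polynomial.poly"
  assumes "p \<noteq> 0"
  shows "zero_points (Polynomial.poly p) z = Polynomial.order z p"
proof -
  obtain q where q: "p = [:- z, 1:] ^ Polynomial.order z p * q" "\<not> [:- z, 1:] dvd q"
    using order_decomp[OF assms] by blast
  have "Polynomial.poly q z \<noteq> 0" using q(2) by (simp add: poly_eq_0_iff_dvd)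
  have "zorder (Polynomial.poly p) z = int (Polynomial.order z p)"
  proof (rule zorder_eqI)
    show "Polynomial.poly q holomorphic_on UNIV" by (intro holomorphic_intros)
    show "Polynomial.poly q z \<noteq> 0" by fact
    fix w
    have "Polynomial.poly p w = Polynomial.poly ([:- z, 1:] ^ Polynomial.order z p * q) w" using q(1) by simp
    thus "Polynomial.poly p w = Polynomial.poly q w * (w - z) powi int (Polynomial.order z p)"
      by (simp add: poly_power mult.commute)
  qed auto
  moreover have "Polynomial.order z p = 0" if "Polynomial.poly p z \<noteq> 0" using that by (rule order_0I)
  ultimately show ?thesis by (auto simp: zero_points_def)
qed

section \<open>Rank-one perturbations, resolvents and eigenvalues\<close>

definition bordered :: "nat \<Rightarrow> (nat \<Rightarrow> nat \<Rightarrow> complex) \<Rightarrow> (nat \<Rightarrow> complex) \<Rightarrow> (nat \<Rightarrow> complex) \<Rightarrow> complex \<Rightarrow> complex Matrix.mat" where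
  "bordered N B x u c = Matrix.mat (Suc N) (Suc N)
     (\<lambda>(i, j). if i < N then (if j < N then B i j else x i) else (if j < N then u j else c))"

lemma bordered_carrier [simp]: "bordered N B x u c \<in> carrier_mat (Suc N) (Suc N)"
  by (simp add: bordered_def)

lemma bordered_index:
  "i < Suc N \<Longrightarrow> j < Suc N \<Longrightarrow> bordered N B x u c $$ (i, j) =
     (if i < N then (if j < N then B i j else x i) else (if j < N then u j else c))"
  by (simp add: bordered_def)

text \<open>The determinant is affine in the corner; the permutations fixing N pick the corner and
  leave a permutation of the block B.\<close>

lemma det_bordered_split:
  "det (bordered N B x u c) = det (bordered N B x u 0) + c * det (Matrix.mat N N (\<lambda>(i, j). B i j))"
proof -
  let ?P = "{p. p permutes {0..<Suc N}}"
  let ?e = "\<lambda>c i j. if i < N then (if j < N then B i j else x i) else (if j < N then u j else c)"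
  have finP: "finite ?P" by (simp add: finite_permutations)
  have det: "det (bordered N B x u c) = (\<Sum>p\<in>?P. signof p * ((\<Prod>i = 0..<N. ?e 0 i (p i)) * ?e c N (p N)))" for c
  proof -
    have "det (bordered N B x u c) = (\<Sum>p\<in>?P. signof p * (\<Prod>i = 0..<Suc N. ?e c i (p i)))"
      unfolding det_def'[OF bordered_carrier]
    proof (intro sum.cong refl arg_cong2[of _ _ _ _ "(*)"] prod.cong)
      fix p i assume p: "p \<in> ?P" "i \<in> {0..<Suc N}"
      hence "p i \<in> {0..<Suc N}" using permutes_in_image[of p "{0..<Suc N}" i] by simp
      with p show "bordered N B x u c $$ (i, p i) = ?e c i (p i)" by (simp add: bordered_index)
    qed
    also have "\<dots> = (\<Sum>p\<in>?P. signof p * ((\<Prod>i = 0..<N. ?e 0 i (p i)) * ?e c N (p N)))"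
      by (intro sum.cong refl) (simp add: prod.atLeast0_lessThan_Suc)
    finally show ?thesis .
  qed
  have sub: "{p. p permutes {0..<N}} = {p \<in> ?P. p N = N}"
  proof (rule Set.set_eqI, rule iffI)
    fix p assume "p \<in> {p. p permutes {0..<N}}"
    hence p: "p permutes {0..<N}" by simp
    have "p permutes {0..<Suc N}" by (rule permutes_subset[OF p]) auto
    thus "p \<in> {p \<in> ?P. p N = N}" using permutes_not_in[OF p, of N] by simp
  next
    fix p assume p: "p \<in> {p \<in> ?P. p N = N}"
    have "p permutes {0..<N}"
    proof (rule permutes_superset)
      show "p permutes {0..<Suc N}" using p by simp
      fix i assume "i \<in> {0..<Suc N} - {0..<N}"
      hence "i = N" by auto
      thus "p i = i" using p by simp
    qed
    thus "p \<in> {p. p permutes {0..<N}}" by simp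
  qed
  have "det (bordered N B x u c) - det (bordered N B x u 0) = (\<Sum>p\<in>?P. if p N = N then c * (signof p * (\<Prod>i = 0..<N. ?e 0 i (p i))) else 0)"
    unfolding det sum_subtractf[symmetric]
  proof (rule sum.cong[OF refl])
    fix p assume "p \<in> ?P"
    hence "p N \<in> {0..<Suc N}" using permutes_in_image[of p "{0..<Suc N}" N] by simp
    hence "p N < N \<or> p N = N" by auto
    thus "signof p * ((\<Prod>i = 0..<N. ?e 0 i (p i)) * ?e c N (p N)) - signof p * ((\<Prod>i = 0..<N. ?e 0 i (p i)) * ?e 0 N (p N))
      = (if p N = N then c * (signof p * (\<Prod>i = 0..<N. ?e 0 i (p i))) else 0)" by auto
  qed
  also have "\<dots> = (\<Sum>p\<in>{p \<in> ?P. p N = N}. c * (signof p * (\<Prod>i = 0..<N. ?e 0 i (p i))))"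
    using finP by (simp only: sum.inter_filter)
  also have "\<dots> = c * det (Matrix.mat N N (\<lambda>(i, j). B i j))"
    unfolding sub[symmetric] sum_distrib_left[symmetric] det_def'[OF mat_carrier]
  proof (intro arg_cong[of _ _ "(*) c"] sum.cong refl arg_cong2[of _ _ _ _ "(*)"] prod.cong)
    fix p i assume p: "p \<in> {p. p permutes {0..<N}}" "i \<in> {0..<N}"
    hence "p i \<in> {0..<N}" using permutes_in_image[of p "{0..<N}" i] by simp
    with p show "?e 0 i (p i) = Matrix.mat N N (\<lambda>(i, j). B i j) $$ (i, p i)" by simp
  qed
  finally show ?thesis by (simp add: algebra_simps)
qed

lemma det_bordered_zero_column: "det (bordered N B (\<lambda>_. 0) u c) = c * det (Matrix.mat N N (\<lambda>(i, j). B i j))"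
proof -
  have "det (bordered N B (\<lambda>_. 0) u 0) = 0"
    unfolding det_def'[OF bordered_carrier]
  proof (rule sum.neutral, rule ballI)
    fix p assume p: "p \<in> {p. p permutes {0..<Suc N}}"
    define i where "i = inv_into UNIV p N"
    have pi: "p i = N" using p by (simp add: i_def permutes_inverses)
    have i: "i \<in> {0..<Suc N}" using permutes_in_image[of p "{0..<Suc N}" i] p pi by simp
    have "(\<Prod>i = 0..<Suc N. bordered N B (\<lambda>_. 0) u 0 $$ (i, p i)) = 0"
      by (rule prod_zero[OF _ bexI[OF _ i]]) (use i pi in \<open>auto simp: bordered_index\<close>)
    thus "signof p * (\<Prod>i = 0..<Suc N. bordered N B (\<lambda>_. 0) u 0 $$ (i, p i)) = 0" by simp
  qed
  thus ?thesis by (subst det_bordered_split) simp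
qed

lemma det_bordered_zero_row: "det (bordered N B x (\<lambda>_. 0) c) = c * det (Matrix.mat N N (\<lambda>(i, j). B i j))"
proof -
  have "det (bordered N B x (\<lambda>_. 0) 0) = 0"
    unfolding det_def'[OF bordered_carrier]
  proof (rule sum.neutral, rule ballI)
    fix p assume p: "p \<in> {p. p permutes {0..<Suc N}}"
    have N: "N \<in> {0..<Suc N}" by simp
    have "p N \<in> {0..<Suc N}" using permutes_in_image[of p "{0..<Suc N}" N] p by simp
    hence "(\<Prod>i = 0..<Suc N. bordered N B x (\<lambda>_. 0) 0 $$ (i, p i)) = 0"
      by (intro prod_zero[OF _ bexI[OF _ N]]) (auto simp: bordered_index)
    thus "signof p * (\<Prod>i = 0..<Suc N. bordered N B x (\<lambda>_. 0) 0 $$ (i, p i)) = 0" by simp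
  qed
  thus ?thesis by (subst det_bordered_split) simp
qed

text \<open>Block multiplication. The bordered determinants below are evaluated by factoring into
  such blocks.\<close>

lemma bordered_mult:
  "bordered N B x u c * bordered N B' x' u' c' = bordered N
     (\<lambda>i j. (\<Sum>k<N. B i k * B' k j) + x i * u' j) (\<lambda>i. (\<Sum>k<N. B i k * x' k) + x i * c')
     (\<lambda>j. (\<Sum>k<N. u k * B' k j) + c * u' j) ((\<Sum>k<N. u k * x' k) + c * c')"
  by (rule eq_matI) (auto simp: bordered_def scalar_prod_def lessThan_atLeast0)

text \<open>With corner 1, elimination by the last row turns the block B into B - x u^T. The
  determinant is a product of two block triangular ones, and B may be singular.\<close>

lemma det_rank_one_update:
  "det (Matrix.mat N N (\<lambda>(i, j). B i j - x i * u j)) = det (Matrix.mat N N (\<lambda>(i, j). B i j)) + det (bordered N B x u 0)"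
proof -
  have id: "det (Matrix.mat N N (\<lambda>(i, j). of_bool (i = j) :: complex)) = 1"
  proof -
    have "Matrix.mat N N (\<lambda>(i, j). of_bool (i = j) :: complex) = 1\<^sub>m N" by (rule eq_matI) auto
    thus ?thesis by simp
  qed
  have "bordered N B x u 1 = bordered N (\<lambda>i j. of_bool (i = j)) x (\<lambda>_. 0) 1 * bordered N (\<lambda>i j. B i j - x i * u j) (\<lambda>_. 0) u 1"
    unfolding bordered_mult by (rule eq_matI) (auto simp: bordered_def)
  hence "det (bordered N B x u 1) = det (bordered N (\<lambda>i j. of_bool (i = j)) x (\<lambda>_. 0) 1) * det (bordered N (\<lambda>i j. B i j - x i * u j) (\<lambda>_. 0) u 1)"
    by (simp only: det_mult[OF bordered_carrier bordered_carrier])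
  thus ?thesis
    unfolding det_bordered_zero_column det_bordered_zero_row id by (subst (asm) det_bordered_split) (simp add: add.commute)
qed

text \<open>If B y = x, a column operation replaces the last column by one with the single nonzero
  entry -u^T y.\<close>

lemma det_bordered_solve:
  assumes "\<And>i. i < N \<Longrightarrow> (\<Sum>k<N. B i k * y k) = x i"
  shows "det (bordered N B x u 0) = - det (Matrix.mat N N (\<lambda>(i, j). B i j)) * (\<Sum>i<N. u i * y i)"
proof -
  have id: "det (Matrix.mat N N (\<lambda>(i, j). of_bool (i = j) :: complex)) = 1"
  proof -
    have "Matrix.mat N N (\<lambda>(i, j). of_bool (i = j) :: complex) = 1\<^sub>m N" by (rule eq_matI) auto
    thus ?thesis by simp
  qed
  have "bordered N B x u 0 = bordered N B (\<lambda>_. 0) u 1 * bordered N (\<lambda>i j. of_bool (i = j)) y (\<lambda>_. 0) (- (\<Sum>i<N. u i * y i))"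
    unfolding bordered_mult by (rule eq_matI) (auto simp: bordered_def assms)
  hence "det (bordered N B x u 0) = det (bordered N B (\<lambda>_. 0) u 1) * det (bordered N (\<lambda>i j. of_bool (i = j)) y (\<lambda>_. 0) (- (\<Sum>i<N. u i * y i)))"
    by (simp only: det_mult[OF bordered_carrier bordered_carrier])
  thus ?thesis unfolding det_bordered_zero_column det_bordered_zero_row id by simp
qed

lemma det_bordered_scale:
  "det (bordered N B (\<lambda>i. c * x i) u 0) = c * det (bordered N B x u 0)"
proof -
  have id: "det (Matrix.mat N N (\<lambda>(i, j). of_bool (i = j) :: complex)) = 1"
  proof -
    have "Matrix.mat N N (\<lambda>(i, j). of_bool (i = j) :: complex) = 1\<^sub>m N" by (rule eq_matI) auto
    thus ?thesis by simp
  qed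
  have "bordered N B (\<lambda>i. c * x i) u 0 = bordered N B x u 0 * bordered N (\<lambda>i j. of_bool (i = j)) (\<lambda>_. 0) (\<lambda>_. 0) c"
    unfolding bordered_mult by (rule eq_matI) (auto simp: bordered_def)
  hence "det (bordered N B (\<lambda>i. c * x i) u 0) = det (bordered N B x u 0) * det (bordered N (\<lambda>i j. of_bool (i = j)) (\<lambda>_. 0) (\<lambda>_. 0) c)"
    by (simp only: det_mult[OF bordered_carrier bordered_carrier])
  thus ?thesis unfolding det_bordered_zero_column id by simp
qed

section \<open>Characteristic polynomials and the resolvent series\<close>

lemma poly_char_poly_eq:
  fixes A :: "complex Matrix.mat"
  assumes A: "A \<in> carrier_mat N N" and z: "z \<noteq> 0"
  shows "Polynomial.poly (char_poly A) z = z ^ N * det (Matrix.mat N N (\<lambda>(i, j). of_bool (i = j) - inverse z * A $$ (i, j)))"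
proof -
  have "- char_matrix A z = z \<cdot>\<^sub>m Matrix.mat N N (\<lambda>(i, j). of_bool (i = j) - inverse z * A $$ (i, j))"
    using A z by (intro eq_matI) (auto simp: char_matrix_def field_simps)
  thus ?thesis by (simp add: char_poly_matrix[OF A])
qed

text \<open>The coefficient of \<open>w\<^sup>k\<close> in \<open>det (1 - w (Y + \<theta> v u\<^sup>T))\<close>.\<close>

definition char_coeff :: "(nat \<Rightarrow> nat \<Rightarrow> complex) \<Rightarrow> (nat \<Rightarrow> complex) \<Rightarrow> (nat \<Rightarrow> complex) \<Rightarrow> complex \<Rightarrow> nat \<Rightarrow> nat \<Rightarrow> complex" where
  "char_coeff y u v \<theta> N k = det_coeff y N k + \<theta> * (if k = 0 then 0 else bordered_coeff y u v N (k - 1))"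

lemma det_coeff_eq_0: "k > N \<Longrightarrow> det_coeff y N k = 0"
proof -
  assume "k > N"
  have "perm_pairs N k = {}"
  proof (rule ccontr)
    assume "perm_pairs N k \<noteq> {}"
    then obtain T where "T \<subseteq> {..<N}" "card T = k" by (auto simp: perm_pairs_def)
    thus False using card_mono[of "{..<N}" T] \<open>k > N\<close> by simp
  qed
  thus ?thesis by (simp add: det_coeff_def)
qed

lemma bordered_coeff_eq_0: "k > Suc N \<Longrightarrow> bordered_coeff y u v N k = 0"
proof -
  assume "k > Suc N"
  have "{T. T \<subseteq> {..<Suc N} \<and> card T = k} = {}"
  proof (rule ccontr)
    assume "{T. T \<subseteq> {..<Suc N} \<and> card T = k} \<noteq> {}"
    then obtain T where "T \<subseteq> {..<Suc N}" "card T = k" by auto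
    thus False using card_mono[of "{..<Suc N}" T] \<open>k > Suc N\<close> by simp
  qed
  thus ?thesis unfolding bordered_coeff_def by (simp only: Sigma_empty1 sum.empty)
qed

lemma det_coeff_0: "det_coeff y N 0 = 1"
proof -
  have "perm_pairs N 0 = {({}, id)}"
    using finite_subset[OF _ finite_lessThan[of N]] by (auto simp: perm_pairs_def)
  thus ?thesis by (simp add: det_coeff_def)
qed

lemma char_coeff_0: "char_coeff y u v \<theta> N 0 = 1"
  by (simp add: char_coeff_def det_coeff_0)

lemma char_coeff_eq_0: "k > Suc (Suc N) \<Longrightarrow> char_coeff y u v \<theta> N k = 0"
  by (simp add: char_coeff_def det_coeff_eq_0 bordered_coeff_eq_0)

lemma sum_char_coeff:
  "(\<Sum>k\<le>Suc (Suc N). char_coeff y u v \<theta> N k * w ^ k) =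
     (\<Sum>k\<le>N. w ^ k * det_coeff y N k) + w * \<theta> * (\<Sum>k\<le>Suc N. w ^ k * bordered_coeff y u v N k)"
proof -
  have 1: "(\<Sum>k\<le>Suc (Suc N). det_coeff y N k * w ^ k) = (\<Sum>k\<le>N. w ^ k * det_coeff y N k)"
    by (simp add: det_coeff_eq_0 mult.commute)
  have 2: "(\<Sum>k\<le>Suc (Suc N). \<theta> * (if k = 0 then 0 else bordered_coeff y u v N (k - 1)) * w ^ k)
      = w * \<theta> * (\<Sum>k\<le>Suc N. w ^ k * bordered_coeff y u v N k)"
    by (subst sum.atMost_Suc_shift) (simp add: mult_ac sum_distrib_left distrib_left)
  show ?thesis unfolding char_coeff_def distrib_right sum.distrib 1 2 ..
qed

lemma det_bordered_mat_eq:
  "det (bordered N (\<lambda>i j. of_bool (i = j) + w * - y i j) v u 0) = (\<Sum>k\<le>Suc N. w ^ k * bordered_coeff y u v N k)"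
proof -
  have "bordered N (\<lambda>i j. of_bool (i = j) + w * - y i j) v u 0 =
    Matrix.mat (Suc N) (Suc N) (\<lambda>(i, j). bordered_const u v N i j + w * bordered_lin y N i j)"
    by (rule eq_matI) (auto simp: bordered_def bordered_const_def bordered_lin_def)
  thus ?thesis by (simp only: det_bordered_expansion)
qed

text \<open>With w = 1 / z the matrix is 1 - w Y minus the rank-one matrix built from
  \<open>w * \<theta> * v\<close> and u, and the update formula splits its determinant.\<close>

lemma poly_char_poly_deformed:
  fixes A :: "complex Matrix.mat"
  assumes A: "A \<in> carrier_mat N N" and z: "z \<noteq> 0"
    and entries: "\<And>i j. i < N \<Longrightarrow> j < N \<Longrightarrow> A $$ (i, j) = \<theta> * v i * u j + y i j"
  shows "Polynomial.poly (char_poly A) z = z ^ N * (\<Sum>k\<le>Suc (Suc N). char_coeff y u v \<theta> N k * inverse z ^ k)"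
proof -
  define w where "w = inverse z"
  have "Matrix.mat N N (\<lambda>(i, j). of_bool (i = j) - w * A $$ (i, j)) =
      Matrix.mat N N (\<lambda>(i, j). (of_bool (i = j) + w * - y i j) - ((w * \<theta>) * v i) * u j)"
    by (rule eq_matI) (auto simp: entries algebra_simps)
  hence "det (Matrix.mat N N (\<lambda>(i, j). of_bool (i = j) - w * A $$ (i, j))) =
      (\<Sum>k\<le>N. w ^ k * det_coeff y N k) + w * \<theta> * (\<Sum>k\<le>Suc N. w ^ k * bordered_coeff y u v N k)"
    by (simp only: det_rank_one_update det_bordered_scale det_one_minus_expansion det_bordered_mat_eq)
  thus ?thesis unfolding poly_char_poly_eq[OF A z] w_def[symmetric] sum_char_coeff by simp
qed

text \<open>The coordinates of Y^k v.\<close>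

primrec mat_iter :: "(nat \<Rightarrow> nat \<Rightarrow> complex) \<Rightarrow> nat \<Rightarrow> (nat \<Rightarrow> complex) \<Rightarrow> nat \<Rightarrow> nat \<Rightarrow> complex" where
  "mat_iter y N v 0 i = v i"
| "mat_iter y N v (Suc k) i = (\<Sum>j<N. y i j * mat_iter y N v k j)"

text \<open>Near \<open>w = 0\<close> the bordered determinant is \<open>- det (1 - w Y)\<close> times the resolvent series
  \<open>\<Sum>k. w\<^sup>k u\<^sup>T Y\<^sup>k v\<close>.\<close>

lemma bordered_resolvent:
  fixes y :: "nat \<Rightarrow> nat \<Rightarrow> complex"
  obtains r where "r > 0" "\<And>w. cmod w < r \<Longrightarrow> (\<lambda>k. (\<Sum>i<N. u i * mat_iter y N v k i) * w ^ k) sums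
      (\<Sum>k. (\<Sum>i<N. u i * mat_iter y N v k i) * w ^ k)"
    "\<And>w. cmod w < r \<Longrightarrow> (\<Sum>k\<le>Suc N. w ^ k * bordered_coeff y u v N k) =
      - (\<Sum>k\<le>N. w ^ k * det_coeff y N k) * (\<Sum>k. (\<Sum>i<N. u i * mat_iter y N v k i) * w ^ k)"
proof -
  \<comment> \<open>An upper bound for all row sums of |y|, so the Neumann series converges for |w|
    < 1 / a; the summand 1 makes it positive.\<close>
  define a where "a = 1 + (\<Sum>i<N. \<Sum>j<N. cmod (y i j))"
  define V where "V = (\<Sum>i<N. cmod (v i))"
  have a: "a > 0" unfolding a_def by (intro add_pos_nonneg sum_nonneg) auto
  have V: "V \<ge> 0" by (simp add: V_def sum_nonneg)
  have row: "(\<Sum>j<N. cmod (y i j)) \<le> a" if "i < N" for i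
  proof -
    have "(\<Sum>j<N. cmod (y i j)) \<le> (\<Sum>i<N. \<Sum>j<N. cmod (y i j))"
      by (rule member_le_sum) (use that in \<open>auto intro: sum_nonneg\<close>)
    thus ?thesis by (simp add: a_def)
  qed
  have bound: "cmod (mat_iter y N v k i) \<le> a ^ k * V" if "i < N" for k i
    using that
  proof (induction k arbitrary: i)
    case 0
    have "cmod (v i) \<le> V" unfolding V_def by (rule member_le_sum) (use 0 in auto)
    thus ?case by simp
  next
    case (Suc k)
    have "cmod (mat_iter y N v (Suc k) i) \<le> (\<Sum>j<N. cmod (y i j) * (a ^ k * V))"
      unfolding mat_iter.simps
      by (rule sum_norm_le) (use Suc.IH in \<open>auto simp: norm_mult intro!: mult_left_mono\<close>)
    also have "\<dots> = (\<Sum>j<N. cmod (y i j)) * (a ^ k * V)" by (simp add: sum_distrib_right)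
    also have "\<dots> \<le> a * (a ^ k * V)" using row[OF Suc.prems] a V by (intro mult_right_mono) auto
    finally show ?case by (simp add: mult_ac)
  qed
  have sums: "(\<lambda>k. mat_iter y N v k i * w ^ k) sums (\<Sum>k. mat_iter y N v k i * w ^ k)"
    if "i < N" "cmod w < 1 / a" for i w
  proof (rule summable_sums, rule summable_norm_cancel, rule summable_comparison_test')
    show "summable (\<lambda>k. V * (a * cmod w) ^ k)"
      using that a by (intro summable_mult summable_geometric) (simp add: field_simps)
    fix k
    have "cmod (mat_iter y N v k i * w ^ k) \<le> (a ^ k * V) * cmod w ^ k"
      unfolding norm_mult norm_power by (intro mult_right_mono bound that) auto
    thus "norm (norm (mat_iter y N v k i * w ^ k)) \<le> V * (a * cmod w) ^ k"
      by (simp add: power_mult_distrib mult_ac)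
  qed
  show ?thesis
  proof (rule that[of "1 / a"])
    show "1 / a > 0" using a by simp
    fix w assume w: "cmod w < 1 / a"
    define x where "x i = (\<Sum>k. mat_iter y N v k i * w ^ k)" for i
    have xs: "(\<lambda>k. mat_iter y N v k i * w ^ k) sums x i" if "i < N" for i
      unfolding x_def by (rule sums[OF that w])
    have us: "(\<lambda>k. (\<Sum>i<N. u i * mat_iter y N v k i) * w ^ k) sums (\<Sum>i<N. u i * x i)"
    proof -
      have "(\<lambda>k. \<Sum>i<N. u i * (mat_iter y N v k i * w ^ k)) sums (\<Sum>i<N. u i * x i)"
        by (intro sums_sum sums_mult xs) auto
      thus ?thesis by (simp add: sum_distrib_right mult.assoc)
    qed
    thus us': "(\<lambda>k. (\<Sum>i<N. u i * mat_iter y N v k i) * w ^ k) sums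
      (\<Sum>k. (\<Sum>i<N. u i * mat_iter y N v k i) * w ^ k)" by (simp add: sums_iff)
    \<comment> \<open>The vector x, the sum of w^k Y^k v, solves (1 - w Y) x = v, which is the input
      of \<open>det_bordered_solve\<close>.\<close>
    have solve: "(\<Sum>k<N. (of_bool (i = k) + w * - y i k) * x k) = v i" if i: "i < N" for i
    proof -
      have "(\<lambda>k. \<Sum>j<N. y i j * (mat_iter y N v k j * w ^ k)) sums (\<Sum>j<N. y i j * x j)"
        by (intro sums_sum sums_mult xs) auto
      hence "(\<lambda>k. w * (\<Sum>j<N. y i j * (mat_iter y N v k j * w ^ k))) sums (w * (\<Sum>j<N. y i j * x j))"
        by (rule sums_mult)
      hence "(\<lambda>k. mat_iter y N v (Suc k) i * w ^ Suc k) sums (w * (\<Sum>j<N. y i j * x j))"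
        by (simp add: sum_distrib_left sum_distrib_right mult_ac)
      hence "(\<lambda>k. mat_iter y N v k i * w ^ k) sums (w * (\<Sum>j<N. y i j * x j) + v i)"
        by (subst (asm) sums_Suc_iff) simp
      hence "x i = w * (\<Sum>j<N. y i j * x j) + v i" using xs[OF i] sums_unique2 by blast
      moreover have "(\<Sum>k<N. (of_bool (i = k) + w * - y i k) * x k) = x i - w * (\<Sum>j<N. y i j * x j)"
      proof -
        have "(\<Sum>k<N. of_bool (i = k) * x k) = x i"
          using i by (subst sum.mono_neutral_right[of _ "{i}"]) auto
        moreover have "(\<Sum>k<N. (of_bool (i = k) + w * - y i k) * x k)
            = (\<Sum>k<N. of_bool (i = k) * x k) - w * (\<Sum>j<N. y i j * x j)"
          by (simp only: distrib_right sum.distrib sum_distrib_left) (simp add: sum_negf mult.assoc)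
        ultimately show ?thesis by simp
      qed
      ultimately show ?thesis by simp
    qed
    have "(\<Sum>k\<le>Suc N. w ^ k * bordered_coeff y u v N k) = - (\<Sum>k\<le>N. w ^ k * det_coeff y N k) * (\<Sum>i<N. u i * x i)"
      unfolding det_bordered_mat_eq[symmetric] det_one_minus_expansion[symmetric] by (rule det_bordered_solve[OF solve])
    thus "(\<Sum>k\<le>Suc N. w ^ k * bordered_coeff y u v N k) =
      - (\<Sum>k\<le>N. w ^ k * det_coeff y N k) * (\<Sum>k. (\<Sum>i<N. u i * mat_iter y N v k i) * w ^ k)"
      using us by (simp add: sums_iff)
  qed
qed

section \<open>Traces of powers and eigenvalues\<close>

definition mat_trace :: "complex Matrix.mat \<Rightarrow> complex" where
  "mat_trace A = (\<Sum>i<dim_row A. A $$ (i, i))"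

lemma mat_trace_comm:
  assumes "A \<in> carrier_mat n n" "B \<in> carrier_mat n n"
  shows "mat_trace (A * B) = mat_trace (B * A)"
proof -
  have "mat_trace (A * B) = (\<Sum>i<n. \<Sum>k<n. A $$ (i, k) * B $$ (k, i))"
    using assms by (auto simp: mat_trace_def scalar_prod_def lessThan_atLeast0 intro!: sum.cong)
  also have "\<dots> = (\<Sum>k<n. \<Sum>i<n. A $$ (i, k) * B $$ (k, i))" by (rule sum.swap)
  also have "\<dots> = mat_trace (B * A)"
    using assms by (auto simp: mat_trace_def scalar_prod_def lessThan_atLeast0 mult.commute intro!: sum.cong)
  finally show ?thesis .
qed

lemma upper_triangular_power:
  fixes B :: "complex Matrix.mat"
  assumes B: "B \<in> carrier_mat n n" and ut: "upper_triangular B"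
  shows "(\<forall>i<n. \<forall>j<i. (B ^\<^sub>m k) $$ (i, j) = 0) \<and> (\<forall>i<n. (B ^\<^sub>m k) $$ (i, i) = (B $$ (i, i)) ^ k)"
proof (induction k)
  case 0 thus ?case using B by auto
next
  case (Suc k)
  have Bk: "B ^\<^sub>m k \<in> carrier_mat n n" using B by (rule pow_carrier_mat)
  have e: "(B ^\<^sub>m Suc k) $$ (i, j) = (\<Sum>l<n. (B ^\<^sub>m k) $$ (i, l) * B $$ (l, j))" if "i < n" "j < n" for i j
    using that B Bk by (simp add: scalar_prod_def lessThan_atLeast0)
  have z: "B $$ (l, j) = 0" if "j < l" "l < n" for l j using ut B that by auto
  show ?case
  proof (intro conjI allI impI)
    fix i j assume ij: "i < n" "j < i"
    have "(\<Sum>l<n. (B ^\<^sub>m k) $$ (i, l) * B $$ (l, j)) = 0"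
    proof (rule sum.neutral, rule ballI)
      fix l assume "l \<in> {..<n}"
      thus "(B ^\<^sub>m k) $$ (i, l) * B $$ (l, j) = 0"
        using Suc ij z[of j l] by (cases "l < i") auto
    qed
    thus "(B ^\<^sub>m Suc k) $$ (i, j) = 0" using e[of i j] ij by simp
  next
    fix i assume i: "i < n"
    have "(\<Sum>l<n. (B ^\<^sub>m k) $$ (i, l) * B $$ (l, i)) = (\<Sum>l\<in>{i}. (B ^\<^sub>m k) $$ (i, l) * B $$ (l, i))"
    proof (rule sum.mono_neutral_right)
      show "\<forall>l\<in>{..<n} - {i}. (B ^\<^sub>m k) $$ (i, l) * B $$ (l, i) = 0"
      proof
        fix l assume "l \<in> {..<n} - {i}"
        thus "(B ^\<^sub>m k) $$ (i, l) * B $$ (l, i) = 0"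
          using Suc i z[of i l] by (cases "l < i") auto
      qed
    qed (use i in auto)
    thus "(B ^\<^sub>m Suc k) $$ (i, i) = (B $$ (i, i)) ^ Suc k" using e[OF i i] Suc i by simp
  qed
qed

text \<open>By Schur's theorem the matrix is similar to a triangular one, whose powers carry the
  powers of the eigenvalues on the diagonal.\<close>

lemma mat_trace_power_eigenvalues:
  fixes A :: "complex Matrix.mat"
  assumes A: "A \<in> carrier_mat n n" and as: "char_poly A = (\<Prod>a\<leftarrow>as. [:- a, 1:])"
  shows "mat_trace (A ^\<^sub>m k) = (\<Sum>a\<leftarrow>as. a ^ k)"
proof -
  obtain B P Q where "schur_decomposition A as = (B, P, Q)" by (metis prod_cases3)
  from schur_decomposition[OF A as this] have sim: "similar_mat_wit A B P Q"
    and ut: "upper_triangular B" and diag: "diag_mat B = as" by auto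
  note S = similar_mat_witD2[OF A sim]
  have Bk: "B ^\<^sub>m k \<in> carrier_mat n n" using S(5) by (rule pow_carrier_mat)
  have "A ^\<^sub>m k = P * B ^\<^sub>m k * Q" by (rule similar_mat_wit_pow_id[OF sim])
  hence "mat_trace (A ^\<^sub>m k) = mat_trace (Q * (P * B ^\<^sub>m k))"
    using mat_trace_comm[of "P * B ^\<^sub>m k" n Q] S Bk by auto
  also have "Q * (P * B ^\<^sub>m k) = (Q * P) * B ^\<^sub>m k"
    by (rule assoc_mult_mat[OF S(7) S(6) Bk, symmetric])
  also have "\<dots> = B ^\<^sub>m k" using S Bk by simp
  also have "mat_trace (B ^\<^sub>m k) = (\<Sum>i<n. (B $$ (i, i)) ^ k)"
    using upper_triangular_power[OF S(5) ut, of k] S(5) by (simp add: mat_trace_def)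
  also have "\<dots> = (\<Sum>a\<leftarrow>diag_mat B. a ^ k)"
    using S(5) by (simp add: diag_mat_def o_def interv_sum_list_conv_sum_set_nat lessThan_atLeast0)
  finally show ?thesis by (simp add: diag)
qed

text \<open>The closing factor W is arbitrary so that the induction can absorb the last step of the
  walk into it, replacing W by A W.\<close>

lemma closed_walk_sum:
  fixes y :: "nat \<Rightarrow> nat \<Rightarrow> complex" and N :: nat
  defines "A \<equiv> Matrix.mat N N (\<lambda>(i, j). y i j)"
  assumes "W \<in> carrier_mat N N"
  shows "(\<Sum>f\<in>{..k} \<rightarrow>\<^sub>E {..<N}. (\<Prod>a<k. y (f a) (f (Suc a))) * W $$ (f k, f 0)) = mat_trace (A ^\<^sub>m k * W)"
  using assms(2)
proof (induction k arbitrary: W)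
  case 0
  have "(\<Sum>f\<in>{..0::nat} \<rightarrow>\<^sub>E {..<N}. W $$ (f 0, f 0)) = (\<Sum>f\<in>insert (0::nat) {} \<rightarrow>\<^sub>E {..<N}. W $$ (f 0, f 0))"
    by (simp only: atMost_0)
  also have "\<dots> = (\<Sum>i<N. W $$ (i, i))" by (subst sum_PiE_insert) auto
  also have "\<dots> = mat_trace (A ^\<^sub>m 0 * W)" using 0 by (simp add: A_def mat_trace_def)
  finally show ?case by simp
next
  case (Suc k)
  have A: "A \<in> carrier_mat N N" by (simp add: A_def)
  have AW: "A * W \<in> carrier_mat N N" using A Suc.prems by simp
  have "{..Suc k} = insert (Suc k) {..k}" by auto
  hence "(\<Sum>f\<in>{..Suc k} \<rightarrow>\<^sub>E {..<N}. (\<Prod>a<Suc k. y (f a) (f (Suc a))) * W $$ (f (Suc k), f 0))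
      = (\<Sum>j<N. \<Sum>f\<in>{..k} \<rightarrow>\<^sub>E {..<N}. (\<Prod>a<Suc k. y ((f(Suc k := j)) a) ((f(Suc k := j)) (Suc a))) * W $$ ((f(Suc k := j)) (Suc k), (f(Suc k := j)) 0))"
    by (simp only: sum_PiE_insert[of "Suc k" "{..k}"] atMost_iff Suc_n_not_le_n not_False_eq_True)
  also have "\<dots> = (\<Sum>j<N. \<Sum>f\<in>{..k} \<rightarrow>\<^sub>E {..<N}. (\<Prod>a<k. y (f a) (f (Suc a))) * (y (f k) j * W $$ (j, f 0)))"
  proof (intro sum.cong refl)
    fix j f
    have "(\<Prod>a<k. y ((f(Suc k := j)) a) ((f(Suc k := j)) (Suc a))) = (\<Prod>a<k. y (f a) (f (Suc a)))"
      by (rule prod.cong) auto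
    thus "(\<Prod>a<Suc k. y ((f(Suc k := j)) a) ((f(Suc k := j)) (Suc a))) * W $$ ((f(Suc k := j)) (Suc k), (f(Suc k := j)) 0)
      = (\<Prod>a<k. y (f a) (f (Suc a))) * (y (f k) j * W $$ (j, f 0))" by (simp add: mult.assoc)
  qed
  also have "\<dots> = (\<Sum>f\<in>{..k} \<rightarrow>\<^sub>E {..<N}. (\<Prod>a<k. y (f a) (f (Suc a))) * (\<Sum>j<N. y (f k) j * W $$ (j, f 0)))"
    by (subst sum.swap) (simp add: sum_distrib_left)
  also have "\<dots> = (\<Sum>f\<in>{..k} \<rightarrow>\<^sub>E {..<N}. (\<Prod>a<k. y (f a) (f (Suc a))) * (A * W) $$ (f k, f 0))"
  proof (intro sum.cong refl arg_cong2[of _ _ _ _ "(*)"])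
    fix f assume f: "f \<in> {..k} \<rightarrow>\<^sub>E {..<N}"
    have "f k < N" "f 0 < N" using f by auto
    thus "(\<Sum>j<N. y (f k) j * W $$ (j, f 0)) = (A * W) $$ (f k, f 0)"
      using Suc.prems by (simp add: A_def scalar_prod_def lessThan_atLeast0)
  qed
  also have "\<dots> = mat_trace (A ^\<^sub>m k * (A * W))" by (rule Suc.IH[OF AW])
  also have "A ^\<^sub>m k * (A * W) = A ^\<^sub>m Suc k * W"
    unfolding pow_mat.simps by (rule assoc_mult_mat[OF pow_carrier_mat[OF A] A Suc.prems, symmetric])
  finally show ?case .
qed

lemma closed_walk_sum_cyclic:
  fixes y :: "nat \<Rightarrow> nat \<Rightarrow> complex"
  assumes k: "k \<ge> 1"
  shows "(\<Sum>f\<in>{..<k} \<rightarrow>\<^sub>E {..<N}. \<Prod>a<k. y (f a) (f (Suc a mod k))) = mat_trace (Matrix.mat N N (\<lambda>(i, j). y i j) ^\<^sub>m k)"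
proof -
  obtain m where m: "k = Suc m" using k by (cases k) auto
  let ?A = "Matrix.mat N N (\<lambda>(i, j). y i j)"
  have "(\<Sum>f\<in>{..<k} \<rightarrow>\<^sub>E {..<N}. \<Prod>a<k. y (f a) (f (Suc a mod k)))
      = (\<Sum>f\<in>{..m} \<rightarrow>\<^sub>E {..<N}. (\<Prod>a<m. y (f a) (f (Suc a))) * ?A $$ (f m, f 0))"
  proof (rule sum.cong)
    fix f assume f: "f \<in> {..m} \<rightarrow>\<^sub>E {..<N}"
    have "(\<Prod>a<m. y (f a) (f (Suc a mod Suc m))) = (\<Prod>a<m. y (f a) (f (Suc a)))"
      by (rule prod.cong) auto
    moreover have "f m < N" "f 0 < N" using f by auto
    ultimately show "(\<Prod>a<k. y (f a) (f (Suc a mod k))) = (\<Prod>a<m. y (f a) (f (Suc a))) * ?A $$ (f m, f 0)"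
      by (simp add: m)
  qed (simp add: m lessThan_Suc_atMost)
  also have "\<dots> = mat_trace (?A ^\<^sub>m m * ?A)" by (rule closed_walk_sum) simp
  finally show ?thesis by (simp add: m)
qed

text \<open>One list of eigenvalues serves both the determinant and the power sums; this is what
  turns the determinant times the exponential of traces into a product of Weierstrass
  factors.\<close>

lemma det_one_minus_eigenvalues:
  fixes y :: "nat \<Rightarrow> nat \<Rightarrow> complex"
  obtains as where "length as = N"
    "\<And>w. (\<Sum>k\<le>N. w ^ k * det_coeff y N k) = (\<Prod>a\<leftarrow>as. 1 - w * a)"
    "\<And>k. k \<ge> 1 \<Longrightarrow> (\<Sum>f\<in>{..<k} \<rightarrow>\<^sub>E {..<N}. \<Prod>a<k. y (f a) (f (Suc a mod k))) = (\<Sum>a\<leftarrow>as. a ^ k)"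
proof -
  let ?A = "Matrix.mat N N (\<lambda>(i, j). y i j)"
  have A: "?A \<in> carrier_mat N N" by simp
  obtain as where as: "char_poly ?A = (\<Prod>a\<leftarrow>as. [:- a, 1:])" "length as = N"
    using char_poly_factorized[OF A] by blast
  show ?thesis
  proof (rule that[OF as(2)])
    fix w :: complex
    have prod: "Polynomial.poly (\<Prod>a\<leftarrow>bs. [:- a, 1:]) z = (\<Prod>a\<leftarrow>bs. z - a)" for bs and z :: complex
      by (induction bs) (auto simp: left_diff_distrib)
    have prod2: "w ^ length bs * (\<Prod>a\<leftarrow>bs. inverse w - a) = (\<Prod>a\<leftarrow>bs. 1 - w * a)" if "w \<noteq> 0" for bs
      using that by (induction bs) (auto simp: field_simps)
    show "(\<Sum>k\<le>N. w ^ k * det_coeff y N k) = (\<Prod>a\<leftarrow>as. 1 - w * a)"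
    proof (cases "w = 0")
      case True
      have "(\<Prod>a\<leftarrow>bs. 1 - w * a) = 1" for bs using True by (induction bs) auto
      moreover have "(\<Sum>k\<le>N. w ^ k * det_coeff y N k) = 1"
        using True by (subst sum.mono_neutral_right[of _ "{0}"]) (auto simp: det_coeff_0)
      ultimately show ?thesis by simp
    next
      case False
      hence iz: "inverse w \<noteq> 0" by simp
      have "Matrix.mat N N (\<lambda>(i, j). of_bool (i = j) - inverse (inverse w) * ?A $$ (i, j)) =
          Matrix.mat N N (\<lambda>(i, j). of_bool (i = j) + w * - y i j)" by (rule eq_matI) auto
      hence "Polynomial.poly (char_poly ?A) (inverse w) = inverse w ^ N * (\<Sum>k\<le>N. w ^ k * det_coeff y N k)"
        by (simp only: poly_char_poly_eq[OF A iz] det_one_minus_expansion)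
      hence "(\<Sum>k\<le>N. w ^ k * det_coeff y N k) = w ^ N * Polynomial.poly (char_poly ?A) (inverse w)"
        using False by (simp add: field_simps)
      also have "\<dots> = (\<Prod>a\<leftarrow>as. 1 - w * a)" using prod2[OF False, of as] by (simp add: as prod)
      finally show ?thesis .
    qed
  next
    fix k :: nat assume "k \<ge> 1"
    thus "(\<Sum>f\<in>{..<k} \<rightarrow>\<^sub>E {..<N}. \<Prod>a<k. y (f a) (f (Suc a mod k))) = (\<Sum>a\<leftarrow>as. a ^ k)"
      by (simp only: closed_walk_sum_cyclic mat_trace_power_eigenvalues[OF A as(1)])
  qed
qed

section \<open>Lower bounds for characteristic polynomials\<close>

lemma powser_coeffs_unique:
  fixes a b :: "nat \<Rightarrow> complex"
  assumes r: "r > 0" and a: "\<And>w. cmod w < r \<Longrightarrow> (\<lambda>n. a n * w ^ n) sums f w"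
    and b: "\<And>w. cmod w < r \<Longrightarrow> (\<lambda>n. b n * w ^ n) sums f w"
  shows "a = b"
proof (rule ccontr)
  assume "a \<noteq> b"
  then obtain m where m: "a m \<noteq> b m" by auto
  have d: "(\<lambda>n. (a n - b n) * w ^ n) sums 0" if "cmod w < r" for w
    using sums_diff[OF a[OF that] b[OF that]] by (simp add: left_diff_distrib)
  \<comment> \<open>Shifted by a factor w, the difference of the series vanishes at 0; a nonzero
    coefficient would make that zero isolated.\<close>
  have s: "(\<lambda>n. (if n = 0 then 0 else a (n - 1) - b (n - 1)) * (w - 0) ^ n) sums 0" if w: "norm (w - 0) < r" for w
  proof -
    have "(\<lambda>n. w * ((a n - b n) * w ^ n)) sums (w * 0)"
      by (rule sums_mult[OF d]) (use w in simp)
    hence "(\<lambda>n. (if Suc n = 0 then 0 else a (Suc n - 1) - b (Suc n - 1)) * w ^ Suc n) sums 0"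
      by (simp add: mult_ac)
    from sums_Suc_iff[THEN iffD1, OF this] show ?thesis by simp
  qed
  have *: "thesis" if "\<And>s. 0 < s \<Longrightarrow> (\<And>z::complex. z \<in> cball 0 s - {0} \<Longrightarrow> False) \<Longrightarrow> thesis" for thesis
    by (rule powser_0_nonzero[of r 0 "\<lambda>n. if n = 0 then 0 else a (n - 1) - b (n - 1)" "\<lambda>_. 0" "Suc m", OF r s])
      (use m that in auto)
  show False
  proof (rule *)
    fix s :: real assume s: "0 < s" "\<And>z::complex. z \<in> cball 0 s - {0} \<Longrightarrow> False"
    show False by (rule s(2)[of "of_real s"]) (use s(1) in simp)
  qed
qed

text \<open>Only the order of vanishing at 0 is of interest, so C and s may depend on the
  list.\<close>

lemma prod_weierstrass_factor_near_1:
  fixes as :: "complex list"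
  shows "\<exists>C s. s > 0 \<and> s \<le> 1 \<and> C \<ge> 0 \<and> (\<forall>w. cmod w \<le> s \<longrightarrow>
    cmod ((\<Prod>a\<leftarrow>as. weierstrass_factor m (w * a)) - 1) \<le> C * cmod w ^ Suc m)"
proof (induction as)
  case Nil
  show ?case by (intro exI[of _ 0] exI[of _ 1]) auto
next
  case (Cons a as)
  then obtain C s where Cs: "s > 0" "s \<le> 1" "C \<ge> 0"
    "\<And>w. cmod w \<le> s \<Longrightarrow> cmod ((\<Prod>a\<leftarrow>as. weierstrass_factor m (w * a)) - 1) \<le> C * cmod w ^ Suc m" by blast
  \<comment> \<open>Keeps |w a| at most 1/2, the range of
    \<open>weierstrass_factor_bound\<close>.\<close>
  define s' where "s' = min s (1 / (2 * (cmod a + 1)))"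
  define C' where "C' = 3 * cmod a ^ Suc m * (1 + C) + C"
  have s': "s' > 0" "s' \<le> s" "s' * cmod a \<le> 1 / 2"
  proof -
    have "cmod a + 1 > 0" using norm_ge_zero[of a] by linarith
    thus "s' > 0" "s' \<le> s" using Cs by (auto simp: s'_def)
    have "s' * cmod a \<le> (1 / (2 * (cmod a + 1))) * cmod a" by (intro mult_right_mono) (auto simp: s'_def)
    also have "\<dots> \<le> 1 / 2" using \<open>cmod a + 1 > 0\<close> by (simp add: field_simps)
    finally show "s' * cmod a \<le> 1 / 2" .
  qed
  show ?case
  proof (rule exI[of _ C'], rule exI[of _ s'], intro conjI allI impI)
    show "s' > 0" "s' \<le> 1" using s' Cs by auto
    show "C' \<ge> 0" using Cs by (simp add: C'_def)
    fix w assume w: "cmod w \<le> s'"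
    define E where "E = weierstrass_factor m (w * a)"
    define Q where "Q = (\<Prod>a\<leftarrow>as. weierstrass_factor m (w * a))"
    have "cmod (w * a) \<le> 1 / 2"
      using w s'(3) mult_right_mono[OF w, of "cmod a"] by (simp add: norm_mult)
    hence E: "cmod (E - 1) \<le> 3 * cmod (w * a) ^ Suc m"
      unfolding E_def by (rule weierstrass_factor_bound)
    have Q: "cmod (Q - 1) \<le> C * cmod w ^ Suc m" unfolding Q_def using w s' by (intro Cs(4)) simp
    have "cmod w ^ Suc m \<le> 1" using w s' Cs by (intro power_le_one) auto
    hence "cmod (Q - 1) \<le> C" using Q Cs(3) mult_left_le[of "cmod w ^ Suc m" C] by linarith
    hence Q1: "cmod Q \<le> 1 + C" using norm_triangle_ineq[of "Q - 1" 1] by simp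
    have "E * Q - 1 = (E - 1) * Q + (Q - 1)" by (simp add: algebra_simps)
    hence "cmod (E * Q - 1) \<le> cmod (E - 1) * cmod Q + cmod (Q - 1)"
      by (metis norm_mult norm_triangle_ineq)
    also have "\<dots> \<le> (3 * cmod (w * a) ^ Suc m) * (1 + C) + C * cmod w ^ Suc m"
      using E Q Q1 by (intro add_mono mult_mono) auto
    also have "\<dots> = C' * cmod w ^ Suc m"
      by (simp add: C'_def norm_mult power_mult_distrib algebra_simps)
    finally show "cmod ((\<Prod>a\<leftarrow>a # as. weierstrass_factor m (w * a)) - 1) \<le> C' * cmod w ^ Suc m"
      by (simp add: E_def Q_def)
  qed
qed

lemma prod_weierstrass_factor_eq:
  "(\<Prod>a\<leftarrow>as. weierstrass_factor m (w * a)) =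
     (\<Prod>a\<leftarrow>as. 1 - w * a) * exp (\<Sum>k = 1..m. (\<Sum>a\<leftarrow>as. a ^ k) * w ^ k / of_nat k)"
proof (induction as)
  case (Cons a as)
  have "(\<Sum>k = 1..m. (\<Sum>a\<leftarrow>a # as. a ^ k) * w ^ k / of_nat k)
      = (\<Sum>k = 1..m. (w * a) ^ k / of_nat k) + (\<Sum>k = 1..m. (\<Sum>a\<leftarrow>as. a ^ k) * w ^ k / of_nat k)"
    unfolding sum.distrib[symmetric] by (rule sum.cong) (simp_all add: power_mult_distrib add_divide_distrib algebra_simps)
  thus ?case using Cons by (simp add: weierstrass_factor_def exp_add mult_ac)
qed simp

text \<open>If the traces \<open>t\<^sub>k\<close> are bounded for \<open>k \<le> m\<close>, then \<open>D(w) exp (\<Sum>k\<le>m. t\<^sub>k w\<^sup>k / k) = 1 + O(w\<^sup>m\<^sup>+\<^sup>1)\<close>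
  is a product of Weierstrass factors, and Cauchy's estimates make the error term small.\<close>

lemma char_poly_lower_bound:
  fixes as :: "complex list"
  defines "D \<equiv> \<lambda>w. \<Prod>a\<leftarrow>as. 1 - w * a"
  assumes r: "0 < r0" "r0 < r1" "r1 < 1" and A: "\<And>w. cmod w \<le> r1 \<Longrightarrow> cmod (D w) \<le> A"
    and T: "\<And>k. 1 \<le> k \<Longrightarrow> k \<le> m \<Longrightarrow> cmod (\<Sum>a\<leftarrow>as. a ^ k) \<le> T k"
    and S: "(\<Sum>k = 1..m. T k * r1 ^ k) \<le> S"
    and small: "(A * exp S + 1) * ((r0 / r1) ^ Suc m / (1 - r0 / r1)) \<le> 1 / 2"
    and w: "cmod w \<le> r0"
  shows "cmod (D w) \<ge> exp (- S) / 2"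
proof -
  define p where "p w = (\<Sum>k = 1..m. (\<Sum>a\<leftarrow>as. a ^ k) * w ^ k / of_nat k)" for w :: complex
  define f where "f w = D w * exp (p w) - 1" for w
  have f_eq: "f w = (\<Prod>a\<leftarrow>as. weierstrass_factor m (w * a)) - 1" for w
    by (simp add: f_def D_def p_def prod_weierstrass_factor_eq)
  have Dhol: "D holomorphic_on UNIV"
    unfolding D_def by (induction as) (auto intro!: holomorphic_intros)
  have fhol: "f holomorphic_on X" for X
    unfolding f_def p_def by (intro holomorphic_intros holomorphic_on_subset[OF Dhol]) auto
  have fcont: "continuous_on X f" for X by (rule holomorphic_on_imp_continuous_on[OF fhol])
  have p_bound: "cmod (p w) \<le> S" if "cmod w \<le> r1" for w
  proof -
    have "cmod (p w) \<le> (\<Sum>k = 1..m. T k * r1 ^ k)"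
      unfolding p_def
    proof (rule sum_norm_le)
      fix k assume k: "k \<in> {1..m}"
      have T0: "T k \<ge> 0" using T[of k] k by (auto intro: order_trans[OF norm_ge_zero])
      have "cmod ((\<Sum>a\<leftarrow>as. a ^ k) * w ^ k / of_nat k) = cmod (\<Sum>a\<leftarrow>as. a ^ k) * cmod w ^ k / real k"
        by (simp add: norm_mult norm_divide norm_power)
      also have "\<dots> \<le> cmod (\<Sum>a\<leftarrow>as. a ^ k) * cmod w ^ k / 1"
        using k by (intro divide_left_mono) auto
      also have "\<dots> \<le> T k * r1 ^ k"
        using k T[of k] that T0 by (simp, intro mult_mono power_mono) auto
      finally show "cmod ((\<Sum>a\<leftarrow>as. a ^ k) * w ^ k / of_nat k) \<le> T k * r1 ^ k" .
    qed
    thus ?thesis using S by simp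
  qed
  have A0: "A \<ge> 0" using A[of 0] r by (auto intro: order_trans[OF norm_ge_zero])
  have f_bound: "cmod (f w) \<le> A * exp S + 1" if "cmod w \<le> r1" for w
  proof -
    have "cmod (D w * exp (p w)) \<le> A * exp S"
    proof (unfold norm_mult, intro mult_mono A that)
      have "Re (p w) \<le> S" using p_bound[OF that] complex_Re_le_cmod[of "p w"] by linarith
      thus "cmod (exp (p w)) \<le> exp S" by simp
    qed (use A0 in auto)
    thus ?thesis unfolding f_def by (intro order_trans[OF norm_triangle_ineq4]) simp
  qed
  define M where "M = A * exp S + 1"
  \<comment> \<open>On the fixed radius r1 Cauchy's estimate bounds every coefficient by a constant
    that involves only A and S.\<close>
  have coeff: "cmod ((deriv ^^ n) f 0) \<le> fact n * M / r1 ^ n" for n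
    by (rule Cauchy_inequality[OF fhol fcont]) (use r f_bound in \<open>auto simp: M_def\<close>)
  obtain C s where Cs: "s > 0" "s \<le> 1" "C \<ge> 0" "\<And>w. cmod w \<le> s \<Longrightarrow> cmod (f w) \<le> C * cmod w ^ Suc m"
    using prod_weierstrass_factor_near_1[of m as] unfolding f_eq by blast
  \<comment> \<open>On a radius t tending to 0 the estimate uses only the order of vanishing, and
    the uncontrolled constant C disappears in the limit.\<close>
  have coeff0: "(deriv ^^ n) f 0 = 0" if n: "n \<le> m" for n
  proof -
    have "cmod ((deriv ^^ n) f 0) \<le> fact n * C * t" if t: "0 < t" "t \<le> s" for t
    proof -
      have "cmod ((deriv ^^ n) f 0) \<le> fact n * (C * t ^ Suc m) / t ^ n"
        by (rule Cauchy_inequality[OF fhol fcont]) (use t Cs(4) in auto)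
      also have "\<dots> = fact n * C * (t ^ Suc m / t ^ n)" by simp
      also have "t ^ Suc m / t ^ n = t ^ (Suc m - n)" using t n by (simp add: power_diff)
      also have "t ^ (Suc m - n) \<le> t ^ 1" using t n Cs by (intro power_decreasing) auto
      finally show ?thesis using Cs(3) by (simp add: mult_left_mono)
    qed
    moreover have "((\<lambda>t. fact n * C * t) \<longlongrightarrow> fact n * C * 0) (at_right 0)"
      by (intro tendsto_intros)
    ultimately have "cmod ((deriv ^^ n) f 0) \<le> fact n * C * 0"
      by (intro tendsto_lowerbound[where F = "at_right (0::real)"])
        (use Cs(1) in \<open>auto simp: eventually_at_right_field intro!: exI[of _ s]\<close>)
    thus ?thesis by simp
  qed
  define q where "q = r0 / r1"
  have q: "0 < q" "q < 1" using r by (auto simp: q_def)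
  have M0: "M \<ge> 0" using A0 by (simp add: M_def)
  have "(\<lambda>n. (deriv ^^ n) f 0 / fact n * (w - 0) ^ n) sums f w"
    by (rule holomorphic_power_series[where r = r1, OF fhol]) (use w r in auto)
  hence sums: "(\<lambda>n. (deriv ^^ n) f 0 / fact n * w ^ n) sums f w" by simp
  have bnd: "cmod ((deriv ^^ n) f 0 / fact n * w ^ n) \<le> M * q ^ n" for n
  proof -
    have "cmod ((deriv ^^ n) f 0 / fact n * w ^ n) \<le> (fact n * M / r1 ^ n) / fact n * r0 ^ n"
      unfolding norm_mult norm_divide norm_power using coeff[of n] w r M0
      by (intro mult_mono divide_mono power_mono) auto
    thus ?thesis by (simp add: q_def power_divide)
  qed
  have "f w = (\<Sum>n. (deriv ^^ (n + Suc m)) f 0 / fact (n + Suc m) * w ^ (n + Suc m))"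
  proof -
    have "f w = (\<Sum>n. (deriv ^^ n) f 0 / fact n * w ^ n)" using sums by (simp add: sums_iff)
    also have "\<dots> = (\<Sum>n. (deriv ^^ (n + Suc m)) f 0 / fact (n + Suc m) * w ^ (n + Suc m))
        + (\<Sum>n<Suc m. (deriv ^^ n) f 0 / fact n * w ^ n)"
      by (rule suminf_split_initial_segment[OF sums_summable[OF sums]])
    also have "(\<Sum>n<Suc m. (deriv ^^ n) f 0 / fact n * w ^ n) = 0"
      by (rule sum.neutral) (simp add: coeff0)
    finally show ?thesis by simp
  qed
  also have "cmod \<dots> \<le> (\<Sum>n. M * q ^ (n + Suc m))"
    by (rule norm_suminf_le[OF bnd]) (use q in \<open>simp add: power_add summable_mult summable_mult2 summable_geometric\<close>)
  also have "(\<Sum>n. M * q ^ (n + Suc m)) = M * (q ^ Suc m / (1 - q))"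
  proof (rule sums_unique[symmetric])
    have "(\<lambda>k. M * q ^ Suc m * q ^ k) sums (M * q ^ Suc m * (1 / (1 - q)))"
      using q by (intro sums_mult geometric_sums) auto
    thus "(\<lambda>k. M * q ^ (k + Suc m)) sums (M * (q ^ Suc m / (1 - q)))"
      by (simp add: power_add mult_ac)
  qed
  also have "\<dots> \<le> 1 / 2" using small by (simp add: M_def q_def)
  finally have "cmod (f w) \<le> 1 / 2" .
  hence "1 / 2 \<le> cmod (D w * exp (p w))"
    using norm_triangle_ineq2[of 1 "- f w"] unfolding f_def by (simp add: norm_minus_commute)
  also have "\<dots> = cmod (D w) * exp (Re (p w))" by (simp add: norm_mult)
  also have "\<dots> \<le> cmod (D w) * exp S"
  proof (intro mult_left_mono)
    have "Re (p w) \<le> S" using p_bound[of w] complex_Re_le_cmod[of "p w"] w r by linarith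
    thus "exp (Re (p w)) \<le> exp S" by simp
  qed simp
  finally show ?thesis by (simp add: exp_minus field_simps)
qed

text \<open>The coefficient of \<open>w\<^sup>k\<close> in \<open>\<surd>N / \<theta> det (1 - w (Y + \<theta> v u\<^sup>T)) / det (1 - w Y)\<close>; the shift by one
  comes from \<open>det (1 - w (Y + \<theta> v u\<^sup>T)) / det (1 - w Y) = 1 - w \<theta> u\<^sup>T (1 - w Y)\<^sup>-\<^sup>1 v\<close>.\<close>

definition resolvent_coeff :: "(nat \<Rightarrow> nat \<Rightarrow> complex) \<Rightarrow> (nat \<Rightarrow> complex) \<Rightarrow> (nat \<Rightarrow> complex) \<Rightarrow> complex \<Rightarrow> nat \<Rightarrow> nat \<Rightarrow> complex" where
  "resolvent_coeff y u v \<theta> N k = (if k = 0 then of_real (sqrt (real N)) / \<theta>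
     else - of_real (sqrt (real N)) * (\<Sum>i<N. u i * mat_iter y N v (k - 1) i))"

text \<open>A growth that suits both sides: the reciprocals telescope to a sum of at most 1, as
  union bounds over all k require, and the weights times r^k are summable for r < 1.\<close>

definition weight :: "nat \<Rightarrow> real" where
  "weight k = (real k + 1) * (real k + 2)"

text \<open>The determinant coefficients are bounded for all k, the traces only up to m, since their
  moments are not uniformly controlled in k.\<close>

definition controlled :: "(nat \<Rightarrow> nat \<Rightarrow> complex) \<Rightarrow> (nat \<Rightarrow> complex) \<Rightarrow> (nat \<Rightarrow> complex) \<Rightarrow> nat \<Rightarrow> real \<Rightarrow> nat \<Rightarrow> bool" where
  "controlled y u v N K m \<longleftrightarrow> (\<forall>k\<le>N. cmod (det_coeff y N k) \<le> K * weight k) \<and>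
     (\<forall>k\<le>Suc N. sqrt (real N) * cmod (bordered_coeff y u v N k) \<le> K * weight k) \<and>
     (\<forall>k\<in>{1..m}. cmod (\<Sum>f\<in>{..<k} \<rightarrow>\<^sub>E {..<N}. \<Prod>a<k. y (f a) (f (Suc a mod k))) \<le> K * weight k)"

lemma weight_pos: "weight k > 0"
  by (simp add: weight_def)

lemma summable_weight:
  assumes "0 \<le> r" "r < 1"
  shows "summable (\<lambda>k. weight k * r ^ k)"
proof -
  have g: "summable (\<lambda>n. (1::real) * x ^ n)" if "norm x < 1" for x
    using that by (simp add: summable_geometric)
  have "summable (\<lambda>n. diffs (\<lambda>_. 1) n * x ^ n)" if "norm x < 1" for x :: real
    by (rule termdiff_converges[OF that g])
  \<comment> \<open>Applying \<open>diffs\<close> twice to the constant coefficient 1 gives (k + 1)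
    (k + 2): the weights are the coefficients of the second derivative of the geometric
    series.\<close>
  hence "summable (\<lambda>n. diffs (diffs (\<lambda>_. 1)) n * r ^ n)"
    by (intro termdiff_converges[where K = 1]) (use assms in auto)
  thus ?thesis by (simp add: diffs_def weight_def algebra_simps)
qed

lemma sum_weight_le:
  assumes "0 \<le> r" "r < 1" "finite I"
  shows "(\<Sum>k\<in>I. weight k * r ^ k) \<le> (\<Sum>k. weight k * r ^ k)"
  using assms less_imp_le[OF weight_pos] by (intro sum_le_suminf summable_weight) auto

lemma char_coeff_tame:
  assumes "R \<ge> 1"
  shows "char_coeff y u v \<theta> N \<in> tame R"
proof -
  obtain n :: nat where n: "real n \<ge> (\<Sum>k\<le>Suc (Suc N). cmod (char_coeff y u v \<theta> N k))"
    using real_arch_simple by blast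
  have "cmod (char_coeff y u v \<theta> N k) \<le> real n * R ^ k" for k
  proof (cases "k \<le> Suc (Suc N)")
    case True
    have "cmod (char_coeff y u v \<theta> N k) \<le> (\<Sum>k\<le>Suc (Suc N). cmod (char_coeff y u v \<theta> N k))"
      by (rule member_le_sum) (use True in auto)
    also have "\<dots> \<le> real n * 1" using n by simp
    also have "\<dots> \<le> real n * R ^ k" using assms by (intro mult_left_mono) auto
    finally show ?thesis .
  qed (use assms in \<open>simp add: char_coeff_eq_0\<close>)
  hence "char_coeff y u v \<theta> N \<in> coeff_bound R (real n)" by (simp add: coeff_bound_def)
  moreover have "char_coeff y u v \<theta> N \<noteq> (\<lambda>_. 0)"
    using char_coeff_0[of y u v \<theta> N] by (metis zero_neq_one)
  ultimately show ?thesis by (auto simp: tame_def)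
qed

lemma laurent_char_coeff:
  "laurent (char_coeff y u v \<theta> N) z = (\<Sum>k\<le>Suc (Suc N). char_coeff y u v \<theta> N k * inverse z ^ k)"
  unfolding laurent_eq by (rule suminf_finite) (auto simp: char_coeff_eq_0)

text \<open>Near 0 the quotient h / D is the resolvent series. By uniqueness its Taylor coefficients
  are the resolvent coefficients, although the Neumann series itself is only known to converge near
  0; Cauchy's estimates on the large disc then bound all of them.\<close>

lemma resolvent_coeff_expansion:
  fixes y :: "nat \<Rightarrow> nat \<Rightarrow> complex" and u v :: "nat \<Rightarrow> complex" and \<theta> :: complex and N :: nat
  defines "a \<equiv> of_real (sqrt (real N)) / \<theta>"
    and "D \<equiv> \<lambda>w. \<Sum>k\<le>N. w ^ k * det_coeff y N k"
    and "h \<equiv> \<lambda>w. of_real (sqrt (real N)) / \<theta> * (\<Sum>k\<le>Suc (Suc N). char_coeff y u v \<theta> N k * w ^ k)"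
  assumes \<theta>: "\<theta> \<noteq> 0" and R: "R > 0" and d: "d > 0"
    and D: "\<And>w. cmod w \<le> 1 / R \<Longrightarrow> cmod (D w) \<ge> d" and h: "\<And>w. cmod w \<le> 1 / R \<Longrightarrow> cmod (h w) \<le> H"
  shows "resolvent_coeff y u v \<theta> N \<in> coeff_bound R (H / d)"
    and "\<And>w. cmod w < 1 / R \<Longrightarrow> (\<lambda>k. resolvent_coeff y u v \<theta> N k * w ^ k) sums (h w / D w)"
proof -
  define G where "G w = h w / D w" for w
  have D0: "D w \<noteq> 0" if "cmod w \<le> 1 / R" for w using D[OF that] d by auto
  have Dhol: "D holomorphic_on X" and hhol: "h holomorphic_on X" for X
    unfolding D_def h_def by (intro holomorphic_intros)+
  have Ghol: "G holomorphic_on ball 0 (1 / R)"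
    unfolding G_def by (intro holomorphic_intros Dhol hhol D0) auto
  have Gcont: "continuous_on (cball 0 (1 / R)) G"
    unfolding G_def by (intro continuous_intros holomorphic_on_imp_continuous_on[OF Dhol]
      holomorphic_on_imp_continuous_on[OF hhol]) (use D0 in auto)
  have H0: "H \<ge> 0" using h[of 0] R by (auto intro: order_trans[OF norm_ge_zero])
  have Gbound: "cmod (G w) \<le> H / d" if "cmod w \<le> 1 / R" for w
    unfolding G_def norm_divide using D[OF that] h[OF that] d H0 by (intro frac_le) auto
  have coeff: "cmod ((deriv ^^ n) G 0) \<le> fact n * (H / d) / (1 / R) ^ n" for n
    by (rule Cauchy_inequality[OF Ghol Gcont]) (use R Gbound in auto)
  have taylor: "(\<lambda>n. (deriv ^^ n) G 0 / fact n * w ^ n) sums G w" if "cmod w < 1 / R" for w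
    using holomorphic_power_series[OF Ghol, of w] that by simp
  obtain r where r: "r > 0" and res: "\<And>w. cmod w < r \<Longrightarrow> (\<lambda>k. (\<Sum>i<N. u i * mat_iter y N v k i) * w ^ k) sums
      (\<Sum>k. (\<Sum>i<N. u i * mat_iter y N v k i) * w ^ k)"
    "\<And>w. cmod w < r \<Longrightarrow> (\<Sum>k\<le>Suc N. w ^ k * bordered_coeff y u v N k) =
      - (\<Sum>k\<le>N. w ^ k * det_coeff y N k) * (\<Sum>k. (\<Sum>i<N. u i * mat_iter y N v k i) * w ^ k)"
    using bordered_resolvent[where u = u and N = N and y = y and v = v] by blast
  have G_eq: "(\<lambda>k. resolvent_coeff y u v \<theta> N k * w ^ k) sums G w" if w: "cmod w < min r (1 / R)" for w
  proof -
    define s where "s = complex_of_real (sqrt (real N))"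
    define W where "W = (\<Sum>k. (\<Sum>i<N. u i * mat_iter y N v k i) * w ^ k)"
    have "h w = s / \<theta> * (D w + w * \<theta> * (- D w * W))"
      unfolding h_def sum_char_coeff s_def[symmetric] D_def W_def using res(2)[of w] w by simp
    also have "\<dots> = D w * (s / \<theta> - s * w * W)" using \<theta> by (simp add: field_simps)
    finally have "G w = s / \<theta> - s * w * W" using D0[of w] w by (simp add: G_def)
    moreover have "(\<lambda>k. - s * w * ((\<Sum>i<N. u i * mat_iter y N v k i) * w ^ k)) sums (- s * w * W)"
      unfolding W_def using w by (intro sums_mult res(1)) simp
    hence "(\<lambda>k. resolvent_coeff y u v \<theta> N (Suc k) * w ^ Suc k) sums (- s * w * W)"
      by (simp add: resolvent_coeff_def s_def mult_ac)
    ultimately show ?thesis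
      using sums_Suc_iff[of "\<lambda>k. resolvent_coeff y u v \<theta> N k * w ^ k" "- s * w * W"]
      by (simp add: resolvent_coeff_def s_def)
  qed
  have eq: "resolvent_coeff y u v \<theta> N = (\<lambda>n. (deriv ^^ n) G 0 / fact n)"
    by (rule powser_coeffs_unique[where r = "min r (1 / R)" and f = G]) (use r R G_eq taylor in auto)
  show "resolvent_coeff y u v \<theta> N \<in> coeff_bound R (H / d)"
    unfolding coeff_bound_def eq using coeff R
    by (auto simp: norm_divide field_simps)
  show "(\<lambda>k. resolvent_coeff y u v \<theta> N k * w ^ k) sums (h w / D w)" if "cmod w < 1 / R" for w
    using taylor[OF that] unfolding eq G_def by simp
qed

lemma zero_points_resolvent_coeff:
  fixes y :: "nat \<Rightarrow> nat \<Rightarrow> complex" and u v :: "nat \<Rightarrow> complex" and \<theta> :: complex and N :: nat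
  assumes \<theta>: "\<theta> \<noteq> 0" and N: "N \<ge> 1" and R: "R \<ge> 1" and z: "z \<in> - cball 0 R"
    and D: "\<And>w. cmod w < 1 / R \<Longrightarrow> (\<Sum>k\<le>N. w ^ k * det_coeff y N k) \<noteq> 0"
    and sums: "\<And>w. cmod w < 1 / R \<Longrightarrow> (\<lambda>k. resolvent_coeff y u v \<theta> N k * w ^ k) sums
      (of_real (sqrt (real N)) / \<theta> * (\<Sum>k\<le>Suc (Suc N). char_coeff y u v \<theta> N k * w ^ k)
        / (\<Sum>k\<le>N. w ^ k * det_coeff y N k))"
  shows "zero_points (laurent (resolvent_coeff y u v \<theta> N)) z = zero_points (laurent (char_coeff y u v \<theta> N)) z"
proof (rule zero_points_mult)
  let ?S = "- cball (0::complex) R"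
  let ?c = "\<lambda>z. of_real (sqrt (real N)) / \<theta> / (\<Sum>k\<le>N. inverse z ^ k * det_coeff y N k)"
  have R0: "R > 0" using R by simp
  have inv: "cmod (inverse z) < 1 / R" if "z \<in> ?S" for z
    using inverse_in_ball[OF that R0] by simp
  obtain B where B: "char_coeff y u v \<theta> N \<in> coeff_bound R B" "char_coeff y u v \<theta> N 0 \<noteq> 0"
    using char_coeff_tame[OF R, of y u v \<theta> N] by (auto simp: tame_def char_coeff_0)
  show "open ?S" "connected ?S" "z \<in> ?S"
    using z connected_outside_cball[of R] by auto
  show "laurent (char_coeff y u v \<theta> N) holomorphic_on ?S" by (rule laurent_holomorphic[OF B(1) R0])
  show "\<exists>w\<in>?S. laurent (char_coeff y u v \<theta> N) w \<noteq> 0" by (rule laurent_not_identically_zero[OF B(1) R0 B(2)])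
  show "?c holomorphic_on ?S"
    using D[OF inv] R0 by (intro holomorphic_intros) auto
  show "?c w \<noteq> 0" if "w \<in> ?S" for w using D[OF inv[OF that]] \<theta> N by simp
  show "laurent (resolvent_coeff y u v \<theta> N) w = ?c w * laurent (char_coeff y u v \<theta> N) w" if "w \<in> ?S" for w
    unfolding laurent_char_coeff unfolding laurent_eq
    using sums_unique[OF sums[OF inv[OF that]], symmetric] by simp
qed

text \<open>Neither B nor m depends on N or on the matrix: S depends on R and K, m is chosen from S,
  and \<open>char_poly_lower_bound\<close> then bounds D below on the disc of radius 1 / R.\<close>

lemma controlled_resolvent_coeff:
  assumes R: "R > 1" and K: "K \<ge> 0"
  shows "\<exists>B m. \<forall>N y u v \<theta>. N \<ge> 1 \<longrightarrow> \<theta> \<noteq> 0 \<longrightarrow> cmod (of_real (sqrt (real N)) / \<theta>) \<le> K \<longrightarrow> controlled y u v N K m \<longrightarrow>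
    resolvent_coeff y u v \<theta> N \<in> coeff_bound R B \<and>
    (\<forall>z\<in>- cball 0 R. zero_points (laurent (resolvent_coeff y u v \<theta> N)) z = zero_points (laurent (char_coeff y u v \<theta> N)) z)"
proof -
  define r0 where "r0 = 1 / R"
  \<comment> \<open>The midpoint of 1 / R and 1: upper bounds are taken on radius r1, and the ratio
    q is what a large m makes small.\<close>
  define r1 where "r1 = (1 + r0) / 2"
  define q where "q = r0 / r1"
  have r: "0 < r0" "r0 < r1" "r1 < 1" using R by (auto simp: r0_def r1_def field_simps)
  have q: "0 < q" "q < 1" using r by (auto simp: q_def)
  \<comment> \<open>A common bound on radius r1 for D, for the scaled bordered determinant and for
    the exponent built from the traces.\<close>
  define S where "S = K * (\<Sum>k. weight k * r1 ^ k)"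
  have sum_le_S: "(\<Sum>k\<in>I. K * weight k * r1 ^ k) \<le> S" if "finite I" for I
    using mult_left_mono[OF sum_weight_le[of r1 I] K] r that by (simp add: S_def sum_distrib_left mult.assoc)
  have S0: "S \<ge> 0" using sum_le_S[of "{}"] by simp
  have "(\<lambda>m. (S * exp S + 1) * (q ^ Suc m / (1 - q))) \<longlonglongrightarrow> (S * exp S + 1) * (0 / (1 - q))"
    using q by (intro tendsto_intros LIMSEQ_Suc[OF LIMSEQ_realpow_zero]) auto
  hence "\<forall>\<^sub>F m in sequentially. (S * exp S + 1) * (q ^ Suc m / (1 - q)) < 1 / 2"
    by (rule order_tendstoD) simp
  then obtain m where m: "(S * exp S + 1) * (q ^ Suc m / (1 - q)) < 1 / 2"
    by (auto simp: eventually_sequentially)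
  define d where "d = exp (- S) / 2"
  show ?thesis
  proof (rule exI[of _ "(K * S + S) / d"], rule exI[of _ m], intro allI impI)
    fix N :: nat and y :: "nat \<Rightarrow> nat \<Rightarrow> complex" and u v :: "nat \<Rightarrow> complex" and \<theta> :: complex
    assume N: "N \<ge> 1" and \<theta>: "\<theta> \<noteq> 0" and a: "cmod (of_real (sqrt (real N)) / \<theta>) \<le> K" and c: "controlled y u v N K m"
    let ?D = "\<lambda>w. \<Sum>k\<le>N. w ^ k * det_coeff y N k"
    let ?h = "\<lambda>w. of_real (sqrt (real N)) / \<theta> * (\<Sum>k\<le>Suc (Suc N). char_coeff y u v \<theta> N k * w ^ k)"
    have D_le: "cmod (?D w) \<le> S" if "cmod w \<le> r1" for w
    proof -
      have "cmod (?D w) \<le> (\<Sum>k\<le>N. K * weight k * r1 ^ k)"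
      proof (rule sum_norm_le)
        fix k assume "k \<in> {..N}"
        hence "cmod (det_coeff y N k) \<le> K * weight k" using c by (auto simp: controlled_def)
        thus "cmod (w ^ k * det_coeff y N k) \<le> K * weight k * r1 ^ k"
          unfolding norm_mult norm_power mult.commute[of "cmod w ^ k"] using that r K weight_pos[of k]
          by (intro mult_mono power_mono) auto
      qed
      also have "\<dots> \<le> S" by (rule sum_le_S) simp
      finally show ?thesis .
    qed
    have b_le: "sqrt (real N) * cmod (\<Sum>k\<le>Suc N. w ^ k * bordered_coeff y u v N k) \<le> S" if "cmod w \<le> r1" for w
    proof -
      have "cmod (\<Sum>k\<le>Suc N. of_real (sqrt (real N)) * (w ^ k * bordered_coeff y u v N k)) \<le> (\<Sum>k\<le>Suc N. K * weight k * r1 ^ k)"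
      proof (rule sum_norm_le)
        fix k assume "k \<in> {..Suc N}"
        hence "sqrt (real N) * cmod (bordered_coeff y u v N k) \<le> K * weight k" using c by (auto simp: controlled_def)
        moreover have "cmod (of_real (sqrt (real N)) * (w ^ k * bordered_coeff y u v N k))
            = (sqrt (real N) * cmod (bordered_coeff y u v N k)) * cmod w ^ k"
          by (simp add: norm_mult norm_power)
        ultimately show "cmod (of_real (sqrt (real N)) * (w ^ k * bordered_coeff y u v N k)) \<le> K * weight k * r1 ^ k"
          using that r K weight_pos[of k] by (auto intro!: mult_mono power_mono)
      qed
      also have "\<dots> \<le> S" by (rule sum_le_S) simp
      finally show ?thesis by (simp add: sum_distrib_left[symmetric] norm_mult)
    qed
    have h_le: "cmod (?h w) \<le> K * S + S" if w: "cmod w \<le> r0" for w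
    proof -
      have h: "?h w = of_real (sqrt (real N)) / \<theta> * ?D w + w * (of_real (sqrt (real N)) * (\<Sum>k\<le>Suc N. w ^ k * bordered_coeff y u v N k))"
        unfolding sum_char_coeff using \<theta> by (simp add: field_simps)
      have "cmod (of_real (sqrt (real N)) / \<theta> * ?D w) \<le> K * S"
        unfolding norm_mult[of _ "?D w"] using a K D_le[of w] w r by (intro mult_mono) auto
      moreover have "cmod (w * (of_real (sqrt (real N)) * (\<Sum>k\<le>Suc N. w ^ k * bordered_coeff y u v N k))) \<le> 1 * S"
        unfolding norm_mult[of w] using b_le[of w] w r by (intro mult_mono) (auto simp: norm_mult)
      ultimately show ?thesis unfolding h by (intro norm_triangle_le) linarith
    qed
    have "\<exists>as. (\<forall>w. ?D w = (\<Prod>a\<leftarrow>as. 1 - w * a)) \<and>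
      (\<forall>k\<ge>1. (\<Sum>f\<in>{..<k} \<rightarrow>\<^sub>E {..<N}. \<Prod>a<k. y (f a) (f (Suc a mod k))) = (\<Sum>a\<leftarrow>as. a ^ k))"
    proof (rule det_one_minus_eigenvalues[where N = N and y = y], intro exI conjI allI impI)
      fix as and w :: complex and k assume *: "\<And>w. ?D w = (\<Prod>a\<leftarrow>as. 1 - w * a)"
        "\<And>k. 1 \<le> k \<Longrightarrow> (\<Sum>f\<in>{..<k} \<rightarrow>\<^sub>E {..<N}. \<Prod>a<k. y (f a) (f (Suc a mod k))) = (\<Sum>a\<leftarrow>as. a ^ k)"
      show "?D w = (\<Prod>a\<leftarrow>as. 1 - w * a)" by (rule *(1))
      show "(\<Sum>f\<in>{..<k} \<rightarrow>\<^sub>E {..<N}. \<Prod>a<k. y (f a) (f (Suc a mod k))) = (\<Sum>a\<leftarrow>as. a ^ k)" if "1 \<le> k"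
        by (rule *(2)[OF that])
    qed
    then obtain as where as: "\<forall>w. ?D w = (\<Prod>a\<leftarrow>as. 1 - w * a)"
      "\<forall>k\<ge>1. (\<Sum>f\<in>{..<k} \<rightarrow>\<^sub>E {..<N}. \<Prod>a<k. y (f a) (f (Suc a mod k))) = (\<Sum>a\<leftarrow>as. a ^ k)" by (elim exE conjE)
    have D_ge: "cmod (?D w) \<ge> d" if w: "cmod w \<le> 1 / R" for w
      unfolding as(1)[rule_format] d_def
    proof (rule char_poly_lower_bound[where ?r0.0 = r0 and ?r1.0 = r1 and A = S and T = "\<lambda>k. K * weight k" and m = m])
      show "cmod (\<Prod>a\<leftarrow>as. 1 - w * a) \<le> S" if "cmod w \<le> r1" for w using D_le[OF that] by (simp only: as(1)[rule_format])
      show "cmod (\<Sum>a\<leftarrow>as. a ^ k) \<le> K * weight k" if "1 \<le> k" "k \<le> m" for k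
        using c that unfolding controlled_def as(2)[rule_format, OF that(1), symmetric] by (elim conjE bspec) simp
      show "(\<Sum>k = 1..m. K * weight k * r1 ^ k) \<le> S" by (rule sum_le_S) simp
      show "(S * exp S + 1) * ((r0 / r1) ^ Suc m / (1 - r0 / r1)) \<le> 1 / 2" using m by (simp add: q_def)
    qed (use r w in \<open>auto simp: r0_def\<close>)
    have d: "d > 0" by (simp add: d_def)
    have R0: "R > 0" using R by simp
    note E = resolvent_coeff_expansion[OF \<theta> R0 d D_ge h_le[unfolded r0_def]]
    have "?D w \<noteq> 0" if "cmod w < 1 / R" for w using D_ge[of w] that d by auto
    hence "\<forall>z\<in>- cball 0 R. zero_points (laurent (resolvent_coeff y u v \<theta> N)) z = zero_points (laurent (char_coeff y u v \<theta> N)) z"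
      using R by (intro ballI zero_points_resolvent_coeff[OF \<theta> N _ _ _ E(2)]) simp_all
    with E(1) show "resolvent_coeff y u v \<theta> N \<in> coeff_bound R ((K * S + S) / d) \<and>
      (\<forall>z\<in>- cball 0 R. zero_points (laurent (resolvent_coeff y u v \<theta> N)) z = zero_points (laurent (char_coeff y u v \<theta> N)) z)"
      by (rule conjI)
  qed
qed

section \<open>The perturbed random matrix\<close>

text \<open>Unrolls the recursion at the other end, so that \<open>sum_mat_iter\<close> can append a
  step to a path by changing v.\<close>

lemma mat_iter_Suc_right: "mat_iter y N v (Suc k) i = mat_iter y N (\<lambda>j. \<Sum>l<N. y j l * v l) k i"
proof (induction k arbitrary: i)
  case (Suc k)
  have "mat_iter y N v (Suc (Suc k)) i = (\<Sum>j<N. y i j * mat_iter y N v (Suc k) j)" by (rule mat_iter.simps(2))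
  also have "\<dots> = (\<Sum>j<N. y i j * mat_iter y N (\<lambda>j. \<Sum>l<N. y j l * v l) k j)"
    by (intro sum.cong refl arg_cong2[of _ _ _ _ "(*)"] Suc.IH)
  finally show ?case by simp
qed simp

lemma sum_mat_iter:
  "(\<Sum>i<N. u i * mat_iter y N v k i) =
     (\<Sum>g\<in>{..k} \<rightarrow>\<^sub>E {..<N}. u (g 0) * (\<Prod>j<k. y (g j) (g (Suc j))) * v (g k))"
proof (induction k arbitrary: v)
  case 0
  have "{..0::nat} \<rightarrow>\<^sub>E {..<N} = insert 0 {} \<rightarrow>\<^sub>E {..<N}" by (simp add: atMost_0)
  thus ?case by (simp only: sum_PiE_insert[of 0 "{}"] empty_iff not_False_eq_True) simp
next
  case (Suc k)
  let ?P = "{..k} \<rightarrow>\<^sub>E {..<N}"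
  have "(\<Sum>i<N. u i * mat_iter y N v (Suc k) i) =
      (\<Sum>g\<in>?P. u (g 0) * (\<Prod>j<k. y (g j) (g (Suc j))) * (\<Sum>l<N. y (g k) l * v l))"
    unfolding mat_iter_Suc_right by (rule Suc.IH)
  also have "\<dots> = (\<Sum>l<N. \<Sum>g\<in>?P. u (g 0) * (\<Prod>j<k. y (g j) (g (Suc j))) * (y (g k) l * v l))"
    by (subst sum.swap) (simp add: sum_distrib_left)
  also have "\<dots> = (\<Sum>l<N. \<Sum>g\<in>?P. u ((g(Suc k := l)) 0) *
      (\<Prod>j<Suc k. y ((g(Suc k := l)) j) ((g(Suc k := l)) (Suc j))) * v ((g(Suc k := l)) (Suc k)))"
  proof (intro sum.cong refl)
    fix l g
    have "(\<Prod>j<k. y ((g(Suc k := l)) j) ((g(Suc k := l)) (Suc j))) = (\<Prod>j<k. y (g j) (g (Suc j)))"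
      by (rule prod.cong) auto
    thus "u (g 0) * (\<Prod>j<k. y (g j) (g (Suc j))) * (y (g k) l * v l) = u ((g(Suc k := l)) 0) *
      (\<Prod>j<Suc k. y ((g(Suc k := l)) j) ((g(Suc k := l)) (Suc j))) * v ((g(Suc k := l)) (Suc k))"
      by simp
  qed
  also have "\<dots> = (\<Sum>g\<in>insert (Suc k) {..k} \<rightarrow>\<^sub>E {..<N}. u (g 0) * (\<Prod>j<Suc k. y (g j) (g (Suc j))) * v (g (Suc k)))"
    by (rule sum_PiE_insert[symmetric]) simp
  finally show ?case by (simp only: atMost_Suc)
qed

lemma sum_inverse_weight_le:
  assumes "finite I"
  shows "(\<Sum>k\<in>I. 1 / weight k) \<le> 1"
proof -
  have eq: "(\<Sum>k<n. 1 / weight k) = 1 - 1 / (real n + 1)" for n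
  proof (induction n)
    case (Suc n)
    have "1 / weight n = 1 / (real n + 1) - 1 / (real n + 2)" by (simp add: weight_def divide_simps)
    thus ?case using Suc by simp
  qed simp
  obtain n where "I \<subseteq> {..<n}" using finite_nat_iff_bounded assms by blast
  hence "(\<Sum>k\<in>I. 1 / weight k) \<le> (\<Sum>k<n. 1 / weight k)"
    using less_imp_le[OF weight_pos] by (intro sum_mono2) auto
  also have "\<dots> \<le> 1" unfolding eq by simp
  finally show ?thesis .
qed

text \<open>Chebyshev's inequality: a second moment of order (k + 1)^2 against the squared weight
  leaves 1 / (k + 2)^2, which is at most \<open>1 / weight k\<close>.\<close>

lemma (in prob_space) weight_tail:
  fixes f :: "'a \<Rightarrow> real"
  assumes [measurable]: "f \<in> borel_measurable M" and int: "integrable M (\<lambda>\<omega>. (f \<omega>)\<^sup>2)"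
    and le: "expectation (\<lambda>\<omega>. (f \<omega>)\<^sup>2) \<le> c * (real k + 1)\<^sup>2" and K: "K > 0"
  shows "prob {\<omega> \<in> space M. f \<omega> > K * weight k} \<le> c / K\<^sup>2 * (1 / weight k)"
proof -
  have "0 \<le> expectation (\<lambda>\<omega>. (f \<omega>)\<^sup>2)" by simp
  hence "0 \<le> c * (real k + 1)\<^sup>2" using le by linarith
  hence c: "c \<ge> 0" by (simp add: zero_le_mult_iff)
  have w: "K * weight k > 0" using K weight_pos by simp
  have "prob {\<omega> \<in> space M. f \<omega> > K * weight k} \<le> prob {\<omega> \<in> space M. (f \<omega>)\<^sup>2 \<ge> (K * weight k)\<^sup>2}"
    using w by (intro finite_measure_mono) (auto intro!: power_mono)
  also have "\<dots> \<le> expectation (\<lambda>\<omega>. (f \<omega>)\<^sup>2) / (K * weight k)\<^sup>2"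
    by (rule integral_Markov_inequality_measure[OF int, of "{}"]) (use w in auto)
  also have "\<dots> \<le> c * (real k + 1)\<^sup>2 / (K * weight k)\<^sup>2" using le by (intro divide_right_mono) auto
  also have "\<dots> = c / K\<^sup>2 * (1 / (real k + 2)\<^sup>2)"
    by (simp add: weight_def power_mult_distrib)
  also have "\<dots> \<le> c / K\<^sup>2 * (1 / weight k)"
    using c by (intro mult_left_mono divide_left_mono) (auto simp: weight_def power2_eq_square intro!: mult_pos_pos)
  finally show ?thesis .
qed

locale iid_deformed = iid_rank_one +
  fixes \<theta> :: "nat \<Rightarrow> complex" and \<kappa> lam :: complex
  assumes \<theta>_nonzero: "N \<ge> 1 \<Longrightarrow> \<theta> N \<noteq> 0"
    and \<theta>_limit: "(\<lambda>N. of_real (sqrt (real N)) / \<theta> N) \<longlonglongrightarrow> \<kappa>"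
    and overlap_limit: "(\<lambda>N. \<theta> N * of_real (\<Sum>i<N. u N i * v N i)) \<longlonglongrightarrow> lam"
begin

definition coeffs :: "nat \<Rightarrow> 'a \<Rightarrow> nat \<Rightarrow> complex" where
  "coeffs N \<omega> = resolvent_coeff (Y N \<omega>) (\<lambda>i. of_real (u N i)) (\<lambda>i. of_real (v N i)) (\<theta> N) N"

definition poly_coeffs :: "nat \<Rightarrow> 'a \<Rightarrow> nat \<Rightarrow> complex" where
  "poly_coeffs N \<omega> = char_coeff (Y N \<omega>) (\<lambda>i. of_real (u N i)) (\<lambda>i. of_real (v N i)) (\<theta> N) N"

lemma path_sum_eq_mat_iter:
  "path_sum N (k, False) \<omega> = of_real (sqrt (real N)) *
     (\<Sum>i<N. of_real (u N i) * mat_iter (Y N \<omega>) N (\<lambda>i. of_real (v N i)) k i)"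
proof -
  have "(\<Prod>j<k. Y N \<omega> (g j) (g (Suc j))) = path_prod k False g \<omega> / of_real (sqrt (real N)) ^ k" for g
    by (simp add: Y_def path_prod_def entry_def prod_dividef)
  thus ?thesis
    unfolding sum_mat_iter path_sum_def paths_def path_weight_def
    by (simp add: sum_distrib_left mult_ac)
qed

lemma coeffs_0: "coeffs N \<omega> 0 = of_real (sqrt (real N)) / \<theta> N"
  by (simp add: coeffs_def resolvent_coeff_def)

lemma coeffs_Suc: "coeffs N \<omega> (Suc k) = - path_sum N (k, False) \<omega>"
  by (simp add: coeffs_def resolvent_coeff_def path_sum_eq_mat_iter)

lemma overlap_eq:
  assumes "N \<ge> 1"
  shows "of_real (sqrt (real N)) / \<theta> N * (\<theta> N * of_real (\<Sum>i<N. u N i * v N i))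
    = complex_of_real (sqrt (real N) * (\<Sum>i<N. u N i * v N i))"
  using \<theta>_nonzero[OF assms] by simp

lemma coeffs_1:
  "coeffs N \<omega> 1 = - of_real (sqrt (real N) * (\<Sum>i<N. u N i * v N i))"
  by (simp add: coeffs_def resolvent_coeff_def)

text \<open>The product of the two assumed limits, in which \<theta> cancels. In particular the
  overlap of u and v is O(N^(-1/2)).\<close>

lemma scaled_overlap_tendsto:
  "(\<lambda>N. complex_of_real (sqrt (real N) * (\<Sum>i<N. u N i * v N i))) \<longlonglongrightarrow> \<kappa> * lam"
  using tendsto_mult[OF \<theta>_limit overlap_limit]
  by (rule Lim_transform_eventually) (rule eventually_mono[OF eventually_ge_at_top[of 1]], rule overlap_eq)

lemma Y_measurable [measurable]: "(\<lambda>\<omega>. Y N \<omega> i j) \<in> borel_measurable P"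
  unfolding Y_def by measurable

lemma det_coeff_measurable [measurable]: "(\<lambda>\<omega>. det_coeff (Y N \<omega>) n k) \<in> borel_measurable P"
  unfolding det_coeff_def case_prod_unfold by measurable

lemma bordered_coeff_measurable [measurable]: "(\<lambda>\<omega>. bordered_coeff (Y N \<omega>) a b n k) \<in> borel_measurable P"
proof -
  have "(\<lambda>\<omega>. bordered_lin (Y N \<omega>) n i j) \<in> borel_measurable P" for i j
    unfolding bordered_lin_def by (cases "i < n \<and> j < n") simp_all
  thus ?thesis unfolding bordered_coeff_def case_prod_unfold
    by (intro borel_measurable_sum borel_measurable_times borel_measurable_prod) simp_all
qed

lemma poly_coeffs_measurable [measurable]: "poly_coeffs N \<in> borel_measurable P"
proof (rule measurable_coordinatewise_then_product)
  show "(\<lambda>\<omega>. poly_coeffs N \<omega> k) \<in> borel_measurable P" for k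
    unfolding poly_coeffs_def char_coeff_def by (cases "k = 0") simp_all
qed

lemma coeffs_measurable [measurable]: "coeffs N \<in> borel_measurable P"
proof (rule measurable_coordinatewise_then_product)
  show "(\<lambda>\<omega>. coeffs N \<omega> k) \<in> borel_measurable P" for k
    by (cases k) (simp_all add: coeffs_0 coeffs_Suc)
qed

lemma trace_power_eq: "trace_power k N \<omega> = (\<Sum>f\<in>{..<k} \<rightarrow>\<^sub>E {..<N}. \<Prod>a<k. Y N \<omega> (f a) (f (Suc a mod k)))"
  by (simp add: trace_power_def Y_def)

lemma trace_power_measurable [measurable]: "trace_power k N \<in> borel_measurable P"
proof -
  have "trace_power k N = (\<lambda>\<omega>. \<Sum>f\<in>{..<k} \<rightarrow>\<^sub>E {..<N}. \<Prod>a<k. Y N \<omega> (f a) (f (Suc a mod k)))"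
    by (rule ext) (rule trace_power_eq)
  thus ?thesis by simp
qed

text \<open>K is found before m, because \<open>controlled_resolvent_coeff\<close> derives m from K;
  only the threshold for N depends on m.\<close>

lemma controlled_probability:
  assumes e: "e > 0"
  shows "\<exists>K>0. (\<forall>\<^sub>F N in sequentially. cmod (of_real (sqrt (real N)) / \<theta> N) \<le> K) \<and>
    (\<forall>m. \<forall>\<^sub>F N in sequentially. prob {\<omega> \<in> space P.
       \<not> controlled (Y N \<omega>) (\<lambda>i. of_real (u N i)) (\<lambda>i. of_real (v N i)) N K m} \<le> e)"
proof -
  obtain L where L: "\<And>N. cmod (complex_of_real (sqrt (real N) * (\<Sum>i<N. u N i * v N i))) \<le> L"
    using convergent_imp_Bseq[OF convergentI[OF scaled_overlap_tendsto]] by (auto simp: Bseq_def)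
  obtain L' where L': "\<And>N. cmod (of_real (sqrt (real N)) / \<theta> N) \<le> L'"
    using convergent_imp_Bseq[OF convergentI[OF \<theta>_limit]] by (auto simp: Bseq_def)
  have L0: "L \<ge> 0" using order_trans[OF norm_ge_zero L] .
  \<comment> \<open>In units of (k + 1)^2: 5 for the traces and 2 + 2 (L + C^2)^2 for the scaled
    bordered coefficients; the determinant coefficients need only 1.\<close>
  define c where "c = 5 + 2 + 2 * (L + C\<^sup>2)\<^sup>2"
  \<comment> \<open>From K >= 1 and K >= 3 c / e it follows that K^2 >= 3 c / e, so three union
    bounds of c / K^2 each add up to at most e. L' bounds the nonrandom coefficient.\<close>
  define K where "K = max (max 1 L') (3 * c / e)"
  have c0: "c \<ge> 7" by (simp add: c_def)
  have K: "K \<ge> 1" "K \<ge> L'" "K \<ge> 3 * c / e" by (auto simp: K_def)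
  have K0: "K > 0" using K by simp
  have "3 * c / e \<le> K\<^sup>2" using K(1,3) self_le_power[of K 2] by linarith
  hence Ke: "c / K\<^sup>2 * 1 + c / K\<^sup>2 * 1 + c / K\<^sup>2 * 1 \<le> e"
    using e K0 by (simp add: field_simps)
  show ?thesis
  proof (intro exI[of _ K] conjI allI)
    show "K > 0" by fact
    show "\<forall>\<^sub>F N in sequentially. cmod (of_real (sqrt (real N)) / \<theta> N) \<le> K"
      using L' K(2) by (intro always_eventually allI) (metis order_trans)
    fix m
    \<comment> \<open>For the finitely many k up to m, the term of the trace bound that involves the
      moments of the entries drops below 1 once N is large.\<close>
    have "\<forall>\<^sub>F N in sequentially. \<forall>k\<in>{1..m}. real ((k - 1) ^ (2 * k)) * abs_moment_bound (2 * k) ^ (2 * k) / real N \<le> 1"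
    proof (intro eventually_ball_finite ballI)
      fix k
      have "(\<lambda>N. real ((k - 1) ^ (2 * k)) * abs_moment_bound (2 * k) ^ (2 * k) / real N) \<longlonglongrightarrow> 0"
        by (rule lim_const_over_n)
      from order_tendstoD(2)[OF this, of 1]
      show "\<forall>\<^sub>F N in sequentially. real ((k - 1) ^ (2 * k)) * abs_moment_bound (2 * k) ^ (2 * k) / real N \<le> 1"
        by (auto elim: eventually_mono)
    qed simp
    thus "\<forall>\<^sub>F N in sequentially. prob {\<omega> \<in> space P.
       \<not> controlled (Y N \<omega>) (\<lambda>i. of_real (u N i)) (\<lambda>i. of_real (v N i)) N K m} \<le> e"
      using eventually_ge_at_top[of 1]
    proof eventually_elim
      case (elim N)
      hence N: "N \<ge> 1" and sN: "sqrt (real N) > 0" by auto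
      let ?u = "\<lambda>i. complex_of_real (u N i)" and ?v = "\<lambda>i. complex_of_real (v N i)"
      define A1 where "A1 k = {\<omega> \<in> space P. cmod (det_coeff (Y N \<omega>) N k) > K * weight k}" for k
      define A2 where "A2 k = {\<omega> \<in> space P. sqrt (real N) * cmod (bordered_coeff (Y N \<omega>) ?u ?v N k) > K * weight k}" for k
      define A3 where "A3 k = {\<omega> \<in> space P. cmod (trace_power k N \<omega>) > K * weight k}" for k
      have sets [measurable]: "A1 k \<in> sets P" "A2 k \<in> sets P" "A3 k \<in> sets P" for k
        unfolding A1_def A2_def A3_def by measurable
      have A1: "prob (A1 k) \<le> c / K\<^sup>2 * (1 / weight k)" for k
        unfolding A1_def
      proof (rule weight_tail[OF _ det_coeff_second_moment(1)[OF N] _ K0])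
        have "c * (real k + 1)\<^sup>2 \<ge> 1 * 1" using c0 by (intro mult_mono) auto
        thus "expectation (\<lambda>\<omega>. (cmod (det_coeff (Y N \<omega>) N k))\<^sup>2) \<le> c * (real k + 1)\<^sup>2"
          using det_coeff_second_moment(2)[OF N, of k] by linarith
      qed measurable
      have A2: "prob (A2 k) \<le> c / K\<^sup>2 * (1 / weight k)" for k
        unfolding A2_def
      proof (rule weight_tail[OF _ _ _ K0])
        have B: "cmod (?u i * ?v i) \<le> C\<^sup>2 / real N" if "i < N" for i
        proof -
          have "cmod (?u i * ?v i) \<le> (C / sqrt (real N)) * (C / sqrt (real N))"
            unfolding norm_mult norm_of_real using u_le[OF N that] v_le[OF N that] by (intro mult_mono) auto
          thus ?thesis by (simp add: power2_eq_square)
        qed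
        have u1: "(\<Sum>i<N. (cmod (?u i))\<^sup>2) = 1" "(\<Sum>i<N. (cmod (?v i))\<^sup>2) = 1"
          using u_unit[OF N] v_unit[OF N] by simp_all
        note M = bordered_coeff_second_moment[OF N u1 B, of k]
        show "(\<lambda>\<omega>. sqrt (real N) * cmod (bordered_coeff (Y N \<omega>) ?u ?v N k)) \<in> borel_measurable P" by measurable
        show "integrable P (\<lambda>\<omega>. (sqrt (real N) * cmod (bordered_coeff (Y N \<omega>) ?u ?v N k))\<^sup>2)"
          unfolding power_mult_distrib using M(1) by simp
        have "expectation (\<lambda>\<omega>. (sqrt (real N) * cmod (bordered_coeff (Y N \<omega>) ?u ?v N k))\<^sup>2)
            = real N * expectation (\<lambda>\<omega>. (cmod (bordered_coeff (Y N \<omega>) ?u ?v N k))\<^sup>2)"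
          unfolding power_mult_distrib by simp
        also have "\<dots> \<le> real N * (2 * (real k / real N) + 2 * (cmod (\<Sum>i<N. ?u i * ?v i) + real k * (C\<^sup>2 / real N))\<^sup>2)"
          using M(2) by (intro mult_left_mono) auto
        also have "\<dots> = 2 * real k + 2 * (sqrt (real N) * cmod (\<Sum>i<N. ?u i * ?v i) + real k * (C\<^sup>2 / sqrt (real N)))\<^sup>2"
        proof -
          have sq: "real N * x\<^sup>2 = (sqrt (real N) * x)\<^sup>2" for x by (simp add: power_mult_distrib)
          have "sqrt (real N) * (cmod (\<Sum>i<N. ?u i * ?v i) + real k * (C\<^sup>2 / real N))
              = sqrt (real N) * cmod (\<Sum>i<N. ?u i * ?v i) + real k * (C\<^sup>2 / sqrt (real N))"
            using sN by (simp add: field_simps)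
          hence "real N * (cmod (\<Sum>i<N. ?u i * ?v i) + real k * (C\<^sup>2 / real N))\<^sup>2
              = (sqrt (real N) * cmod (\<Sum>i<N. ?u i * ?v i) + real k * (C\<^sup>2 / sqrt (real N)))\<^sup>2"
            by (simp only: sq)
          thus ?thesis using N by (simp add: distrib_left)
        qed
        also have "\<dots> \<le> 2 * (real k + 1)\<^sup>2 + 2 * ((L + C\<^sup>2) * (real k + 1))\<^sup>2"
        proof (intro add_mono mult_left_mono power_mono)
          show "real k \<le> (real k + 1)\<^sup>2" by (simp add: power2_eq_square algebra_simps)
          have "sqrt (real N) * cmod (\<Sum>i<N. ?u i * ?v i) \<le> L"
          proof -
            have "complex_of_real (sqrt (real N) * (\<Sum>i<N. u N i * v N i)) = of_real (sqrt (real N)) * (\<Sum>i<N. ?u i * ?v i)" by simp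
            thus ?thesis using L[of N] by (simp only: norm_mult norm_of_real) simp
          qed
          also have "L \<le> L * (real k + 1)" using L0 by (simp add: algebra_simps)
          finally have 1: "sqrt (real N) * cmod (\<Sum>i<N. ?u i * ?v i) \<le> L * (real k + 1)" .
          have "C\<^sup>2 / sqrt (real N) \<le> C\<^sup>2 / 1" using N by (intro divide_left_mono) auto
          hence "real k * (C\<^sup>2 / sqrt (real N)) \<le> (real k + 1) * C\<^sup>2" by (intro mult_mono) auto
          with 1 show "sqrt (real N) * cmod (\<Sum>i<N. ?u i * ?v i) + real k * (C\<^sup>2 / sqrt (real N)) \<le> (L + C\<^sup>2) * (real k + 1)"
            by (simp add: algebra_simps)
        qed auto
        also have "\<dots> = (2 + 2 * (L + C\<^sup>2)\<^sup>2) * (real k + 1)\<^sup>2" unfolding power_mult_distrib by (simp only: distrib_right mult.assoc)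
        also have "\<dots> \<le> c * (real k + 1)\<^sup>2" by (intro mult_right_mono) (simp_all add: c_def)
        finally show "expectation (\<lambda>\<omega>. (sqrt (real N) * cmod (bordered_coeff (Y N \<omega>) ?u ?v N k))\<^sup>2) \<le> c * (real k + 1)\<^sup>2" .
      qed
      have A3: "prob (A3 k) \<le> c / K\<^sup>2 * (1 / weight k)" if k: "k \<in> {1..m}" for k
        unfolding A3_def
      proof (rule weight_tail[OF _ trace_power_second_moment(1) _ K0])
        have k1: "k \<ge> 1" using k by simp
        show "k \<ge> 1" "N \<ge> 1" by fact+
        have "expectation (\<lambda>\<omega>. (cmod (trace_power k N \<omega>))\<^sup>2) \<le> 4 * (real k)\<^sup>2 + 1"
          using trace_power_second_moment(2)[OF k1 N] elim(1) k by fastforce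
        also have "\<dots> \<le> 5 * (real k + 1)\<^sup>2" by (simp add: power2_eq_square algebra_simps)
        also have "\<dots> \<le> c * (real k + 1)\<^sup>2" using c0 by (intro mult_right_mono) auto
        finally show "expectation (\<lambda>\<omega>. (cmod (trace_power k N \<omega>))\<^sup>2) \<le> c * (real k + 1)\<^sup>2" .
      qed measurable
      have union: "prob (\<Union>k\<in>I. A k) \<le> c / K\<^sup>2 * 1"
        if I: "finite I" and A: "\<And>k. k \<in> I \<Longrightarrow> A k \<in> sets P" "\<And>k. k \<in> I \<Longrightarrow> prob (A k) \<le> c / K\<^sup>2 * (1 / weight k)" for I A
      proof -
        have "prob (\<Union>k\<in>I. A k) \<le> (\<Sum>k\<in>I. prob (A k))"
          using I A(1) by (intro finite_measure_subadditive_finite) auto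
        also have "\<dots> \<le> (\<Sum>k\<in>I. c / K\<^sup>2 * (1 / weight k))" by (intro sum_mono A(2))
        also have "\<dots> \<le> c / K\<^sup>2 * 1"
          unfolding sum_distrib_left[symmetric] using c0 by (intro mult_left_mono sum_inverse_weight_le I) auto
        finally show ?thesis .
      qed
      have "{\<omega> \<in> space P. \<not> controlled (Y N \<omega>) ?u ?v N K m} \<subseteq> (\<Union>k\<in>{..N}. A1 k) \<union> (\<Union>k\<in>{..Suc N}. A2 k) \<union> (\<Union>k\<in>{1..m}. A3 k)"
        unfolding controlled_def A1_def A2_def A3_def trace_power_eq by (auto simp: not_le)
      hence "prob {\<omega> \<in> space P. \<not> controlled (Y N \<omega>) ?u ?v N K m}
          \<le> prob ((\<Union>k\<in>{..N}. A1 k) \<union> (\<Union>k\<in>{..Suc N}. A2 k) \<union> (\<Union>k\<in>{1..m}. A3 k))"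
        by (intro finite_measure_mono) auto
      also have "\<dots> \<le> (prob (\<Union>k\<in>{..N}. A1 k) + prob (\<Union>k\<in>{..Suc N}. A2 k)) + prob (\<Union>k\<in>{1..m}. A3 k)"
        by (intro order_trans[OF measure_Un_le] add_right_mono measure_Un_le) auto
      also have "\<dots> \<le> (c / K\<^sup>2 * 1 + c / K\<^sup>2 * 1) + c / K\<^sup>2 * 1"
        using A1 A2 A3 by (intro add_mono union) auto
      finally show ?case using Ke by simp
    qed
  qed
qed

text \<open>The first two coordinates are deterministic and contribute a phase; the others are
  negated path sums, whence the signs.\<close>

lemma coeffs_char_tendsto:
  "(\<lambda>N. expectation (\<lambda>\<omega>. iexp (Re (\<Sum>k<Suc (Suc n). s k * coeffs N \<omega> k)))) \<longlonglongrightarrow>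
     iexp (Re (s 0 * \<kappa> - s 1 * (\<kappa> * lam))) * of_real (exp (- lin_variance (\<lambda>k. - s (Suc (Suc k))) n / 2))"
proof -
  define d where "d N = Re (s 0 * (of_real (sqrt (real N)) / \<theta> N) - s 1 * of_real (sqrt (real N) * (\<Sum>i<N. u N i * v N i)))" for N
  have eq: "Re (\<Sum>k<Suc (Suc n). s k * coeffs N \<omega> k) = d N + lin_comb (\<lambda>k. - s (Suc (Suc k))) n N \<omega>" for N \<omega>
    unfolding sum.lessThan_Suc_shift d_def lin_comb_def
    using coeffs_1[of N \<omega>] by (simp add: coeffs_0 coeffs_Suc)
  have "d \<longlonglongrightarrow> Re (s 0 * \<kappa> - s 1 * (\<kappa> * lam))"
    unfolding d_def[abs_def] by (intro tendsto_intros \<theta>_limit scaled_overlap_tendsto)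
  hence "(\<lambda>N. iexp (d N)) \<longlonglongrightarrow> iexp (Re (s 0 * \<kappa> - s 1 * (\<kappa> * lam)))"
    by (intro tendsto_intros)
  from tendsto_mult[OF this lin_comb_char_tendsto[of "\<lambda>k. - s (Suc (Suc k))" n]]
  show ?thesis unfolding eq by (simp add: distrib_left exp_add)
qed

end

section \<open>Gaussian Laurent series\<close>

text \<open>Expressed through the second moment, the formula covers the degenerate and the
  nondegenerate case alike.\<close>

lemma (in prob_space) char_centered_gaussian:
  assumes "centered_gaussian_real M Z"
  shows "integrable M (\<lambda>\<omega>. (Z \<omega>)\<^sup>2)"
    and "expectation (\<lambda>\<omega>. iexp (Z \<omega>)) = of_real (exp (- expectation (\<lambda>\<omega>. (Z \<omega>)\<^sup>2) / 2))"
proof -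
  have meas [measurable]: "Z \<in> borel_measurable M" using assms by (simp add: centered_gaussian_real_def)
  have "integrable M (\<lambda>\<omega>. (Z \<omega>)\<^sup>2) \<and>
    expectation (\<lambda>\<omega>. iexp (Z \<omega>)) = of_real (exp (- expectation (\<lambda>\<omega>. (Z \<omega>)\<^sup>2) / 2))"
  proof (cases "AE \<omega> in M. Z \<omega> = 0")
    case True
    have "integrable M (\<lambda>\<omega>. (Z \<omega>)\<^sup>2) \<longleftrightarrow> integrable M (\<lambda>\<omega>. 0::real)"
      by (rule integrable_cong_AE) (use True in auto)
    moreover have "expectation (\<lambda>\<omega>. (Z \<omega>)\<^sup>2) = expectation (\<lambda>\<omega>. 0::real)"
      by (rule integral_cong_AE) (use True in auto)
    moreover have "expectation (\<lambda>\<omega>. iexp (Z \<omega>)) = expectation (\<lambda>\<omega>. 1)"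
      by (rule integral_cong_AE) (use True in auto)
    ultimately show ?thesis by (simp add: prob_space)
  next
    case False
    then obtain \<sigma> where \<sigma>: "\<sigma> > 0" and D: "distributed M lborel Z (normal_density 0 \<sigma>)"
      using assms by (auto simp: centered_gaussian_real_def)
    have E: "expectation Z = 0" by (rule normal_distributed_expectation[OF \<sigma> D])
    have V: "expectation (\<lambda>\<omega>. (Z \<omega>)\<^sup>2) = \<sigma>\<^sup>2" using normal_distributed_variance[OF \<sigma> D] by (simp add: E)
    have D': "distributed M lborel (\<lambda>\<omega>. Z \<omega> / \<sigma>) std_normal_density"
      using D normal_standard_normal_convert[OF \<sigma>, of Z 0] by simp
    have "distr M borel (\<lambda>\<omega>. Z \<omega> / \<sigma>) = std_normal_distribution"
      using distributed_distr_eq_density[OF D'] distr_cong[of M M borel lborel "\<lambda>\<omega>. Z \<omega> / \<sigma>"] by simp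
    moreover have "char (distr M borel (\<lambda>\<omega>. Z \<omega> / \<sigma>)) \<sigma> = expectation (\<lambda>\<omega>. iexp (\<sigma> * (Z \<omega> / \<sigma>)))"
      unfolding char_def by (subst integral_distr) auto
    ultimately have "expectation (\<lambda>\<omega>. iexp (\<sigma> * (Z \<omega> / \<sigma>))) = char std_normal_distribution \<sigma>" by simp
    \<comment> \<open>A function that is not integrable has integral 0 by convention, whereas this
      integral is positive.\<close>
    moreover have "integrable M (\<lambda>\<omega>. (Z \<omega>)\<^sup>2)"
    proof (rule ccontr)
      assume "\<not> ?thesis"
      from not_integrable_integral_eq[OF this] V \<sigma> show False by simp
    qed
    ultimately show ?thesis using \<sigma> V by (simp add: char_std_normal_distribution)
  qed
  thus "integrable M (\<lambda>\<omega>. (Z \<omega>)\<^sup>2)"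
    "expectation (\<lambda>\<omega>. iexp (Z \<omega>)) = of_real (exp (- expectation (\<lambda>\<omega>. (Z \<omega>)\<^sup>2) / 2))" by auto
qed

locale gaussian_coeffs = prob_space Q for Q :: "'b measure" +
  fixes \<gamma> :: "nat \<Rightarrow> 'b \<Rightarrow> complex" and \<tau> :: complex
  assumes indep: "indep_vars (\<lambda>_. borel) \<gamma> UNIV"
    and gaussian: "centered_gaussian_complex Q (\<gamma> k)"
    and variance: "expectation (\<lambda>\<omega>. (cmod (\<gamma> k \<omega>))\<^sup>2) = 1"
    and pseudo_variance: "expectation (\<lambda>\<omega>. (\<gamma> k \<omega>)\<^sup>2) = \<tau> ^ (k + 1)"
begin

lemma \<gamma>_measurable [measurable]: "\<gamma> k \<in> borel_measurable Q"
  using indep by (simp add: indep_vars_def)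

lemma gaussian_re: "centered_gaussian_real Q (\<lambda>\<omega>. Re (s * \<gamma> k \<omega>))"
proof -
  have "centered_gaussian_real Q (\<lambda>\<omega>. Re s * Re (\<gamma> k \<omega>) + (- Im s) * Im (\<gamma> k \<omega>))"
    using gaussian[of k] unfolding centered_gaussian_complex_def by blast
  thus ?thesis by simp
qed

lemma integrable_\<gamma>_square: "integrable Q (\<lambda>\<omega>. (cmod (\<gamma> k \<omega>))\<^sup>2)" "integrable Q (\<lambda>\<omega>. (\<gamma> k \<omega>)\<^sup>2)"
proof -
  \<comment> \<open>Again the integral would be 0 by convention, but it is 1.\<close>
  show 1: "integrable Q (\<lambda>\<omega>. (cmod (\<gamma> k \<omega>))\<^sup>2)"
  proof (rule ccontr)
    assume "\<not> ?thesis"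
    from not_integrable_integral_eq[OF this] variance[of k] show False by simp
  qed
  show "integrable Q (\<lambda>\<omega>. (\<gamma> k \<omega>)\<^sup>2)"
    by (rule Bochner_Integration.integrable_bound[OF 1]) (auto simp: norm_power)
qed

lemma expectation_re_square:
  "expectation (\<lambda>\<omega>. (Re (s * \<gamma> k \<omega>))\<^sup>2) = ((cmod s)\<^sup>2 + Re (s\<^sup>2 * \<tau> ^ (k + 1))) / 2"
proof -
  have eq: "(Re w)\<^sup>2 = ((cmod w)\<^sup>2 + Re (w\<^sup>2)) / 2" for w
    by (simp only: cmod_power2 Re_power2) simp
  have "expectation (\<lambda>\<omega>. (Re (s * \<gamma> k \<omega>))\<^sup>2)
      = expectation (\<lambda>\<omega>. ((cmod s)\<^sup>2 * (cmod (\<gamma> k \<omega>))\<^sup>2 + Re (s\<^sup>2 * (\<gamma> k \<omega>)\<^sup>2)) / 2)"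
    unfolding eq norm_mult power_mult_distrib ..
  also have "\<dots> = ((cmod s)\<^sup>2 * expectation (\<lambda>\<omega>. (cmod (\<gamma> k \<omega>))\<^sup>2) + Re (s\<^sup>2 * expectation (\<lambda>\<omega>. (\<gamma> k \<omega>)\<^sup>2))) / 2"
    using integrable_\<gamma>_square[of k] by (simp add: integral_Re)
  finally show ?thesis by (simp add: variance pseudo_variance)
qed

lemma char_gaussian_sum:
  "expectation (\<lambda>\<omega>. iexp (Re (\<Sum>k<n. s k * \<gamma> k \<omega>)))
    = of_real (exp (- (\<Sum>k<n. ((cmod (s k))\<^sup>2 + Re ((s k)\<^sup>2 * \<tau> ^ Suc k)) / 2) / 2))"
proof -
  have "expectation (\<lambda>\<omega>. iexp (Re (\<Sum>k<n. s k * \<gamma> k \<omega>))) = expectation (\<lambda>\<omega>. \<Prod>k<n. iexp (Re (s k * \<gamma> k \<omega>)))"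
    by (simp only: Re_sum of_real_sum sum_distrib_left exp_sum[OF finite_lessThan])
  also have "\<dots> = (\<Prod>k<n. expectation (\<lambda>\<omega>. iexp (Re (s k * \<gamma> k \<omega>))))"
  proof (rule indep_vars_lebesgue_integral)
    have "indep_vars (\<lambda>_. borel) (\<lambda>k \<omega>. iexp (Re (s k * \<gamma> k \<omega>))) UNIV"
      by (rule indep_vars_compose2[OF indep, where Y = "\<lambda>k w. iexp (Re (s k * w))"]) measurable
    thus "indep_vars (\<lambda>_. borel) (\<lambda>k \<omega>. iexp (Re (s k * \<gamma> k \<omega>))) {..<n}"
      by (rule indep_vars_subset) auto
    show "integrable Q (\<lambda>\<omega>. iexp (Re (s k * \<gamma> k \<omega>)))" for k
      by (rule integrable_const_bound[of _ 1]) auto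
  qed simp
  also have "\<dots> = (\<Prod>k<n. of_real (exp (- (((cmod (s k))\<^sup>2 + Re ((s k)\<^sup>2 * \<tau> ^ Suc k)) / 2) / 2)))"
    by (intro prod.cong refl) (simp only: char_centered_gaussian(2)[OF gaussian_re] expectation_re_square Suc_eq_plus1)
  also have "\<dots> = of_real (exp (- (\<Sum>k<n. ((cmod (s k))\<^sup>2 + Re ((s k)\<^sup>2 * \<tau> ^ Suc k)) / 2) / 2))"
    by (simp only: of_real_prod[symmetric] exp_sum[OF finite_lessThan, symmetric] sum_negf sum_divide_distrib[symmetric] minus_divide_left[symmetric])
  finally show ?thesis .
qed

text \<open>Positive variance makes \<open>Re (s * \<gamma> k)\<close> a nondegenerate Gaussian for
  some s, and such a variable has no atom at 0. This includes variables concentrated on a real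
  line.\<close>

lemma AE_nonzero: "AE \<omega> in Q. \<gamma> k \<omega> \<noteq> 0"
proof -
  have "\<exists>s. \<not> (AE \<omega> in Q. Re (s * \<gamma> k \<omega>) = 0)"
  proof (rule ccontr)
    assume "\<not> ?thesis"
    hence *: "AE \<omega> in Q. Re (s * \<gamma> k \<omega>) = 0" for s by blast
    \<comment> \<open>The choices s = 1 and s = -i recover the real and the imaginary part.\<close>
    have "AE \<omega> in Q. \<gamma> k \<omega> = 0"
      using *[of 1] *[of "- \<i>"] by eventually_elim (simp add: complex_eq_iff)
    hence "expectation (\<lambda>\<omega>. (cmod (\<gamma> k \<omega>))\<^sup>2) = expectation (\<lambda>\<omega>. 0)"
      by (intro integral_cong_AE) auto
    thus False using variance[of k] by simp
  qed
  then obtain s \<sigma> where \<sigma>: "\<sigma> > 0" and D: "distributed Q lborel (\<lambda>\<omega>. Re (s * \<gamma> k \<omega>)) (normal_density 0 \<sigma>)"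
    using gaussian_re[of _ k] unfolding centered_gaussian_real_def by blast
  have "AE x in distr Q lborel (\<lambda>\<omega>. Re (s * \<gamma> k \<omega>)). x \<noteq> 0"
    unfolding distributed_distr_eq_density[OF D]
    by (subst AE_density) (auto intro: AE_mp[OF AE_lborel_singleton])
  hence "AE \<omega> in Q. Re (s * \<gamma> k \<omega>) \<noteq> 0" by (subst (asm) AE_distr_iff) auto
  thus ?thesis by eventually_elim auto
qed

lemma nonzero_tail:
  assumes e: "e > 0"
  shows "\<exists>\<delta>>0. prob {\<omega> \<in> space Q. cmod (\<gamma> k \<omega>) \<le> \<delta>} \<le> e"
proof -
  define A where "A n = {\<omega> \<in> space Q. cmod (\<gamma> k \<omega>) \<le> 1 / real (Suc n)}" for n
  have "(\<lambda>n. prob (A n)) \<longlonglongrightarrow> prob (\<Inter>n. A n)"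
  proof (rule finite_Lim_measure_decseq)
    show "range A \<subseteq> sets Q" unfolding A_def by auto
    show "decseq A" unfolding A_def decseq_def by (auto intro: order_trans[OF _ divide_left_mono])
  qed
  moreover have "(\<Inter>n. A n) = {\<omega> \<in> space Q. \<gamma> k \<omega> = 0}"
  proof -
    have "w = 0" if "\<forall>n. cmod w \<le> 1 / real (Suc n)" for w :: complex
    proof (rule ccontr)
      assume "w \<noteq> 0"
      then obtain n where "inverse (real (Suc n)) < cmod w" using reals_Archimedean[of "cmod w"] by auto
      with that[rule_format, of n] show False by (simp add: inverse_eq_divide)
    qed
    thus ?thesis by (auto simp: A_def)
  qed
  moreover have "prob {\<omega> \<in> space Q. \<gamma> k \<omega> = 0} = 0"
    using AE_nonzero[of k] by (subst prob_eq_0) auto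
  ultimately have "(\<lambda>n. prob (A n)) \<longlonglongrightarrow> 0" by simp
  hence "\<forall>\<^sub>F n in sequentially. prob (A n) < e" using e by (rule order_tendstoD)
  then obtain n where "prob (A n) < e" by (auto simp: eventually_sequentially)
  thus ?thesis unfolding A_def by (intro exI[of _ "1 / real (Suc n)"]) auto
qed

text \<open>For a = \<kappa> and b = -\<kappa> lam, the Laurent coefficients of (\<kappa> z (z -
  lam) + g(z)) / z^2.\<close>

definition limit_coeffs :: "complex \<Rightarrow> complex \<Rightarrow> 'b \<Rightarrow> nat \<Rightarrow> complex" where
  "limit_coeffs a b \<omega> k = (if k = 0 then a else if k = 1 then b else \<gamma> (k - 2) \<omega>)"

lemma limit_coeffs_simps [simp]: "limit_coeffs a b \<omega> 0 = a" "limit_coeffs a b \<omega> (Suc 0) = b"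
  "limit_coeffs a b \<omega> (Suc (Suc k)) = \<gamma> k \<omega>"
  by (simp_all add: limit_coeffs_def)

lemma limit_coeffs_measurable [measurable]: "limit_coeffs a b \<in> borel_measurable Q"
proof (rule measurable_coordinatewise_then_product)
  show "(\<lambda>\<omega>. limit_coeffs a b \<omega> k) \<in> borel_measurable Q" for k
    by (cases k; cases "k - 1") simp_all
qed

text \<open>Chebyshev's inequality at level B R^k for every k; R > 1 makes the union bound a
  geometric series.\<close>

lemma limit_coeffs_tight:
  assumes e: "e > 0" and R: "R > 1"
  shows "\<exists>B0. \<forall>B\<ge>B0. prob {\<omega> \<in> space Q. limit_coeffs a b \<omega> \<notin> coeff_bound R B} \<le> e"
proof -
  define S where "S = (\<Sum>k. (1 / R\<^sup>2) ^ k)"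
  have R2: "1 / R\<^sup>2 < 1" using R by (simp add: power2_eq_square less_1_mult)
  have summ: "summable (\<lambda>k. (1 / R\<^sup>2) ^ k)" using R R2 by (intro summable_geometric) auto
  have S1: "S \<ge> 1" unfolding S_def using sum_le_suminf[OF summ, of "{0}"] by auto
  \<comment> \<open>For B >= 1 and B >= S / e the union bound S / B^2 is at most e; the two
    deterministic coordinates are dominated as well.\<close>
  define B0 where "B0 = max (max 1 (S / e)) (max (cmod a) (cmod b))"
  show ?thesis
  proof (intro exI[of _ B0] allI impI)
    fix B assume "B \<ge> B0"
    hence B: "B \<ge> 1" "B \<ge> S / e" "B \<ge> cmod a" "B \<ge> cmod b" by (auto simp: B0_def)
    define A where "A k = {\<omega> \<in> space Q. (cmod (\<gamma> k \<omega>))\<^sup>2 \<ge> (B * R ^ k)\<^sup>2}" for k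
    have [measurable]: "A k \<in> sets Q" for k unfolding A_def by measurable
    have A: "prob (A k) \<le> 1 / B\<^sup>2 * (1 / R\<^sup>2) ^ k" for k
    proof -
      have "prob (A k) \<le> expectation (\<lambda>\<omega>. (cmod (\<gamma> k \<omega>))\<^sup>2) / (B * R ^ k)\<^sup>2"
        unfolding A_def
        by (rule integral_Markov_inequality_measure[OF integrable_\<gamma>_square(1), of "{}"]) (use B R in auto)
      also have "\<dots> = 1 / B\<^sup>2 * (1 / R\<^sup>2) ^ k"
        by (simp add: variance power_mult_distrib power_divide power_mult[symmetric] mult.commute)
      finally show ?thesis .
    qed
    have sA: "summable (\<lambda>k. prob (A k))"
      by (rule summable_comparison_test'[OF summable_mult[OF summ, of "1 / B\<^sup>2"]]) (use A in auto)
    have "{\<omega> \<in> space Q. limit_coeffs a b \<omega> \<notin> coeff_bound R B} \<subseteq> (\<Union>k. A k)"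
    proof
      fix \<omega> assume "\<omega> \<in> {\<omega> \<in> space Q. limit_coeffs a b \<omega> \<notin> coeff_bound R B}"
      then obtain k where \<omega>: "\<omega> \<in> space Q" and k: "cmod (limit_coeffs a b \<omega> k) > B * R ^ k"
        by (auto simp: coeff_bound_def not_le)
      have B_le: "B \<le> B * R ^ k" using B R by simp
      have "k \<noteq> 0" using k B(3) by (intro notI) simp
      moreover have "k \<noteq> 1" using k B_le B(4) by (intro notI) simp
      ultimately
      obtain j where j: "k = Suc (Suc j)" by (metis One_nat_def not0_implies_Suc)
      have "B * R ^ j \<le> B * R ^ k" using B R j by (intro mult_left_mono power_increasing) auto
      hence "B * R ^ j \<le> cmod (\<gamma> j \<omega>)" using k j by simp
      hence "\<omega> \<in> A j" using \<omega> B R by (auto simp: A_def intro!: power_mono)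
      thus "\<omega> \<in> (\<Union>k. A k)" by blast
    qed
    hence "prob {\<omega> \<in> space Q. limit_coeffs a b \<omega> \<notin> coeff_bound R B} \<le> prob (\<Union>k. A k)"
      by (intro finite_measure_mono) auto
    also have "\<dots> \<le> (\<Sum>k. prob (A k))" using sA by (intro finite_measure_subadditive_countably) auto
    also have "\<dots> \<le> (\<Sum>k. 1 / B\<^sup>2 * (1 / R\<^sup>2) ^ k)"
      by (intro suminf_le A sA summable_mult summ)
    also have "\<dots> = S / B\<^sup>2" unfolding S_def by (subst suminf_mult[OF summ]) simp
    also have "\<dots> \<le> e"
    proof -
      have "S / e \<le> B\<^sup>2" using B(1,2) self_le_power[of B 2] by linarith
      thus ?thesis using e B(1) by (simp add: field_simps)
    qed
    finally show "prob {\<omega> \<in> space Q. limit_coeffs a b \<omega> \<notin> coeff_bound R B} \<le> e" .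
  qed
qed

lemma limit_coeffs_char:
  "expectation (\<lambda>\<omega>. iexp (Re (\<Sum>k<Suc (Suc n). s k * limit_coeffs a b \<omega> k))) =
     iexp (Re (s 0 * a + s 1 * b)) *
     of_real (exp (- (\<Sum>k<n. ((cmod (s (Suc (Suc k))))\<^sup>2 + Re ((s (Suc (Suc k)))\<^sup>2 * \<tau> ^ Suc k)) / 2) / 2))"
proof -
  have "iexp (Re (\<Sum>k<Suc (Suc n). s k * limit_coeffs a b \<omega> k))
      = iexp (Re (s 0 * a + s 1 * b)) * iexp (Re (\<Sum>k<n. s (Suc (Suc k)) * \<gamma> k \<omega>))" for \<omega>
    unfolding sum.lessThan_Suc_shift by (simp add: exp_add[symmetric] algebra_simps)
  thus ?thesis by (simp only: integral_mult_right_zero char_gaussian_sum)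
qed

end

section \<open>Convergence of the point processes\<close>

text \<open>Off \<open>tame R\<close> the value of \<open>zero_sum\<close> is junk, and cutting it off makes it Borel measurable.\<close>

definition tame_zero_sum :: "real \<Rightarrow> (complex \<Rightarrow> real) \<Rightarrow> (nat \<Rightarrow> complex) \<Rightarrow> real" where
  "tame_zero_sum R \<phi> \<xi> = indicator (tame R) \<xi> *\<^sub>R zero_sum R \<phi> \<xi>"

lemma tame_zero_sum_eq: "\<xi> \<in> tame R \<Longrightarrow> tame_zero_sum R \<phi> \<xi> = zero_sum R \<phi> \<xi>"
  by (simp add: tame_zero_sum_def)

lemma compact_coeff_bound_away:
  "compact {\<xi> \<in> coeff_bound R B. cmod (\<xi> k) \<ge> \<delta>}"
proof -
  have "closed {\<xi> :: nat \<Rightarrow> complex. cmod (\<xi> k) \<ge> \<delta>}"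
    by (intro closed_Collect_le continuous_intros continuous_on_coord)
  from compact_Int_closed[OF compact_coeff_bound this, of R B] show ?thesis
    by (simp add: Int_def)
qed

lemma coeff_bound_away_subset:
  "\<delta> > 0 \<Longrightarrow> {\<xi> \<in> coeff_bound R B. cmod (\<xi> k) \<ge> \<delta>} \<subseteq> coeff_bound R B - {\<lambda>_. 0}"
  by auto

lemma coeff_bound_in_sets: "coeff_bound R B \<in> sets borel"
  by (rule borel_closed[OF closed_coeff_bound])

lemma coord_measurable [measurable]: "(\<lambda>\<xi> :: nat \<Rightarrow> complex. \<xi> k) \<in> borel_measurable borel"
  by (intro borel_measurable_continuous_onI continuous_on_coord)

context iid_deformed
begin

text \<open>On one event of large probability the coefficients lie in a fixed compact set and their
  Laurent series has the same zeros as the characteristic polynomial.\<close>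

lemma coeffs_regular:
  assumes R: "R > 1" and e: "e > 0"
  shows "\<exists>B0. \<forall>\<^sub>F N in sequentially. \<exists>A\<in>sets P. prob A \<le> e \<and> (\<forall>\<omega>\<in>space P - A. coeffs N \<omega> \<in> coeff_bound R B0 \<and>
    (\<forall>z\<in>- cball 0 R. zero_points (laurent (coeffs N \<omega>)) z = zero_points (laurent (poly_coeffs N \<omega>)) z))"
proof -
  obtain K where K: "K > 0" "\<forall>\<^sub>F N in sequentially. cmod (of_real (sqrt (real N)) / \<theta> N) \<le> K"
    "\<And>m. \<forall>\<^sub>F N in sequentially. prob {\<omega> \<in> space P.
       \<not> controlled (Y N \<omega>) (\<lambda>i. of_real (u N i)) (\<lambda>i. of_real (v N i)) N K m} \<le> e"
    using controlled_probability[OF e] by blast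
  obtain B0 m where Bm: "\<And>N y u v \<theta>. N \<ge> 1 \<Longrightarrow> \<theta> \<noteq> 0 \<Longrightarrow> cmod (of_real (sqrt (real N)) / \<theta>) \<le> K \<Longrightarrow> controlled y u v N K m \<Longrightarrow>
    resolvent_coeff y u v \<theta> N \<in> coeff_bound R B0 \<and>
    (\<forall>z\<in>- cball 0 R. zero_points (laurent (resolvent_coeff y u v \<theta> N)) z = zero_points (laurent (char_coeff y u v \<theta> N)) z)"
    using controlled_resolvent_coeff[OF R, of K] K(1) by (metis less_imp_le)
  show ?thesis
  proof (rule exI[of _ B0])
    show "\<forall>\<^sub>F N in sequentially. \<exists>A\<in>sets P. prob A \<le> e \<and> (\<forall>\<omega>\<in>space P - A. coeffs N \<omega> \<in> coeff_bound R B0 \<and>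
      (\<forall>z\<in>- cball 0 R. zero_points (laurent (coeffs N \<omega>)) z = zero_points (laurent (poly_coeffs N \<omega>)) z))"
      using K(2) K(3)[of m] eventually_ge_at_top[of 1]
    proof eventually_elim
      case (elim N)
      let ?A = "{\<omega> \<in> space P. \<not> controlled (Y N \<omega>) (\<lambda>i. of_real (u N i)) (\<lambda>i. of_real (v N i)) N K m}"
      have "?A \<in> sets P"
        unfolding controlled_def trace_power_eq[symmetric] by measurable
      moreover have "coeffs N \<omega> \<in> coeff_bound R B0 \<and>
        (\<forall>z\<in>- cball 0 R. zero_points (laurent (coeffs N \<omega>)) z = zero_points (laurent (poly_coeffs N \<omega>)) z)"
        if "\<omega> \<in> space P - ?A" for \<omega>
        unfolding coeffs_def poly_coeffs_def
        by (rule Bm[OF elim(3) \<theta>_nonzero[OF elim(3)] elim(1)]) (use that in blast)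
      ultimately show ?case using elim(2) by blast
    qed
  qed
qed

lemma coeffs_nonzero: "N \<ge> 1 \<Longrightarrow> coeffs N \<omega> \<noteq> (\<lambda>_. 0)"
  using coeffs_0[of N \<omega>] \<theta>_nonzero[of N] by (auto simp: fun_eq_iff intro!: exI[of _ 0])

lemma poly_coeffs_tame: "R \<ge> 1 \<Longrightarrow> poly_coeffs N \<omega> \<in> tame R"
  unfolding poly_coeffs_def by (rule char_coeff_tame)

end

locale deformed_limit = iid_deformed P X u v C \<theta> \<kappa> lam + G: gaussian_coeffs Q \<gamma> "iid_entries.pseudo_var P X"
  for P :: "'a measure" and X and u v :: "nat \<Rightarrow> nat \<Rightarrow> real" and C \<theta> \<kappa> lam and Q :: "'b measure" and \<gamma>
begin

definition limit :: "'b \<Rightarrow> nat \<Rightarrow> complex" where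
  "limit = G.limit_coeffs \<kappa> (- (\<kappa> * lam))"

lemma limit_measurable [measurable]: "limit \<in> borel_measurable Q"
  unfolding limit_def by (rule G.limit_coeffs_measurable)

lemma char_tendsto:
  "(\<lambda>N. expectation (\<lambda>\<omega>. iexp (Re (\<Sum>k<n. s k * coeffs N \<omega> k)))) \<longlonglongrightarrow>
     G.expectation (\<lambda>\<omega>. iexp (Re (\<Sum>k<n. s k * limit \<omega> k)))"
proof -
  \<comment> \<open>Padding with zeros makes the number of coordinates at least 2, as the formulas
    for both sides assume.\<close>
  define s' where "s' k = (if k < n then s k else 0)" for k
  have eq: "(\<Sum>k<n. s k * x k) = (\<Sum>k<Suc (Suc n). s' k * x k)" for x :: "nat \<Rightarrow> complex"
    by (rule sum.mono_neutral_cong_left) (auto simp: s'_def)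
  have "G.expectation (\<lambda>\<omega>. iexp (Re (\<Sum>k<Suc (Suc n). s' k * limit \<omega> k)))
      = iexp (Re (s' 0 * \<kappa> - s' 1 * (\<kappa> * lam))) * of_real (exp (- lin_variance (\<lambda>k. - s' (Suc (Suc k))) n / 2))"
    unfolding limit_def G.limit_coeffs_char by (simp add: lin_variance_def)
  thus ?thesis unfolding eq using coeffs_char_tendsto[where s = s' and n = n] by simp
qed

lemma coeffs_tight:
  assumes R: "R > 1" and e: "e > 0"
  shows "\<exists>B. (\<forall>\<^sub>F N in sequentially. prob {\<omega> \<in> space P. coeffs N \<omega> \<notin> coeff_bound R B} \<le> e) \<and>
    G.prob {\<omega> \<in> space Q. limit \<omega> \<notin> coeff_bound R B} \<le> e"
proof -
  obtain B1 where B1: "\<forall>\<^sub>F N in sequentially. \<exists>A\<in>sets P. prob A \<le> e \<and> (\<forall>\<omega>\<in>space P - A. coeffs N \<omega> \<in> coeff_bound R B1 \<and>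
    (\<forall>z\<in>- cball 0 R. zero_points (laurent (coeffs N \<omega>)) z = zero_points (laurent (poly_coeffs N \<omega>)) z))"
    using coeffs_regular[OF R e] by blast
  obtain B2 where B2: "\<forall>B\<ge>B2. G.prob {\<omega> \<in> space Q. limit \<omega> \<notin> coeff_bound R B} \<le> e"
    using G.limit_coeffs_tight[OF e R] unfolding limit_def by blast
  show ?thesis
  proof (intro exI[of _ "max B1 B2"] conjI)
    show "\<forall>\<^sub>F N in sequentially. prob {\<omega> \<in> space P. coeffs N \<omega> \<notin> coeff_bound R (max B1 B2)} \<le> e"
      using B1
    proof eventually_elim
      case (elim N)
      then obtain A where A: "A \<in> sets P" "prob A \<le> e" "\<And>\<omega>. \<omega> \<in> space P - A \<Longrightarrow> coeffs N \<omega> \<in> coeff_bound R B1" by blast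
      have "coeff_bound R B1 \<subseteq> coeff_bound R (max B1 B2)" using R by (intro coeff_bound_mono) auto
      hence "{\<omega> \<in> space P. coeffs N \<omega> \<notin> coeff_bound R (max B1 B2)} \<subseteq> A" using A(3) by blast
      hence "prob {\<omega> \<in> space P. coeffs N \<omega> \<notin> coeff_bound R (max B1 B2)} \<le> prob A"
        using A(1) by (intro finite_measure_mono) auto
      thus ?case using A(2) by simp
    qed
    show "G.prob {\<omega> \<in> space Q. limit \<omega> \<notin> coeff_bound R (max B1 B2)} \<le> e" using B2 by simp
  qed
qed

text \<open>Coordinate 2 is used because its limit is \<gamma>_0, which has no atom at 0; both
  earlier coordinates vanish in the limit if \<kappa> = 0. Weak convergence carries the bound over
  to large N.\<close>

lemma coeffs_away_from_0:
  assumes e: "e > 0"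
  shows "\<exists>\<delta>>0. (\<forall>\<^sub>F N in sequentially. prob {\<omega> \<in> space P. cmod (coeffs N \<omega> 2) < \<delta>} \<le> e) \<and>
    G.prob {\<omega> \<in> space Q. cmod (limit \<omega> 2) < \<delta>} \<le> e"
proof -
  obtain d where d: "d > 0" "G.prob {\<omega> \<in> space Q. cmod (\<gamma> 0 \<omega>) \<le> d} \<le> e / 2"
    using G.nonzero_tail[of "e / 2" 0] e by auto
  have lim2: "limit \<omega> 2 = \<gamma> 0 \<omega>" for \<omega> by (simp add: limit_def G.limit_coeffs_def)
  define \<delta> where "\<delta> = d / 2"
  have \<delta>: "\<delta> > 0" using d by (simp add: \<delta>_def)
  \<comment> \<open>F is 1 up to \<delta> and 0 from 2 \<delta> = d on, so it lies between the
    indicators of the two events to be compared.\<close>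
  define F :: "(nat \<Rightarrow> complex) \<Rightarrow> real" where "F \<xi> = max 0 (min 1 (2 - cmod (\<xi> 2) / \<delta>))" for \<xi>
  have Fcont: "continuous_on S F" for S
    unfolding F_def by (intro continuous_intros continuous_on_coord) (use \<delta> in auto)
  have Fmeas [measurable]: "F \<in> borel_measurable borel"
    by (rule borel_measurable_continuous_onI[OF Fcont])
  have F01: "0 \<le> F \<xi>" "F \<xi> \<le> 1" for \<xi> by (auto simp: F_def)
  have "(\<lambda>N. expectation (\<lambda>\<omega>. F (coeffs N \<omega>))) \<longlonglongrightarrow> G.expectation (\<lambda>\<omega>. F (limit \<omega>))"
  proof (rule weak_limit_of_characteristic_functions[OF prob_space_axioms G.prob_space_axioms coeffs_measurable limit_measurable char_tendsto Fmeas])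
    show "\<bar>F \<xi>\<bar> \<le> 1" for \<xi> using F01[of \<xi>] by simp
    fix e :: real assume "e > 0"
    from coeffs_tight[OF _ this, of 2] show "\<exists>K. compact K \<and> continuous_on K F \<and>
      (\<forall>\<^sub>F N in sequentially. prob {\<omega> \<in> space P. coeffs N \<omega> \<notin> K} \<le> e) \<and> G.prob {\<omega> \<in> space Q. limit \<omega> \<notin> K} \<le> e"
      using compact_coeff_bound Fcont by auto
  qed
  moreover have "G.expectation (\<lambda>\<omega>. F (limit \<omega>)) < e"
  proof -
    have "G.expectation (\<lambda>\<omega>. F (limit \<omega>)) \<le> G.expectation (indicator {\<omega> \<in> space Q. cmod (\<gamma> 0 \<omega>) \<le> d})"
    proof (rule integral_mono)
      show "integrable Q (\<lambda>\<omega>. F (limit \<omega>))" by (rule G.integrable_const_bound[of _ 1]) (use F01 in auto)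
      show "integrable Q (indicator {\<omega> \<in> space Q. cmod (\<gamma> 0 \<omega>) \<le> d} :: 'b \<Rightarrow> real)"
        by (rule G.integrable_const_bound[of _ 1]) auto
      fix \<omega> assume \<omega>: "\<omega> \<in> space Q"
      show "F (limit \<omega>) \<le> indicator {\<omega> \<in> space Q. cmod (\<gamma> 0 \<omega>) \<le> d} \<omega>"
      proof (cases "cmod (\<gamma> 0 \<omega>) \<le> d")
        case True
        thus ?thesis using \<omega> F01 by simp
      next
        case False
        hence "cmod (\<gamma> 0 \<omega>) / \<delta> \<ge> 2" using \<delta> by (simp add: \<delta>_def field_simps)
        thus ?thesis using False by (simp add: F_def lim2)
      qed
    qed
    also have "\<dots> = G.prob {\<omega> \<in> space Q. cmod (\<gamma> 0 \<omega>) \<le> d}" by simp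
    finally show ?thesis using d(2) e by linarith
  qed
  ultimately have ev: "\<forall>\<^sub>F N in sequentially. expectation (\<lambda>\<omega>. F (coeffs N \<omega>)) < e" by (rule order_tendstoD)
  show ?thesis
  proof (intro exI[of _ \<delta>] conjI)
    show "\<forall>\<^sub>F N in sequentially. prob {\<omega> \<in> space P. cmod (coeffs N \<omega> 2) < \<delta>} \<le> e"
      using ev
    proof eventually_elim
      case (elim N)
      have [measurable]: "{\<omega> \<in> space P. cmod (coeffs N \<omega> 2) < \<delta>} \<in> sets P" by measurable
      have "prob {\<omega> \<in> space P. cmod (coeffs N \<omega> 2) < \<delta>} = expectation (indicator {\<omega> \<in> space P. cmod (coeffs N \<omega> 2) < \<delta>})"
        by simp
      also have "\<dots> \<le> expectation (\<lambda>\<omega>. F (coeffs N \<omega>))"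
      proof (rule integral_mono)
        show "integrable P (\<lambda>\<omega>. F (coeffs N \<omega>))" by (rule integrable_const_bound[of _ 1]) (use F01 in auto)
        show "integrable P (indicator {\<omega> \<in> space P. cmod (coeffs N \<omega> 2) < \<delta>} :: 'a \<Rightarrow> real)"
          by (rule integrable_const_bound[of _ 1]) auto
        fix \<omega>
        show "indicator {\<omega> \<in> space P. cmod (coeffs N \<omega> 2) < \<delta>} \<omega> \<le> F (coeffs N \<omega>)"
        proof (cases "cmod (coeffs N \<omega> 2) < \<delta>")
          case True
          hence "cmod (coeffs N \<omega> 2) / \<delta> \<le> 1" using \<delta> by simp
          hence "F (coeffs N \<omega>) = 1" by (simp add: F_def)
          thus ?thesis by (simp add: indicator_def)
        qed (use F01 in simp)
      qed
      finally show ?case using elim by simp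
    qed
    have "G.prob {\<omega> \<in> space Q. cmod (limit \<omega> 2) < \<delta>} \<le> G.prob {\<omega> \<in> space Q. cmod (\<gamma> 0 \<omega>) \<le> d}"
      using d(1) by (intro G.finite_measure_mono) (auto simp: lim2 \<delta>_def)
    thus "G.prob {\<omega> \<in> space Q. cmod (limit \<omega> 2) < \<delta>} \<le> e" using d(2) e by linarith
  qed fact
qed

text \<open>Tightness at every level e makes the event that no coefficient bound holds null, and
  \<gamma>_0 is almost surely nonzero.\<close>

lemma limit_tame:
  assumes R: "R > 1"
  shows "AE \<omega> in Q. limit \<omega> \<in> tame R"
proof -
  have meas [measurable]: "{\<omega> \<in> space Q. limit \<omega> \<notin> coeff_bound R B} \<in> sets Q" for B
    using coeff_bound_in_sets[of R B] by measurable
  define E where "E = (\<Inter>n::nat. {\<omega> \<in> space Q. limit \<omega> \<notin> coeff_bound R (real n)})"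
  have [measurable]: "E \<in> sets Q" unfolding E_def by measurable
  have "G.prob E \<le> 0"
  proof (rule field_le_epsilon)
    fix e :: real assume e: "e > 0"
    obtain B0 where B0: "\<forall>B\<ge>B0. G.prob {\<omega> \<in> space Q. limit \<omega> \<notin> coeff_bound R B} \<le> e"
      using G.limit_coeffs_tight[OF e R] unfolding limit_def by blast
    obtain n :: nat where "real n \<ge> B0" using real_arch_simple by blast
    hence "G.prob {\<omega> \<in> space Q. limit \<omega> \<notin> coeff_bound R (real n)} \<le> e" using B0 by blast
    moreover have "G.prob E \<le> G.prob {\<omega> \<in> space Q. limit \<omega> \<notin> coeff_bound R (real n)}"
      by (rule G.finite_measure_mono) (auto simp: E_def)
    ultimately show "G.prob E \<le> 0 + e" by simp
  qed
  hence "G.prob E = 0" by (simp add: measure_le_0_iff)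
  hence "AE \<omega> in Q. \<omega> \<notin> E" by (subst (asm) G.prob_eq_0) auto
  moreover have "AE \<omega> in Q. limit \<omega> 2 \<noteq> 0"
    using G.AE_nonzero[of 0] by (simp add: limit_def G.limit_coeffs_def)
  ultimately show ?thesis using AE_space
  proof eventually_elim
    case (elim \<omega>)
    hence "\<exists>n::nat. limit \<omega> \<in> coeff_bound R (real n)" by (auto simp: E_def)
    moreover have "limit \<omega> \<noteq> (\<lambda>_. 0)" using elim(2) by (metis (full_types))
    ultimately show ?case by (auto simp: tame_def)
  qed
qed

text \<open>The limit is taken for the resolvent coefficients, whose law is understood, and
  transferred to the characteristic polynomial, which has the same zeros with high
  probability.\<close>

lemma tame_zero_sum_tendsto:
  fixes f :: "real \<Rightarrow> real"
  assumes R: "R > 1" and \<phi>: "test_fun R \<phi>" and f: "continuous_on UNIV f" and f_le: "\<And>x. \<bar>f x\<bar> \<le> 1"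
  shows "(\<lambda>N. expectation (\<lambda>\<omega>. f (tame_zero_sum R \<phi> (poly_coeffs N \<omega>)))) \<longlonglongrightarrow>
    G.expectation (\<lambda>\<omega>. f (tame_zero_sum R \<phi> (limit \<omega>)))"
proof -
  have R1: "R \<ge> 1" using R by simp
  have [measurable]: "f \<in> borel_measurable borel" by (rule borel_measurable_continuous_onI[OF f])
  have [measurable]: "tame_zero_sum R \<phi> \<in> borel_measurable borel"
    unfolding tame_zero_sum_def[abs_def] by (rule borel_measurable_zero_sum[OF R1 \<phi>])
  have Fmeas: "(\<lambda>\<xi>. f (tame_zero_sum R \<phi> \<xi>)) \<in> borel_measurable borel" by measurable
  have lim: "(\<lambda>N. expectation (\<lambda>\<omega>. f (tame_zero_sum R \<phi> (coeffs N \<omega>)))) \<longlonglongrightarrow>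
    G.expectation (\<lambda>\<omega>. f (tame_zero_sum R \<phi> (limit \<omega>)))"
  proof (rule weak_limit_of_characteristic_functions[OF prob_space_axioms G.prob_space_axioms coeffs_measurable limit_measurable char_tendsto Fmeas f_le])
    fix e :: real assume "e > 0"
    hence e: "e / 2 > 0" by simp
    obtain B where B: "\<forall>\<^sub>F N in sequentially. prob {\<omega> \<in> space P. coeffs N \<omega> \<notin> coeff_bound R B} \<le> e / 2"
      "G.prob {\<omega> \<in> space Q. limit \<omega> \<notin> coeff_bound R B} \<le> e / 2" using coeffs_tight[OF R e] by blast
    obtain \<delta> where \<delta>: "\<delta> > 0" "\<forall>\<^sub>F N in sequentially. prob {\<omega> \<in> space P. cmod (coeffs N \<omega> 2) < \<delta>} \<le> e / 2"
      "G.prob {\<omega> \<in> space Q. cmod (limit \<omega> 2) < \<delta>} \<le> e / 2" using coeffs_away_from_0[OF e] by blast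
    note [measurable] = coeff_bound_in_sets[of R B]
    \<comment> \<open>The lower bound on coordinate 2 is a closed condition, so it excludes the zero
      sequence and preserves compactness.\<close>
    let ?K = "{\<xi> \<in> coeff_bound R B. cmod (\<xi> 2) \<ge> \<delta>}"
    show "\<exists>K. compact K \<and> continuous_on K (\<lambda>\<xi>. f (tame_zero_sum R \<phi> \<xi>)) \<and>
      (\<forall>\<^sub>F N in sequentially. prob {\<omega> \<in> space P. coeffs N \<omega> \<notin> K} \<le> e) \<and> G.prob {\<omega> \<in> space Q. limit \<omega> \<notin> K} \<le> e"
    proof (intro exI[of _ ?K] conjI)
      show "compact ?K" by (rule compact_coeff_bound_away)
      have K: "?K \<subseteq> coeff_bound R B - {\<lambda>_. 0}" using \<delta>(1) by (rule coeff_bound_away_subset)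
      have "continuous_on ?K (zero_sum R \<phi>)"
        by (rule continuous_on_subset[OF continuous_on_zero_sum[OF R1 \<phi>] K])
      hence "continuous_on ?K (\<lambda>\<xi>. f (zero_sum R \<phi> \<xi>))"
        by (rule continuous_on_compose2[OF f]) auto
      moreover have "?K \<subseteq> tame R" using K coeff_bound_subset_tame[of R B] R by auto
      ultimately show "continuous_on ?K (\<lambda>\<xi>. f (tame_zero_sum R \<phi> \<xi>))"
        by (elim continuous_on_cong[THEN iffD1, OF refl, rotated]) (auto simp: tame_zero_sum_eq subset_iff)
      show "\<forall>\<^sub>F N in sequentially. prob {\<omega> \<in> space P. coeffs N \<omega> \<notin> ?K} \<le> e"
        using B(1) \<delta>(2)
      proof eventually_elim
        case (elim N)
        have "prob {\<omega> \<in> space P. coeffs N \<omega> \<notin> ?K} \<le> prob ({\<omega> \<in> space P. coeffs N \<omega> \<notin> coeff_bound R B} \<union> {\<omega> \<in> space P. cmod (coeffs N \<omega> 2) < \<delta>})"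
          by (rule finite_measure_mono) auto
        also have "\<dots> \<le> prob {\<omega> \<in> space P. coeffs N \<omega> \<notin> coeff_bound R B} + prob {\<omega> \<in> space P. cmod (coeffs N \<omega> 2) < \<delta>}"
          by (rule measure_Un_le) measurable
        finally show ?case using elim by linarith
      qed
      have "G.prob {\<omega> \<in> space Q. limit \<omega> \<notin> ?K} \<le> G.prob ({\<omega> \<in> space Q. limit \<omega> \<notin> coeff_bound R B} \<union> {\<omega> \<in> space Q. cmod (limit \<omega> 2) < \<delta>})"
        by (rule G.finite_measure_mono) auto
      also have "\<dots> \<le> G.prob {\<omega> \<in> space Q. limit \<omega> \<notin> coeff_bound R B} + G.prob {\<omega> \<in> space Q. cmod (limit \<omega> 2) < \<delta>}"
        by (rule measure_Un_le) measurable
      finally show "G.prob {\<omega> \<in> space Q. limit \<omega> \<notin> ?K} \<le> e" using B(2) \<delta>(3) by linarith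
    qed
  qed
  \<comment> \<open>The two sums over zeros agree off an event of probability at most e / 3, and |f|
    <= 1, so the expectations differ by at most 2 e / 3.\<close>
  have "(\<lambda>N. expectation (\<lambda>\<omega>. f (tame_zero_sum R \<phi> (poly_coeffs N \<omega>))) - expectation (\<lambda>\<omega>. f (tame_zero_sum R \<phi> (coeffs N \<omega>)))) \<longlonglongrightarrow> 0"
  proof (rule tendstoI)
    fix e :: real assume "e > 0"
    hence e: "e / 3 > 0" by simp
    obtain B0 where "\<forall>\<^sub>F N in sequentially. \<exists>A\<in>sets P. prob A \<le> e / 3 \<and> (\<forall>\<omega>\<in>space P - A. coeffs N \<omega> \<in> coeff_bound R B0 \<and>
      (\<forall>z\<in>- cball 0 R. zero_points (laurent (coeffs N \<omega>)) z = zero_points (laurent (poly_coeffs N \<omega>)) z))"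
      using coeffs_regular[OF R e] by blast
    thus "\<forall>\<^sub>F N in sequentially. dist (expectation (\<lambda>\<omega>. f (tame_zero_sum R \<phi> (poly_coeffs N \<omega>))) - expectation (\<lambda>\<omega>. f (tame_zero_sum R \<phi> (coeffs N \<omega>)))) 0 < e"
      using eventually_ge_at_top[of 1]
    proof eventually_elim
      case (elim N)
      then obtain A where A [measurable]: "A \<in> sets P" and pA: "prob A \<le> e / 3"
        and *: "\<And>\<omega>. \<omega> \<in> space P - A \<Longrightarrow> coeffs N \<omega> \<in> coeff_bound R B0"
          "\<And>\<omega> z. \<omega> \<in> space P - A \<Longrightarrow> z \<in> - cball 0 R \<Longrightarrow> zero_points (laurent (coeffs N \<omega>)) z = zero_points (laurent (poly_coeffs N \<omega>)) z"
        by blast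
      let ?f = "\<lambda>\<omega>. f (tame_zero_sum R \<phi> (poly_coeffs N \<omega>))" and ?g = "\<lambda>\<omega>. f (tame_zero_sum R \<phi> (coeffs N \<omega>))"
      have int: "integrable P ?f" "integrable P ?g"
        by (rule integrable_const_bound[of _ 1]; use f_le in simp)+
      have eq: "?f \<omega> = ?g \<omega>" if \<omega>: "\<omega> \<in> space P - A" for \<omega>
      proof -
        have "coeffs N \<omega> \<in> tame R"
          using *(1)[OF \<omega>] coeffs_nonzero[OF elim(2)] coeff_bound_subset_tame[of R B0] R by auto
        moreover have "zero_sum R \<phi> (coeffs N \<omega>) = zero_sum R \<phi> (poly_coeffs N \<omega>)"
          unfolding zero_sum_def sum_over_points_def by (intro infsum_cong) (simp add: *(2)[OF \<omega>])
        ultimately show ?thesis by (simp add: tame_zero_sum_eq poly_coeffs_tame[OF R1])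
      qed
      have "\<bar>expectation ?f - expectation ?g\<bar> = \<bar>expectation (\<lambda>\<omega>. ?f \<omega> - ?g \<omega>)\<bar>"
        using int by (subst Bochner_Integration.integral_diff) auto
      also have "\<dots> \<le> expectation (\<lambda>\<omega>. \<bar>?f \<omega> - ?g \<omega>\<bar>)" by (rule integral_abs_bound)
      also have "\<dots> \<le> expectation (\<lambda>\<omega>. 2 * indicator A \<omega>)"
      proof (rule integral_mono)
        show "integrable P (\<lambda>\<omega>. \<bar>?f \<omega> - ?g \<omega>\<bar>)" using int by (intro integrable_abs Bochner_Integration.integrable_diff)
        show "integrable P (\<lambda>\<omega>. 2 * indicator A \<omega> :: real)"
          by (rule integrable_const_bound[of _ 2]) (auto simp: indicator_def)
        fix \<omega> assume \<omega>: "\<omega> \<in> space P"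
        show "\<bar>?f \<omega> - ?g \<omega>\<bar> \<le> 2 * indicator A \<omega>"
        proof (cases "\<omega> \<in> A")
          case True
          have "\<bar>?f \<omega> - ?g \<omega>\<bar> \<le> \<bar>?f \<omega>\<bar> + \<bar>?g \<omega>\<bar>" by (rule abs_triangle_ineq4)
          also have "\<dots> \<le> 1 + 1" by (intro add_mono f_le)
          finally show ?thesis using True by simp
        next
          case False
          thus ?thesis using eq[of \<omega>] \<omega> by simp
        qed
      qed
      also have "\<dots> = 2 * prob A" by simp
      finally show ?case using pA \<open>e > 0\<close> by (simp add: dist_real_def)
    qed
  qed
  from tendsto_add[OF this lim] show ?thesis by simp
qed

text \<open>The two functions differ by the factor z^2, which has no zero outside the disc.\<close>

lemma zero_points_limit:
  assumes R: "R > 1" and \<omega>: "limit \<omega> \<in> tame R" and z: "z \<in> - cball 0 R"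
  shows "zero_points (\<lambda>z. \<kappa> * z * (z - lam) + (\<Sum>k. \<gamma> k \<omega> * z powi (- int k))) z = zero_points (laurent (limit \<omega>)) z"
proof (rule zero_points_mult)
  let ?S = "- cball (0::complex) R"
  have R0: "R > 0" using R by simp
  obtain n :: nat and m where B: "limit \<omega> \<in> coeff_bound R (real n)" "limit \<omega> m \<noteq> 0"
    using \<omega> by (auto simp: tame_def fun_eq_iff)
  show "open ?S" "connected ?S" "z \<in> ?S" using z connected_outside_cball[of R] by auto
  show "laurent (limit \<omega>) holomorphic_on ?S" by (rule laurent_holomorphic[OF B(1) R0])
  show "\<exists>w\<in>?S. laurent (limit \<omega>) w \<noteq> 0" by (rule laurent_not_identically_zero[OF B(1) R0 B(2)])
  show "(\<lambda>w. w\<^sup>2) holomorphic_on ?S" by (intro holomorphic_intros)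
  show "w\<^sup>2 \<noteq> 0" if "w \<in> ?S" for w using that R0 by auto
  show "\<kappa> * w * (w - lam) + (\<Sum>k. \<gamma> k \<omega> * w powi (- int k)) = w\<^sup>2 * laurent (limit \<omega>) w" if w: "w \<in> ?S" for w
  proof -
    have w0: "w \<noteq> 0" using w R0 by auto
    have "cmod (inverse w) < 1 / R" using inverse_in_ball[OF w R0] by simp
    from coeff_bound_sums[OF B(1) R0 this]
    have s: "summable (\<lambda>k. limit \<omega> k * inverse w ^ k)" by (rule sums_summable)
    have lim: "limit \<omega> 0 = \<kappa>" "limit \<omega> (Suc 0) = - (\<kappa> * lam)" "limit \<omega> (Suc (Suc k)) = \<gamma> k \<omega>" for k
      by (simp_all add: limit_def)
    have s1: "summable (\<lambda>k. limit \<omega> (Suc k) * inverse w ^ Suc k)" using s by (subst summable_Suc_iff)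
    have s2: "summable (\<lambda>k. limit \<omega> (Suc (Suc k)) * inverse w ^ Suc (Suc k))"
      using s1 summable_Suc_iff[of "\<lambda>k. limit \<omega> (Suc k) * inverse w ^ Suc k"] by blast
    have gen: "w\<^sup>2 * (T + - (\<kappa> * lam) * inverse w ^ Suc 0 + \<kappa> * inverse w ^ 0) = w\<^sup>2 * T + \<kappa> * w * (w - lam)" for T
      using w0 by (simp add: field_simps power2_eq_square)
    have "laurent (limit \<omega>) w = (\<Sum>k. limit \<omega> (Suc (Suc k)) * inverse w ^ Suc (Suc k)) + limit \<omega> (Suc 0) * inverse w ^ Suc 0 + limit \<omega> 0 * inverse w ^ 0"
      unfolding laurent_eq using suminf_split_head[OF s] suminf_split_head[OF s1] by simp
    hence "w\<^sup>2 * laurent (limit \<omega>) w = w\<^sup>2 * (\<Sum>k. \<gamma> k \<omega> * inverse w ^ Suc (Suc k)) + \<kappa> * w * (w - lam)"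
      by (simp only: lim gen)
    also have "w\<^sup>2 * (\<Sum>k. \<gamma> k \<omega> * inverse w ^ Suc (Suc k)) = (\<Sum>k. w\<^sup>2 * (\<gamma> k \<omega> * inverse w ^ Suc (Suc k)))"
      using s2 unfolding lim by (rule suminf_mult[symmetric])
    also have "(\<lambda>k. w\<^sup>2 * (\<gamma> k \<omega> * inverse w ^ Suc (Suc k))) = (\<lambda>k. \<gamma> k \<omega> * w powi (- int k))"
      using w0 by (simp add: fun_eq_iff powi_uminus power2_eq_square field_simps)
    finally show ?thesis by simp
  qed
qed

end

section \<open>Passage to the matrices, norms and completed measures of the statement\<close>

lemma eigenvalue_points_deformed:
  fixes A :: "complex Matrix.mat"
  assumes A: "A \<in> carrier_mat N N" and R: "R \<ge> 1" and z: "z \<in> - cball 0 R"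
    and entries: "\<And>i j. i < N \<Longrightarrow> j < N \<Longrightarrow> A $$ (i, j) = \<theta> * v i * u j + y i j"
  shows "eigenvalue_points A z = zero_points (laurent (char_coeff y u v \<theta> N)) z"
proof -
  let ?S = "- cball (0::complex) R"
  have R0: "R > 0" using R by simp
  obtain B where B: "char_coeff y u v \<theta> N \<in> coeff_bound R B" "char_coeff y u v \<theta> N 0 \<noteq> 0"
    using char_coeff_tame[OF R, of y u v \<theta> N] by (auto simp: tame_def char_coeff_0)
  have "char_poly A \<noteq> 0" using degree_monic_char_poly[OF A] by auto
  hence "eigenvalue_points A z = zero_points (Polynomial.poly (char_poly A)) z"
    unfolding eigenvalue_points_def by (rule zero_points_poly[symmetric])
  also have "\<dots> = zero_points (laurent (char_coeff y u v \<theta> N)) z"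
  proof (rule zero_points_mult)
    show "open ?S" "connected ?S" "z \<in> ?S" using z connected_outside_cball[of R] by auto
    show "laurent (char_coeff y u v \<theta> N) holomorphic_on ?S" by (rule laurent_holomorphic[OF B(1) R0])
    show "\<exists>w\<in>?S. laurent (char_coeff y u v \<theta> N) w \<noteq> 0" by (rule laurent_not_identically_zero[OF B(1) R0 B(2)])
    show "(\<lambda>w. w ^ N) holomorphic_on ?S" by (intro holomorphic_intros)
    show "w ^ N \<noteq> 0" if "w \<in> ?S" for w using that R0 by auto
    show "Polynomial.poly (char_poly A) w = w ^ N * laurent (char_coeff y u v \<theta> N) w" if "w \<in> ?S" for w
      unfolding laurent_char_coeff by (rule poly_char_poly_deformed[OF A _ entries]) (use that R0 in auto)
  qed
  finally show ?thesis .
qed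

text \<open>The asymptotic bound holds only from some N0 on; a finite sum over the earlier N is
  added to the constant.\<close>

lemma sup_norm_vec_bound:
  fixes u :: "nat \<Rightarrow> real Matrix.vec"
  assumes u: "\<forall>N\<ge>1. u N \<in> carrier_vec N" and O: "(\<lambda>N. sup_norm_vec (u N)) \<in> O(\<lambda>N. 1 / sqrt (real N))"
  shows "\<exists>C. \<forall>N i. N \<ge> 1 \<longrightarrow> i < N \<longrightarrow> \<bar>vec_index (u N) i\<bar> \<le> C / sqrt (real N)"
proof -
  obtain c where "c > 0" "\<forall>\<^sub>F N in sequentially. norm (sup_norm_vec (u N)) \<le> c * norm (1 / sqrt (real N))"
    using landau_o.bigE[OF O] by blast
  then obtain N0 where N0: "\<And>N. N \<ge> N0 \<Longrightarrow> \<bar>sup_norm_vec (u N)\<bar> \<le> c * \<bar>1 / sqrt (real N)\<bar>"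
    by (auto simp: eventually_sequentially)
  define C where "C = max c (\<Sum>N<N0. sqrt (real N) * \<bar>sup_norm_vec (u N)\<bar>)"
  show ?thesis
  proof (intro exI[of _ C] allI impI)
    fix N i :: nat assume N: "N \<ge> 1" and i: "i < N"
    have dim: "dim_vec (u N) = N" using u N by auto
    have s: "sqrt (real N) > 0" using N by simp
    have "\<bar>vec_index (u N) i\<bar> \<le> sup_norm_vec (u N)"
      unfolding sup_norm_vec_def dim using i by (intro Max_ge) auto
    hence "sqrt (real N) * \<bar>vec_index (u N) i\<bar> \<le> sqrt (real N) * \<bar>sup_norm_vec (u N)\<bar>" by (intro mult_left_mono) auto
    also have "\<dots> \<le> C"
    proof (cases "N < N0")
      case True
      hence "sqrt (real N) * \<bar>sup_norm_vec (u N)\<bar> \<le> (\<Sum>N<N0. sqrt (real N) * \<bar>sup_norm_vec (u N)\<bar>)"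
        by (intro member_le_sum) auto
      thus ?thesis by (simp add: C_def)
    next
      case False
      hence "sqrt (real N) * \<bar>sup_norm_vec (u N)\<bar> \<le> sqrt (real N) * (c * \<bar>1 / sqrt (real N)\<bar>)"
        by (intro mult_left_mono N0) auto
      also have "\<dots> = c" using s by simp
      finally show ?thesis by (simp add: C_def)
    qed
    finally show "\<bar>vec_index (u N) i\<bar> \<le> C / sqrt (real N)" using s by (simp add: field_simps)
  qed
qed

lemma measurable_completion_AE_eq:
  fixes f g :: "'a \<Rightarrow> real"
  assumes [measurable]: "f \<in> borel_measurable M" and AE: "AE \<omega> in M. g \<omega> = f \<omega>"
  shows "g \<in> borel_measurable (completion M)"
proof (rule measurableI)
  fix S :: "real set" assume [measurable]: "S \<in> sets borel"
  show "g -` S \<inter> space (completion M) \<in> sets (completion M)"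
  proof (rule completion.in_sets_AE)
    show "f -` S \<inter> space M \<in> sets (completion M)" by (rule sets_completionI_sets, rule measurable_sets[OF assms(1)]) fact
    show "AE \<omega> in completion M. (\<omega> \<in> f -` S \<inter> space M) = (\<omega> \<in> g -` S \<inter> space (completion M))"
      using AE_completion[OF AE] by eventually_elim simp
  qed auto
qed simp

text \<open>Weak convergence need only be tested on continuous steps, which are bounded by 1. W is a
  Borel version of the limit variable, and passing to the completion does not change integrals of
  Borel functions.\<close>

lemma weak_conv_m_completion:
  fixes Z :: "nat \<Rightarrow> 'a \<Rightarrow> real" and W W' :: "'b \<Rightarrow> real"
  assumes P: "prob_space P" and Q: "prob_space Q" and Z: "\<And>N. Z N \<in> borel_measurable P"
    and W: "W \<in> borel_measurable Q" and AE: "AE \<omega> in Q. W' \<omega> = W \<omega>"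
    and lim: "\<And>f :: real \<Rightarrow> real. continuous_on UNIV f \<Longrightarrow> (\<And>x. \<bar>f x\<bar> \<le> 1) \<Longrightarrow>
      (\<lambda>N. \<integral>\<omega>. f (Z N \<omega>) \<partial>P) \<longlonglongrightarrow> (\<integral>\<omega>. f (W \<omega>) \<partial>Q)"
  shows "converges_in_distribution P Z Q W'"
  unfolding converges_in_distribution_def
proof (intro conjI allI)
  interpret P: prob_space "completion P" using P by (rule prob_space.prob_space_completion)
  interpret Q: prob_space "completion Q" using Q by (rule prob_space.prob_space_completion)
  show Z' [measurable]: "Z N \<in> borel_measurable (completion P)" for N by (rule measurable_completion[OF Z])
  show W' [measurable]: "W' \<in> borel_measurable (completion Q)" by (rule measurable_completion_AE_eq[OF W AE])
  have W'': "W \<in> borel_measurable (completion Q)" by (rule measurable_completion[OF W])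
  show "weak_conv_m (\<lambda>N. distr (completion P) borel (Z N)) (distr (completion Q) borel W')"
  proof (rule integral_cts_step_conv_imp_weak_conv)
    show "real_distribution (distr (completion P) borel (Z N))" for N by simp
    show "real_distribution (distr (completion Q) borel W')" by simp
    fix a b :: real assume ab: "a < b"
    let ?f = "cts_step a b"
    have cont: "continuous_on UNIV ?f"
      by (rule uniformly_continuous_imp_continuous[OF cts_step_uniformly_continuous[OF ab]])
    have [measurable]: "?f \<in> borel_measurable borel" by (rule borel_measurable_continuous_onI[OF cont])
    have le: "\<bar>?f x\<bar> \<le> 1" for x using ab by (auto simp: cts_step_def)
    have eqP: "integral\<^sup>L (distr (completion P) borel (Z N)) ?f = (\<integral>\<omega>. ?f (Z N \<omega>) \<partial>P)" for N
    proof -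
      have "(\<lambda>\<omega>. ?f (Z N \<omega>)) \<in> borel_measurable P" using Z by measurable
      thus ?thesis by (subst integral_distr) (simp_all add: integral_completion)
    qed
    have eqQ: "integral\<^sup>L (distr (completion Q) borel W') ?f = (\<integral>\<omega>. ?f (W \<omega>) \<partial>Q)"
    proof -
      have "integral\<^sup>L (distr (completion Q) borel W') ?f = (\<integral>\<omega>. ?f (W' \<omega>) \<partial>completion Q)"
        by (subst integral_distr) simp_all
      also have "\<dots> = (\<integral>\<omega>. ?f (W \<omega>) \<partial>completion Q)"
        using AE_completion[OF AE] W'' by (intro integral_cong_AE) auto
      also have "\<dots> = (\<integral>\<omega>. ?f (W \<omega>) \<partial>Q)"
        by (rule integral_completion) (use W in measurable)
      finally show ?thesis .
    qed
    show "(\<lambda>N. integral\<^sup>L (distr (completion P) borel (Z N)) ?f) \<longlonglongrightarrow> integral\<^sup>L (distr (completion Q) borel W') ?f"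
      unfolding eqP eqQ by (rule lim[OF cont le])
  qed
qed

theorem corollary1p12:
  fixes P :: "'a measure" and Q :: "'b measure"
    and X :: "nat \<Rightarrow> nat \<Rightarrow> 'a \<Rightarrow> complex"
    and \<gamma> :: "nat \<Rightarrow> 'b \<Rightarrow> complex"
    and \<theta> :: "nat \<Rightarrow> complex"
    and u v :: "nat \<Rightarrow> real Matrix.vec"
    and \<kappa> lam :: complex and c \<epsilon> :: real
  assumes "prob_space P"
    and "prob_space.indep_vars P (\<lambda>_. borel) (\<lambda>(i, j). X i j) UNIV"
    and "\<forall>i j. distr P borel (X i j) = distr P borel (X 0 0)"
    and "\<forall>i j. integrable P (X i j) \<and> (\<integral>\<omega>. X i j \<omega> \<partial>P) = 0"
    and "\<forall>i j. integrable P (\<lambda>\<omega>. (cmod (X i j \<omega>))\<^sup>2) \<and> (\<integral>\<omega>. (cmod (X i j \<omega>))\<^sup>2 \<partial>P) = 1"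
    and "c > 0"
    and "\<forall>i j. \<forall>k\<ge>1. integrable P (\<lambda>\<omega>. cmod (X i j \<omega>) ^ k) \<and>
           (\<integral>\<omega>. cmod (X i j \<omega>) ^ k \<partial>P) \<le> (c * real k) powr (c * real k)"
    and "\<forall>N\<ge>1. \<theta> N \<noteq> 0"
    and "(\<lambda>N. of_real (sqrt (real N)) / \<theta> N) \<longlonglongrightarrow> \<kappa>"
    and "\<forall>N\<ge>1. u N \<in> carrier_vec N \<and> v N \<in> carrier_vec N"
    and "\<forall>N\<ge>1. l2_norm_vec (u N) = 1 \<and> l2_norm_vec (v N) = 1"
    and "(\<lambda>N. \<theta> N * of_real (scalar_prod (u N) (v N))) \<longlonglongrightarrow> lam"
    and "(\<lambda>N. sup_norm_vec (u N)) \<in> O(\<lambda>N. 1 / sqrt (real N))"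
    and "(\<lambda>N. sup_norm_vec (v N)) \<in> O(\<lambda>N. 1 / sqrt (real N))"
    and "\<epsilon> > 0"
    and "prob_space Q"
    and "prob_space.indep_vars Q (\<lambda>_. borel) \<gamma> UNIV"
    and "\<forall>k. centered_gaussian_complex Q (\<gamma> k)"
    and "\<forall>k. (\<integral>\<omega>. (cmod (\<gamma> k \<omega>))\<^sup>2 \<partial>Q) = 1"
    and "\<forall>k. (\<integral>\<omega>. (\<gamma> k \<omega>)\<^sup>2 \<partial>Q) = (\<integral>\<omega>. (X 0 0 \<omega>)\<^sup>2 \<partial>P) ^ (k + 1)"
  shows "converges_vaguely (- cball 0 (1 + \<epsilon>))
    P (\<lambda>N \<omega>. eigenvalue_points
               (rank_one_mat (\<theta> N) (v N) (u N) + scaled_corner (\<lambda>i j. X i j \<omega>) N))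
    Q (\<lambda>\<omega>. zero_points
               (\<lambda>z. \<kappa> * z * (z - lam) + (\<Sum>k. \<gamma> k \<omega> * z powi (- int k))))"
proof -
  interpret P: prob_space P by fact
  interpret Q: prob_space Q by fact
  have dim: "dim_vec (u N) = N" "dim_vec (v N) = N" if "N \<ge> 1" for N using assms(10) that by auto
  define u' where "u' N i = vec_index (u N) i" for N i
  define v' where "v' N i = vec_index (v N) i" for N i
  have prod: "scalar_prod (u N) (v N) = (\<Sum>i<N. u' N i * v' N i)" if "N \<ge> 1" for N
    using dim[OF that] by (simp add: scalar_prod_def u'_def v'_def lessThan_atLeast0)
  obtain Cu where Cu: "\<And>N i. N \<ge> 1 \<Longrightarrow> i < N \<Longrightarrow> \<bar>vec_index (u N) i\<bar> \<le> Cu / sqrt (real N)"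
    using sup_norm_vec_bound[of u] assms(10,13) by blast
  obtain Cv where Cv: "\<And>N i. N \<ge> 1 \<Longrightarrow> i < N \<Longrightarrow> \<bar>vec_index (v N) i\<bar> \<le> Cv / sqrt (real N)"
    using sup_norm_vec_bound[of v] assms(10,14) by blast
  define C where "C = max 0 (max Cu Cv)"
  interpret E: iid_entries P X
  proof
    show "P.indep_vars (\<lambda>_. borel) (\<lambda>(i, j). X i j) UNIV" by fact
    show "distr P borel (X i j) = distr P borel (X 0 0)" for i j using assms(3) by blast
    show "P.expectation (X 0 0) = 0" using assms(4) by blast
    show "P.expectation (\<lambda>\<omega>. (cmod (X 0 0 \<omega>))\<^sup>2) = 1" using assms(5) by blast
    show "integrable P (\<lambda>\<omega>. cmod (X 0 0 \<omega>) ^ k)" for k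
      using assms(7)[rule_format, of k 0 0] by (cases "k = 0") simp_all
  qed
  interpret deformed_limit P X u' v' C \<theta> \<kappa> lam Q \<gamma>
  proof
    show "(\<Sum>i<N. (u' N i)\<^sup>2) = 1" if "N \<ge> 1" for N
      using assms(11) that dim[OF that]
      by (auto simp: l2_norm_vec_def scalar_prod_def u'_def lessThan_atLeast0 power2_eq_square)
    show "(\<Sum>i<N. (v' N i)\<^sup>2) = 1" if "N \<ge> 1" for N
      using assms(11) that dim[OF that]
      by (auto simp: l2_norm_vec_def scalar_prod_def v'_def lessThan_atLeast0 power2_eq_square)
    show "\<bar>u' N i\<bar> \<le> C / sqrt (real N)" if "N \<ge> 1" "i < N" for N i
      using Cu[OF that] unfolding u'_def by (rule order_trans) (auto simp: C_def intro!: divide_right_mono)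
    show "\<bar>v' N i\<bar> \<le> C / sqrt (real N)" if "N \<ge> 1" "i < N" for N i
      using Cv[OF that] unfolding v'_def by (rule order_trans) (auto simp: C_def intro!: divide_right_mono)
    show "0 \<le> C" by (simp add: C_def)
    show "\<theta> N \<noteq> 0" if "N \<ge> 1" for N using assms(8) that by blast
    show "(\<lambda>N. of_real (sqrt (real N)) / \<theta> N) \<longlonglongrightarrow> \<kappa>" by fact
    show "(\<lambda>N. \<theta> N * of_real (\<Sum>i<N. u' N i * v' N i)) \<longlonglongrightarrow> lam"
      using assms(12) by (rule Lim_transform_eventually)
        (rule eventually_mono[OF eventually_ge_at_top[of 1]], simp only: prod)
    show "Q.indep_vars (\<lambda>_. borel) \<gamma> UNIV" by fact
    show "centered_gaussian_complex Q (\<gamma> k)" for k using assms(18) by blast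
    show "Q.expectation (\<lambda>\<omega>. (cmod (\<gamma> k \<omega>))\<^sup>2) = 1" for k using assms(19) by blast
    show "Q.expectation (\<lambda>\<omega>. (\<gamma> k \<omega>)\<^sup>2) = E.pseudo_var ^ (k + 1)" for k
      using assms(20) by (simp add: E.pseudo_var_def)
  qed
  define R where "R = 1 + \<epsilon>"
  have R: "R > 1" "R \<ge> 1" using assms(15) by (auto simp: R_def)
  let ?M = "\<lambda>N \<omega>. rank_one_mat (\<theta> N) (v N) (u N) + scaled_corner (\<lambda>i j. X i j \<omega>) N"
  have eig: "eigenvalue_points (?M N \<omega>) z = zero_points (laurent (poly_coeffs N \<omega>)) z"
    if N: "N \<ge> 1" and z: "z \<in> - cball 0 R" for N \<omega> z
    unfolding poly_coeffs_def
  proof (rule eigenvalue_points_deformed[OF _ R(2) z])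
    show "?M N \<omega> \<in> carrier_mat N N" by (simp add: scaled_corner_def)
    show "?M N \<omega> $$ (i, j) = \<theta> N * of_real (v' N i) * of_real (u' N j) + E.Y N \<omega> i j" if "i < N" "j < N" for i j
      using that dim[OF N] by (simp add: scaled_corner_def rank_one_mat_def E.Y_def u'_def v'_def)
  qed
  show ?thesis
    unfolding converges_vaguely_def R_def[symmetric]
  proof (intro allI impI)
    fix \<phi> :: "complex \<Rightarrow> real"
    assume "continuous_on (- cball 0 R) \<phi> \<and> (\<exists>K. compact K \<and> K \<subseteq> - cball 0 R \<and> (\<forall>z\<in>- cball 0 R - K. \<phi> z = 0))"
    hence \<phi>: "test_fun R \<phi>" by (simp add: test_fun_def)
    have [measurable]: "tame_zero_sum R \<phi> \<in> borel_measurable borel"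
      unfolding tame_zero_sum_def[abs_def] by (rule borel_measurable_zero_sum[OF R(2) \<phi>])
    define Z where "Z N \<omega> = sum_over_points (- cball 0 R) (eigenvalue_points (?M N \<omega>)) \<phi>" for N \<omega>
    have Z_eq: "Z N \<omega> = tame_zero_sum R \<phi> (poly_coeffs N \<omega>)" if "N \<ge> 1" for N \<omega>
      unfolding tame_zero_sum_eq[OF poly_coeffs_tame[OF R(2)]] Z_def zero_sum_def sum_over_points_def
      by (intro infsum_cong) (simp add: eig[OF that])
    show "converges_in_distribution P (\<lambda>N \<omega>. sum_over_points (- cball 0 R) (eigenvalue_points (?M N \<omega>)) \<phi>)
      Q (\<lambda>\<omega>. sum_over_points (- cball 0 R) (zero_points (\<lambda>z. \<kappa> * z * (z - lam) + (\<Sum>k. \<gamma> k \<omega> * z powi (- int k)))) \<phi>)"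
      unfolding Z_def[symmetric]
    proof (rule weak_conv_m_completion[where W = "\<lambda>\<omega>. tame_zero_sum R \<phi> (limit \<omega>)", OF assms(1) assms(16)])
      show "Z N \<in> borel_measurable P" for N
      proof (cases "N = 0")
        \<comment> \<open>For N = 0 nothing is known about u, v and \<theta>, but the sum must still
          be measurable: it is, as an empty corner does not depend on the outcome.\<close>
        case True
        have "scaled_corner (\<lambda>i j. X i j \<omega>) 0 = scaled_corner (\<lambda>_ _. 0) 0" for \<omega>
          by (rule eq_matI) (simp_all add: scaled_corner_def)
        thus ?thesis unfolding True Z_def[abs_def] by simp
      next
        case False
        hence "Z N = (\<lambda>\<omega>. tame_zero_sum R \<phi> (poly_coeffs N \<omega>))" using Z_eq[of N] by auto
        thus ?thesis by simp
      qed
      show "(\<lambda>\<omega>. tame_zero_sum R \<phi> (limit \<omega>)) \<in> borel_measurable Q" by measurable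
      \<comment> \<open>Off a null set the limiting series converges outside the disc and is not
        identically zero, and there the truncated sum is the actual one.\<close>
      show "AE \<omega> in Q. sum_over_points (- cball 0 R) (zero_points (\<lambda>z. \<kappa> * z * (z - lam) + (\<Sum>k. \<gamma> k \<omega> * z powi (- int k)))) \<phi>
          = tame_zero_sum R \<phi> (limit \<omega>)"
        using limit_tame[OF R(1)]
      proof eventually_elim
        case (elim \<omega>)
        thus ?case
          unfolding tame_zero_sum_eq[OF elim] zero_sum_def sum_over_points_def
          by (intro infsum_cong) (simp only: zero_points_limit[OF R(1) elim])
      qed
      fix f :: "real \<Rightarrow> real" assume f: "continuous_on UNIV f" "\<And>x. \<bar>f x\<bar> \<le> 1"
      show "(\<lambda>N. \<integral>\<omega>. f (Z N \<omega>) \<partial>P) \<longlonglongrightarrow> (\<integral>\<omega>. f (tame_zero_sum R \<phi> (limit \<omega>)) \<partial>Q)"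
        using tame_zero_sum_tendsto[OF R(1) \<phi> f]
        by (rule Lim_transform_eventually)
          (rule eventually_mono[OF eventually_ge_at_top[of 1]], simp only: Z_eq)
    qed
  qed
qed

end
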